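(* Let $\nu$ be a probability measure on $\mathbb{R}^d$ that is absolutely continuous with respect to the Lebesgue measure and has a finite second moment. Suppose that $\nu$ satisfies at least one of the following: (i) $\nu$ is $\beta$-semi-log-convex for some $\beta>0$ and $\kappa$-semi-log-concave for some $\kappa>0$, with $\mathrm{supp}(\nu)=\mathbb{R}^d$; (iii) $\nu=N(0,\sigma^2\mathbf{I}_d)*\rho$ with $\sigma>0$, where $\rho$ is a probability measure supported on a Euclidean ball of radius $R$ in $\mathbb{R}^d$; (iv) $\nu$ is $\beta$-semi-log-convex for some $\beta>0$, $\kappa$-semi-log-concave for some $\kappa\le0$, and $\frac{d\nu}{d\gamma_d}(x)$ is $L$-log-Lipschitz in $x$ for some $L\ge0$, with $\mathrm{supp}(\nu)=\mathbb{R}^d$. Then the time-reversed flow $(X_t^* )_{t\in[0,1]}$ associated with $\nu$ is a unique solution to the initial value problem $$\frac{dX_t^*}{dt}(x)=-v(1-t,X_t^*(x)),\quad X_0^*(x)\sim\nu,\quad t\in[0,1].$$ The push-forward measure satisfies ${X_t^*}_{\#}\nu=\mathrm{Law}(a_{1-t}\mathsf{Z}+b_{1-t}\mathsf{X}_1)$, where $\mathsf{Z}\sim\gamma_d$, $\mathsf{X}_1\sim\nu$. Moreover, the flow map satisfies $X_t^*(x)=X_t^{-1}(x)$.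
   Context: Fix functions $a_t,b_t$ of $t\in[0,1]$ (a dot denotes the time derivative) satisfying: $\dot a_t\le 0$, $\dot b_t\ge 0$, $a_0>0$, $b_0\ge 0$, $a_1=0$, $b_1=1$; $a_t>0$ and $b_t>0$ for all $t\in(0,1)$; $a_t,b_t\in C^2([0,1))$, $a_t^2\in C^1([0,1])$, $b_t\in C^1([0,1])$. Let $\gamma_d:=N(0,\mathbf{I}_d)$, let $\mathsf{Z}\sim\gamma_d$ and $\mathsf{X}_1\sim\nu$ be independent, and $\mathsf{X}_t=a_t\mathsf{Z}+b_t\mathsf{X}_1$. The velocity field is $v(t,x)=\mathbb{E}[\dot a_t\mathsf{Z}+\dot b_t\mathsf{X}_1\mid\mathsf{X}_t=x]$ for $t\in(0,1)$, $v(0,x)=\lim_{t\downarrow0}v(t,x)$, $v(1,x)=\lim_{t\uparrow1}v(t,x)$. With $\mu=\mathrm{Law}(a_0\mathsf{Z}+b_0\mathsf{X}_1)$, the (forward) flow $(X_t)_{t\in[0,1]}$ is the solution of $\frac{dX_t}{dt}(x)=v(t,X_t(x))$, $X_0(x)\sim\mu$, $t\in[0,1]$, and $X_t^{-1}$ denotes the inverse of the flow map $X_t$. For a map $g$ and a measure $\pi$, $g_{\#}\pi$ is the push-forward of $\pi$ by $g$, and $*$ denotes convolution of measures. A probability measure $\exp(-U)\,dx$ is $\kappa$-semi-log-concave ($\kappa\in\mathbb{R}$) if its support $\Omega\subseteq\mathbb{R}^d$ is convex and $U\in C^2(\Omega)$ satisfies $\nabla^2U(x)\succeq\kappa\mathbf{I}_d$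 on $\Omega$; it is $\beta$-semi-log-convex ($\beta>0$) if its support $\Omega$ is convex and $U\in C^2(\Omega)$ satisfies $\nabla^2U(x)\preceq\beta\mathbf{I}_d$ on $\Omega$. A function $f:\mathbb{R}^d\to\mathbb{R}_+$ is $L$-log-Lipschitz if $\log f$ is $L$-Lipschitz.
   Formalization: "X_t^*(x)=X_t^{-1}(x)" fails for 0<t<1 (e.g. ν=N(0,4), a_t=1-t, b_t=t); proved instead: X_t^*=X_{1-t}∘X_1^{-1}, so X_t^* inverts the forward flow over [1-t,1]; X_t^{-1} is the reversed flow run over [1-t,1]; and X_1^*=X_1^{-1}. *)

theory Defs
  imports "HOL-Probability.Probability"
begin

definition C1_on :: "(real \<Rightarrow> real) \<Rightarrow> real set \<Rightarrow> bool" where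
  "C1_on f I \<longleftrightarrow>
     (\<exists>f'. (\<forall>t\<in>I. (f has_real_derivative f' t) (at t within I)) \<and> continuous_on I f')"

definition C2_on :: "(real \<Rightarrow> real) \<Rightarrow> real set \<Rightarrow> bool" where
  "C2_on f I \<longleftrightarrow>
     (\<exists>f'. (\<forall>t\<in>I. (f has_real_derivative f' t) (at t within I)) \<and> C1_on f' I)"

(* The sign conditions on the derivatives are only stated on the open interval; at the
   endpoints where the (one-sided) derivative exists they follow from continuity or
   monotonicity. Note that a need not be differentiable at 1, only its square is. *)
definition interpolation_coeffs :: "(real \<Rightarrow> real) \<Rightarrow> (real \<Rightarrow> real) \<Rightarrow> bool" where
  "interpolation_coeffs a b \<longleftrightarrow>
     (\<forall>t\<in>{0<..<1}. deriv a t \<le> 0 \<and> deriv b t \<ge> 0) \<and>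
     a 0 > 0 \<and> b 0 \<ge> 0 \<and> a 1 = 0 \<and> b 1 = 1 \<and>
     (\<forall>t\<in>{0<..<1}. a t > 0 \<and> b t > 0) \<and>
     C2_on a {0..<1} \<and> C2_on b {0..<1} \<and>
     C1_on (\<lambda>t. (a t)\<^sup>2) {0..1} \<and> C1_on b {0..1}"

(* The second argument of normal_density is the standard deviation, so this is the centred
   Gaussian with covariance sigma^2 times the identity. *)
definition gaussian :: "real \<Rightarrow> 'a::euclidean_space measure" where
  "gaussian \<sigma> = density lborel (\<lambda>x. ennreal (\<Prod>i\<in>Basis. normal_density 0 \<sigma> (x \<bullet> i)))"

definition msupport :: "'a::topological_space measure \<Rightarrow> 'a set" where
  "msupport \<nu> = {x. \<forall>A. open A \<and> x \<in> A \<longrightarrow> emeasure \<nu> A > 0}"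

(* U is C^2 on \<Omega> with Hessian H; derivatives at boundary points are taken within \<Omega>. *)
definition C2_with_hessian ::
  "'a::euclidean_space set \<Rightarrow> ('a \<Rightarrow> real) \<Rightarrow> ('a \<Rightarrow> 'a \<Rightarrow>\<^sub>L 'a) \<Rightarrow> bool" where
  "C2_with_hessian \<Omega> U H \<longleftrightarrow>
     (\<exists>G. \<forall>x\<in>\<Omega>. (U has_derivative (\<lambda>h. G x \<bullet> h)) (at x within \<Omega>) \<and>
                 (G has_derivative blinfun_apply (H x)) (at x within \<Omega>)) \<and>
     continuous_on \<Omega> H"

definition has_potential :: "'a::euclidean_space measure \<Rightarrow> ('a \<Rightarrow> real) \<Rightarrow> bool" where
  "has_potential \<nu> U \<longleftrightarrow>
     \<nu> = density lborel (\<lambda>x. indicator (msupport \<nu>) x * ennreal (exp (- U x)))"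

definition semi_log_concave :: "real \<Rightarrow> 'a::euclidean_space measure \<Rightarrow> bool" where
  "semi_log_concave \<kappa> \<nu> \<longleftrightarrow>
     prob_space \<nu> \<and> convex (msupport \<nu>) \<and>
     (\<exists>U H. has_potential \<nu> U \<and> C2_with_hessian (msupport \<nu>) U H \<and>
        (\<forall>x\<in>msupport \<nu>. \<forall>h. h \<bullet> blinfun_apply (H x) h \<ge> \<kappa> * (h \<bullet> h)))"

definition semi_log_convex :: "real \<Rightarrow> 'a::euclidean_space measure \<Rightarrow> bool" where
  "semi_log_convex \<beta> \<nu> \<longleftrightarrow>
     prob_space \<nu> \<and> convex (msupport \<nu>) \<and>
     (\<exists>U H. has_potential \<nu> U \<and> C2_with_hessian (msupport \<nu>) U H \<and>
        (\<forall>x\<in>msupport \<nu>. \<forall>h. h \<bullet> blinfun_apply (H x) h \<le> \<beta> * (h \<bullet> h)))"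

definition log_lipschitz :: "real \<Rightarrow> ('a::euclidean_space \<Rightarrow> real) \<Rightarrow> bool" where
  "log_lipschitz L f \<longleftrightarrow> (\<forall>x. f x > 0) \<and> L-lipschitz_on UNIV (\<lambda>x. ln (f x))"

(* g is a version of x \<mapsto> E[Y | X = x]; the library has conditional expectations of
   real-valued variables only, so vectors are treated componentwise. *)
definition cond_exp_version ::
  "'w measure \<Rightarrow> ('w \<Rightarrow> 'b::euclidean_space) \<Rightarrow> ('w \<Rightarrow> 'a::euclidean_space) \<Rightarrow> ('a \<Rightarrow> 'b) \<Rightarrow> bool"
where
  "cond_exp_version M Y X g \<longleftrightarrow>
     g \<in> borel_measurable borel \<and>
     (\<forall>i\<in>Basis. AE \<omega> in M.
        g (X \<omega>) \<bullet> i = real_cond_exp M (vimage_algebra (space M) X borel) (\<lambda>\<omega>. Y \<omega> \<bullet> i) \<omega>)"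

(* E[Y | X = x] is a priori defined only up to null sets of the law of X. Pointwise values are
   those of the continuous version, which is unique when that law has full support. *)
definition cond_exp_at ::
  "'w measure \<Rightarrow> ('w \<Rightarrow> 'b::euclidean_space) \<Rightarrow> ('w \<Rightarrow> 'a::euclidean_space) \<Rightarrow> 'a \<Rightarrow> 'b" where
  "cond_exp_at M Y X = (THE g. continuous_on UNIV g \<and> cond_exp_version M Y X g)"

definition interpolant ::
  "(real \<Rightarrow> real) \<Rightarrow> (real \<Rightarrow> real) \<Rightarrow> ('w \<Rightarrow> 'a::euclidean_space) \<Rightarrow> ('w \<Rightarrow> 'a) \<Rightarrow> real \<Rightarrow> 'w \<Rightarrow> 'a"
where
  "interpolant a b Z X1 t \<omega> = a t *\<^sub>R Z \<omega> + b t *\<^sub>R X1 \<omega>"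

definition velocity_interior ::
  "'w measure \<Rightarrow> (real \<Rightarrow> real) \<Rightarrow> (real \<Rightarrow> real) \<Rightarrow> ('w \<Rightarrow> 'a::euclidean_space) \<Rightarrow> ('w \<Rightarrow> 'a)
     \<Rightarrow> real \<Rightarrow> 'a \<Rightarrow> 'a" where
  "velocity_interior M a b Z X1 t =
     cond_exp_at M (\<lambda>\<omega>. deriv a t *\<^sub>R Z \<omega> + deriv b t *\<^sub>R X1 \<omega>) (interpolant a b Z X1 t)"

(* Only the values for t in [0,1] are meaningful. *)
definition velocity ::
  "'w measure \<Rightarrow> (real \<Rightarrow> real) \<Rightarrow> (real \<Rightarrow> real) \<Rightarrow> ('w \<Rightarrow> 'a::euclidean_space) \<Rightarrow> ('w \<Rightarrow> 'a)
     \<Rightarrow> real \<Rightarrow> 'a \<Rightarrow> 'a" where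
  "velocity M a b Z X1 t x =
     (if t = 0 then Lim (at_right 0) (\<lambda>s. velocity_interior M a b Z X1 s x)
      else if t = 1 then Lim (at_left 1) (\<lambda>s. velocity_interior M a b Z X1 s x)
      else velocity_interior M a b Z X1 t x)"

definition solves_ivp ::
  "(real \<Rightarrow> 'a::euclidean_space \<Rightarrow> 'a) \<Rightarrow> 'a \<Rightarrow> (real \<Rightarrow> 'a) \<Rightarrow> bool" where
  "solves_ivp w x y \<longleftrightarrow>
     y 0 = x \<and> (\<forall>t\<in>{0..1}. (y has_vector_derivative w t (y t)) (at t within {0..1}))"

(* X t x is the position at time t of the unique solution started at x. An initial condition
   X_0(x) ~ pi means that the starting point x is drawn from pi, so that the law at time t is
   the push-forward of pi under X t. *)
definition unique_flow ::
  "(real \<Rightarrow> 'a::euclidean_space \<Rightarrow> 'a) \<Rightarrow> (real \<Rightarrow> 'a \<Rightarrow> 'a) \<Rightarrow> bool" where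
  "unique_flow w X \<longleftrightarrow>
     (\<forall>x. solves_ivp w x (\<lambda>t. X t x) \<and>
          (\<forall>y. solves_ivp w x y \<longrightarrow> (\<forall>t\<in>{0..1}. y t = X t x)))"

(* The flow map from time s to time t. The reversed flow starts at the terminal time of the
   forward flow, so after running for time t it inverts the forward flow over [1-t,1], which
   is the forward flow map X t itself only for t = 0, t = 1 or special fields. *)
definition transition :: "(real \<Rightarrow> 'a \<Rightarrow> 'a) \<Rightarrow> real \<Rightarrow> real \<Rightarrow> 'a \<Rightarrow> 'a" where
  "transition X s t = X t \<circ> inv (X s)"

end

theory Submission
  imports Defs
begin

text \<open>Each of the three hypotheses makes \<open>\<nu>\<close> a tilt \<open>f \<cdot> N(0, \<sigma>\<^sup>2 I)\<close> of a centred Gaussian for which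
  \<open>\<nabla> log f\<close> is Lipschitz and the Gaussian-smoothed tilts have uniformly bounded variance.
  Rotating the Gaussian pair and integrating by parts, the conditional expectation becomes
  \<open>v t x = p t x + q t h(c t x, \<tau> t)\<close>, where \<open>h z \<tau>\<close> is the mean of \<open>\<nabla> log f\<close> under the tilt of
  \<open>N(z, \<tau>\<^sup>2 I)\<close> by \<open>f\<close>, and the coefficients only involve \<open>a\<^sup>2\<close>, \<open>b\<close> and their first
  derivatives. Hence \<open>v\<close> extends continuously to both endpoints. The gradient of \<open>h\<close> in \<open>z\<close> is a
  covariance, which the variance bound controls uniformly in \<open>\<tau>\<close>, so \<open>v\<close> is Lipschitz in space
  and the flow is a family of homeomorphisms.

  That the flow transports the law of the interpolant is shown without densities or Jacobians: a test
  function is pulled back along an Euler scheme for a Gaussian mollification of \<open>v\<close>. The pull-backs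
  keep a quadratic remainder bound, so that one step changes the expectation along the interpolant
  only by a lower-order term, because \<open>v\<close> is the conditional expectation of its derivative.\<close>

text \<open>The obstacle is time 1, where \<open>a\<close> may behave like a square root and the
  derivative of the interpolant may blow up although \<open>v\<close> extends continuously. In
  rotated coordinates the singular factor \<open>al' / (2 * a)\<close> meets a coefficient
  proportional to \<open>a\<close> in the first coordinate; in the second one it is integration by
  parts that supplies such a factor, namely \<open>tau\<close>. No cancellation of this kind exists
  path by path, so the transport of the law is shown on compact subintervals of the open time
  interval and extended by continuity.

  Mollification is there because composing a test function with a merely Lipschitz map destroys
  quadratic remainder bounds. Its constant may explode as the mollification error tends to 0: the
  step size is chosen last.

  The reference variance is a free parameter: \<open>1 / \<kappa>\<close> in the strongly
  log-concave case, which makes the tilt log-concave; the variance of the Gaussian factor for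
  mixtures; 1 in the log-Lipschitz case. The variance bound comes from monotonicity of the gradient
  of log f in the first case and from the log-Lipschitz bound on f in the other two.\<close>

lemma has_vector_derivative_at_0_iff:
  fixes f :: "real \<Rightarrow> 'c::real_normed_vector"
  shows "(f has_vector_derivative D) (at 0) \<longleftrightarrow> ((\<lambda>r. (f r - f 0) /\<^sub>R r) \<longlongrightarrow> D) (at 0)"
proof -
  have "norm (f r - f 0 - r *\<^sub>R D) / norm r = norm ((f r - f 0) /\<^sub>R r - D)" if "r \<noteq> 0" for r
  proof -
    have "(f r - f 0) /\<^sub>R r - D = (f r - f 0 - r *\<^sub>R D) /\<^sub>R r"
      using that by (simp add: scaleR_diff_right)
    then show ?thesis by (simp add: divide_inverse)
  qed
  then have "((\<lambda>r. norm (f r - f 0 - r *\<^sub>R D) / norm r) \<longlongrightarrow> 0) (at 0)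
    \<longleftrightarrow> ((\<lambda>r. norm ((f r - f 0) /\<^sub>R r - D)) \<longlongrightarrow> 0) (at 0)"
    by (intro filterlim_cong refl) (auto simp: eventually_at_filter)
  also have "\<dots> \<longleftrightarrow> ((\<lambda>r. (f r - f 0) /\<^sub>R r) \<longlongrightarrow> D) (at 0)"
    by (simp add: tendsto_norm_zero_iff LIM_zero_iff)
  finally show ?thesis
    unfolding has_vector_derivative_def has_derivative_at by (simp add: bounded_linear_scaleR_left)
qed

text \<open>Dominated convergence for the difference quotients at 0: the increment bound says
  precisely that \<open>K\<close> dominates them for |r| at most 1.\<close>

lemma has_vector_derivative_integral:
  fixes F :: "real \<Rightarrow> 'b \<Rightarrow> 'c::euclidean_space"
  assumes meas: "\<And>r. F r \<in> borel_measurable M" and meas': "F' \<in> borel_measurable M"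
    and int0: "integrable M (F 0)" and K: "integrable M K"
    and der: "\<And>y. y \<in> space M \<Longrightarrow> ((\<lambda>r. F r y) has_vector_derivative F' y) (at 0)"
    and bd: "\<And>r y. y \<in> space M \<Longrightarrow> \<bar>r\<bar> \<le> 1 \<Longrightarrow> norm (F r y - F 0 y) \<le> \<bar>r\<bar> * K y"
  shows "((\<lambda>r. \<integral>y. F r y \<partial>M) has_vector_derivative (\<integral>y. F' y \<partial>M)) (at 0)"
proof -
  have int: "integrable M (F r)" if "\<bar>r\<bar> \<le> 1" for r
  proof -
    have "integrable M (\<lambda>y. F r y - F 0 y)"
    proof (rule Bochner_Integration.integrable_bound)
      show "integrable M (\<lambda>y. \<bar>r\<bar> * K y)" using K by simp
      show "(\<lambda>y. F r y - F 0 y) \<in> borel_measurable M" using meas by measurable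
      show "AE y in M. norm (F r y - F 0 y) \<le> norm (\<bar>r\<bar> * K y)"
        using bd[OF _ that] by (intro AE_I2) (smt (verit, best) real_norm_def)
    qed
    from Bochner_Integration.integrable_add[OF this int0] show ?thesis by simp
  qed
  have "(\<lambda>n. ((\<integral>y. F (X n) y \<partial>M) - (\<integral>y. F 0 y \<partial>M)) /\<^sub>R X n) \<longlonglongrightarrow> (\<integral>y. F' y \<partial>M)"
    if X: "\<forall>n. X n \<in> UNIV - {0}" "X \<longlonglongrightarrow> 0" for X :: "nat \<Rightarrow> real"
  proof -
    \<comment> \<open>The bound is available for |r| at most 1 only. Larger terms are replaced by 1,
      which is nonzero; eventually nothing is replaced, so the limit is unaffected.\<close>
    define Y where "Y n = (if \<bar>X n\<bar> \<le> 1 then X n else 1)" for n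
    have Y0: "Y n \<noteq> 0" and Y1: "\<bar>Y n\<bar> \<le> 1" for n using X(1) by (auto simp: Y_def)
    have "\<forall>\<^sub>F n in sequentially. \<bar>X n\<bar> < 1"
      using order_tendstoD(2)[OF tendsto_rabs_zero[OF X(2)], of 1] by simp
    then have ev: "\<forall>\<^sub>F n in sequentially. Y n = X n"
      by eventually_elim (auto simp: Y_def)
    have Yl: "Y \<longlonglongrightarrow> 0" using X(2) tendsto_cong[OF ev] by blast
    have "(\<lambda>n. \<integral>y. (F (Y n) y - F 0 y) /\<^sub>R Y n \<partial>M) \<longlonglongrightarrow> (\<integral>y. F' y \<partial>M)"
    proof (rule integral_dominated_convergence[where w = K])
      show "F' \<in> borel_measurable M" by fact
      show "(\<lambda>y. (F (Y n) y - F 0 y) /\<^sub>R Y n) \<in> borel_measurable M" for n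
        using meas by measurable
      show "integrable M K" by fact
      show "AE y in M. (\<lambda>n. (F (Y n) y - F 0 y) /\<^sub>R Y n) \<longlonglongrightarrow> F' y"
      proof (rule AE_I2)
        fix y assume y: "y \<in> space M"
        have "((\<lambda>r. (F r y - F 0 y) /\<^sub>R r) \<longlongrightarrow> F' y) (at 0)"
          using der[OF y] by (simp add: has_vector_derivative_at_0_iff)
        from this[unfolded tendsto_at_iff_sequentially, rule_format, of Y]
        show "(\<lambda>n. (F (Y n) y - F 0 y) /\<^sub>R Y n) \<longlonglongrightarrow> F' y"
          using Y0 Yl by (simp add: comp_def)
      qed
      show "AE y in M. norm ((F (Y n) y - F 0 y) /\<^sub>R Y n) \<le> K y" for n
      proof (rule AE_I2)
        fix y assume y: "y \<in> space M"
        show "norm ((F (Y n) y - F 0 y) /\<^sub>R Y n) \<le> K y"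
          using mult_left_mono[OF bd[OF y Y1[of n]], of "inverse \<bar>Y n\<bar>"] Y0[of n]
          by (simp add: mult.assoc[symmetric])
      qed
    qed
    moreover have "(\<integral>y. (F (Y n) y - F 0 y) /\<^sub>R Y n \<partial>M)
       = ((\<integral>y. F (Y n) y \<partial>M) - (\<integral>y. F 0 y \<partial>M)) /\<^sub>R Y n" for n
      using Bochner_Integration.integral_diff[OF int[OF Y1] int0] by (simp only: integral_scaleR_right)
    ultimately have "(\<lambda>n. ((\<integral>y. F (Y n) y \<partial>M) - (\<integral>y. F 0 y \<partial>M)) /\<^sub>R Y n) \<longlonglongrightarrow> (\<integral>y. F' y \<partial>M)"
      by (simp only:)
    then show ?thesis
      by (rule Lim_transform_eventually) (use ev in eventually_elim, simp)
  qed
  then show ?thesis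
    unfolding has_vector_derivative_at_0_iff tendsto_at_iff_sequentially by (simp add: comp_def)
qed

subsection \<open>The Gaussian measure\<close>

text \<open>The radial form of the product density: translations and rotations act on it through the
  norm alone.\<close>

definition gdens :: "real \<Rightarrow> 'a::euclidean_space \<Rightarrow> real" where
  "gdens \<sigma> x = (1 / sqrt (2 * pi * \<sigma>\<^sup>2)) ^ DIM('a) * exp (- (norm x)\<^sup>2 / (2 * \<sigma>\<^sup>2))"

lemma gdens_nonneg[simp]: "0 \<le> gdens \<sigma> x"
  by (simp add: gdens_def)

lemma gdens_pos: "\<sigma> > 0 \<Longrightarrow> 0 < gdens \<sigma> x"
  by (simp add: gdens_def)

lemma borel_measurable_gdens[measurable]: "gdens \<sigma> \<in> borel_measurable borel"
  unfolding gdens_def by measurable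

lemma prod_normal_density:
  fixes x :: "'a::euclidean_space"
  shows "(\<Prod>i\<in>Basis. normal_density 0 \<sigma> (x \<bullet> i)) = gdens \<sigma> x"
proof -
  have "(\<Sum>i\<in>Basis. - (x \<bullet> i)\<^sup>2 / (2 * \<sigma>\<^sup>2)) = - (norm x)\<^sup>2 / (2 * \<sigma>\<^sup>2)"
    unfolding power2_norm_eq_inner euclidean_inner[of x x]
    by (simp add: sum_divide_distrib sum_negf power2_eq_square)
  then show ?thesis
    by (simp add: gdens_def normal_density_def prod_dividef power_divide flip: exp_sum)
qed

lemma gaussian_eq: "gaussian \<sigma> = density lborel (\<lambda>x::'a::euclidean_space. ennreal (gdens \<sigma> x))"
  unfolding gaussian_def prod_normal_density ..

lemma sets_gaussian[simp, measurable_cong]: "sets (gaussian \<sigma>) = sets borel"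
  by (simp add: gaussian_def)

lemma space_gaussian[simp]: "space (gaussian \<sigma>) = UNIV"
  by (simp add: gaussian_def)

lemma prob_space_gaussian:
  assumes "\<sigma> > 0" shows "prob_space (gaussian \<sigma> :: 'a::euclidean_space measure)"
proof
  have 1: "(\<integral>\<^sup>+x. ennreal (normal_density 0 \<sigma> x) \<partial>lborel) = 1"
    using prob_space.emeasure_space_1[OF prob_space_normal_density[OF assms, of 0]]
    by (simp add: emeasure_density)
  have "emeasure (gaussian \<sigma>) (space (gaussian \<sigma> :: 'a measure))
      = (\<integral>\<^sup>+x. (\<Prod>i\<in>Basis. ennreal (normal_density 0 \<sigma> ((x::'a) \<bullet> i))) \<partial>lborel)"
    by (simp add: gaussian_def emeasure_density prod_ennreal)
  also have "\<dots> = (\<Prod>i\<in>(Basis::'a set). \<integral>\<^sup>+x. ennreal (normal_density 0 \<sigma> x) \<partial>lborel)"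
    by (intro nn_integral_lborel_prod) auto
  finally show "emeasure (gaussian \<sigma>) (space (gaussian \<sigma> :: 'a measure)) = 1"
    by (simp add: 1)
qed

lemma nn_integral_lborel_affine:
  fixes F :: "'a::euclidean_space \<Rightarrow> ennreal"
  assumes [measurable]: "F \<in> borel_measurable borel" and c: "c > 0"
  shows "(\<integral>\<^sup>+x. F x \<partial>lborel) = ennreal (c ^ DIM('a)) * (\<integral>\<^sup>+x. F (t + c *\<^sub>R x) \<partial>lborel)"
proof -
  have "(\<integral>\<^sup>+x. F x \<partial>lborel) = (\<integral>\<^sup>+x. F x \<partial>density (distr lborel borel (\<lambda>x. t + c *\<^sub>R x)) (\<lambda>_. \<bar>c\<bar> ^ DIM('a)))"
    using lborel_affine[of c t] c by simp
  also have "\<dots> = ennreal (c ^ DIM('a)) * (\<integral>\<^sup>+x. F (t + c *\<^sub>R x) \<partial>lborel)"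
    using c by (simp add: nn_integral_density nn_integral_distr nn_integral_cmult)
  finally show ?thesis .
qed

lemma nn_integral_gaussian:
  fixes F :: "'a::euclidean_space \<Rightarrow> ennreal"
  assumes [measurable]: "F \<in> borel_measurable borel"
  shows "(\<integral>\<^sup>+x. F x \<partial>gaussian \<sigma>) = (\<integral>\<^sup>+x. ennreal (gdens \<sigma> x) * F x \<partial>lborel)"
  unfolding gaussian_eq by (simp add: nn_integral_density)

lemma gaussian_scale:
  assumes "\<sigma> > 0"
  shows "gaussian \<sigma> = distr (gaussian 1) borel (\<lambda>x::'a::euclidean_space. \<sigma> *\<^sub>R x)"
proof (rule measure_eqI)
  fix A :: "'a set" assume "A \<in> sets (gaussian \<sigma>)"
  then have [measurable]: "A \<in> sets borel" by simp
  have d: "ennreal (\<sigma> ^ DIM('a)) * ennreal (gdens \<sigma> (\<sigma> *\<^sub>R x)) = ennreal (gdens 1 x)" for x :: 'a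
  proof -
    have "sqrt (2 * pi * \<sigma>\<^sup>2) = sqrt (2 * pi) * \<sigma>" using assms by (simp add: real_sqrt_mult)
    then have "\<sigma> ^ DIM('a) * gdens \<sigma> (\<sigma> *\<^sub>R x) = gdens 1 x"
      using assms by (simp add: gdens_def power_divide power_mult_distrib)
    then show ?thesis using assms by (simp flip: ennreal_mult')
  qed
  have "emeasure (gaussian \<sigma>) A = (\<integral>\<^sup>+x. indicator A x \<partial>gaussian \<sigma>)" by simp
  also have "\<dots> = (\<integral>\<^sup>+x. ennreal (gdens \<sigma> x) * indicator A x \<partial>lborel)"
    by (rule nn_integral_gaussian) measurable
  also have "\<dots> = ennreal (\<sigma> ^ DIM('a)) * (\<integral>\<^sup>+x. ennreal (gdens \<sigma> (0 + \<sigma> *\<^sub>R x)) * indicator A (0 + \<sigma> *\<^sub>R x) \<partial>lborel)"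
    by (rule nn_integral_lborel_affine) (use assms in measurable)
  also have "\<dots> = (\<integral>\<^sup>+x. ennreal (gdens 1 x) * indicator A (\<sigma> *\<^sub>R x) \<partial>lborel)"
    by (subst nn_integral_cmult[symmetric]) (simp_all add: mult.assoc[symmetric] d)
  also have "\<dots> = (\<integral>\<^sup>+x. indicator A (\<sigma> *\<^sub>R x) \<partial>gaussian 1)"
    by (rule nn_integral_gaussian[symmetric]) measurable
  also have "\<dots> = (\<integral>\<^sup>+x. indicator A x \<partial>distr (gaussian 1) borel (\<lambda>x. \<sigma> *\<^sub>R x))"
    by (subst nn_integral_distr) auto
  finally show "emeasure (gaussian \<sigma>) A = emeasure (distr (gaussian 1) borel (\<lambda>x. \<sigma> *\<^sub>R x)) A"
    by simp
qed simp

text \<open>The Cameron-Martin formula, obtained by expanding the square in the exponent of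
  \<open>gdens 1 (x - k)\<close>.\<close>

lemma gaussian_shift:
  fixes k :: "'a::euclidean_space"
  shows "distr (gaussian 1) borel (\<lambda>x. x + k)
    = density (gaussian 1) (\<lambda>x. ennreal (exp (x \<bullet> k - (norm k)\<^sup>2 / 2)))"
proof (rule measure_eqI)
  fix A :: "'a set" assume "A \<in> sets (distr (gaussian 1) borel (\<lambda>x. x + k))"
  then have [measurable]: "A \<in> sets borel" by simp
  have d: "gdens 1 (x - k) = gdens 1 x * exp (x \<bullet> k - (norm k)\<^sup>2 / 2)" for x :: 'a
    by (simp add: gdens_def power2_norm_eq_inner inner_diff field_simps inner_commute flip: exp_add)
  have "emeasure (distr (gaussian 1) borel (\<lambda>x. x + k)) A = (\<integral>\<^sup>+x. indicator A x \<partial>distr (gaussian 1) borel (\<lambda>x. x + k))"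
    by simp
  also have "\<dots> = (\<integral>\<^sup>+x. indicator A (x + k) \<partial>gaussian 1)"
    by (subst nn_integral_distr) auto
  also have "\<dots> = (\<integral>\<^sup>+x. ennreal (gdens 1 x) * indicator A (x + k) \<partial>lborel)"
    by (rule nn_integral_gaussian) measurable
  also have "\<dots> = ennreal (1 ^ DIM('a)) * (\<integral>\<^sup>+x. ennreal (gdens 1 (- k + 1 *\<^sub>R x)) * indicator A (- k + 1 *\<^sub>R x + k) \<partial>lborel)"
    by (rule nn_integral_lborel_affine) simp_all
  also have "\<dots> = (\<integral>\<^sup>+x. ennreal (gdens 1 (x - k)) * indicator A x \<partial>lborel)"
    by (simp add: algebra_simps)
  also have "\<dots> = (\<integral>\<^sup>+x. ennreal (gdens 1 x) * (ennreal (exp (x \<bullet> k - (norm k)\<^sup>2 / 2)) * indicator A x) \<partial>lborel)"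
    unfolding d by (simp add: ennreal_mult mult.assoc)
  also have "\<dots> = (\<integral>\<^sup>+x. ennreal (exp (x \<bullet> k - (norm k)\<^sup>2 / 2)) * indicator A x \<partial>gaussian 1)"
    by (rule nn_integral_gaussian[symmetric]) measurable
  also have "\<dots> = emeasure (density (gaussian 1) (\<lambda>x. ennreal (exp (x \<bullet> k - (norm k)\<^sup>2 / 2)))) A"
    by (simp add: emeasure_density)
  finally show "emeasure (distr (gaussian 1) borel (\<lambda>x. x + k)) A = \<dots>" .
qed simp

text \<open>Moving a translation from the integrand into the weight makes the integral smooth in
  \<open>k\<close> however rough \<open>F\<close> is. Integration by parts, the mollification and
  the gradient of \<open>drift\<close> all start from this.\<close>

lemma
  fixes F :: "'a::euclidean_space \<Rightarrow> 'c::euclidean_space"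
  assumes [measurable]: "F \<in> borel_measurable borel"
  shows integral_gaussian_shift:
      "(\<integral>x. F (x + k) \<partial>gaussian 1) = (\<integral>x. exp (x \<bullet> k - (norm k)\<^sup>2 / 2) *\<^sub>R F x \<partial>gaussian 1)"
    and integrable_gaussian_shift:
      "integrable (gaussian 1) (\<lambda>x. F (x + k)) \<longleftrightarrow>
       integrable (gaussian 1) (\<lambda>x. exp (x \<bullet> k - (norm k)\<^sup>2 / 2) *\<^sub>R F x)"
proof -
  have [measurable]: "(\<lambda>x. x + k) \<in> gaussian 1 \<rightarrow>\<^sub>M borel" by measurable
  show "(\<integral>x. F (x + k) \<partial>gaussian 1) = (\<integral>x. exp (x \<bullet> k - (norm k)\<^sup>2 / 2) *\<^sub>R F x \<partial>gaussian 1)"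
    by (subst integral_distr[symmetric, where f=F and N=borel], measurable)
      (simp add: gaussian_shift integral_density)
  show "integrable (gaussian 1) (\<lambda>x. F (x + k)) \<longleftrightarrow>
       integrable (gaussian 1) (\<lambda>x. exp (x \<bullet> k - (norm k)\<^sup>2 / 2) *\<^sub>R F x)"
    by (subst integrable_distr_eq[symmetric, where f=F and N=borel], measurable)
      (simp add: gaussian_shift integrable_density)
qed

text \<open>Half of the Gaussian exponent absorbs the exponential, since \<open>B * norm x\<close>
  is at most \<open>B\<^sup>2 + (norm x)\<^sup>2 / 4\<close>; the other half is a Gaussian of
  variance 2, which has finite mass.\<close>

lemma integrable_gaussian_exp_norm:
  "integrable (gaussian 1) (\<lambda>x::'a::euclidean_space. exp (B * norm x))"
proof (rule integrableI_bounded)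
  have s2: "prob_space (gaussian (sqrt 2) :: 'a measure)" by (rule prob_space_gaussian) simp
  \<comment> \<open>The power of \<open>sqrt 2\<close> is the quotient of the normalising constants
    for variances 1 and 2; the exponential comes from completing the square.\<close>
  define C where "C = (sqrt 2) ^ DIM('a) * exp (B\<^sup>2)"
  have le: "gdens 1 x * exp (B * norm x) \<le> C * gdens (sqrt 2) x" for x :: 'a
  proof -
    have "0 \<le> (B - norm x / 2)\<^sup>2" by simp
    then have "B * norm x \<le> B\<^sup>2 + (norm x)\<^sup>2 / 4" by (simp add: power2_eq_square field_simps)
    then have "exp (- (norm x)\<^sup>2 / 2 + B * norm x) \<le> exp (B\<^sup>2 + - (norm x)\<^sup>2 / 4)" by simp
    then have "exp (- (norm x)\<^sup>2 / 2) * exp (B * norm x) \<le> exp (B\<^sup>2) * exp (- (norm x)\<^sup>2 / 4)"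
      unfolding exp_add .
    then have "(1 / sqrt (2 * pi)) ^ DIM('a) * (exp (- (norm x)\<^sup>2 / 2) * exp (B * norm x))
        \<le> (1 / sqrt (2 * pi)) ^ DIM('a) * (exp (B\<^sup>2) * exp (- (norm x)\<^sup>2 / 4))"
      by (rule mult_left_mono) simp
    moreover have "(1 / sqrt (2 * pi)) ^ DIM('a) = sqrt 2 ^ DIM('a) * (1 / sqrt (4 * pi)) ^ DIM('a)"
      unfolding power_mult_distrib[symmetric]
      by (rule arg_cong[where f="\<lambda>z. z ^ DIM('a)"]) (simp add: real_sqrt_mult real_sqrt_divide real_div_sqrt field_simps)
    ultimately show ?thesis by (simp add: gdens_def C_def mult_ac)
  qed
  have "(\<integral>\<^sup>+x. ennreal (norm (exp (B * norm x))) \<partial>(gaussian 1 :: 'a measure))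
      = (\<integral>\<^sup>+x. ennreal (gdens 1 x) * ennreal (exp (B * norm x)) \<partial>(lborel :: 'a measure))"
    by (subst nn_integral_gaussian) auto
  also have "\<dots> \<le> (\<integral>\<^sup>+x. ennreal C * ennreal (gdens (sqrt 2) x) \<partial>(lborel :: 'a measure))"
  proof (rule nn_integral_mono)
    fix x :: 'a
    have "C \<ge> 0" by (simp add: C_def)
    then show "ennreal (gdens 1 x) * ennreal (exp (B * norm x)) \<le> ennreal C * ennreal (gdens (sqrt 2) x)"
      using le[of x] by (simp add: ennreal_leI flip: ennreal_mult'')
  qed
  also have "\<dots> = ennreal C * (\<integral>\<^sup>+x. 1 \<partial>(gaussian (sqrt 2) :: 'a measure))"
    by (subst nn_integral_gaussian) (auto simp: nn_integral_cmult)
  also have "\<dots> = ennreal C"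
    using prob_space.emeasure_space_1[OF s2] by simp
  also have "\<dots> < \<infinity>" by simp
  finally show "(\<integral>\<^sup>+x. ennreal (norm (exp (B * norm x))) \<partial>(gaussian 1 :: 'a measure)) < \<infinity>" .
qed simp

text \<open>Exponential growth in the norm is the working class of integrands: it survives shifts,
  multiplication by linear factors and exponential tilts.\<close>

lemma integrable_gaussian_exp_bound:
  fixes F :: "'a::euclidean_space \<Rightarrow> 'c::euclidean_space"
  assumes "F \<in> borel_measurable borel" "\<And>x. norm (F x) \<le> A * exp (B * norm x)"
  shows "integrable (gaussian 1) F"
proof (rule Bochner_Integration.integrable_bound)
  show "integrable (gaussian 1) (\<lambda>x::'a. A * exp (B * norm x))"
    by (intro integrable_mult_right integrable_gaussian_exp_norm)
  show "AE x in gaussian 1. norm (F x) \<le> norm (A * exp (B * norm x))"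
    using assms(2) by (intro AE_I2) (smt (verit, best) real_norm_def)
qed (use assms in measurable)

section \<open>Derivatives of exponential tilts and Gaussian integration by parts\<close>

text \<open>The factor 2 in the integrability assumption pays twice: one
  \<open>exp \<bar>\<eta> y\<bar>\<close> bounds the slope of the exponential for |r| at most 1, the
  other absorbs the factor \<open>\<eta> y\<close> of the increment.\<close>

lemma tilt_derivative:
  fixes F :: "'b \<Rightarrow> 'c::euclidean_space"
  assumes [measurable]: "\<eta> \<in> borel_measurable M" "F \<in> borel_measurable M"
    and int: "integrable M (\<lambda>y. exp (2 * \<bar>\<eta> y\<bar>) *\<^sub>R F y)"
  shows "((\<lambda>r. \<integral>y. exp (r * \<eta> y) *\<^sub>R F y \<partial>M) has_vector_derivative (\<integral>y. \<eta> y *\<^sub>R F y \<partial>M)) (at 0)"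
proof (rule has_vector_derivative_integral[where K="\<lambda>y. exp (2 * \<bar>\<eta> y\<bar>) * norm (F y)"])
  show "integrable M (\<lambda>y. exp (2 * \<bar>\<eta> y\<bar>) * norm (F y))"
    using integrable_norm[OF int] by simp
  show "integrable M (\<lambda>y. exp (0 * \<eta> y) *\<^sub>R F y)"
  proof (rule Bochner_Integration.integrable_bound[OF int])
    show "AE y in M. norm (exp (0 * \<eta> y) *\<^sub>R F y) \<le> norm (exp (2 * \<bar>\<eta> y\<bar>) *\<^sub>R F y)"
      by (intro AE_I2) (simp add: mult_le_cancel_right1)
  qed measurable
  fix y
  show "((\<lambda>r. exp (r * \<eta> y) *\<^sub>R F y) has_vector_derivative \<eta> y *\<^sub>R F y) (at 0)"
    by (auto intro!: derivative_eq_intros)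
  fix r :: real assume r: "\<bar>r\<bar> \<le> 1"
  define t where "t = r * \<eta> y"
  have t: "\<bar>t\<bar> \<le> \<bar>\<eta> y\<bar>" using r by (simp add: t_def abs_mult mult_left_le_one_le)
  have "norm (exp t - exp 0) \<le> exp \<bar>t\<bar> * norm (t - 0)"
    by (rule field_differentiable_bound[where S="closed_segment 0 t" and f'=exp])
      (auto simp: closed_segment_eq_real_ivl split: if_splits intro!: derivative_eq_intros)
  also have "\<dots> \<le> exp \<bar>\<eta> y\<bar> * \<bar>t\<bar>" using t by (simp add: mult_right_mono)
  also have "\<bar>t\<bar> = \<bar>r\<bar> * \<bar>\<eta> y\<bar>" by (simp add: t_def abs_mult)
  also have "exp \<bar>\<eta> y\<bar> * (\<bar>r\<bar> * \<bar>\<eta> y\<bar>) \<le> exp \<bar>\<eta> y\<bar> * (\<bar>r\<bar> * exp \<bar>\<eta> y\<bar>)"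
    using exp_ge_add_one_self[of "\<bar>\<eta> y\<bar>"] by (intro mult_left_mono order_trans[OF _ exp_ge_add_one_self]) auto
  also have "\<dots> = \<bar>r\<bar> * exp (2 * \<bar>\<eta> y\<bar>)" by (simp add: mult_ac flip: exp_add)
  finally have "norm (exp t - 1) * norm (F y) \<le> \<bar>r\<bar> * exp (2 * \<bar>\<eta> y\<bar>) * norm (F y)"
    by (intro mult_right_mono) auto
  moreover have "exp (r * \<eta> y) *\<^sub>R F y - exp (0 * \<eta> y) *\<^sub>R F y = (exp t - 1) *\<^sub>R F y"
    by (simp add: t_def scaleR_diff_left)
  ultimately show "norm (exp (r * \<eta> y) *\<^sub>R F y - exp (0 * \<eta> y) *\<^sub>R F y) \<le> \<bar>r\<bar> * (exp (2 * \<bar>\<eta> y\<bar>) * norm (F y))"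
    by (simp add: mult.assoc)
qed measurable

lemma exp_abs_inner_le: "exp (2 * \<bar>x \<bullet> k\<bar>) \<le> exp (2 * norm k * norm x)"
  using Cauchy_Schwarz_ineq2[of x k] by (simp add: mult.commute)

text \<open>The integral of \<open>\<psi> (x + r *\<^sub>R k)\<close> is differentiated at r = 0 in
  two ways, under the integral sign and after the Cameron-Martin formula has moved the shift into
  the weight. Uniqueness of the derivative equates the results.\<close>

lemma gaussian_integration_by_parts:
  fixes \<psi> \<psi>' :: "'a::euclidean_space \<Rightarrow> real"
  assumes [measurable]: "\<psi> \<in> borel_measurable borel" "\<psi>' \<in> borel_measurable borel"
    and bd: "\<And>x. \<bar>\<psi> x\<bar> \<le> A * exp (B * norm x)" and bd': "\<And>x. \<bar>\<psi>' x\<bar> \<le> A * exp (B * norm x)"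
    and B: "B \<ge> 0"
    and der: "\<And>x. ((\<lambda>r. \<psi> (x + r *\<^sub>R k)) has_real_derivative \<psi>' x) (at 0)"
  shows "(\<integral>x. \<psi>' x \<partial>gaussian 1) = (\<integral>x. \<psi> x * (x \<bullet> k) \<partial>gaussian 1)"
proof -
  have A: "A \<ge> 0" using bd[of 0] by simp
  have der': "((\<lambda>r. \<psi> (x + r *\<^sub>R k)) has_real_derivative \<psi>' (x + s *\<^sub>R k)) (at s)" for x s
  proof -
    have "((\<lambda>r. \<psi> (x + s *\<^sub>R k + r *\<^sub>R k)) has_real_derivative \<psi>' (x + s *\<^sub>R k)) (at (s + - s))"
      using der[of "x + s *\<^sub>R k"] by simp
    then have "((\<lambda>r. \<psi> (x + s *\<^sub>R k + (r + - s) *\<^sub>R k)) has_real_derivative \<psi>' (x + s *\<^sub>R k)) (at s)"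
      by (subst (asm) DERIV_shift)
    then show ?thesis by (simp add: algebra_simps)
  qed
  \<comment> \<open>Shifting the argument by at most one multiple of \<open>k\<close> costs the
    factor \<open>exp (B * norm k)\<close>.\<close>
  define A1 where "A1 = A * exp (B * norm k)"
  have "((\<lambda>r. \<integral>x. \<psi> (x + r *\<^sub>R k) \<partial>gaussian 1) has_vector_derivative (\<integral>x. \<psi>' x \<partial>gaussian 1)) (at 0)"
  proof (rule has_vector_derivative_integral[where K="\<lambda>x. A1 * exp (B * norm x)"])
    show "(\<lambda>x. \<psi> (x + r *\<^sub>R k)) \<in> borel_measurable (gaussian 1)" for r by measurable
    show "\<psi>' \<in> borel_measurable (gaussian 1)" by measurable
    show "integrable (gaussian 1) (\<lambda>x. \<psi> (x + 0 *\<^sub>R k))"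
      using integrable_gaussian_exp_bound[of \<psi> A B] bd by simp
    show "integrable (gaussian 1) (\<lambda>x::'a. A1 * exp (B * norm x))"
      by (intro integrable_mult_right integrable_gaussian_exp_norm)
    show "((\<lambda>r. \<psi> (y + r *\<^sub>R k)) has_vector_derivative \<psi>' y) (at 0)" for y
      using der by (simp add: has_real_derivative_iff_has_vector_derivative)
    fix r :: real and y :: 'a assume r: "\<bar>r\<bar> \<le> 1"
    have "norm (\<psi> (y + r *\<^sub>R k) - \<psi> (y + 0 *\<^sub>R k)) \<le> (A1 * exp (B * norm y)) * norm (r - 0)"
    proof (rule field_differentiable_bound[where S="closed_segment 0 r"])
      show "((\<lambda>r. \<psi> (y + r *\<^sub>R k)) has_field_derivative \<psi>' (y + s *\<^sub>R k)) (at s within closed_segment 0 r)" for s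
        using der' by (rule has_field_derivative_at_within)
      show "norm (\<psi>' (y + s *\<^sub>R k)) \<le> A1 * exp (B * norm y)" if "s \<in> closed_segment 0 r" for s
      proof -
        have "\<bar>s\<bar> \<le> 1" using that r by (auto simp: closed_segment_eq_real_ivl split: if_splits)
        then have "norm (s *\<^sub>R k) \<le> norm k" by (simp add: mult_left_le_one_le)
        then have "norm (y + s *\<^sub>R k) \<le> norm k + norm y"
          using norm_triangle_ineq[of y "s *\<^sub>R k"] by linarith
        then have "A * exp (B * norm (y + s *\<^sub>R k)) \<le> A * exp (B * (norm k + norm y))"
          using A B by (simp add: mult_left_mono)
        then show ?thesis
          using bd'[of "y + s *\<^sub>R k"] by (simp add: A1_def distrib_left exp_add)
      qed
    qed auto
    then show "norm (\<psi> (y + r *\<^sub>R k) - \<psi> (y + 0 *\<^sub>R k)) \<le> \<bar>r\<bar> * (A1 * exp (B * norm y))"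
      by (simp add: mult.commute)
  qed
  moreover
  \<comment> \<open>The prefactor is quadratic in r, so its derivative at 0 vanishes and only the
    tilt contributes.\<close>
  have "((\<lambda>r. exp (- (norm k)\<^sup>2 / 2 * r\<^sup>2) *\<^sub>R (\<integral>x. exp (r * (x \<bullet> k)) *\<^sub>R \<psi> x \<partial>gaussian 1))
      has_vector_derivative (\<integral>x. (x \<bullet> k) *\<^sub>R \<psi> x \<partial>gaussian 1)) (at 0)"
  proof -
    have "integrable (gaussian 1) (\<lambda>y. exp (2 * \<bar>y \<bullet> k\<bar>) *\<^sub>R \<psi> y)"
    proof (rule integrable_gaussian_exp_bound)
      fix x :: 'a
      have "norm (exp (2 * \<bar>x \<bullet> k\<bar>) *\<^sub>R \<psi> x) \<le> exp (2 * norm k * norm x) * (A * exp (B * norm x))"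
        using mult_mono[OF exp_abs_inner_le[of x k] bd[of x]] by (simp add: abs_mult)
      also have "\<dots> = A * exp ((2 * norm k + B) * norm x)" by (simp add: exp_add distrib_right)
      finally show "norm (exp (2 * \<bar>x \<bullet> k\<bar>) *\<^sub>R \<psi> x) \<le> \<dots>" .
    qed measurable
    from tilt_derivative[OF _ _ this] have d: "((\<lambda>r. \<integral>x. exp (r * (x \<bullet> k)) *\<^sub>R \<psi> x \<partial>gaussian 1)
      has_vector_derivative (\<integral>x. (x \<bullet> k) *\<^sub>R \<psi> x \<partial>gaussian 1)) (at 0)" by measurable
    show ?thesis
      by (rule has_vector_derivative_eq_rhs[OF has_vector_derivative_scaleR[OF _ d, where f'=0]])
        (auto intro!: derivative_eq_intros)
  qed
  moreover have "(\<integral>x. \<psi> (x + r *\<^sub>R k) \<partial>gaussian 1)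
     = exp (- (norm k)\<^sup>2 / 2 * r\<^sup>2) *\<^sub>R (\<integral>x. exp (r * (x \<bullet> k)) *\<^sub>R \<psi> x \<partial>gaussian 1)" for r
  proof -
    have "exp (x \<bullet> (r *\<^sub>R k) - (norm (r *\<^sub>R k))\<^sup>2 / 2) *\<^sub>R \<psi> x
      = exp (- (norm k)\<^sup>2 / 2 * r\<^sup>2) *\<^sub>R (exp (r * (x \<bullet> k)) *\<^sub>R \<psi> x)" for x
      by (simp add: power_mult_distrib mult.assoc[symmetric] mult_ac diff_conv_add_uminus flip: exp_add del: add_uminus_conv_diff)
    then show ?thesis
      unfolding integral_gaussian_shift[OF assms(1)] by (simp only: integral_scaleR_right)
  qed
  ultimately have "(\<integral>x. \<psi>' x \<partial>gaussian 1) = (\<integral>x. (x \<bullet> k) *\<^sub>R \<psi> x \<partial>gaussian 1)"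
    using vector_derivative_unique_at by simp
  then show ?thesis by (simp add: mult.commute)
qed

text \<open>The rotation is factored into two one-variable affine substitutions, each with the other
  variable frozen, with an exchange of the integrals in between; dividing by \<open>c\<close> is
  what requires c > 0.\<close>

lemma gaussian_rotation:
  fixes c d :: real
  assumes cd: "c\<^sup>2 + d\<^sup>2 = 1" and c: "c > 0"
  shows "distr (gaussian 1 \<Otimes>\<^sub>M gaussian 1) (borel \<Otimes>\<^sub>M borel)
      (\<lambda>(x, y). (c *\<^sub>R x - d *\<^sub>R y, d *\<^sub>R x + c *\<^sub>R y)) = (gaussian 1 \<Otimes>\<^sub>M (gaussian 1 :: 'a::euclidean_space measure))"
    (is "distr ?G _ ?R = _")
proof (rule measure_eqI)
  interpret g: prob_space "gaussian 1 :: 'a measure" by (rule prob_space_gaussian) simp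
  interpret gg: pair_prob_space "gaussian 1 :: 'a measure" "gaussian 1 :: 'a measure" ..
  have sets_eq[measurable_cong]: "sets ?G = sets (borel \<Otimes>\<^sub>M borel)" by (intro sets_pair_measure_cong) simp_all
  fix A assume "A \<in> sets (distr ?G (borel \<Otimes>\<^sub>M borel) ?R)"
  then have A[measurable]: "A \<in> sets (borel \<Otimes>\<^sub>M borel)" by simp
  let ?g = "\<lambda>x::'a. ennreal (gdens 1 x)"
  let ?i = "\<lambda>x. indicator A x :: ennreal"
  have R[measurable]: "?R \<in> borel \<Otimes>\<^sub>M borel \<rightarrow>\<^sub>M borel \<Otimes>\<^sub>M borel" by measurable
  have gg_eq: "?g ((1/c) *\<^sub>R (u + d *\<^sub>R (c *\<^sub>R w + (-d) *\<^sub>R u))) * ?g (c *\<^sub>R w + (-d) *\<^sub>R u) = ?g u * ?g w" for u w :: 'a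
  proof -
    have "u + d *\<^sub>R (c *\<^sub>R w + (-d) *\<^sub>R u) = (1 - d\<^sup>2) *\<^sub>R u + (d * c) *\<^sub>R w"
      by (simp add: algebra_simps power2_eq_square)
    also have "1 - d\<^sup>2 = c\<^sup>2" using cd by simp
    finally have *: "(1/c) *\<^sub>R (u + d *\<^sub>R (c *\<^sub>R w + (-d) *\<^sub>R u)) = c *\<^sub>R u + d *\<^sub>R w"
      using c by (simp add: scaleR_add_right power2_eq_square)
    have "(norm (c *\<^sub>R u + d *\<^sub>R w))\<^sup>2 + (norm (c *\<^sub>R w + (-d) *\<^sub>R u))\<^sup>2 = (c\<^sup>2 + d\<^sup>2) * (norm u)\<^sup>2 + (c\<^sup>2 + d\<^sup>2) * (norm w)\<^sup>2"
      unfolding power2_norm_eq_inner by (simp add: inner_add inner_diff algebra_simps power2_eq_square inner_commute)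
    then have "(norm (c *\<^sub>R u + d *\<^sub>R w))\<^sup>2 + (norm (c *\<^sub>R w + (-d) *\<^sub>R u))\<^sup>2 = (norm u)\<^sup>2 + (norm w)\<^sup>2"
      using cd by simp
    then have "exp (- (norm (c *\<^sub>R u + d *\<^sub>R w))\<^sup>2 / 2) * exp (- (norm (c *\<^sub>R w + (-d) *\<^sub>R u))\<^sup>2 / 2) = exp (- (norm u)\<^sup>2 / 2) * exp (- (norm w)\<^sup>2 / 2)"
      unfolding exp_add[symmetric] by (simp add: field_simps)
    then have "gdens 1 (c *\<^sub>R u + d *\<^sub>R w) * gdens 1 (c *\<^sub>R w + (-d) *\<^sub>R u) = gdens 1 u * gdens 1 w"
      by (simp add: gdens_def mult_ac)
    then show ?thesis unfolding * by (simp flip: ennreal_mult)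
  qed
  have "emeasure (distr ?G (borel \<Otimes>\<^sub>M borel) ?R) A = (\<integral>\<^sup>+p. ?i p \<partial>distr ?G (borel \<Otimes>\<^sub>M borel) ?R)"
    by simp
  also have "\<dots> = (\<integral>\<^sup>+p. ?i (?R p) \<partial>?G)"
    by (subst nn_integral_distr) auto
  also have "\<dots> = (\<integral>\<^sup>+y. \<integral>\<^sup>+x. ?i (?R (x, y)) \<partial>gaussian 1 \<partial>gaussian 1)"
    by (subst gg.nn_integral_snd[symmetric]) auto
  also have "\<dots> = (\<integral>\<^sup>+y. \<integral>\<^sup>+x. ?g x * ?i (?R (x, y)) \<partial>lborel \<partial>gaussian 1)"
    by (intro nn_integral_cong nn_integral_gaussian) measurable
  also have "\<dots> = (\<integral>\<^sup>+y. ?g y * (\<integral>\<^sup>+x. ?g x * ?i (?R (x, y)) \<partial>lborel) \<partial>lborel)"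
    by (rule nn_integral_gaussian) measurable
  \<comment> \<open>Substitution of u = c x - d y for x, at fixed y.\<close>
  also have "\<dots> = (\<integral>\<^sup>+y. ?g y * (ennreal ((1/c) ^ DIM('a)) * (\<integral>\<^sup>+u. ?g ((d/c) *\<^sub>R y + (1/c) *\<^sub>R u) * ?i (?R ((d/c) *\<^sub>R y + (1/c) *\<^sub>R u, y)) \<partial>lborel)) \<partial>lborel)"
  proof (rule nn_integral_cong)
    fix y :: 'a
    have "(\<integral>\<^sup>+x. ?g x * ?i (?R (x, y)) \<partial>lborel)
      = ennreal ((1/c) ^ DIM('a)) * (\<integral>\<^sup>+u. ?g ((d/c) *\<^sub>R y + (1/c) *\<^sub>R u) * ?i (?R ((d/c) *\<^sub>R y + (1/c) *\<^sub>R u, y)) \<partial>lborel)"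
      by (rule nn_integral_lborel_affine) (use c in auto)
    then show "?g y * (\<integral>\<^sup>+x. ?g x * ?i (?R (x, y)) \<partial>lborel) = ?g y * (ennreal ((1/c) ^ DIM('a)) * (\<integral>\<^sup>+u. ?g ((d/c) *\<^sub>R y + (1/c) *\<^sub>R u) * ?i (?R ((d/c) *\<^sub>R y + (1/c) *\<^sub>R u, y)) \<partial>lborel))"
      by simp
  qed
  also have "\<dots> = (\<integral>\<^sup>+y. \<integral>\<^sup>+u. ennreal ((1/c) ^ DIM('a)) * (?g y * (?g ((1/c) *\<^sub>R (u + d *\<^sub>R y)) * ?i (u, (1/c) *\<^sub>R (y + d *\<^sub>R u)))) \<partial>lborel \<partial>lborel)"
  proof (rule nn_integral_cong)
    fix y :: 'a
    have r: "?R ((d/c) *\<^sub>R y + (1/c) *\<^sub>R u, y) = (u, (1/c) *\<^sub>R (y + d *\<^sub>R u))" for u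
    proof -
      have "d * d / c + c = 1 / c" using cd c by (simp add: field_simps power2_eq_square)
      then have "(d * d / c) *\<^sub>R y + c *\<^sub>R y = (1/c) *\<^sub>R y" by (metis scaleR_add_left)
      then show ?thesis using c by (simp add: algebra_simps)
    qed
    have r2: "(d/c) *\<^sub>R y + (1/c) *\<^sub>R u = (1/c) *\<^sub>R (u + d *\<^sub>R y)" for u by (simp add: algebra_simps)
    show "?g y * (ennreal ((1/c) ^ DIM('a)) * (\<integral>\<^sup>+u. ?g ((d/c) *\<^sub>R y + (1/c) *\<^sub>R u) * ?i (?R ((d/c) *\<^sub>R y + (1/c) *\<^sub>R u, y)) \<partial>lborel))
      = (\<integral>\<^sup>+u. ennreal ((1/c) ^ DIM('a)) * (?g y * (?g ((1/c) *\<^sub>R (u + d *\<^sub>R y)) * ?i (u, (1/c) *\<^sub>R (y + d *\<^sub>R u)))) \<partial>lborel)"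
      unfolding r unfolding r2
      by (subst nn_integral_cmult, measurable)+ (simp add: mult_ac)
  qed
  also have "\<dots> = (\<integral>\<^sup>+u. \<integral>\<^sup>+y. ennreal ((1/c) ^ DIM('a)) * (?g y * (?g ((1/c) *\<^sub>R (u + d *\<^sub>R y)) * ?i (u, (1/c) *\<^sub>R (y + d *\<^sub>R u)))) \<partial>lborel \<partial>lborel)"
    by (rule lborel_pair.Fubini') measurable
  also have "\<dots> = (\<integral>\<^sup>+u. ennreal ((1/c) ^ DIM('a)) * (\<integral>\<^sup>+y. ?g y * (?g ((1/c) *\<^sub>R (u + d *\<^sub>R y)) * ?i (u, (1/c) *\<^sub>R (y + d *\<^sub>R u))) \<partial>lborel) \<partial>lborel)"
    by (subst nn_integral_cmult) auto
  \<comment> \<open>Substitution of w = (y + d u) / c for y, at fixed u. Its Jacobian cancels the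
    one of the first substitution, and \<open>gg_eq\<close> restores the product density.\<close>
  also have "\<dots> = (\<integral>\<^sup>+u. ennreal ((1/c) ^ DIM('a)) * (ennreal (c ^ DIM('a)) * (\<integral>\<^sup>+w. ?g ((-d) *\<^sub>R u + c *\<^sub>R w) *
       (?g ((1/c) *\<^sub>R (u + d *\<^sub>R ((-d) *\<^sub>R u + c *\<^sub>R w))) * ?i (u, (1/c) *\<^sub>R ((-d) *\<^sub>R u + c *\<^sub>R w + d *\<^sub>R u))) \<partial>lborel)) \<partial>lborel)"
  proof (rule nn_integral_cong)
    fix u :: 'a
    have "(\<integral>\<^sup>+y. ?g y * (?g ((1/c) *\<^sub>R (u + d *\<^sub>R y)) * ?i (u, (1/c) *\<^sub>R (y + d *\<^sub>R u))) \<partial>lborel)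
     = ennreal (c ^ DIM('a)) * (\<integral>\<^sup>+w. ?g ((-d) *\<^sub>R u + c *\<^sub>R w) *
       (?g ((1/c) *\<^sub>R (u + d *\<^sub>R ((-d) *\<^sub>R u + c *\<^sub>R w))) * ?i (u, (1/c) *\<^sub>R ((-d) *\<^sub>R u + c *\<^sub>R w + d *\<^sub>R u))) \<partial>lborel)"
      by (rule nn_integral_lborel_affine) (use c in auto)
    then show "ennreal ((1/c) ^ DIM('a)) * (\<integral>\<^sup>+y. ?g y * (?g ((1/c) *\<^sub>R (u + d *\<^sub>R y)) * ?i (u, (1/c) *\<^sub>R (y + d *\<^sub>R u))) \<partial>lborel)
      = ennreal ((1/c) ^ DIM('a)) * (ennreal (c ^ DIM('a)) * (\<integral>\<^sup>+w. ?g ((-d) *\<^sub>R u + c *\<^sub>R w) *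
       (?g ((1/c) *\<^sub>R (u + d *\<^sub>R ((-d) *\<^sub>R u + c *\<^sub>R w))) * ?i (u, (1/c) *\<^sub>R ((-d) *\<^sub>R u + c *\<^sub>R w + d *\<^sub>R u))) \<partial>lborel))"
      by simp
  qed
  also have "\<dots> = (\<integral>\<^sup>+u. ?g u * (\<integral>\<^sup>+w. ?g w * ?i (u, w) \<partial>lborel) \<partial>lborel)"
  proof (rule nn_integral_cong)
    fix u :: 'a
    have 1: "ennreal ((1/c) ^ DIM('a)) * ennreal (c ^ DIM('a)) = 1"
      using c by (simp add: power_divide flip: ennreal_mult')
    have key: "?g ((-d) *\<^sub>R u + c *\<^sub>R w) * (?g ((1/c) *\<^sub>R (u + d *\<^sub>R ((-d) *\<^sub>R u + c *\<^sub>R w))) * ?i (u, (1/c) *\<^sub>R ((-d) *\<^sub>R u + c *\<^sub>R w + d *\<^sub>R u)))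
       = ?g u * (?g w * ?i (u, w))" for w
    proof -
      have 2: "(-d) *\<^sub>R u + c *\<^sub>R w = c *\<^sub>R w + (-d) *\<^sub>R u" by (rule add.commute)
      have 3: "(1/c) *\<^sub>R (c *\<^sub>R w + (-d) *\<^sub>R u + d *\<^sub>R u) = w" using c by simp
      have 4: "p * (q * r) = q * p * r" for p q r :: ennreal by (simp add: mult_ac)
      show ?thesis unfolding 2 3 4[of "?g (c *\<^sub>R w + (-d) *\<^sub>R u)"] gg_eq by (rule mult.assoc)
    qed
    show "ennreal ((1/c) ^ DIM('a)) * (ennreal (c ^ DIM('a)) * (\<integral>\<^sup>+w. ?g ((-d) *\<^sub>R u + c *\<^sub>R w) *
       (?g ((1/c) *\<^sub>R (u + d *\<^sub>R ((-d) *\<^sub>R u + c *\<^sub>R w))) * ?i (u, (1/c) *\<^sub>R ((-d) *\<^sub>R u + c *\<^sub>R w + d *\<^sub>R u))) \<partial>lborel))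
       = ?g u * (\<integral>\<^sup>+w. ?g w * ?i (u, w) \<partial>lborel)"
      unfolding mult.assoc[symmetric, of "ennreal ((1/c) ^ DIM('a))"] 1 mult_1_left key by (intro nn_integral_cmult) measurable
  qed
  also have "\<dots> = (\<integral>\<^sup>+u. \<integral>\<^sup>+w. ?g w * ?i (u, w) \<partial>lborel \<partial>gaussian 1)"
    by (rule nn_integral_gaussian[symmetric]) measurable
  also have "\<dots> = (\<integral>\<^sup>+u. \<integral>\<^sup>+w. ?i (u, w) \<partial>gaussian 1 \<partial>gaussian 1)"
    by (intro nn_integral_cong nn_integral_gaussian[symmetric]) measurable
  also have "\<dots> = emeasure ?G A"
    by (subst g.emeasure_pair_measure) auto
  finally show "emeasure (distr ?G (borel \<Otimes>\<^sub>M borel) ?R) A = emeasure ?G A" .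
qed simp

subsection \<open>Ordinary differential equations with Lipschitz fields\<close>

definition lipschitz_field :: "real \<Rightarrow> (real \<Rightarrow> 'a::euclidean_space \<Rightarrow> 'a) \<Rightarrow> bool" where
  "lipschitz_field L w \<longleftrightarrow> L > 0 \<and> continuous_on ({0..1} \<times> UNIV) (\<lambda>(t, x). w t x) \<and>
     (\<forall>t\<in>{0..1}. \<forall>x y. norm (w t x - w t y) \<le> L * norm (x - y))"

lemma lipschitz_fieldD:
  assumes "lipschitz_field L w"
  shows "L > 0" "continuous_on ({0..1} \<times> UNIV) (\<lambda>(t, x). w t x)"
    "t \<in> {0..1} \<Longrightarrow> norm (w t x - w t y) \<le> L * norm (x - y)"
  using assms by (auto simp: lipschitz_field_def)

lemma lipschitz_field_continuous_on_curve:
  assumes "lipschitz_field L w" "S \<subseteq> {0..1}" "continuous_on S y"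
  shows "continuous_on S (\<lambda>t. w t (y t))"
proof -
  have "continuous_on S (\<lambda>t. (\<lambda>(t, x). w t x) (t, y t))"
    by (rule continuous_on_compose2[OF lipschitz_fieldD(2)[OF assms(1)]])
      (use assms in \<open>auto intro!: continuous_intros\<close>)
  then show ?thesis by simp
qed

text \<open>The integrating factor \<open>exp (- K * t)\<close> turns the differential inequality
  into monotonicity. \<open>K\<close> may have either sign, so lower bounds on growth are covered
  too.\<close>

lemma exp_weighted_monotone:
  fixes D D' :: "real \<Rightarrow> real"
  assumes "a \<le> b" and D: "\<And>t. t \<in> {a..b} \<Longrightarrow> (D has_real_derivative D' t) (at t within {a..b})"
    and le: "\<And>t. t \<in> {a..b} \<Longrightarrow> D' t \<le> K * D t"
  shows "exp (- K * b) * D b \<le> exp (- K * a) * D a"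
proof (rule DERIV_nonpos_imp_decreasing_open[OF \<open>a \<le> b\<close>])
  fix t assume t: "a < t" "t < b"
  then have "(D has_real_derivative D' t) (at t)"
    using D[of t] at_within_Icc_at[of a t b] by auto
  then have "((\<lambda>t. exp (- K * t) * D t) has_real_derivative exp (- K * t) * (D' t - K * D t)) (at t)"
    by (auto intro!: derivative_eq_intros simp: algebra_simps)
  moreover have "exp (- K * t) * (D' t - K * D t) \<le> 0"
    using le[of t] t by (intro mult_nonneg_nonpos) auto
  ultimately show "\<exists>y. ((\<lambda>t. exp (- K * t) * D t) has_real_derivative y) (at t) \<and> y \<le> 0" by blast
next
  have "continuous_on {a..b} D"
    using D by (meson DERIV_continuous continuous_on_eq_continuous_within)
  then show "continuous_on {a..b} (\<lambda>t. exp (- K * t) * D t)" by (intro continuous_intros)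
qed

text \<open>The squared distance \<open>D\<close> of two solutions is differentiable where the norm
  need not be, and satisfies |D'| at most 2 L D. The upper half of this bound limits the spreading
  of solutions, the lower half their merging.\<close>

lemma lipschitz_field_gronwall:
  fixes w :: "real \<Rightarrow> 'a::euclidean_space \<Rightarrow> 'a"
  assumes w: "lipschitz_field L w" and ab: "0 \<le> a" "a \<le> b" "b \<le> 1"
    and y: "\<And>t. t \<in> {a..b} \<Longrightarrow> (y has_vector_derivative w t (y t)) (at t within {a..b})"
    and z: "\<And>t. t \<in> {a..b} \<Longrightarrow> (z has_vector_derivative w t (z t)) (at t within {a..b})"
  shows "norm (y b - z b) \<le> exp (L * (b - a)) * norm (y a - z a)"
    and "norm (y a - z a) \<le> exp (L * (b - a)) * norm (y b - z b)"
proof -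
  define D where "D t = (y t - z t) \<bullet> (y t - z t)" for t
  define D' where "D' t = 2 * ((y t - z t) \<bullet> (w t (y t) - w t (z t)))" for t
  have D: "(D has_real_derivative D' t) (at t within {a..b})" if "t \<in> {a..b}" for t
  proof -
    have "((\<lambda>t. y t - z t) has_vector_derivative (w t (y t) - w t (z t))) (at t within {a..b})"
      using y[OF that] z[OF that] by (rule has_vector_derivative_diff)
    then have "((\<lambda>t. y t - z t) has_derivative (\<lambda>h. h *\<^sub>R (w t (y t) - w t (z t)))) (at t within {a..b})"
      by (simp add: has_vector_derivative_def)
    from has_derivative_inner[OF this this]
    have "(D has_derivative (\<lambda>h. (y t - z t) \<bullet> h *\<^sub>R (w t (y t) - w t (z t)) + h *\<^sub>R (w t (y t) - w t (z t)) \<bullet> (y t - z t))) (at t within {a..b})"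
      by (simp only: D_def[abs_def])
    then show ?thesis
      unfolding has_field_derivative_def D'_def
      by (rule has_derivative_eq_rhs) (auto simp: fun_eq_iff inner_commute)
  qed
  have D'b: "\<bar>D' t\<bar> \<le> 2 * L * D t" if "t \<in> {a..b}" for t
  proof -
    have "\<bar>(y t - z t) \<bullet> (w t (y t) - w t (z t))\<bar> \<le> norm (y t - z t) * norm (w t (y t) - w t (z t))"
      by (rule Cauchy_Schwarz_ineq2)
    also have "\<dots> \<le> norm (y t - z t) * (L * norm (y t - z t))"
      using that ab by (intro mult_left_mono lipschitz_fieldD(3)[OF w]) auto
    finally show ?thesis unfolding D'_def D_def by (simp add: dot_square_norm power2_eq_square mult_ac)
  qed
  \<comment> \<open>Common end of both estimates: the exponential weights are collected and a square
    root is taken.\<close>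
  have sq: "norm p \<le> exp (L * (b - a)) * norm q"
    if "exp (- (2 * L) * t) * (p \<bullet> p) \<le> exp (- (2 * L) * s) * (q \<bullet> q)" "t - s = b - a" for p q :: 'a and s t
  proof -
    have "exp (2 * L * t) * exp (- (2 * L) * t) = 1" by (simp flip: exp_add)
    then have "p \<bullet> p = exp (2 * L * t) * (exp (- (2 * L) * t) * (p \<bullet> p))" by (simp only: mult.assoc[symmetric] mult_1_left)
    also have "\<dots> \<le> exp (2 * L * t) * (exp (- (2 * L) * s) * (q \<bullet> q))"
      using that(1) by (intro mult_left_mono) auto
    also have "\<dots> = exp (2 * L * (t - s)) * (q \<bullet> q)"
    proof -
      have "exp (2 * L * t) * exp (- (2 * L) * s) = exp (2 * L * (t - s))"
        unfolding exp_add[symmetric] by (simp add: algebra_simps)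
      then show ?thesis by (simp only: mult.assoc[symmetric])
    qed
    also have "\<dots> = (exp (L * (b - a)) * norm q)\<^sup>2"
      unfolding that(2) by (simp only: mult.assoc exp_double dot_square_norm power_mult_distrib)
    finally have "(norm p)\<^sup>2 \<le> (exp (L * (b - a)) * norm q)\<^sup>2" by (simp add: dot_square_norm)
    then show ?thesis by (rule power2_le_imp_le) simp
  qed
  have "exp (- (2 * L) * b) * D b \<le> exp (- (2 * L) * a) * D a"
    using exp_weighted_monotone[of a b D D' "2 * L"] D D'b ab by (force simp: abs_le_iff)
  then show "norm (y b - z b) \<le> exp (L * (b - a)) * norm (y a - z a)"
    unfolding D_def by (rule sq) simp
  \<comment> \<open>The lower half of the bound on D' is an upper bound for -D with rate -2
    L.\<close>
  have "exp (- (- (2 * L)) * b) * (- D b) \<le> exp (- (- (2 * L)) * a) * (- D a)"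
    using exp_weighted_monotone[of a b "\<lambda>t. - D t" "\<lambda>t. - D' t" "- (2 * L)"] D D'b ab
    by (force simp: abs_le_iff intro!: derivative_intros)
  then have "exp (- (2 * L) * (- a)) * D a \<le> exp (- (2 * L) * (- b)) * D b" by simp
  then show "norm (y a - z a) \<le> exp (L * (b - a)) * norm (y b - z b)"
    unfolding D_def by (rule sq) simp
qed

text \<open>Picard iteration as a fixed point for the unknown
  \<open>z t = exp (- 2 * L * t) *\<^sub>R y t\<close>. The exponential weight makes the map a
  contraction with factor 1/2 on the whole interval at once, so no short intervals have to be
  glued.\<close>

lemma lipschitz_field_solution:
  fixes w :: "real \<Rightarrow> 'a::euclidean_space \<Rightarrow> 'a"
  assumes w: "lipschitz_field L w"
  shows "\<exists>y. solves_ivp w x y"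
proof -
  note L = lipschitz_fieldD(1)[OF w]
  \<comment> \<open>Times are clamped to [0,1] so that the iterates are bounded continuous functions
    on the whole real line, which form a complete space.\<close>
  define cl where "cl t = max 0 (min 1 t)" for t :: real
  have cl: "cl t \<in> {0..1}" for t by (auto simp: cl_def)
  have cl_id: "cl t = t" if "t \<in> {0..1}" for t using that by (auto simp: cl_def)
  define f where "f z r = w r (exp (2 * L * r) *\<^sub>R apply_bcontfun z r)" for z :: "real \<Rightarrow>\<^sub>C 'a" and r
  have fc: "continuous_on {0..1} (f z)" for z
    unfolding f_def by (intro lipschitz_field_continuous_on_curve[OF w] continuous_intros) auto
  define G where "G z t = exp (- 2 * L * t) *\<^sub>R (x + integral {0..t} (f z))" for z t
  have Gc: "continuous_on {0..1} (G z)" for z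
    unfolding G_def by (intro continuous_intros indefinite_integral_continuous_1 integrable_continuous_interval fc)
  have GB: "(\<lambda>t. G z (cl t)) \<in> bcontfun" for z
  proof -
    have "continuous_on UNIV (\<lambda>t. G z (cl t))"
      by (rule continuous_on_compose2[OF Gc]) (use cl in \<open>auto simp: cl_def intro!: continuous_intros\<close>)
    moreover have "bounded (G z ` {0..1})"
      by (intro compact_imp_bounded compact_continuous_image Gc) simp
    then obtain B where "\<forall>t\<in>{0..1}. norm (G z t) \<le> B" unfolding bounded_iff by blast
    ultimately show ?thesis using cl by (intro bcontfun_normI[where b=B]) blast+
  qed
  define P where "P z = Bcontfun (\<lambda>t. G z (cl t))" for z
  have P: "apply_bcontfun (P z) t = G z (cl t)" for z t
    unfolding P_def using GB by (simp add: Bcontfun_inverse)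
  have contr: "dist (P z) (P z') \<le> 1/2 * dist z z'" for z z'
  proof (rule dist_bound)
    fix t
    define s where "s = cl t"
    have s: "s \<in> {0..1}" using cl by (simp add: s_def)
    have int: "f z integrable_on {0..s}" for z
      using fc s by (intro integrable_continuous_interval continuous_on_subset[OF fc]) auto
    \<comment> \<open>The weight \<open>exp (2 * L * r)\<close> integrates to 1/(2 L) of itself;
      together with the Lipschitz constant L this is the factor 1/2.\<close>
    have FT: "((\<lambda>r. L * exp (2 * L * r) * dist z z') has_integral
        (exp (2 * L * s) / 2 * dist z z' - exp (2 * L * 0) / 2 * dist z z')) {0..s}"
      using s L by (intro fundamental_theorem_of_calculus)
        (auto intro!: derivative_eq_intros simp flip: has_real_derivative_iff_has_vector_derivative)
    have "norm (integral {0..s} (\<lambda>r. f z r - f z' r)) \<le> integral {0..s} (\<lambda>r. L * exp (2 * L * r) * dist z z')"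
    proof (rule integral_norm_bound_integral)
      show "(\<lambda>r. f z r - f z' r) integrable_on {0..s}" using int by (intro integrable_diff)
      show "(\<lambda>r. L * exp (2 * L * r) * dist z z') integrable_on {0..s}" using FT by blast
      fix r assume "r \<in> {0..s}"
      then have "norm (f z r - f z' r) \<le> L * norm (exp (2 * L * r) *\<^sub>R apply_bcontfun z r - exp (2 * L * r) *\<^sub>R apply_bcontfun z' r)"
        unfolding f_def using s by (intro lipschitz_fieldD(3)[OF w]) auto
      also have "\<dots> = L * exp (2 * L * r) * dist (apply_bcontfun z r) (apply_bcontfun z' r)"
        by (simp add: dist_norm flip: scaleR_diff_right)
      also have "\<dots> \<le> L * exp (2 * L * r) * dist z z'"
        using L by (intro mult_left_mono dist_bounded) auto
      finally show "norm (f z r - f z' r) \<le> L * exp (2 * L * r) * dist z z'" .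
    qed
    also have "\<dots> \<le> exp (2 * L * s) / 2 * dist z z'"
      unfolding integral_unique[OF FT] by simp
    finally have "exp (- 2 * L * s) * norm (integral {0..s} (\<lambda>r. f z r - f z' r)) \<le> exp (- 2 * L * s) * (exp (2 * L * s) / 2 * dist z z')"
      by (intro mult_left_mono) auto
    also have "\<dots> = 1/2 * dist z z'" by (simp add: mult.assoc[symmetric] flip: exp_add)
    also have "exp (- 2 * L * s) * norm (integral {0..s} (\<lambda>r. f z r - f z' r)) = dist (G z s) (G z' s)"
      unfolding G_def dist_norm scaleR_diff_right[symmetric] norm_scaleR
      using int by (simp add: Henstock_Kurzweil_Integration.integral_diff)
    finally show "dist (apply_bcontfun (P z) t) (apply_bcontfun (P z') t) \<le> 1/2 * dist z z'"
      unfolding P s_def .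
  qed
  have "\<exists>!z. P z = z"
    by (rule banach_fix_type[where c="1/2"]) (use contr in auto)
  then obtain z where z: "P z = z" by blast
  define y where "y t = x + integral {0..t} (f z)" for t
  have zy: "exp (2 * L * t) *\<^sub>R apply_bcontfun z t = y t" if "t \<in> {0..1}" for t
  proof -
    have "apply_bcontfun z t = G z t" using P[of z t] cl_id[OF that] z by simp
    then show ?thesis by (simp add: G_def y_def flip: exp_add)
  qed
  have "solves_ivp w x y"
    unfolding solves_ivp_def
  proof (intro conjI ballI)
    show "y 0 = x" by (simp add: y_def)
    fix t :: real assume t: "t \<in> {0..1}"
    have "(y has_vector_derivative 0 + f z t) (at t within {0..1})"
      unfolding y_def by (intro has_vector_derivative_add has_vector_derivative_const
          integral_has_vector_derivative fc t)
    also have "f z t = w t (y t)" unfolding f_def zy[OF t] ..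
    finally show "(y has_vector_derivative w t (y t)) (at t within {0..1})" by simp
  qed
  then show ?thesis by blast
qed

lemma solves_ivp_unique:
  assumes w: "lipschitz_field L w" and "solves_ivp w x y" "solves_ivp w x z" "t \<in> {0..1}"
  shows "y t = z t"
proof -
  have "norm (y t - z t) \<le> exp (L * (t - 0)) * norm (y 0 - z 0)"
  proof (rule lipschitz_field_gronwall(1)[OF w])
    fix r assume r: "r \<in> {0..t}"
    have sub: "{0..t} \<subseteq> {0..1}" using assms by auto
    show "(y has_vector_derivative w r (y r)) (at r within {0..t})"
      "(z has_vector_derivative w r (z r)) (at r within {0..t})"
      using assms r by (auto simp: solves_ivp_def intro!: has_vector_derivative_within_subset[OF _ sub])
  qed (use assms in auto)
  then show ?thesis using assms by (simp add: solves_ivp_def)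
qed

lemma lipschitz_field_unique_flow:
  assumes w: "lipschitz_field L w"
  obtains X where "unique_flow w X"
proof
  define X where "X t x = (SOME y. solves_ivp w x y) t" for t x
  have "solves_ivp w x (\<lambda>t. X t x)" for x
    using someI_ex[OF lipschitz_field_solution[OF w, of x]] by (simp only: X_def)
  then show "unique_flow w X"
    unfolding unique_flow_def using solves_ivp_unique[OF w] by blast
qed

lemma unique_flow_derivative:
  assumes "unique_flow w X" "0 \<le> a" "b \<le> 1" "t \<in> {a..b}"
  shows "((\<lambda>t. X t x) has_vector_derivative w t (X t x)) (at t within {a..b})"
proof -
  have sub: "{a..b} \<subseteq> {0..1}" using assms by auto
  have "((\<lambda>t. X t x) has_vector_derivative w t (X t x)) (at t within {0..1})"
    using assms sub unfolding unique_flow_def solves_ivp_def by blast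
  then show ?thesis by (rule has_vector_derivative_within_subset[OF _ sub])
qed

lemma unique_flow_0: "unique_flow w X \<Longrightarrow> X 0 x = x"
  by (simp add: unique_flow_def solves_ivp_def)

lemma unique_flow_lipschitz:
  assumes w: "lipschitz_field L w" and X: "unique_flow w X" and t: "t \<in> {0..1}"
  shows "norm (X t x - X t y) \<le> exp (L * t) * norm (x - y)"
    "norm (x - y) \<le> exp (L * t) * norm (X t x - X t y)"
  using lipschitz_field_gronwall[OF w, of 0 t "\<lambda>t. X t x" "\<lambda>t. X t y"] t
    unique_flow_derivative[OF X] by (auto simp: unique_flow_0[OF X])

lemma unique_flow_continuous:
  assumes w: "lipschitz_field L w" and X: "unique_flow w X" and t: "t \<in> {0..1}"
  shows "continuous_on UNIV (X t)"
proof -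
  have "(exp (L * t))-lipschitz_on UNIV (X t)"
    using unique_flow_lipschitz(1)[OF w X t] by (intro lipschitz_onI) (auto simp: dist_norm)
  then show ?thesis by (rule lipschitz_on_continuous_on)
qed

text \<open>Injectivity is the non-merging half of Gronwall. For surjectivity the equation is solved
  backwards from the desired endpoint.\<close>

lemma unique_flow_bij:
  fixes w :: "real \<Rightarrow> 'a::euclidean_space \<Rightarrow> 'a"
  assumes w: "lipschitz_field L w" and X: "unique_flow w X" and s: "s \<in> {0..1}"
  shows "bij (X s)"
proof (rule bijI)
  show "inj (X s)"
    using unique_flow_lipschitz(2)[OF w X s] by (intro injI) (metis eq_iff_diff_eq_0 mult_zero_right norm_le_zero_iff norm_zero)
  show "surj (X s)"
  proof (cases "s = 0")
    case True then show ?thesis using unique_flow_0[OF X] by (auto simp: surj_def)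
  next
    case False
    then have s0: "s > 0" using s by auto
    \<comment> \<open>The field reversed from time s and rescaled to the unit interval; the factor s
      is at most 1, so L remains a Lipschitz constant.\<close>
    define w2 where "w2 r y = - (s *\<^sub>R w (s * (1 - r)) y)" for r y
    have "lipschitz_field L w2"
      unfolding lipschitz_field_def
    proof (intro conjI ballI allI)
      show "L > 0" using lipschitz_fieldD[OF w] by blast
      have *: "s * (1 - r) \<in> {0..1}" if "r \<in> {0..1}" for r
        using that s by (auto intro!: mult_le_one)
      have "continuous_on ({0..1} \<times> UNIV) (\<lambda>p::real \<times> 'a. (\<lambda>(t, x). w t x) (s * (1 - fst p), snd p))"
      proof (rule continuous_on_compose2[OF lipschitz_fieldD(2)[OF w]])
        show "(\<lambda>p::real \<times> 'a. (s * (1 - fst p), snd p)) ` ({0..1} \<times> UNIV) \<subseteq> {0..1} \<times> UNIV"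
          using * by (intro image_subsetI) (simp only: mem_Times_iff fst_conv snd_conv simp_thms UNIV_I)
      qed (intro continuous_intros)
      then show "continuous_on ({0..1} \<times> UNIV) (\<lambda>(t, x). w2 t x)"
        unfolding w2_def case_prod_beta fst_conv snd_conv
        by (intro continuous_on_minus continuous_on_scaleR continuous_on_const)
      fix t x y assume t: "t \<in> {0..1::real}"
      have "norm (w2 t x - w2 t y) = s * norm (w (s * (1 - t)) x - w (s * (1 - t)) y)"
        unfolding w2_def using s0 by (simp add: norm_minus_commute flip: scaleR_diff_right)
      also have "\<dots> \<le> 1 * (L * norm (x - y))"
        using s0 s lipschitz_fieldD(3)[OF w *[OF t]] by (intro mult_mono) auto
      finally show "norm (w2 t x - w2 t y) \<le> L * norm (x - y)" by simp
    qed
    note w2 = this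
    have "\<exists>x0. X s x0 = x" for x
    proof -
      obtain y where y: "solves_ivp w2 x y" using lipschitz_field_solution[OF w2] by blast
      define c where "c r = y (1 - r / s)" for r
      have c: "(c has_vector_derivative w r (c r)) (at r within {0..s})" if r: "r \<in> {0..s}" for r
      proof -
        have im: "(\<lambda>r. 1 - r / s) ` {0..s} \<subseteq> {0..1}" using s0 by (auto simp: field_simps)
        have "(y has_vector_derivative w2 (1 - r / s) (y (1 - r / s))) (at (1 - r / s) within {0..1})"
          using y imageI[OF r, of "\<lambda>r. 1 - r / s"] im unfolding solves_ivp_def by blast
        then have "(y has_vector_derivative w2 (1 - r / s) (y (1 - r / s))) (at (1 - r / s) within (\<lambda>r. 1 - r / s) ` {0..s})"
          using im by (rule has_vector_derivative_within_subset)
        moreover have "((\<lambda>r. 1 - r / s) has_vector_derivative - (1 / s)) (at r within {0..s})"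
          using s0 by (auto intro!: derivative_eq_intros simp flip: has_real_derivative_iff_has_vector_derivative)
        ultimately have "((y \<circ> (\<lambda>r. 1 - r / s)) has_vector_derivative (- (1 / s)) *\<^sub>R w2 (1 - r / s) (y (1 - r / s))) (at r within {0..s})"
          by (intro vector_diff_chain_within)
        then show ?thesis unfolding w2_def c_def comp_def using s0 by simp
      qed
      \<comment> \<open>The curve \<open>c\<close> and the flow line through \<open>c 0\<close>
        solve the same equation with the same start, so the flow carries \<open>c 0\<close> to
        \<open>c s = x\<close>.\<close>
      have "norm (X s (c 0) - c s) \<le> exp (L * (s - 0)) * norm (X 0 (c 0) - c 0)"
        using s s0 unique_flow_derivative[OF X] c by (intro lipschitz_field_gronwall(1)[OF w]) auto
      moreover have "c s = x" using y s0 by (simp add: c_def solves_ivp_def)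
      ultimately show ?thesis by (auto simp: unique_flow_0[OF X])
    qed
    then show ?thesis by (metis surjI)
  qed
qed

text \<open>A reversed trajectory from x is the forward one that reaches x at time 1, read
  backwards; its start is \<open>inv (X 1) x\<close>. Uniqueness holds because the reversed field is
  again Lipschitz.\<close>

lemma unique_flow_reverse:
  fixes w :: "real \<Rightarrow> 'a::euclidean_space \<Rightarrow> 'a"
  assumes w: "lipschitz_field L w" and X: "unique_flow w X"
  shows "unique_flow (\<lambda>t x. - w (1 - t) x) (\<lambda>t. X (1 - t) \<circ> inv (X 1))"
proof -
  have "lipschitz_field L (\<lambda>t x. - w (1 - t) x)"
    unfolding lipschitz_field_def
  proof (intro conjI ballI allI)
    show "L > 0" using lipschitz_fieldD[OF w] by blast
    have "continuous_on ({0..1} \<times> UNIV) (\<lambda>p::real \<times> 'a. (\<lambda>(t, x). w t x) (1 - fst p, snd p))"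
      by (rule continuous_on_compose2[OF lipschitz_fieldD(2)[OF w]]) (auto intro!: continuous_intros)
    then show "continuous_on ({0..1} \<times> UNIV) (\<lambda>(t, x). - w (1 - t) x)"
      unfolding case_prod_beta fst_conv snd_conv by (rule continuous_on_minus)
    fix t x y assume "t \<in> {0..1::real}"
    then show "norm (- w (1 - t) x - - w (1 - t) y) \<le> L * norm (x - y)"
      using lipschitz_fieldD(3)[OF w, of "1 - t" x y] by (simp add: norm_minus_commute)
  qed
  note w' = this
  have b: "bij (X 1)" by (rule unique_flow_bij[OF w X]) simp
  have "solves_ivp (\<lambda>t x. - w (1 - t) x) x (\<lambda>t. (X (1 - t) \<circ> inv (X 1)) x)" for x
    unfolding solves_ivp_def
  proof (intro conjI ballI)
    show "(X (1 - 0) \<circ> inv (X 1)) x = x" using b by (simp add: bij_is_surj surj_f_inv_f)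
    fix t :: real assume t: "t \<in> {0..1}"
    let ?x = "inv (X 1) x"
    have im: "(\<lambda>t::real. 1 - t) ` {0..1} \<subseteq> {0..1}" by auto
    have "((\<lambda>t. X t ?x) has_vector_derivative w (1 - t) (X (1 - t) ?x)) (at (1 - t) within {0..1})"
      using t by (intro unique_flow_derivative[OF X]) auto
    then have "((\<lambda>t. X t ?x) has_vector_derivative w (1 - t) (X (1 - t) ?x)) (at (1 - t) within (\<lambda>t. 1 - t) ` {0..1})"
      using im by (rule has_vector_derivative_within_subset)
    moreover have "((\<lambda>t::real. 1 - t) has_vector_derivative - 1) (at t within {0..1})"
      by (auto intro!: derivative_eq_intros)
    ultimately have "(((\<lambda>t. X t ?x) \<circ> (\<lambda>t. 1 - t)) has_vector_derivative (- 1) *\<^sub>R w (1 - t) (X (1 - t) ?x)) (at t within {0..1})"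
      by (intro vector_diff_chain_within)
    then show "((\<lambda>t. (X (1 - t) \<circ> inv (X 1)) x) has_vector_derivative - w (1 - t) ((X (1 - t) \<circ> inv (X 1)) x)) (at t within {0..1})"
      by (simp add: comp_def)
  qed
  then show ?thesis
    unfolding unique_flow_def using solves_ivp_unique[OF w'] by blast
qed

subsection \<open>Transport of laws along a Lipschitz field\<close>

text \<open>A quantitative stand-in for a differentiable map with Lipschitz derivative: it only
  records a linear part with a global quadratic remainder, and composes with explicit
  constants.\<close>

definition quadratic_approx :: "real \<Rightarrow> ('a::euclidean_space \<Rightarrow> 'c::euclidean_space) \<Rightarrow> ('a \<Rightarrow> 'a \<Rightarrow> 'c) \<Rightarrow> bool" where
  "quadratic_approx Q F D \<longleftrightarrow> (\<forall>x. linear (D x)) \<and>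
     (\<forall>x y. norm (F y - F x - D x (y - x)) \<le> Q * (norm (y - x))\<^sup>2)"

lemma exp_taylor_bound: "\<bar>exp t - 1 - t\<bar> \<le> t\<^sup>2 * exp \<bar>t\<bar>" for t :: real
proof -
  have "\<exists>s. \<bar>s\<bar> \<le> \<bar>t\<bar> \<and> exp t = (\<Sum>m<2. t ^ m / fact m) + exp s / fact 2 * t ^ 2"
    by (rule Maclaurin_exp_le)
  then obtain s where s: "\<bar>s\<bar> \<le> \<bar>t\<bar>" "exp t = 1 + t + exp s / 2 * t\<^sup>2"
    by (auto simp: numeral_2_eq_2)
  then have "\<bar>exp t - 1 - t\<bar> = exp s / 2 * t\<^sup>2" by simp
  also have "\<dots> \<le> exp \<bar>t\<bar> * t\<^sup>2"
  proof (rule mult_right_mono)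
    have "exp s \<le> exp \<bar>t\<bar>" using s(1) by simp
    then show "exp s / 2 \<le> exp \<bar>t\<bar>" using exp_gt_zero[of s] by linarith
  qed simp
  finally show ?thesis by (simp add: mult.commute)
qed

text \<open>Second-order expansion of the Cameron-Martin weight. It is split into the Taylor
  remainder of \<open>exp (y \<bullet> k)\<close> and the deviation of
  \<open>exp (- (norm k)\<^sup>2 / 2)\<close> from 1, both of order
  \<open>(norm k)\<^sup>2\<close>.\<close>

lemma exp_shift_bound:
  fixes y k :: "'a::euclidean_space"
  assumes "norm k \<le> 1"
  shows "\<bar>exp (y \<bullet> k - (norm k)\<^sup>2 / 2) - 1 - y \<bullet> k\<bar> \<le> (norm k)\<^sup>2 * (((norm y)\<^sup>2 + 1) * exp (norm y))"
proof -
  let ?t = "y \<bullet> k"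
  have t: "\<bar>?t\<bar> \<le> norm y * norm k" by (rule Cauchy_Schwarz_ineq2)
  also have "\<dots> \<le> norm y" using assms by (simp add: mult_left_le)
  finally have t1: "\<bar>?t\<bar> \<le> norm y" .
  have q: "\<bar>exp (- ((norm k)\<^sup>2 / 2)) - 1\<bar> \<le> (norm k)\<^sup>2"
  proof -
    have "exp (- ((norm k)\<^sup>2 / 2)) \<le> 1" by simp
    moreover have "1 + - ((norm k)\<^sup>2 / 2) \<le> exp (- ((norm k)\<^sup>2 / 2))" by (rule exp_ge_add_one_self)
    moreover have "0 \<le> (norm k)\<^sup>2" by simp
    ultimately show ?thesis by linarith
  qed
  have "exp (?t - (norm k)\<^sup>2 / 2) - 1 - ?t = (exp ?t - 1 - ?t) + exp ?t * (exp (- ((norm k)\<^sup>2 / 2)) - 1)"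
  proof -
    have "exp (?t - (norm k)\<^sup>2 / 2) = exp ?t * exp (- ((norm k)\<^sup>2 / 2))"
      unfolding exp_add[symmetric] by simp
    then show ?thesis by (simp add: right_diff_distrib)
  qed
  then have "\<bar>exp (?t - (norm k)\<^sup>2 / 2) - 1 - ?t\<bar> \<le> \<bar>exp ?t - 1 - ?t\<bar> + \<bar>exp ?t * (exp (- ((norm k)\<^sup>2 / 2)) - 1)\<bar>"
    using abs_triangle_ineq[of "exp ?t - 1 - ?t" "exp ?t * (exp (- ((norm k)\<^sup>2 / 2)) - 1)"] by argo
  also have "\<dots> = \<bar>exp ?t - 1 - ?t\<bar> + exp ?t * \<bar>exp (- ((norm k)\<^sup>2 / 2)) - 1\<bar>"
    by (simp only: abs_mult abs_exp_cancel)
  also have "\<dots> \<le> ?t\<^sup>2 * exp \<bar>?t\<bar> + exp \<bar>?t\<bar> * (norm k)\<^sup>2"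
  proof (rule add_mono[OF exp_taylor_bound mult_mono[OF _ q]])
    show "exp ?t \<le> exp \<bar>?t\<bar>" using abs_ge_self[of ?t] by simp
  qed simp_all
  also have "\<dots> \<le> (norm y * norm k)\<^sup>2 * exp (norm y) + exp (norm y) * (norm k)\<^sup>2"
  proof (rule add_mono)
    have "?t\<^sup>2 \<le> (norm y * norm k)\<^sup>2" using t by (metis abs_ge_zero power2_abs power_mono)
    then show "?t\<^sup>2 * exp \<bar>?t\<bar> \<le> (norm y * norm k)\<^sup>2 * exp (norm y)"
      using t1 by (simp add: mult_mono)
    show "exp \<bar>?t\<bar> * (norm k)\<^sup>2 \<le> exp (norm y) * (norm k)\<^sup>2"
      using t1 by (simp add: mult_right_mono)
  qed
  also have "\<dots> = (norm k)\<^sup>2 * (((norm y)\<^sup>2 + 1) * exp (norm y))"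
    by (simp add: power_mult_distrib algebra_simps)
  finally show ?thesis .
qed

lemma norm_le_exp: "norm x \<le> exp (norm x)" for x :: "'a::real_normed_vector"
  using exp_ge_add_one_self[of "norm x"] by linarith

lemma exp_mult_nat: "exp (real n * norm x) = exp (norm x) ^ n" for x :: "'a::real_normed_vector"
  by (simp add: exp_of_nat_mult)

lemma norm_integral_le:
  fixes f :: "'b \<Rightarrow> 'c::euclidean_space"
  assumes "integrable M f" "integrable M g" "\<And>x. norm (f x) \<le> g x"
  shows "norm (\<integral>x. f x \<partial>M) \<le> (\<integral>x. g x \<partial>M)"
  by (rule order_trans[OF integral_norm_bound integral_mono]) (use assms in auto)

text \<open>\<open>F'\<close> is the average of \<open>F (x + e *\<^sub>R Y)\<close> over a standard
  Gaussian Y. Derivatives fall on the Gaussian weight, so a Lipschitz \<open>F\<close> is enough.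
  The constant is obtained before \<open>F\<close>, which makes it uniform over all time slices of
  the velocity field.\<close>

lemma mollify:
  fixes L \<delta> :: real
  assumes L: "L \<ge> 0" and \<delta>: "\<delta> > 0"
  obtains C where "C \<ge> 0"
    "\<And>F :: 'a::euclidean_space \<Rightarrow> 'c::euclidean_space. (\<And>x y. norm (F x - F y) \<le> L * norm (x - y)) \<Longrightarrow>
       \<exists>F' D. (\<forall>x. norm (F' x - F x) \<le> \<delta>) \<and> (\<forall>x y. norm (F' x - F' y) \<le> L * norm (x - y)) \<and>
         quadratic_approx C F' D"
proof
  let ?\<gamma> = "gaussian 1 :: 'a measure"
  interpret prob_space ?\<gamma> by (rule prob_space_gaussian) simp
  have pU: "prob UNIV = 1" using prob_space by simp
  define m1 where "m1 = (\<integral>x. norm x \<partial>?\<gamma>)"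
  define m2 where "m2 = (\<integral>x. norm x * norm x \<partial>?\<gamma>)"
  define m3 where "m3 = (\<integral>x. norm x * (((norm x)\<^sup>2 + 1) * exp (norm x)) \<partial>?\<gamma>)"
  have i1: "integrable ?\<gamma> norm"
    by (rule integrable_gaussian_exp_bound[of _ 1 1]) (auto simp: norm_le_exp)
  have i2: "integrable ?\<gamma> (\<lambda>x. norm x * norm x)"
  proof (rule integrable_gaussian_exp_bound[of _ 1 2])
    show "norm (norm x * norm x) \<le> 1 * exp (2 * norm x)" for x :: 'a
      using exp_mult_nat[of 2 x] norm_le_exp[of x] by (auto simp: power2_eq_square intro!: mult_mono)
  qed measurable
  have i3: "integrable ?\<gamma> (\<lambda>x. norm x * (((norm x)\<^sup>2 + 1) * exp (norm x)))"
  proof (rule integrable_gaussian_exp_bound[of _ 2 4])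
    fix x :: 'a
    have e: "1 \<le> exp (norm x)" by simp
    have "norm x * (((norm x)\<^sup>2 + 1) * exp (norm x)) \<le> exp (norm x) * (((exp (norm x))\<^sup>2 + (exp (norm x))\<^sup>2) * exp (norm x))"
      using norm_le_exp[of x] e by (intro mult_mono add_mono power_mono) (auto simp: one_le_power)
    also have "\<dots> = 2 * exp (4 * norm x)"
      using exp_mult_nat[of 4 x] by (simp add: power2_eq_square power4_eq_xxxx)
    finally show "norm (norm x * (((norm x)\<^sup>2 + 1) * exp (norm x))) \<le> 2 * exp (4 * norm x)" by simp
  qed measurable
  have m: "m1 \<ge> 0" "m2 \<ge> 0" "m3 \<ge> 0" by (auto simp: m1_def m2_def m3_def intro!: integral_nonneg)
  \<comment> \<open>Averaging over radius e moves a value by at most \<open>L * e * m1\<close>,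
    where \<open>m1\<close> is the mean norm; the added 1 keeps the denominator positive.\<close>
  define e where "e = \<delta> / (L * m1 + 1)"
  have d1: "L * m1 + 1 > 0" using L m by (simp add: add_nonneg_pos)
  then have e: "e > 0" using \<delta> by (simp add: e_def)
  have "L * e * m1 = \<delta> * (L * m1 / (L * m1 + 1))" by (simp add: e_def)
  also have "\<dots> \<le> \<delta> * 1" using \<delta> d1 by (intro mult_left_mono) auto
  finally have Le: "L * e * m1 \<le> \<delta>" by simp
  \<comment> \<open>\<open>m3\<close> serves points at distance at most e, \<open>1 + m2\<close>
    those further apart.\<close>
  define C where "C = L * (1 + m2 + m3) / e"
  show "C \<ge> 0" using L m e by (simp add: C_def)
  fix F :: "'a \<Rightarrow> 'c" assume F: "\<And>x y. norm (F x - F y) \<le> L * norm (x - y)"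
  have "L-lipschitz_on UNIV F" using F L by (intro lipschitz_onI) (auto simp: dist_norm)
  then have "continuous_on UNIV F" by (rule lipschitz_on_continuous_on)
  then have [measurable]: "F \<in> borel_measurable borel" by (rule borel_measurable_continuous_onI)
  \<comment> \<open>Everything is expressed through increments: they are bounded by
    \<open>L * e * norm y\<close> uniformly in x, whereas the values of \<open>F\<close> are not
    bounded uniformly.\<close>
  define \<Delta> where "\<Delta> x y = F (x + e *\<^sub>R y) - F x" for x y
  have [measurable]: "\<Delta> x \<in> borel_measurable borel" for x unfolding \<Delta>_def by measurable
  have \<Delta>: "norm (\<Delta> x y) \<le> L * e * norm y" for x y
    using F[of "x + e *\<^sub>R y" x] e by (simp add: \<Delta>_def mult.assoc)
  have iD: "integrable ?\<gamma> (\<Delta> x)" for x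
    by (rule Bochner_Integration.integrable_bound[of _ "\<lambda>y. L * e * norm y"])
      (use \<Delta> i1 L e in \<open>auto simp: abs_mult\<close>)
  define F' where "F' x = F x + (\<integral>y. \<Delta> x y \<partial>?\<gamma>)" for x
  \<comment> \<open>The first-order term of the Cameron-Martin weight for the shift h / e.\<close>
  define D where "D x h = (\<integral>y. (y \<bullet> h / e) *\<^sub>R \<Delta> x y \<partial>?\<gamma>)" for x h
  have yb: "norm ((y \<bullet> h / e) *\<^sub>R \<Delta> x y) \<le> L * norm h * (norm y * norm y)" for x y h
  proof -
    have "\<bar>y \<bullet> h / e\<bar> \<le> norm y * norm h / e"
      using Cauchy_Schwarz_ineq2[of y h] e by (simp add: divide_right_mono)
    then have "norm ((y \<bullet> h / e) *\<^sub>R \<Delta> x y) \<le> (norm y * norm h / e) * (L * e * norm y)"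
      unfolding norm_scaleR using \<Delta>[of x y] e by (intro mult_mono) auto
    also have "\<dots> = L * norm h * (norm y * norm y)" using e by simp
    finally show ?thesis .
  qed
  have iyD: "integrable ?\<gamma> (\<lambda>y. (y \<bullet> h / e) *\<^sub>R \<Delta> x y)" for x h
    by (rule Bochner_Integration.integrable_bound[of _ "\<lambda>y. L * norm h * (norm y * norm y)"])
      (use yb i2 L in \<open>auto simp: abs_mult\<close>)
  have lin: "linear (D x)" for x
  proof (rule linearI)
    fix h h' :: 'a and c :: real
    show "D x (h + h') = D x h + D x h'"
      unfolding D_def Bochner_Integration.integral_add[OF iyD iyD, symmetric]
      by (simp add: inner_add_right add_divide_distrib scaleR_add_left)
    have "(\<lambda>y. (y \<bullet> (c *\<^sub>R h) / e) *\<^sub>R \<Delta> x y) = (\<lambda>y. c *\<^sub>R ((y \<bullet> h / e) *\<^sub>R \<Delta> x y))" by auto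
    then show "D x (c *\<^sub>R h) = c *\<^sub>R D x h" unfolding D_def by (simp only: integral_scaleR_right)
  qed
  have Db: "norm (D x h) \<le> L * m2 * norm h" for x h
  proof -
    have eq: "(\<integral>y. L * norm h * (norm y * norm y) \<partial>?\<gamma>) = L * norm h * m2"
      unfolding m2_def by (rule integral_mult_right_zero)
    have "norm (D x h) \<le> (\<integral>y. L * norm h * (norm y * norm y) \<partial>?\<gamma>)"
      unfolding D_def by (rule norm_integral_le[OF iyD _ yb]) (use i2 in simp)
    then show ?thesis unfolding eq by (simp only: mult.assoc mult.commute[of m2])
  qed
  have 1: "norm (F' x - F x) \<le> \<delta>" for x
  proof -
    have "norm (\<integral>y. \<Delta> x y \<partial>?\<gamma>) \<le> (\<integral>y. L * e * norm y \<partial>?\<gamma>)"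
      by (rule norm_integral_le[OF iD _ \<Delta>]) (use i1 in simp)
    also have "\<dots> = L * e * m1" by (simp add: m1_def)
    finally show ?thesis using Le by (simp add: F'_def)
  qed
  have 2: "norm (F' x - F' y) \<le> L * norm (x - y)" for x y
  proof -
    have i: "integrable ?\<gamma> (\<lambda>z. F (x + e *\<^sub>R z))" for x
      using Bochner_Integration.integrable_add[OF iD[of x] integrable_const[of "F x"]] by (simp add: \<Delta>_def)
    have eq: "F' x = (\<integral>z. F (x + e *\<^sub>R z) \<partial>?\<gamma>)" for x
      unfolding F'_def \<Delta>_def using i[of x] by (simp add: pU)
    have "norm (F' x - F' y) = norm (\<integral>z. F (x + e *\<^sub>R z) - F (y + e *\<^sub>R z) \<partial>?\<gamma>)"
      unfolding eq by (simp add: Bochner_Integration.integral_diff[OF i i])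
    also have "\<dots> \<le> (\<integral>z. L * norm (x - y) \<partial>?\<gamma>)"
      using F[of "x + e *\<^sub>R z" "y + e *\<^sub>R z" for z]
      by (intro norm_integral_le Bochner_Integration.integrable_diff i) auto
    finally show ?thesis by (simp add: pU)
  qed
  have 3: "norm (F' y - F' x - D x (y - x)) \<le> C * (norm (y - x))\<^sup>2" for x y
  proof -
    define k where "k = (1 / e) *\<^sub>R (y - x)"
    have nk: "norm k = norm (y - x) / e" using e by (simp add: k_def)
    have Dk: "D x (y - x) = (\<integral>z. (z \<bullet> k) *\<^sub>R \<Delta> x z \<partial>?\<gamma>)" by (simp add: D_def k_def)
    show ?thesis
    \<comment> \<open>For small shifts the expansion of the weight applies. Otherwise a linear
      estimate is already quadratic, since \<open>norm (y - x)\<close> exceeds e.\<close>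
    proof (cases "norm k \<le> 1")
      case True
      \<comment> \<open>Because \<open>e *\<^sub>R k = y - x\<close>, shifting the Gaussian variable
        by k moves the base point from x to y.\<close>
      have s: "\<Delta> x (z + k) = \<Delta> y z + (F y - F x)" for z
        using e by (simp add: \<Delta>_def k_def algebra_simps)
      have "F' y - F x = (\<integral>z. \<Delta> x (z + k) \<partial>?\<gamma>)"
        unfolding s F'_def using iD[of y] by (simp add: pU)
      also have "\<dots> = (\<integral>z. exp (z \<bullet> k - (norm k)\<^sup>2 / 2) *\<^sub>R \<Delta> x z \<partial>?\<gamma>)"
        by (rule integral_gaussian_shift) measurable
      finally have a: "F' y - F x = \<dots>" .
      have ie: "integrable ?\<gamma> (\<lambda>z. exp (z \<bullet> k - (norm k)\<^sup>2 / 2) *\<^sub>R \<Delta> x z)"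
        unfolding integrable_gaussian_shift[symmetric, OF \<open>\<Delta> x \<in> borel_measurable borel\<close>] s using iD by simp
      have ik: "integrable ?\<gamma> (\<lambda>z. (z \<bullet> k) *\<^sub>R \<Delta> x z)" using iyD[of "e *\<^sub>R k" x] e by simp
      have eq: "(exp (z \<bullet> k - (norm k)\<^sup>2 / 2) - 1 - z \<bullet> k) *\<^sub>R \<Delta> x z
          = exp (z \<bullet> k - (norm k)\<^sup>2 / 2) *\<^sub>R \<Delta> x z - \<Delta> x z - (z \<bullet> k) *\<^sub>R \<Delta> x z" for z
        by (simp add: scaleR_diff_left)
      have "F' y - F' x - D x (y - x) = (F' y - F x) - (\<integral>z. \<Delta> x z \<partial>?\<gamma>) - D x (y - x)" by (simp add: F'_def)
      also have "\<dots> = (\<integral>z. (exp (z \<bullet> k - (norm k)\<^sup>2 / 2) - 1 - z \<bullet> k) *\<^sub>R \<Delta> x z \<partial>?\<gamma>)"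
        unfolding a Dk eq using ie iD ik by (subst Bochner_Integration.integral_diff, simp_all)+
      finally have "norm (F' y - F' x - D x (y - x)) = norm \<dots>" by simp
      also have "\<dots> \<le> (\<integral>z. (norm k)\<^sup>2 * (L * e) * (norm z * (((norm z)\<^sup>2 + 1) * exp (norm z))) \<partial>?\<gamma>)"
      proof (rule norm_integral_le)
        show "integrable ?\<gamma> (\<lambda>z. (exp (z \<bullet> k - (norm k)\<^sup>2 / 2) - 1 - z \<bullet> k) *\<^sub>R \<Delta> x z)"
          unfolding eq using ie iD ik by simp
        show "integrable ?\<gamma> (\<lambda>z. (norm k)\<^sup>2 * (L * e) * (norm z * (((norm z)\<^sup>2 + 1) * exp (norm z))))"
          using i3 by (rule integrable_mult_right)
        fix z
        have "norm ((exp (z \<bullet> k - (norm k)\<^sup>2 / 2) - 1 - z \<bullet> k) *\<^sub>R \<Delta> x z)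
           \<le> ((norm k)\<^sup>2 * (((norm z)\<^sup>2 + 1) * exp (norm z))) * (L * e * norm z)"
          using exp_shift_bound[OF True, of z] \<Delta>[of x z] unfolding norm_scaleR
          by (intro mult_mono) auto
        then show "norm ((exp (z \<bullet> k - (norm k)\<^sup>2 / 2) - 1 - z \<bullet> k) *\<^sub>R \<Delta> x z)
           \<le> (norm k)\<^sup>2 * (L * e) * (norm z * (((norm z)\<^sup>2 + 1) * exp (norm z)))"
          by (simp add: mult_ac)
      qed
      also have "\<dots> = (norm k)\<^sup>2 * (L * e) * m3" by (simp add: m3_def)
      also have "\<dots> = L * m3 / e * (norm (y - x))\<^sup>2"
        unfolding nk using e by (simp add: power_divide power2_eq_square)
      also have "\<dots> \<le> C * (norm (y - x))\<^sup>2"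
        unfolding C_def using L m e by (intro mult_right_mono divide_right_mono mult_left_mono) auto
      finally show ?thesis .
    next
      case False
      have "norm (F' y - F' x - D x (y - x)) \<le> norm (F' y - F' x) + norm (D x (y - x))"
        by (rule norm_triangle_ineq4)
      also have "\<dots> \<le> L * norm (y - x) + L * m2 * norm (y - x)"
        using 2 Db by (intro add_mono) auto
      also have "\<dots> = L * (1 + m2) * norm (y - x) * 1" by (simp add: algebra_simps)
      also have "\<dots> \<le> L * (1 + m2) * norm (y - x) * norm k"
        using False L m by (intro mult_left_mono) auto
      also have "\<dots> = L * (1 + m2) / e * (norm (y - x))\<^sup>2"
        unfolding nk by (simp add: power2_eq_square)
      also have "\<dots> \<le> C * (norm (y - x))\<^sup>2"
        unfolding C_def using L m e by (intro mult_right_mono divide_right_mono mult_left_mono) auto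
      finally show ?thesis .
    qed
  qed
  show "\<exists>F' D. (\<forall>x. norm (F' x - F x) \<le> \<delta>) \<and> (\<forall>x y. norm (F' x - F' y) \<le> L * norm (x - y)) \<and>
         quadratic_approx C F' D"
    using 1 2 3 lin unfolding quadratic_approx_def by blast
qed

text \<open>For a short step t in direction k the remainder is of order t squared, so the Lipschitz
  constant of the map passes to its linear part in the limit.\<close>

lemma quadratic_approx_norm_le:
  fixes F :: "'a::euclidean_space \<Rightarrow> 'c::euclidean_space"
  assumes q: "quadratic_approx Q F D" and lip: "\<And>x y. norm (F x - F y) \<le> L * norm (x - y)"
  shows "norm (D x k) \<le> L * norm k"
proof (rule field_le_epsilon)
  fix e :: real assume e: "e > 0"
  have lin: "linear (D x)" using q by (simp add: quadratic_approx_def)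
  define c where "c = \<bar>Q\<bar> * (norm k)\<^sup>2 + 1"
  have c: "c > 0" by (simp add: c_def add_nonneg_pos)
  define t where "t = e / c"
  have t: "t > 0" using e c by (simp add: t_def)
  have "norm (F (x + t *\<^sub>R k) - F x - D x (t *\<^sub>R k)) \<le> Q * (norm (t *\<^sub>R k))\<^sup>2"
    using q unfolding quadratic_approx_def by (metis add_diff_cancel_left')
  also have "\<dots> \<le> t * (t * c)"
  proof -
    have "Q * (norm k)\<^sup>2 \<le> \<bar>Q\<bar> * (norm k)\<^sup>2" by (intro mult_right_mono) auto
    then have "Q * (norm k)\<^sup>2 \<le> c" by (simp add: c_def)
    then have "t * t * (Q * (norm k)\<^sup>2) \<le> t * t * c" using t by (intro mult_left_mono) auto
    then show ?thesis by (simp add: power_mult_distrib power2_eq_square mult_ac)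
  qed
  finally have a: "norm (F (x + t *\<^sub>R k) - F x - D x (t *\<^sub>R k)) \<le> t * (t * c)" .
  have "t * norm (D x k) = norm (D x (t *\<^sub>R k))" using t by (simp add: linear_cmul[OF lin])
  also have "\<dots> \<le> norm (F (x + t *\<^sub>R k) - F x - D x (t *\<^sub>R k)) + norm (F (x + t *\<^sub>R k) - F x)"
    by (metis diff_diff_eq2 diff_add_cancel norm_triangle_sub norm_minus_commute add.commute)
  also have "\<dots> \<le> t * (t * c) + L * norm (t *\<^sub>R k)"
    using a lip[of "x + t *\<^sub>R k" x] by simp
  also have "\<dots> = t * (L * norm k + t * c)" using t by (simp add: algebra_simps)
  also have "t * c = e" using c by (simp add: t_def)
  finally show "norm (D x k) \<le> L * norm k + e" using t by simp
qed

text \<open>Both constants grow by a factor 1 + O(h), with an added term O(h) for the quadratic one.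
  They therefore stay bounded over 1/h steps, although \<open>C\<close> may be huge.\<close>

lemma quadratic_approx_euler_step:
  fixes u :: "'a::euclidean_space \<Rightarrow> 'c::euclidean_space" and w :: "'a \<Rightarrow> 'a"
  assumes u: "quadratic_approx Q u D" and ul: "\<And>x y. norm (u x - u y) \<le> \<Lambda> * norm (x - y)"
    and w: "quadratic_approx C w Dw" and wl: "\<And>x y. norm (w x - w y) \<le> L * norm (x - y)"
    and nn: "h \<ge> 0" "Q \<ge> 0" "\<Lambda> \<ge> 0" "L \<ge> 0"
  shows "\<exists>D'. quadratic_approx (Q * (1 + h * L)\<^sup>2 + \<Lambda> * h * C) (\<lambda>x. u (x + h *\<^sub>R w x)) D'"
    and "norm (u (x + h *\<^sub>R w x) - u (y + h *\<^sub>R w y)) \<le> \<Lambda> * (1 + h * L) * norm (x - y)"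
proof -
  let ?T = "\<lambda>x. x + h *\<^sub>R w x"
  have Tl: "norm (?T x - ?T y) \<le> (1 + h * L) * norm (x - y)" for x y
  proof -
    have "?T x - ?T y = (x - y) + h *\<^sub>R (w x - w y)" by (simp add: algebra_simps)
    then have "norm (?T x - ?T y) \<le> norm (x - y) + h * norm (w x - w y)"
      using norm_triangle_ineq[of "x - y" "h *\<^sub>R (w x - w y)"] nn by (simp only: norm_scaleR abs_of_nonneg)
    also have "\<dots> \<le> norm (x - y) + h * (L * norm (x - y))"
      using wl nn by (intro add_left_mono mult_left_mono) auto
    finally show ?thesis by (simp add: algebra_simps)
  qed
  show "norm (u (x + h *\<^sub>R w x) - u (y + h *\<^sub>R w y)) \<le> \<Lambda> * (1 + h * L) * norm (x - y)"
    using ul[of "?T x" "?T y"] mult_left_mono[OF Tl[of x y] nn(3)] by (simp add: mult.assoc)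
  define D' where "D' x k = D (?T x) (k + h *\<^sub>R Dw x k)" for x k
  have linD: "linear (D x)" and linDw: "linear (Dw x)" for x using u w by (auto simp: quadratic_approx_def)
  have "linear (D' x)" for x
    unfolding D'_def by (rule linearI)
      (simp_all add: linear_add[OF linD] linear_add[OF linDw] linear_cmul[OF linD] linear_cmul[OF linDw] algebra_simps)
  moreover have "norm (u (?T y) - u (?T x) - D' x (y - x)) \<le> (Q * (1 + h * L)\<^sup>2 + \<Lambda> * h * C) * (norm (y - x))\<^sup>2" for x y
  proof -
    let ?r = "w y - w x - Dw x (y - x)"
    have e1: "?T y - ?T x - ((y - x) + h *\<^sub>R Dw x (y - x)) = h *\<^sub>R ?r" by (simp add: algebra_simps)
    \<comment> \<open>The remainder of the composition is the remainder of u at the image point plus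
      the linear part of u applied to the remainder of the step.\<close>
    have e2: "u (?T y) - u (?T x) - D' x (y - x) = (u (?T y) - u (?T x) - D (?T x) (?T y - ?T x)) + D (?T x) (h *\<^sub>R ?r)"
      unfolding e1[symmetric] linear_diff[OF linD] D'_def by simp
    have "norm (u (?T y) - u (?T x) - D (?T x) (?T y - ?T x)) \<le> Q * (norm (?T y - ?T x))\<^sup>2"
      using u by (simp add: quadratic_approx_def)
    also have "\<dots> \<le> Q * ((1 + h * L) * norm (y - x))\<^sup>2"
      using Tl[of y x] nn by (intro mult_left_mono power_mono) auto
    finally have a: "norm (u (?T y) - u (?T x) - D (?T x) (?T y - ?T x)) \<le> Q * (1 + h * L)\<^sup>2 * (norm (y - x))\<^sup>2"
      by (simp add: power_mult_distrib mult.assoc)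
    have "norm (D (?T x) (h *\<^sub>R ?r)) \<le> \<Lambda> * norm (h *\<^sub>R ?r)"
      by (rule quadratic_approx_norm_le[OF u ul])
    also have "\<dots> = \<Lambda> * h * norm ?r" using nn by simp
    also have "\<dots> \<le> \<Lambda> * h * (C * (norm (y - x))\<^sup>2)"
      using w nn unfolding quadratic_approx_def by (intro mult_left_mono) auto
    finally have b: "norm (D (?T x) (h *\<^sub>R ?r)) \<le> \<Lambda> * h * C * (norm (y - x))\<^sup>2" by (simp add: mult.assoc)
    show ?thesis
      unfolding e2 by (rule order_trans[OF norm_triangle_ineq]) (use a b in \<open>simp add: distrib_right\<close>)
  qed
  ultimately show "\<exists>D'. quadratic_approx (Q * (1 + h * L)\<^sup>2 + \<Lambda> * h * C) (\<lambda>x. u (x + h *\<^sub>R w x)) D'"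
    unfolding quadratic_approx_def by blast
qed

text \<open>The linear part comes from an existential statement without any regularity;
  measurability is recovered by writing it as a limit of difference quotients.\<close>

lemma quadratic_approx_measurable:
  fixes u :: "'a::euclidean_space \<Rightarrow> real"
  assumes u: "quadratic_approx Q u D" and [measurable]: "u \<in> borel_measurable borel"
  shows "(\<lambda>x. D x k) \<in> borel_measurable borel"
proof (rule borel_measurable_LIMSEQ_real)
  have lin: "linear (D x)" for x using u by (simp add: quadratic_approx_def)
  fix x
  let ?t = "\<lambda>n. inverse (real (Suc n))"
  let ?q = "\<lambda>n. real (Suc n) * (u (x + ?t n *\<^sub>R k) - u x)"
  have "(\<lambda>n. ?q n - D x k) \<longlonglongrightarrow> 0"
  proof (rule Lim_null_comparison)
    show "\<forall>\<^sub>F n in sequentially. norm (?q n - D x k) \<le> (Q * (norm k)\<^sup>2) * ?t n"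
    proof (rule always_eventually, rule allI)
      fix n
      have n: "real (Suc n) * ?t n = 1" by simp
      have "?q n - D x k = real (Suc n) * (u (x + ?t n *\<^sub>R k) - u x - D x (?t n *\<^sub>R k))"
        by (simp only: linear_cmul[OF lin] right_diff_distrib real_scaleR_def mult.assoc[symmetric] n mult_1_left)
      then have "norm (?q n - D x k) = real (Suc n) * norm (u (x + ?t n *\<^sub>R k) - u x - D x (?t n *\<^sub>R k))"
        by (simp only: norm_mult) simp
      also have "\<dots> \<le> real (Suc n) * (Q * (norm (?t n *\<^sub>R k))\<^sup>2)"
        using u unfolding quadratic_approx_def by (intro mult_left_mono) (metis add_diff_cancel_left', simp)
      also have "\<dots> = (real (Suc n) * ?t n) * (Q * (norm k)\<^sup>2 * ?t n)"
        by (simp only: norm_scaleR power_mult_distrib power2_abs power2_eq_square real_norm_def mult_ac abs_of_nonneg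
            inverse_nonnegative_iff_nonnegative of_nat_0_le_iff)
      finally show "norm (?q n - D x k) \<le> (Q * (norm k)\<^sup>2) * ?t n" unfolding n by simp
    qed
    show "(\<lambda>n. (Q * (norm k)\<^sup>2) * ?t n) \<longlonglongrightarrow> 0"
      by (intro tendsto_mult_right_zero LIMSEQ_inverse_real_of_nat)
  qed
  then show "(\<lambda>n. ?q n) \<longlonglongrightarrow> D x k" by (rule LIM_zero_cancel)
qed measurable

text \<open>\<open>J'\<close> plays the role of the time derivative of \<open>J\<close>, and the last assumption says that
  \<open>v t\<close> is its conditional expectation given \<open>J t\<close>.\<close>

locale transport = prob_space M for M :: "'w measure" +
  fixes J J' :: "real \<Rightarrow> 'w \<Rightarrow> 'a::euclidean_space" and v :: "real \<Rightarrow> 'a \<Rightarrow> 'a"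
    and S :: "'w \<Rightarrow> real" and L K s0 s1 :: real
  assumes field: "lipschitz_field L v"
    and s01: "0 \<le> s0" "s0 < s1" "s1 \<le> 1"
    and J_meas[measurable]: "\<And>t. J t \<in> borel_measurable M" and J'_meas[measurable]: "\<And>t. J' t \<in> borel_measurable M"
    and S_meas[measurable]: "S \<in> borel_measurable M" and S1: "\<And>\<omega>. 1 \<le> S \<omega>" and S2: "integrable M (\<lambda>\<omega>. (S \<omega>)\<^sup>2)"
    and K: "K \<ge> 0"
    and J'_bound: "\<And>t \<omega>. t \<in> {s0..s1} \<Longrightarrow> norm (J' t \<omega>) \<le> K * S \<omega>"
    and v_bound: "\<And>t \<omega>. t \<in> {s0..s1} \<Longrightarrow> norm (v t (J t \<omega>)) \<le> K * S \<omega>"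
    and J_diff: "\<And>\<epsilon>. \<epsilon> > 0 \<Longrightarrow> \<exists>\<eta>>0. \<forall>s\<in>{s0..s1}. \<forall>t\<in>{s0..s1}. s \<le> t \<longrightarrow> t - s < \<eta> \<longrightarrow>
        (\<forall>\<omega>. norm (J t \<omega> - J s \<omega> - (t - s) *\<^sub>R J' s \<omega>) \<le> \<epsilon> * (t - s) * S \<omega>)"
    and J_v: "\<And>t g B. t \<in> {s0..s1} \<Longrightarrow> g \<in> borel_measurable borel \<Longrightarrow> (\<And>x. norm (g x) \<le> B) \<Longrightarrow>
        (\<integral>\<omega>. g (J t \<omega>) \<bullet> (J' t \<omega> - v t (J t \<omega>)) \<partial>M) = 0"
begin

lemma S_int: "integrable M S"
proof (rule Bochner_Integration.integrable_bound[OF S2])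
  show "AE \<omega> in M. norm (S \<omega>) \<le> norm ((S \<omega>)\<^sup>2)"
    using S1 by (intro AE_I2) (smt (verit) mult_le_cancel_left1 power2_eq_square real_norm_def zero_le_power2)
qed measurable

lemma v_meas: "t \<in> {0..1} \<Longrightarrow> v t \<in> borel_measurable borel"
proof (rule borel_measurable_continuous_onI)
  assume "t \<in> {0..1}"
  then have "L-lipschitz_on UNIV (v t)"
    using lipschitz_fieldD[OF field] by (intro lipschitz_onI) (auto simp: dist_norm less_imp_le)
  then show "continuous_on UNIV (v t)" by (rule lipschitz_on_continuous_on)
qed

text \<open>The two test-function arguments differ to first order by h (J' - v(J)), whose pairing
  with the gradient has mean zero. What is left are two quadratic remainders, the linearisation
  error \<epsilon> of J and the mollification error \<delta>.\<close>

lemma euler_step_expectation: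
  fixes u :: "'a \<Rightarrow> real"
  assumes u: "quadratic_approx Q u D" and ul: "\<And>x y. norm (u x - u y) \<le> \<Lambda> * norm (x - y)"
    and ub: "\<And>x. \<bar>u x\<bar> \<le> B"
    and nn: "Q \<ge> 0" "\<Lambda> \<ge> 0" "h \<ge> 0" "\<delta> \<ge> 0" "\<delta> \<le> 1" "\<epsilon> \<ge> 0" "\<epsilon> \<le> 1"
    and t: "t \<in> {s0..s1}" "t + h \<in> {s0..s1}"
    and w[measurable]: "w \<in> borel_measurable borel" and wv: "\<And>x. norm (w x - v t x) \<le> \<delta>"
    and Jd: "\<And>\<omega>. norm (J (t + h) \<omega> - J t \<omega> - h *\<^sub>R J' t \<omega>) \<le> \<epsilon> * h * S \<omega>"
  shows "\<bar>(\<integral>\<omega>. u (J (t + h) \<omega>) \<partial>M) - (\<integral>\<omega>. u (J t \<omega> + h *\<^sub>R w (J t \<omega>)) \<partial>M)\<bar>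
    \<le> h * (h * (2 * Q * (K + 1)\<^sup>2 * (\<integral>\<omega>. (S \<omega>)\<^sup>2 \<partial>M)) + \<Lambda> * \<epsilon> * (\<integral>\<omega>. S \<omega> \<partial>M) + \<Lambda> * \<delta>)"
proof -
  have "\<Lambda>-lipschitz_on UNIV u" using ul nn by (intro lipschitz_onI) (auto simp: dist_norm)
  then have [measurable]: "u \<in> borel_measurable borel"
    by (intro borel_measurable_continuous_onI lipschitz_on_continuous_on)
  have t1: "t \<in> {0..1}" using t s01 by auto
  have [measurable]: "v t \<in> borel_measurable borel" by (rule v_meas[OF t1])
  have lin: "linear (D x)" for x using u by (simp add: quadratic_approx_def)
  have [measurable]: "(\<lambda>x. D x k) \<in> borel_measurable borel" for k by (rule quadratic_approx_measurable[OF u]) measurable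
  \<comment> \<open>The gradient vector representing the linear part; assumption \<open>J_v\<close>
    is stated for vector-valued test functions.\<close>
  define g where "g x = (\<Sum>i\<in>Basis. D x i *\<^sub>R i)" for x
  have g[measurable]: "g \<in> borel_measurable borel" unfolding g_def by measurable
  have gD: "g x \<bullet> k = D x k" for x k
  proof -
    have "D x k = D x (\<Sum>i\<in>Basis. (k \<bullet> i) *\<^sub>R i)" by (simp add: euclidean_representation)
    also have "\<dots> = (\<Sum>i\<in>Basis. (k \<bullet> i) * D x i)" by (simp add: linear_sum[OF lin] linear_cmul[OF lin])
    also have "\<dots> = g x \<bullet> k"
      unfolding g_def inner_sum_left by (intro sum.cong refl) (simp add: inner_commute mult.commute)
    finally show ?thesis by simp
  qed
  have gb: "norm (g x) \<le> \<Lambda>" for x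
  proof -
    have "(norm (g x))\<^sup>2 = D x (g x)" by (simp add: gD[symmetric] power2_norm_eq_inner)
    also have "\<dots> \<le> \<Lambda> * norm (g x)" using quadratic_approx_norm_le[OF u ul, of x "g x"] by simp
    finally have "norm (g x) * norm (g x) \<le> \<Lambda> * norm (g x)" by (simp add: power2_eq_square)
    then show ?thesis using nn by (metis mult_right_le_imp_le norm_ge_zero order_le_less)
  qed
  have gi: "\<bar>g x \<bullet> k\<bar> \<le> \<Lambda> * norm k" for x k
    using Cauchy_Schwarz_ineq2[of "g x" k] mult_right_mono[OF gb[of x] norm_ge_zero[of k]] by linarith
  have uq: "\<bar>u (x + k) - u x - g x \<bullet> k\<bar> \<le> Q * (norm k)\<^sup>2" for x k
    using u unfolding quadratic_approx_def gD by (metis add_diff_cancel_left' real_norm_def)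
  \<comment> \<open>The first-order term, which vanishes in expectation.\<close>
  define X where "X \<omega> = g (J t \<omega>) \<bullet> (J' t \<omega> - v t (J t \<omega>))" for \<omega>
  have Xm[measurable]: "X \<in> borel_measurable M" unfolding X_def by measurable
  have Xi: "integrable M X"
  proof (rule Bochner_Integration.integrable_bound[of _ "\<lambda>\<omega>. \<Lambda> * (2 * K) * S \<omega>"])
    show "integrable M (\<lambda>\<omega>. \<Lambda> * (2 * K) * S \<omega>)" using S_int by simp
    have "\<bar>X \<omega>\<bar> \<le> \<Lambda> * (2 * K) * S \<omega>" for \<omega>
    proof -
      have "\<bar>X \<omega>\<bar> \<le> \<Lambda> * norm (J' t \<omega> - v t (J t \<omega>))" unfolding X_def by (rule gi)
      also have "\<dots> \<le> \<Lambda> * (K * S \<omega> + K * S \<omega>)"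
        using J'_bound[OF t(1), of \<omega>] v_bound[OF t(1), of \<omega>] norm_triangle_ineq4[of "J' t \<omega>" "v t (J t \<omega>)"] nn
        by (intro mult_left_mono) auto
      finally show ?thesis by (simp add: mult_ac)
    qed
    then show "AE \<omega> in M. norm (X \<omega>) \<le> norm (\<Lambda> * (2 * K) * S \<omega>)"
      by (intro AE_I2) (smt (verit) real_norm_def)
  qed measurable
  have X0: "(\<integral>\<omega>. X \<omega> \<partial>M) = 0"
    unfolding X_def by (rule J_v[OF t(1) g gb])
  have ui: "integrable M (\<lambda>\<omega>. u (Y \<omega>))" if "Y \<in> borel_measurable M" for Y
    using that ub by (intro integrable_const_bound[of _ B]) auto
  let ?R = "\<lambda>\<omega>. u (J (t + h) \<omega>) - u (J t \<omega> + h *\<^sub>R w (J t \<omega>)) - h * X \<omega>"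
  have Rb: "\<bar>?R \<omega>\<bar> \<le> h * (h * (2 * Q * (K + 1)\<^sup>2) * (S \<omega>)\<^sup>2 + \<Lambda> * \<epsilon> * S \<omega> + \<Lambda> * \<delta>)" for \<omega>
  proof -
    let ?x = "J t \<omega>" and ?d = "J (t + h) \<omega> - J t \<omega>" and ?w = "w (J t \<omega>)" and ?v = "v t (J t \<omega>)"
    note S1' = S1[of \<omega>]
    have sq: "Q * (norm k)\<^sup>2 \<le> h * (h * (Q * (K + 1)\<^sup>2 * (S \<omega>)\<^sup>2))" if "norm k \<le> h * ((K + 1) * S \<omega>)" for k :: 'a
    proof -
      have "Q * (norm k)\<^sup>2 \<le> Q * (h * ((K + 1) * S \<omega>))\<^sup>2"
        using that nn by (intro mult_left_mono power_mono) auto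
      then show ?thesis by (simp add: power2_eq_square mult_ac)
    qed
    have "norm ?d \<le> norm (?d - h *\<^sub>R J' t \<omega>) + norm (h *\<^sub>R J' t \<omega>)"
      by (metis norm_triangle_sub add.commute)
    also have "\<dots> \<le> \<epsilon> * h * S \<omega> + h * (K * S \<omega>)"
      using Jd[of \<omega>] J'_bound[OF t(1), of \<omega>] nn by (intro add_mono) (auto intro: mult_left_mono)
    also have "\<dots> \<le> 1 * h * S \<omega> + h * (K * S \<omega>)"
      using nn S1' by (intro add_right_mono mult_right_mono) auto
    also have "\<dots> = h * ((K + 1) * S \<omega>)" by (simp add: algebra_simps)
    finally have b1: "\<bar>u (?x + ?d) - u ?x - g ?x \<bullet> ?d\<bar> \<le> h * (h * (Q * (K + 1)\<^sup>2 * (S \<omega>)\<^sup>2))"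
      by (rule order_trans[OF uq sq])
    have "norm ?w \<le> norm ?v + norm (?w - ?v)" by (rule norm_triangle_sub)
    also have "\<dots> \<le> K * S \<omega> + 1 * S \<omega>"
      using v_bound[OF t(1), of \<omega>] wv[of "J t \<omega>"] nn S1' by (intro add_mono) auto
    also have "\<dots> = (K + 1) * S \<omega>" by (simp add: distrib_right)
    finally have "h * norm ?w \<le> h * ((K + 1) * S \<omega>)" using nn(3) by (rule mult_left_mono)
    then have "norm (h *\<^sub>R ?w) \<le> h * ((K + 1) * S \<omega>)" using nn(3) by simp
    then have b2: "\<bar>u (?x + h *\<^sub>R ?w) - u ?x - g ?x \<bullet> (h *\<^sub>R ?w)\<bar> \<le> h * (h * (Q * (K + 1)\<^sup>2 * (S \<omega>)\<^sup>2))"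
      by (rule order_trans[OF uq sq])
    have b3: "\<bar>g ?x \<bullet> (?d - h *\<^sub>R J' t \<omega>)\<bar> \<le> \<Lambda> * (\<epsilon> * h * S \<omega>)"
      by (rule order_trans[OF gi mult_left_mono[OF Jd nn(2)]])
    have b4: "\<bar>g ?x \<bullet> (h *\<^sub>R (?w - ?v))\<bar> \<le> \<Lambda> * (h * \<delta>)"
    proof (rule order_trans[OF gi mult_left_mono[OF _ nn(2)]])
      show "norm (h *\<^sub>R (?w - ?v)) \<le> h * \<delta>" using mult_left_mono[OF wv[of ?x] nn(3)] nn by simp
    qed
    have 4: "r = p - q + c - d \<Longrightarrow> \<bar>p\<bar> \<le> p' \<Longrightarrow> \<bar>q\<bar> \<le> q' \<Longrightarrow> \<bar>c\<bar> \<le> c' \<Longrightarrow> \<bar>d\<bar> \<le> d' \<Longrightarrow> \<bar>r\<bar> \<le> p' + q' + c' + d'"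
      for r p q c d p' q' c' d' :: real by linarith
    \<comment> \<open>In this order: remainder of u along the true increment, remainder along the
      Euler step, linearisation error of J, mollification error of the field.\<close>
    have eq: "?R \<omega> = (u (?x + ?d) - u ?x - g ?x \<bullet> ?d) - (u (?x + h *\<^sub>R ?w) - u ?x - g ?x \<bullet> (h *\<^sub>R ?w))
        + g ?x \<bullet> (?d - h *\<^sub>R J' t \<omega>) - g ?x \<bullet> (h *\<^sub>R (?w - ?v))"
      unfolding X_def by (simp add: inner_diff_right right_diff_distrib)
    show ?thesis
      by (rule order_trans[OF 4[OF eq b1 b2 b3 b4]]) (simp add: distrib_left mult_ac)
  qed
  have Ri: "integrable M ?R" using Xi by (intro Bochner_Integration.integrable_diff ui integrable_mult_right) auto
  have eqR: "(\<integral>\<omega>. u (J (t + h) \<omega>) \<partial>M) - (\<integral>\<omega>. u (J t \<omega> + h *\<^sub>R w (J t \<omega>)) \<partial>M) = (\<integral>\<omega>. ?R \<omega> \<partial>M)"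
  proof -
    have i1: "integrable M (\<lambda>\<omega>. u (J (t + h) \<omega>))" "integrable M (\<lambda>\<omega>. u (J t \<omega> + h *\<^sub>R w (J t \<omega>)))" "integrable M (\<lambda>\<omega>. h * X \<omega>)"
      using Xi by (auto intro!: ui)
    have "(\<integral>\<omega>. ?R \<omega> \<partial>M) = (\<integral>\<omega>. u (J (t + h) \<omega>) \<partial>M) - (\<integral>\<omega>. u (J t \<omega> + h *\<^sub>R w (J t \<omega>)) \<partial>M) - (\<integral>\<omega>. h * X \<omega> \<partial>M)"
      using i1 by (simp only: Bochner_Integration.integral_diff Bochner_Integration.integrable_diff)
    then show ?thesis by (simp add: X0)
  qed
  have "\<bar>\<integral>\<omega>. ?R \<omega> \<partial>M\<bar> \<le> (\<integral>\<omega>. h * (h * (2 * Q * (K + 1)\<^sup>2) * (S \<omega>)\<^sup>2 + \<Lambda> * \<epsilon> * S \<omega> + \<Lambda> * \<delta>) \<partial>M)"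
    unfolding real_norm_def[symmetric]
    by (rule norm_integral_le[OF Ri]) (use Rb S2 S_int in auto)
  moreover have "(\<integral>\<omega>. h * (h * (2 * Q * (K + 1)\<^sup>2) * (S \<omega>)\<^sup>2 + \<Lambda> * \<epsilon> * S \<omega> + \<Lambda> * \<delta>) \<partial>M)
    = h * (h * (2 * Q * (K + 1)\<^sup>2 * (\<integral>\<omega>. (S \<omega>)\<^sup>2 \<partial>M)) + \<Lambda> * \<epsilon> * (\<integral>\<omega>. S \<omega> \<partial>M) + \<Lambda> * \<delta>)"
    using S2 S_int by (simp add: prob_space mult.assoc)
  ultimately show ?thesis unfolding eqR by (simp only:)
qed

end

section \<open>The Euler scheme, forwards on points and backwards on test functions\<close>

primrec euler_iter :: "(nat \<Rightarrow> 'a \<Rightarrow> 'a) \<Rightarrow> nat \<Rightarrow> 'a \<Rightarrow> 'a" where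
  "euler_iter T 0 x = x"
| "euler_iter T (Suc k) x = T k (euler_iter T k x)"

text \<open>The test function pulled back through the last \<open>j\<close> of \<open>N\<close>
  steps: a discrete value function, indexed by the number of steps that remain.\<close>

primrec euler_back :: "(nat \<Rightarrow> 'a \<Rightarrow> 'a) \<Rightarrow> ('a \<Rightarrow> 'b) \<Rightarrow> nat \<Rightarrow> nat \<Rightarrow> 'a \<Rightarrow> 'b" where
  "euler_back T \<phi> N 0 x = \<phi> x"
| "euler_back T \<phi> N (Suc j) x = euler_back T \<phi> N j (T (N - Suc j) x)"

lemma euler_back_iter: "j \<le> N \<Longrightarrow> euler_back T \<phi> N j (euler_iter T (N - j) x) = \<phi> (euler_iter T N x)"
proof (induction j)
  case (Suc j)
  then have "N - j = Suc (N - Suc j)" by simp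
  then show ?case using Suc by simp
qed simp

lemma quadratic_approx_mono:
  assumes "quadratic_approx Q F D" "Q \<le> Q'" shows "quadratic_approx Q' F D"
  using assms unfolding quadratic_approx_def by (meson mult_right_mono order_trans zero_le_power2)

text \<open>Iterates the one-step bounds. As long as j h stays bounded, both constants do,
  independently of the number of steps.\<close>

lemma euler_back_bounds:
  fixes \<phi> :: "'a::euclidean_space \<Rightarrow> 'c::euclidean_space"
  assumes w: "\<And>k. quadratic_approx C (w k) (Dw k)" "\<And>k x y. norm (w k x - w k y) \<le> L * norm (x - y)"
    and \<phi>: "quadratic_approx Q \<phi> D" "\<And>x y. norm (\<phi> x - \<phi> y) \<le> \<Lambda> * norm (x - y)"
    and nn: "h \<ge> 0" "Q \<ge> 0" "\<Lambda> \<ge> 0" "L \<ge> 0" "C \<ge> 0"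
  defines "T \<equiv> \<lambda>k x. x + h *\<^sub>R w k x"
  shows "(\<exists>D. quadratic_approx ((Q + j * h * \<Lambda> * C) * (1 + h * L) ^ (2 * j)) (euler_back T \<phi> N j) D) \<and>
    (\<forall>x y. norm (euler_back T \<phi> N j x - euler_back T \<phi> N j y) \<le> \<Lambda> * (1 + h * L) ^ j * norm (x - y))"
proof (induction j)
  case 0
  have "euler_back T \<phi> N 0 = \<phi>" by auto
  then show ?case using \<phi> by auto
next
  case (Suc j)
  let ?E = "1 + h * L" and ?Q = "(Q + j * h * \<Lambda> * C) * (1 + h * L) ^ (2 * j)"
  have E: "?E \<ge> 1" using nn by simp
  obtain Dj where Dj: "quadratic_approx ?Q (euler_back T \<phi> N j) Dj" using Suc by blast
  have lj: "norm (euler_back T \<phi> N j x - euler_back T \<phi> N j y) \<le> \<Lambda> * ?E ^ j * norm (x - y)" for x y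
    using Suc by blast
  have Qn: "?Q \<ge> 0" and Ln: "\<Lambda> * ?E ^ j \<ge> 0" using nn E by auto
  note step = quadratic_approx_euler_step[OF Dj lj w nn(1) Qn Ln nn(4)]
  have eq: "euler_back T \<phi> N (Suc j) = (\<lambda>x. euler_back T \<phi> N j (x + h *\<^sub>R w (N - Suc j) x))"
    by (auto simp: T_def)
  have "?Q * ?E\<^sup>2 + \<Lambda> * ?E ^ j * h * C \<le> ?Q * ?E\<^sup>2 + h * \<Lambda> * C * ?E ^ (2 * j + 2)"
  proof -
    \<comment> \<open>Wasteful on purpose: raising the power brings the new term to the common
      factor, so that the closed form reproduces itself.\<close>
    have "?E ^ j \<le> ?E ^ (2 * j + 2)" using E by (intro power_increasing) auto
    then have "(h * \<Lambda> * C) * ?E ^ j \<le> (h * \<Lambda> * C) * ?E ^ (2 * j + 2)" using nn by (intro mult_left_mono) auto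
    then show ?thesis by (simp only: mult_ac add_left_mono)
  qed
  also have "\<dots> = (Q + Suc j * h * \<Lambda> * C) * ?E ^ (2 * Suc j)"
  proof -
    have "(Q + real j * c) * E ^ (2 * j) * E\<^sup>2 + c * E ^ (2 * j + 2) = (Q + real (Suc j) * c) * E ^ (2 * Suc j)" for E c
      by (simp add: power_add power2_eq_square algebra_simps)
    from this[of "h * \<Lambda> * C" ?E] show ?thesis by (simp only: mult.assoc)
  qed
  finally have "?Q * ?E\<^sup>2 + \<Lambda> * ?E ^ j * h * C \<le> (Q + Suc j * h * \<Lambda> * C) * ?E ^ (2 * Suc j)" .
  then have "\<exists>D. quadratic_approx ((Q + Suc j * h * \<Lambda> * C) * ?E ^ (2 * Suc j)) (euler_back T \<phi> N (Suc j)) D"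
    unfolding eq using step(1)[of "N - Suc j"] quadratic_approx_mono by blast
  moreover have "norm (euler_back T \<phi> N (Suc j) x - euler_back T \<phi> N (Suc j) y) \<le> \<Lambda> * ?E ^ Suc j * norm (x - y)" for x y
    unfolding eq using step(2)[of x "N - Suc j" y] by (simp add: mult_ac)
  ultimately show ?case by blast
qed

text \<open>The local error per step is h (\<delta> + \<omega>). The modulus \<omega> along the
  given trajectory replaces a Lipschitz condition in time, because the field is merely continuous in
  t.\<close>

lemma euler_iter_error:
  fixes y :: "real \<Rightarrow> 'a::euclidean_space" and w :: "nat \<Rightarrow> 'a \<Rightarrow> 'a"
  assumes v: "lipschitz_field L v"
    and y: "\<And>t. t \<in> {s0..s1} \<Longrightarrow> (y has_vector_derivative v t (y t)) (at t within {s0..s1})"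
    and s: "0 \<le> s0" "s1 \<le> 1" and N: "s0 + real N * h \<le> s1" and h: "h \<ge> 0"
    and w: "\<And>k x. k < N \<Longrightarrow> norm (w k x - v (s0 + real k * h) x) \<le> \<delta>"
    and om: "\<And>s t. s \<in> {s0..s1} \<Longrightarrow> t \<in> {s0..s1} \<Longrightarrow> \<bar>s - t\<bar> \<le> h \<Longrightarrow> norm (v s (y s) - v t (y t)) \<le> \<omega>"
    and nn: "\<delta> \<ge> 0" "\<omega> \<ge> 0"
  defines "T \<equiv> \<lambda>k x. x + h *\<^sub>R w k x"
  shows "k \<le> N \<Longrightarrow> norm (euler_iter T k (y s0) - y (s0 + k * h)) \<le> k * h * (\<delta> + \<omega>) * (1 + h * L) ^ k"
proof (induction k)
  case (Suc k)
  have L: "L > 0" using lipschitz_fieldD(1)[OF v] .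
  let ?E = "1 + h * L" and ?P = "euler_iter T k (y s0)" and ?t = "s0 + k * h"
  have E: "?E \<ge> 1" using L h by simp
  have kh: "real (Suc k) * h \<le> real N * h" using Suc.prems h by (intro mult_right_mono) auto
  have t: "?t \<in> {s0..s1}" "?t + h \<in> {s0..s1}" using kh N h by (auto simp: distrib_right)
  have t01: "?t \<in> {0..1}" using t s by auto
  have sub: "{?t..?t + h} \<subseteq> {s0..s1}" using t by auto
  have b: "norm (y (?t + h) - y ?t - (?t + h - ?t) *\<^sub>R v ?t (y ?t)) \<le> norm (?t + h - ?t) * \<omega>"
  proof (rule vector_differentiable_bound_linearization[where S="{?t..?t+h}" and f'="\<lambda>t. v t (y t)"])
    show "(y has_vector_derivative v x (y x)) (at x within {?t..?t+h})" if "x \<in> {?t..?t+h}" for x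
      using y[OF subsetD[OF sub that]] sub by (rule has_vector_derivative_within_subset)
    show "closed_segment ?t (?t + h) \<subseteq> {?t..?t + h}" using h by (simp add: closed_segment_eq_real_ivl)
    show "norm (v x (y x) - v ?t (y ?t)) \<le> \<omega>" if "x \<in> {?t..?t+h}" for x
      using om[OF subsetD[OF sub that] t(1)] that by auto
    show "?t \<in> {?t..?t + h}" using h by simp
  qed
  have eq: "euler_iter T (Suc k) (y s0) - y (?t + h)
     = (?P - y ?t) + h *\<^sub>R (v ?t ?P - v ?t (y ?t)) + h *\<^sub>R (w k ?P - v ?t ?P) - (y (?t + h) - y ?t - h *\<^sub>R v ?t (y ?t))"
    by (simp add: T_def algebra_simps)
  have tri: "norm (p + q + r - s) \<le> norm p + norm q + norm r + norm s" for p q r s :: 'a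
    using norm_triangle_ineq4[of "p + q + r" s] norm_triangle_ineq[of "p + q" r] norm_triangle_ineq[of p q] by linarith
  have "norm (euler_iter T (Suc k) (y s0) - y (?t + h)) \<le> norm (?P - y ?t) + norm (h *\<^sub>R (v ?t ?P - v ?t (y ?t))) + norm (h *\<^sub>R (w k ?P - v ?t ?P)) + norm (y (?t + h) - y ?t - h *\<^sub>R v ?t (y ?t))"
    unfolding eq by (rule tri)
  also have "\<dots> \<le> norm (?P - y ?t) + h * (L * norm (?P - y ?t)) + h * \<delta> + h * \<omega>"
    using h b w[of k ?P] lipschitz_fieldD(3)[OF v t01, of ?P "y ?t"] Suc.prems
    by (intro add_mono) (auto intro!: mult_left_mono)
  also have "\<dots> = ?E * norm (?P - y ?t) + h * (\<delta> + \<omega>)" by (simp add: algebra_simps)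
  also have "\<dots> \<le> ?E * (k * h * (\<delta> + \<omega>) * ?E ^ k) + h * (\<delta> + \<omega>) * ?E ^ Suc k"
  proof (rule add_mono)
    show "?E * norm (?P - y ?t) \<le> ?E * (k * h * (\<delta> + \<omega>) * ?E ^ k)"
      using Suc E by (intro mult_left_mono) auto
    show "h * (\<delta> + \<omega>) \<le> h * (\<delta> + \<omega>) * ?E ^ Suc k"
      using mult_left_mono[OF one_le_power[OF E, of "Suc k"], of "h * (\<delta> + \<omega>)"] h nn by simp
  qed
  also have "\<dots> = Suc k * h * (\<delta> + \<omega>) * ?E ^ Suc k"
  proof -
    have "E * (real k * h * a * E ^ k) + h * a * E ^ Suc k = real (Suc k) * h * a * E ^ Suc k" for E a
      by (simp add: algebra_simps)
    from this[of ?E "\<delta> + \<omega>"] show ?thesis .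
  qed
  finally show ?case by (simp add: distrib_right add.commute add.left_commute)
qed simp

lemma power_le_exp:
  assumes "h \<ge> 0" "L \<ge> 0" "real j * h \<le> c" shows "(1 + h * L) ^ j \<le> exp (c * L)"
proof -
  have "(1 + h * L) ^ j \<le> exp (h * L) ^ j"
    using assms exp_ge_add_one_self[of "h * L"] by (intro power_mono) auto
  also have "\<dots> = exp (real j * h * L)" by (simp add: exp_of_nat_mult[symmetric] mult.assoc)
  also have "\<dots> \<le> exp (c * L)" using assms by (simp add: mult_right_mono)
  finally show ?thesis .
qed

context transport
begin

text \<open>\<open>P\<close> is the composition of all mollified Euler steps. It is fixed before any
  trajectory is, and the closeness to the flow is stated relative to a modulus \<omega> of that
  trajectory, since no modulus is uniform over all starting points.\<close>

lemma euler_scheme: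
  fixes \<phi> :: "'a \<Rightarrow> real"
  assumes \<phi>: "quadratic_approx Q \<phi> D\<phi>" "\<And>x y. norm (\<phi> x - \<phi> y) \<le> \<Lambda> * norm (x - y)" "\<And>x. \<bar>\<phi> x\<bar> \<le> B"
    and nn: "Q \<ge> 0" "\<Lambda> \<ge> 0" and \<delta>: "0 < \<delta>" "\<delta> \<le> 1"
  shows "\<exists>h P. 0 < h \<and> h < \<delta> \<and> P \<in> borel_measurable borel \<and>
    \<bar>(\<integral>\<omega>. \<phi> (J s1 \<omega>) \<partial>M) - (\<integral>\<omega>. \<phi> (P (J s0 \<omega>)) \<partial>M)\<bar> \<le> \<delta> * (1 + \<Lambda> * exp L * (\<integral>\<omega>. S \<omega> \<partial>M) + \<Lambda> * exp L) \<and>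
    (\<forall>y \<omega>. (\<forall>t\<in>{s0..s1}. (y has_vector_derivative v t (y t)) (at t within {s0..s1})) \<longrightarrow> \<omega> \<ge> 0 \<longrightarrow>
      (\<forall>s\<in>{s0..s1}. \<forall>t\<in>{s0..s1}. \<bar>s - t\<bar> \<le> h \<longrightarrow> norm (v s (y s) - v t (y t)) \<le> \<omega>) \<longrightarrow>
      norm (P (y s0) - y s1) \<le> exp L * (\<delta> + \<omega>))"
proof -
  have L: "L > 0" using lipschitz_fieldD(1)[OF field] .
  obtain C where C: "C \<ge> 0" and moll:
    "\<And>F :: 'a \<Rightarrow> 'a. (\<And>x y. norm (F x - F y) \<le> L * norm (x - y)) \<Longrightarrow>
       \<exists>F' D. (\<forall>x. norm (F' x - F x) \<le> \<delta>) \<and> (\<forall>x y. norm (F' x - F' y) \<le> L * norm (x - y)) \<and> quadratic_approx C F' D"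
    using mollify[of L \<delta>] L \<delta> by (metis less_imp_le)
  obtain \<eta> where \<eta>: "\<eta> > 0" "\<forall>s\<in>{s0..s1}. \<forall>t\<in>{s0..s1}. s \<le> t \<longrightarrow> t - s < \<eta> \<longrightarrow>
        (\<forall>\<omega>. norm (J t \<omega> - J s \<omega> - (t - s) *\<^sub>R J' s \<omega>) \<le> \<delta> * (t - s) * S \<omega>)"
    using J_diff[OF \<delta>(1)] by blast
  \<comment> \<open>A bound for the quadratic constants of all pull-backs at once, valid because the
    total time N h is at most 1.\<close>
  define Qb where "Qb = (Q + \<Lambda> * C) * exp (2 * L)"
  have Qb: "Qb \<ge> 0" using nn C by (simp add: Qb_def)
  define c2 where "c2 = 2 * Qb * (K + 1)\<^sup>2 * (\<integral>\<omega>. (S \<omega>)\<^sup>2 \<partial>M)"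
  have c2: "c2 \<ge> 0" using Qb by (simp add: c2_def)
  \<comment> \<open>Below \<open>\<eta>\<close> the linearisation of J holds, below
    \<open>\<delta> / (c2 + 1)\<close> the quadratic contribution of a step is at most \<delta> h,
    and below \<open>\<delta>\<close> the claimed bound on h holds.\<close>
  define c0 where "c0 = min (min \<delta> \<eta>) (\<delta> / (c2 + 1))"
  have c0: "c0 > 0" using \<delta> \<eta> c2 by (simp add: c0_def)
  obtain N :: nat where N: "1 / c0 < N" using reals_Archimedean2 by blast
  have N0: "real N > 0" using N c0 by (smt (verit) divide_pos_pos)
  define h where "h = (s1 - s0) / N"
  have h0: "h > 0" using s01 N0 by (simp add: h_def)
  have "h \<le> 1 / N" unfolding h_def using s01 N0 by (intro divide_right_mono) auto
  also have "\<dots> < c0" using N N0 c0 by (simp add: field_simps)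
  finally have h: "h < c0" .
  have hN: "s0 + real N * h = s1" using N0 by (simp add: h_def)
  have Nh1: "real N * h \<le> 1" using hN s01 by simp
  have hd: "h < \<delta>" "h < \<eta>" using h by (auto simp: c0_def)
  have "h < \<delta> / (c2 + 1)" using h by (simp add: c0_def)
  then have hc2: "h * c2 \<le> \<delta>" using c2 h0 by (simp add: field_simps)
  have t_in: "s0 + real k * h \<in> {s0..s1}" if "k \<le> N" for k
    using hN h0 mult_right_mono[of "real k" "real N" h] that by auto
  \<comment> \<open>The time index is capped at N so that the Lipschitz bound, hence the choice of
    mollified fields, covers every k.\<close>
  define vk where "vk k = v (s0 + real (min k N) * h)" for k
  have vk_lip: "norm (vk k x - vk k y) \<le> L * norm (x - y)" for k x y
    unfolding vk_def using t_in[of "min k N"] s01 by (intro lipschitz_fieldD(3)[OF field]) auto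
  have "\<forall>k. \<exists>F' D. (\<forall>x. norm (F' x - vk k x) \<le> \<delta>) \<and> (\<forall>x y. norm (F' x - F' y) \<le> L * norm (x - y)) \<and> quadratic_approx C F' D"
    using moll[OF vk_lip] by blast
  then obtain w Dw where wv: "\<And>k x. norm (w k x - vk k x) \<le> \<delta>" and wl: "\<And>k x y. norm (w k x - w k y) \<le> L * norm (x - y)"
    and wq: "\<And>k. quadratic_approx C (w k) (Dw k)"
    by metis
  have wm[measurable]: "w k \<in> borel_measurable borel" for k
  proof -
    have "L-lipschitz_on UNIV (w k)" using wl L by (intro lipschitz_onI) (auto simp: dist_norm)
    then show ?thesis by (intro borel_measurable_continuous_onI lipschitz_on_continuous_on)
  qed
  define T where "T k x = x + h *\<^sub>R w k x" for k x
  have T_eq: "T = (\<lambda>k x. x + h *\<^sub>R w k x)" by (simp add: T_def fun_eq_iff)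
  have [measurable]: "T k \<in> borel_measurable borel" for k unfolding T_eq by measurable
  define P where "P = euler_iter T N"
  have itm: "euler_iter T k \<in> borel_measurable borel" for k
  proof (induction k)
    case 0 then show ?case by (simp add: euler_iter.simps(1)[abs_def])
  next
    case (Suc k)
    note [measurable] = Suc
    have "(\<lambda>x. T k (euler_iter T k x)) \<in> borel_measurable borel" by measurable
    then show ?case by (simp add: fun_eq_iff cong: measurable_cong)
  qed
  \<comment> \<open>Telescoping quantity: the true law is followed for the first N - j steps and the
    Euler map for the last j. It joins the law of \<open>J s1\<close> (j = 0) to the image of the
    law of \<open>J s0\<close> under \<open>P\<close> (j = N).\<close>
  define a where "a j = (\<integral>\<omega>. euler_back T \<phi> N j (J (s0 + real (N - j) * h) \<omega>) \<partial>M)" for j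
  define cc where "cc = \<delta> * (1 + \<Lambda> * exp L * (\<integral>\<omega>. S \<omega> \<partial>M) + \<Lambda> * exp L)"
  have ES: "(\<integral>\<omega>. S \<omega> \<partial>M) \<ge> 0"
    by (rule integral_nonneg_AE, rule AE_I2, rule order_trans[OF zero_le_one S1])
  have step: "\<bar>a j - a (Suc j)\<bar> \<le> h * cc" if j: "j < N" for j
  proof -
    let ?t = "s0 + real (N - Suc j) * h" and ?E = "1 + h * L"
    have jh: "real j * h \<le> 1"
    proof (rule order_trans[OF _ Nh1])
      show "real j * h \<le> real N * h" using j h0 by (intro mult_right_mono) auto
    qed
    have tj: "?t + h = s0 + real (N - j) * h" using j by (simp add: of_nat_diff algebra_simps)
    note bb = euler_back_bounds[where w=w and Dw=Dw, OF wq wl \<phi>(1,2) less_imp_le[OF h0] nn less_imp_le[OF L] C, where j=j and N=N, folded T_eq]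
    obtain Dj where Dj: "quadratic_approx ((Q + j * h * \<Lambda> * C) * ?E ^ (2 * j)) (euler_back T \<phi> N j) Dj"
      using bb by blast
    have e2: "?E ^ (2 * j) \<le> exp (2 * L)"
      using power_le_exp[of h L "2 * j" 2] jh h0 L by simp
    have "j * h * (\<Lambda> * C) \<le> 1 * (\<Lambda> * C)" using jh nn C by (intro mult_right_mono) auto
    then have "(Q + j * h * \<Lambda> * C) * ?E ^ (2 * j) \<le> Qb"
      unfolding Qb_def using e2 nn C h0 L by (intro mult_mono) (auto simp: mult.assoc)
    then have Dj': "quadratic_approx Qb (euler_back T \<phi> N j) Dj" by (rule quadratic_approx_mono[OF Dj])
    have e1: "?E ^ j \<le> exp L" using power_le_exp[of h L j 1] jh h0 L by simp
    have lj: "norm (euler_back T \<phi> N j x - euler_back T \<phi> N j y) \<le> (\<Lambda> * exp L) * norm (x - y)" for x y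
    proof -
      have "norm (euler_back T \<phi> N j x - euler_back T \<phi> N j y) \<le> \<Lambda> * ?E ^ j * norm (x - y)" using bb by blast
      also have "\<dots> \<le> (\<Lambda> * exp L) * norm (x - y)" using e1 nn by (intro mult_right_mono mult_left_mono) auto
      finally show ?thesis .
    qed
    have bj: "\<bar>euler_back T \<phi> N j x\<bar> \<le> B" for x
      by (induction j arbitrary: x) (use \<phi>(3) in auto)
    have tin: "?t \<in> {s0..s1}" "?t + h \<in> {s0..s1}" using t_in[of "N - Suc j"] t_in[of "N - j"] unfolding tj by auto
    have wj: "norm (w (N - Suc j) x - v ?t x) \<le> \<delta>" for x using wv[of "N - Suc j" x] by (simp add: vk_def)
    have Jd: "norm (J (?t + h) \<omega> - J ?t \<omega> - h *\<^sub>R J' ?t \<omega>) \<le> \<delta> * h * S \<omega>" for \<omega>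
      using \<eta>(2)[rule_format, OF tin] h0 hd by simp
    have "\<bar>(\<integral>\<omega>. euler_back T \<phi> N j (J (?t + h) \<omega>) \<partial>M) - (\<integral>\<omega>. euler_back T \<phi> N j (J ?t \<omega> + h *\<^sub>R w (N - Suc j) (J ?t \<omega>)) \<partial>M)\<bar>
      \<le> h * (h * (2 * Qb * (K + 1)\<^sup>2 * (\<integral>\<omega>. (S \<omega>)\<^sup>2 \<partial>M)) + (\<Lambda> * exp L) * \<delta> * (\<integral>\<omega>. S \<omega> \<partial>M) + (\<Lambda> * exp L) * \<delta>)"
      by (rule euler_step_expectation[OF Dj' lj bj Qb _ _ _ _ _ _ tin wm wj Jd]) (use nn h0 \<delta> in auto)
    also have "\<dots> \<le> h * (\<delta> + (\<Lambda> * exp L) * \<delta> * (\<integral>\<omega>. S \<omega> \<partial>M) + (\<Lambda> * exp L) * \<delta>)"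
      using hc2 h0 unfolding c2_def by (intro mult_left_mono add_right_mono) auto
    also have "\<dots> = h * cc" by (simp add: cc_def algebra_simps)
    finally show ?thesis unfolding a_def tj[symmetric] by (simp add: T_def)
  qed
  have "j \<le> N \<Longrightarrow> \<bar>a 0 - a j\<bar> \<le> real j * (h * cc)" for j
  proof (induction j)
    case (Suc j)
    have "\<bar>a 0 - a (Suc j)\<bar> \<le> \<bar>a 0 - a j\<bar> + \<bar>a j - a (Suc j)\<bar>" by simp
    also have "\<dots> \<le> real j * (h * cc) + h * cc" using Suc step[of j] by (intro add_mono) auto
    finally show ?case by (simp add: distrib_right)
  qed simp
  from this[of N] have "\<bar>a 0 - a N\<bar> \<le> (real N * h) * cc" by (simp add: mult.assoc)
  also have "\<dots> \<le> 1 * cc" using Nh1 \<delta> nn ES by (intro mult_right_mono) (auto simp: cc_def)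
  finally have "\<bar>a 0 - a N\<bar> \<le> cc" by simp
  moreover have "a 0 = (\<integral>\<omega>. \<phi> (J s1 \<omega>) \<partial>M)" by (simp add: a_def hN)
  moreover have "a N = (\<integral>\<omega>. \<phi> (P (J s0 \<omega>)) \<partial>M)"
    using euler_back_iter[of N N T \<phi>] by (simp add: a_def P_def)
  ultimately have main: "\<bar>(\<integral>\<omega>. \<phi> (J s1 \<omega>) \<partial>M) - (\<integral>\<omega>. \<phi> (P (J s0 \<omega>)) \<partial>M)\<bar> \<le> cc" by simp
  have "norm (P (y s0) - y s1) \<le> exp L * (\<delta> + \<omega>)"
    if y: "\<forall>t\<in>{s0..s1}. (y has_vector_derivative v t (y t)) (at t within {s0..s1})" and \<omega>: "\<omega> \<ge> 0"
      and om: "\<forall>s\<in>{s0..s1}. \<forall>t\<in>{s0..s1}. \<bar>s - t\<bar> \<le> h \<longrightarrow> norm (v s (y s) - v t (y t)) \<le> \<omega>" for y \<omega>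
  proof -
    have wv': "norm (w k x - v (s0 + real k * h) x) \<le> \<delta>" if "k < N" for k x
      using wv[of k x] that by (simp add: vk_def)
    have "norm (euler_iter T N (y s0) - y (s0 + real N * h)) \<le> real N * h * (\<delta> + \<omega>) * (1 + h * L) ^ N"
      unfolding T_eq
      by (rule euler_iter_error[OF field, where y=y and w=w and ?s0.0=s0 and k=N and N=N and ?s1.0=s1]) (use y om \<omega> s01 hN h0 wv' \<delta> in auto)
    also have "\<dots> \<le> 1 * (\<delta> + \<omega>) * exp L"
      using power_le_exp[of h L N 1] Nh1 h0 L \<delta> \<omega> by (intro mult_mono) auto
    finally show ?thesis unfolding hN P_def by (simp add: mult.commute)
  qed
  then show ?thesis
    using h0 hd main itm[of N] unfolding cc_def P_def[symmetric] by blast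
qed

end

section \<open>From test functions to laws\<close>

text \<open>Closed sets generate the Borel sets and are stable under intersection; the indicator of
  a closed set is a decreasing limit of bounded Lipschitz functions of the distance to it.\<close>

lemma prob_measure_eqI_lipschitz:
  fixes A B :: "'a::euclidean_space measure"
  assumes A: "prob_space A" "sets A = sets borel" and B: "prob_space B" "sets B = sets borel"
    and eq: "\<And>\<phi> :: 'a \<Rightarrow> real. \<And>\<Lambda>. (\<And>x y. norm (\<phi> x - \<phi> y) \<le> \<Lambda> * norm (x - y)) \<Longrightarrow> (\<And>x. \<bar>\<phi> x\<bar> \<le> 1) \<Longrightarrow> \<Lambda> \<ge> 0 \<Longrightarrow>
        (\<integral>x. \<phi> x \<partial>A) = (\<integral>x. \<phi> x \<partial>B)"
  shows "A = B"
proof (rule measure_eqI_generator_eq[where E="Collect closed" and \<Omega>=UNIV and A="\<lambda>_. UNIV"])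
  interpret A: prob_space A by fact
  interpret B: prob_space B by fact
  have spA: "space A = UNIV" and spB: "space B = UNIV"     using sets_eq_imp_space_eq[OF A(2)] sets_eq_imp_space_eq[OF B(2)] by simp_all
  show "Int_stable (Collect closed :: 'a set set)" by (auto simp: Int_stable_def)
  show "Collect closed \<subseteq> Pow (UNIV :: 'a set)" by simp
  show "sets A = sigma_sets UNIV (Collect closed)" "sets B = sigma_sets UNIV (Collect closed)"
    unfolding A B borel_eq_closed by simp_all
  show "range (\<lambda>_. UNIV :: 'a set) \<subseteq> Collect closed" by auto
  show "\<Union> (range (\<lambda>_::nat. UNIV :: 'a set)) = UNIV" by auto
  show "emeasure A UNIV \<noteq> \<infinity>" for i :: nat by simp
  fix C :: "'a set" assume "C \<in> Collect closed"
  then have C: "closed C" by simp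
  show "emeasure A C = emeasure B C"
  \<comment> \<open>\<open>infdist\<close> to the empty set is 0 by convention, so the functions
    below would tend to 1 instead of the indicator.\<close>
  proof (cases "C = {}")
    case False
    define \<phi> where "\<phi> n x = max 0 (1 - real n * infdist x C)" for n x
    have lim: "(\<lambda>n. \<phi> n x) \<longlonglongrightarrow> indicator C x" for x
    proof (cases "x \<in> C")
      case True then show ?thesis by (simp add: \<phi>_def)
    next
      case F: False
      then have d: "infdist x C > 0" using C \<open>C \<noteq> {}\<close> by (simp add: infdist_pos_not_in_closed)
      obtain n0 :: nat where n0: "1 / infdist x C < n0" using reals_Archimedean2 by blast
      have "\<forall>\<^sub>F n in sequentially. \<phi> n x = indicator C x"
      proof (rule eventually_sequentiallyI[of n0])
        fix n assume "n0 \<le> n"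
        then have "1 / infdist x C \<le> real n" using n0 by linarith
        then have "1 \<le> real n * infdist x C" using d by (simp add: field_simps)
        then show "\<phi> n x = indicator C x" using F by (simp add: \<phi>_def)
      qed
      then show ?thesis by (rule tendsto_eventually)
    qed
    have b: "\<bar>\<phi> n x\<bar> \<le> 1" for n x by (simp add: \<phi>_def infdist_nonneg)
    have lip: "norm (\<phi> n x - \<phi> n y) \<le> real n * norm (x - y)" for n x y
    proof -
      have "\<bar>\<phi> n x - \<phi> n y\<bar> \<le> \<bar>real n * infdist x C - real n * infdist y C\<bar>" unfolding \<phi>_def by linarith
      also have "\<dots> = real n * \<bar>infdist x C - infdist y C\<bar>" by (simp add: abs_mult flip: right_diff_distrib)
      also have "\<dots> \<le> real n * dist x y" by (intro mult_left_mono infdist_triangle_abs) simp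
      finally show ?thesis by (simp add: dist_norm)
    qed
    have m: "\<phi> n \<in> borel_measurable borel" for n
      unfolding \<phi>_def by (intro borel_measurable_continuous_onI continuous_intros)
    have L: "(\<lambda>n. \<integral>x. \<phi> n x \<partial>N) \<longlonglongrightarrow> measure N C" if N: "prob_space N" "sets N = sets borel" for N
    proof -
      interpret prob_space N by fact
      have [measurable_cong]: "sets N = sets borel" by fact
      have [measurable]: "C \<in> sets borel" using C by simp
      have spN: "space N = UNIV" using sets_eq_imp_space_eq[OF N(2)] by simp
      have "(\<lambda>n. \<integral>x. \<phi> n x \<partial>N) \<longlonglongrightarrow> (\<integral>x. indicator C x \<partial>N)"
        by (rule integral_dominated_convergence[where w="\<lambda>_. 1"]) (use m lim b in \<open>auto simp: measurable_cong_sets[OF N(2)]\<close>)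
      then show ?thesis by (simp add: spN)
    qed
    have "(\<lambda>n. \<integral>x. \<phi> n x \<partial>A) = (\<lambda>n. \<integral>x. \<phi> n x \<partial>B)"
      by (intro ext eq[OF lip b]) simp
    then have "measure A C = measure B C" using L[OF A] L[OF B] LIMSEQ_unique by metis
    then show ?thesis by (simp add: A.emeasure_eq_measure B.emeasure_eq_measure)
  qed simp
qed

lemma unique_flow_inv_lipschitz:
  assumes w: "lipschitz_field L w" and X: "unique_flow w X" and t: "t \<in> {0..1}"
  shows "norm (inv (X t) x - inv (X t) y) \<le> exp L * norm (x - y)"
proof -
  have b: "surj (X t)" using unique_flow_bij[OF w X t] by (simp add: bij_is_surj)
  have "norm (inv (X t) x - inv (X t) y) \<le> exp (L * t) * norm (x - y)"
    using unique_flow_lipschitz(2)[OF w X t, of "inv (X t) x" "inv (X t) y"] b by (simp add: surj_f_inv_f)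
  also have "\<dots> \<le> exp L * norm (x - y)"
    using lipschitz_fieldD(1)[OF w] t by (intro mult_right_mono) (auto simp: mult_left_le)
  finally show ?thesis .
qed

lemma unique_flow_inv_continuous:
  assumes w: "lipschitz_field L w" and X: "unique_flow w X" and t: "t \<in> {0..1}"
  shows "continuous_on UNIV (inv (X t))"
proof -
  have "(exp L)-lipschitz_on UNIV (inv (X t))"
    using unique_flow_inv_lipschitz[OF w X t] by (intro lipschitz_onI) (auto simp: dist_norm)
  then show ?thesis by (rule lipschitz_on_continuous_on)
qed

lemma unique_flow_time_continuous:
  assumes X: "unique_flow w X"
  shows "continuous_on {0..1} (\<lambda>t. X t x)"
  using unique_flow_derivative[OF X, of 0 1]
  by (meson has_vector_derivative_continuous continuous_on_eq_continuous_within order_refl)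

context transport
begin

text \<open>The Euler maps \<open>P n\<close> converge pointwise to the flow from \<open>s0\<close>
  to \<open>s1\<close> as the tolerance tends to 0, and a bounded test function allows the limit
  under the expectation.\<close>

lemma law_quadratic:
  fixes \<phi> :: "'a \<Rightarrow> real"
  assumes X: "unique_flow v X"
    and \<phi>: "quadratic_approx Q \<phi> D\<phi>" "\<And>x y. norm (\<phi> x - \<phi> y) \<le> \<Lambda> * norm (x - y)" "\<And>x. \<bar>\<phi> x\<bar> \<le> B"
    and nn: "Q \<ge> 0" "\<Lambda> \<ge> 0"
  shows "(\<integral>\<omega>. \<phi> (J s1 \<omega>) \<partial>M) = (\<integral>\<omega>. \<phi> (X s1 (inv (X s0) (J s0 \<omega>))) \<partial>M)"
proof -
  define \<delta> where "\<delta> n = inverse (real (Suc n))" for n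
  have \<delta>: "0 < \<delta> n" "\<delta> n \<le> 1" for n by (auto simp: \<delta>_def field_simps)
  have \<delta>0: "\<delta> \<longlonglongrightarrow> 0" unfolding \<delta>_def by (rule LIMSEQ_inverse_real_of_nat)
  let ?c = "1 + \<Lambda> * exp L * (\<integral>\<omega>. S \<omega> \<partial>M) + \<Lambda> * exp L"
  let ?good = "\<lambda>n h P. 0 < h \<and> h < \<delta> n \<and> P \<in> borel_measurable borel \<and>
    \<bar>(\<integral>\<omega>. \<phi> (J s1 \<omega>) \<partial>M) - (\<integral>\<omega>. \<phi> (P (J s0 \<omega>)) \<partial>M)\<bar> \<le> \<delta> n * ?c \<and>
    (\<forall>y \<omega>. (\<forall>t\<in>{s0..s1}. (y has_vector_derivative v t (y t)) (at t within {s0..s1})) \<longrightarrow> \<omega> \<ge> 0 \<longrightarrow>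
      (\<forall>s\<in>{s0..s1}. \<forall>t\<in>{s0..s1}. \<bar>s - t\<bar> \<le> h \<longrightarrow> norm (v s (y s) - v t (y t)) \<le> \<omega>) \<longrightarrow>
      norm (P (y s0) - y s1) \<le> exp L * (\<delta> n + \<omega>))"
  have "\<forall>n. \<exists>h P. ?good n h P"
    using euler_scheme[OF \<phi> nn \<delta>] by blast
  then obtain h P where hP: "\<And>n. ?good n (h n) (P n)" by metis
  have s0: "s0 \<in> {0..1}" and s1: "s1 \<in> {0..1}" using s01 by auto
  have surj0: "surj (X s0)" using unique_flow_bij[OF field X s0] by (rule bij_is_surj)
  have Pl: "(\<lambda>n. P n x) \<longlonglongrightarrow> X s1 (inv (X s0) x)" for x
  proof (rule metric_LIMSEQ_I)
    fix r :: real assume r: "r > 0"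
    define y where "y t = X t (inv (X s0) x)" for t
    have y: "(y has_vector_derivative v t (y t)) (at t within {s0..s1})" if "t \<in> {s0..s1}" for t
      unfolding y_def using s01 that by (intro unique_flow_derivative[OF X]) auto
    have ys0: "y s0 = x" using surj0 by (simp add: y_def surj_f_inv_f)
    have "continuous_on {s0..s1} y" using y by (meson has_vector_derivative_continuous continuous_on_eq_continuous_within)
    then have "continuous_on {s0..s1} (\<lambda>t. v t (y t))"
      using s01 by (intro lipschitz_field_continuous_on_curve[OF field]) auto
    then have uc: "uniformly_continuous_on {s0..s1} (\<lambda>t. v t (y t))"
      by (rule compact_uniformly_continuous) simp
    \<comment> \<open>A quarter of r after division by \<open>exp L\<close>: the error stays below
      three such quarters.\<close>
    define \<omega> where "\<omega> = r / (4 * exp L)"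
    have \<omega>: "\<omega> > 0" using r by (simp add: \<omega>_def)
    obtain d where d: "d > 0" "\<And>s t. s \<in> {s0..s1} \<Longrightarrow> t \<in> {s0..s1} \<Longrightarrow> dist s t < d \<Longrightarrow> dist (v s (y s)) (v t (y t)) < \<omega>"
      using uc \<omega> unfolding uniformly_continuous_on_def by metis
    have "\<forall>\<^sub>F n in sequentially. \<delta> n < min d \<omega>" using d \<omega> by (intro order_tendstoD(2)[OF \<delta>0]) auto
    then obtain N where N: "\<And>n. n \<ge> N \<Longrightarrow> \<delta> n < min d \<omega>" unfolding eventually_sequentially by blast
    have "dist (P n x) (X s1 (inv (X s0) x)) < r" if n: "n \<ge> N" for n
    proof -
      have "norm (P n (y s0) - y s1) \<le> exp L * (\<delta> n + \<omega>)"
      proof -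
        have "\<forall>s\<in>{s0..s1}. \<forall>t\<in>{s0..s1}. \<bar>s - t\<bar> \<le> h n \<longrightarrow> norm (v s (y s) - v t (y t)) \<le> \<omega>"
          using d(2) hP[of n] N[OF n] by (fastforce simp: dist_norm intro: less_imp_le)
        then show ?thesis using hP[of n] y \<omega> by (meson less_imp_le)
      qed
      also have "\<dots> < exp L * (\<omega> + \<omega> + \<omega>)" using N[OF n] \<omega> by (intro mult_strict_left_mono) auto
      also have "\<dots> < r" using r by (simp add: \<omega>_def)
      finally show ?thesis unfolding ys0 by (simp add: dist_norm y_def)
    qed
    then show "\<exists>N. \<forall>n\<ge>N. dist (P n x) (X s1 (inv (X s0) x)) < r" by blast
  qed
  have "\<Lambda>-lipschitz_on UNIV \<phi>" using \<phi> nn by (intro lipschitz_onI) (auto simp: dist_norm)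
  then have \<phi>c: "continuous_on UNIV \<phi>" by (rule lipschitz_on_continuous_on)
  then have [measurable]: "\<phi> \<in> borel_measurable borel" by (rule borel_measurable_continuous_onI)
  have [measurable]: "X s1 \<in> borel_measurable borel" "inv (X s0) \<in> borel_measurable borel"
    using unique_flow_continuous[OF field X s1] unique_flow_inv_continuous[OF field X s0]
    by (auto intro: borel_measurable_continuous_onI)
  have [measurable]: "P n \<in> borel_measurable borel" for n using hP[of n] by blast
  have "(\<lambda>n. \<integral>\<omega>. \<phi> (P n (J s0 \<omega>)) \<partial>M) \<longlonglongrightarrow> (\<integral>\<omega>. \<phi> (X s1 (inv (X s0) (J s0 \<omega>))) \<partial>M)"
  proof (rule integral_dominated_convergence[where w="\<lambda>_. B"])
    show "AE \<omega> in M. (\<lambda>n. \<phi> (P n (J s0 \<omega>))) \<longlonglongrightarrow> \<phi> (X s1 (inv (X s0) (J s0 \<omega>)))"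
    proof (rule AE_I2, rule isCont_tendsto_compose[OF _ Pl])
      show "isCont \<phi> x" for x using \<phi>c by (simp add: continuous_on_eq_continuous_at)
    qed
  qed (use \<phi>(3) in auto)
  moreover have "(\<lambda>n. \<integral>\<omega>. \<phi> (P n (J s0 \<omega>)) \<partial>M) \<longlonglongrightarrow> (\<integral>\<omega>. \<phi> (J s1 \<omega>) \<partial>M)"
  proof (rule LIM_zero_cancel, rule Lim_null_comparison)
    show "\<forall>\<^sub>F n in sequentially. norm ((\<integral>\<omega>. \<phi> (P n (J s0 \<omega>)) \<partial>M) - (\<integral>\<omega>. \<phi> (J s1 \<omega>) \<partial>M)) \<le> \<delta> n * ?c"
    proof (rule always_eventually, rule allI)
      fix n
      have "\<bar>(\<integral>\<omega>. \<phi> (J s1 \<omega>) \<partial>M) - (\<integral>\<omega>. \<phi> (P n (J s0 \<omega>)) \<partial>M)\<bar> \<le> \<delta> n * ?c" using hP[of n] by blast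
      then show "norm ((\<integral>\<omega>. \<phi> (P n (J s0 \<omega>)) \<partial>M) - (\<integral>\<omega>. \<phi> (J s1 \<omega>) \<partial>M)) \<le> \<delta> n * ?c"
        unfolding real_norm_def by (subst abs_minus_commute)
    qed
    show "(\<lambda>n. \<delta> n * ?c) \<longlonglongrightarrow> 0" by (rule tendsto_mult_left_zero[OF \<delta>0])
  qed
  ultimately show ?thesis by (metis LIMSEQ_unique)
qed

text \<open>Mollifying the test function itself supplies the quadratic remainder bound, at a uniform
  cost of e on each side.\<close>

lemma law_lipschitz:
  fixes \<phi> :: "'a \<Rightarrow> real"
  assumes X: "unique_flow v X"
    and \<phi>: "\<And>x y. norm (\<phi> x - \<phi> y) \<le> \<Lambda> * norm (x - y)" "\<And>x. \<bar>\<phi> x\<bar> \<le> B" and \<Lambda>: "\<Lambda> \<ge> 0"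
  shows "(\<integral>\<omega>. \<phi> (J s1 \<omega>) \<partial>M) = (\<integral>\<omega>. \<phi> (X s1 (inv (X s0) (J s0 \<omega>))) \<partial>M)" (is "?l = ?r")
proof -
  have s0: "s0 \<in> {0..1}" and s1: "s1 \<in> {0..1}" using s01 by auto
  have [measurable]: "X s1 \<in> borel_measurable borel" "inv (X s0) \<in> borel_measurable borel"
    using unique_flow_continuous[OF field X s1] unique_flow_inv_continuous[OF field X s0]
    by (auto intro: borel_measurable_continuous_onI)
  have lm: "\<psi> \<in> borel_measurable borel" if "\<And>x y. norm (\<psi> x - \<psi> y) \<le> \<Lambda> * norm (x - y)" for \<psi> :: "'a \<Rightarrow> real"
  proof -
    have "\<Lambda>-lipschitz_on UNIV \<psi>" using that \<Lambda> by (intro lipschitz_onI) (auto simp: dist_norm)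
    then show ?thesis by (intro borel_measurable_continuous_onI lipschitz_on_continuous_on)
  qed
  have "\<bar>?l - ?r\<bar> \<le> 2 * e" if e: "e > 0" for e
  proof -
    obtain C where C: "C \<ge> 0" "\<exists>F' D. (\<forall>x. norm (F' x - \<phi> x) \<le> e) \<and> (\<forall>x y. norm (F' x - F' y) \<le> \<Lambda> * norm (x - y)) \<and> quadratic_approx C F' D"
      using mollify[OF \<Lambda> e] \<phi>(1) by metis
    then obtain \<psi> D where \<psi>: "\<And>x. norm (\<psi> x - \<phi> x) \<le> e" "\<And>x y. norm (\<psi> x - \<psi> y) \<le> \<Lambda> * norm (x - y)" "quadratic_approx C \<psi> D" by blast
    have \<psi>b: "\<bar>\<psi> x\<bar> \<le> B + e" for x using \<psi>(1)[of x] \<phi>(2)[of x] by simp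
    have eq: "(\<integral>\<omega>. \<psi> (J s1 \<omega>) \<partial>M) = (\<integral>\<omega>. \<psi> (X s1 (inv (X s0) (J s0 \<omega>))) \<partial>M)"
      by (rule law_quadratic[OF X \<psi>(3,2) \<psi>b C(1) \<Lambda>])
    have [measurable]: "\<phi> \<in> borel_measurable borel" "\<psi> \<in> borel_measurable borel" using lm \<phi>(1) \<psi>(2) by auto
    have close: "\<bar>(\<integral>\<omega>. \<psi> (Y \<omega>) \<partial>M) - (\<integral>\<omega>. \<phi> (Y \<omega>) \<partial>M)\<bar> \<le> e" if [measurable]: "Y \<in> borel_measurable M" for Y
    proof -
      have i: "integrable M (\<lambda>\<omega>. \<psi> (Y \<omega>))" "integrable M (\<lambda>\<omega>. \<phi> (Y \<omega>))"
        using integrable_const_bound[of "\<lambda>\<omega>. \<psi> (Y \<omega>)" "B + e"] integrable_const_bound[of "\<lambda>\<omega>. \<phi> (Y \<omega>)" B] \<phi>(2) \<psi>b by auto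
      have "norm (\<integral>\<omega>. \<psi> (Y \<omega>) - \<phi> (Y \<omega>) \<partial>M) \<le> (\<integral>\<omega>. e \<partial>M)"
        by (rule norm_integral_le) (use i \<psi>(1) in auto)
      then show ?thesis using i by (simp add: prob_space)
    qed
    have "\<bar>(\<integral>\<omega>. \<psi> (J s1 \<omega>) \<partial>M) - ?l\<bar> \<le> e" "\<bar>(\<integral>\<omega>. \<psi> (X s1 (inv (X s0) (J s0 \<omega>))) \<partial>M) - ?r\<bar> \<le> e"
      by (rule close; measurable)+
    then show ?thesis using eq by linarith
  qed
  \<comment> \<open>With this e the difference would be at most half of itself.\<close>
  from this[of "\<bar>?l - ?r\<bar> / 4"] show ?thesis by (cases "?l = ?r") auto
qed

end

text \<open>The transport locale is required only on compact subintervals of the open interval.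
  Continuity of the paths of J and of the flow lines carries the identity to the endpoints, so J'
  may be singular there.\<close>

lemma flow_transports_law:
  fixes J :: "real \<Rightarrow> 'w \<Rightarrow> 'a::euclidean_space"
  assumes M: "prob_space M" and v: "lipschitz_field L v" and X: "unique_flow v X"
    and Jm[measurable]: "\<And>t. J t \<in> borel_measurable M" and Jc: "\<And>\<omega>. continuous_on {0..1} (\<lambda>t. J t \<omega>)"
    and tr: "\<And>s0 s1. 0 < s0 \<Longrightarrow> s0 < s1 \<Longrightarrow> s1 < 1 \<Longrightarrow> \<exists>J' S K. transport M J J' v S L K s0 s1"
    and t: "t \<in> {0..1}"
  shows "distr M borel (J t) = distr M borel (\<lambda>\<omega>. X t (J 0 \<omega>))"
proof (cases "t = 0")
  case True then show ?thesis by (simp add: unique_flow_0[OF X])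
next
  case False
  then have t0: "t > 0" using t by simp
  interpret prob_space M by fact
  have [measurable]: "X t \<in> borel_measurable borel"
    using unique_flow_continuous[OF v X t] by (rule borel_measurable_continuous_onI)
  show ?thesis
  proof (rule prob_measure_eqI_lipschitz)
    show "prob_space (distr M borel (J t))" "prob_space (distr M borel (\<lambda>\<omega>. X t (J 0 \<omega>)))"
      by (rule prob_space_distr; measurable)+
    fix \<phi> :: "'a \<Rightarrow> real" and \<Lambda> assume \<phi>: "\<And>x y. norm (\<phi> x - \<phi> y) \<le> \<Lambda> * norm (x - y)" "\<And>x. \<bar>\<phi> x\<bar> \<le> 1" and \<Lambda>: "\<Lambda> \<ge> 0"
    have "\<Lambda>-lipschitz_on UNIV \<phi>" using \<phi> \<Lambda> by (intro lipschitz_onI) (auto simp: dist_norm)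
    then have \<phi>c: "continuous_on UNIV \<phi>" by (rule lipschitz_on_continuous_on)
    then have [measurable]: "\<phi> \<in> borel_measurable borel" by (rule borel_measurable_continuous_onI)
    \<comment> \<open>The denominator n + 3 keeps \<open>s n\<close> below t/2, hence below
      \<open>r n\<close>, from the very first index.\<close>
    define s where "s n = t * inverse (real (Suc (Suc (Suc n))))" for n
    define r where "r n = t - s n" for n
    have "(\<lambda>n. inverse (real (Suc (Suc (Suc n))))) \<longlonglongrightarrow> 0"
      using LIMSEQ_ignore_initial_segment[OF LIMSEQ_inverse_real_of_nat, of 2] by simp
    then have s0: "s \<longlonglongrightarrow> 0" unfolding s_def by (rule tendsto_mult_right_zero)
    then have r0: "r \<longlonglongrightarrow> t" unfolding r_def using tendsto_diff[OF tendsto_const[of t] s0] by simp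
    have sb: "0 < s n" "s n < r n" "r n < 1" for n
    proof -
      have "inverse (real (Suc (Suc (Suc n)))) < 1/2" "inverse (real (Suc (Suc (Suc n)))) > 0" by (auto simp: field_simps)
      from mult_strict_left_mono[OF this(1) t0] mult_pos_pos[OF t0 this(2)]
      have "s n < t * (1/2)" "0 < s n" by (simp_all only: s_def)
      then show "0 < s n" "s n < r n" "r n < 1" using t unfolding r_def by auto
    qed
    have s_in: "s n \<in> {0..1}" and r_in: "r n \<in> {0..1}" for n using sb[of n] by auto
    have [measurable]: "X (r n) \<in> borel_measurable borel" "inv (X (s n)) \<in> borel_measurable borel" for n
      using unique_flow_continuous[OF v X r_in] unique_flow_inv_continuous[OF v X s_in]
      by (auto intro: borel_measurable_continuous_onI)
    have eq: "(\<integral>\<omega>. \<phi> (J (r n) \<omega>) \<partial>M) = (\<integral>\<omega>. \<phi> (X (r n) (inv (X (s n)) (J (s n) \<omega>))) \<partial>M)" for n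
    proof -
      obtain J' S K where "transport M J J' v S L K (s n) (r n)" using tr[OF sb] by blast
      then interpret transport M J J' v S L K "s n" "r n" .
      show ?thesis by (rule law_lipschitz[OF X \<phi> \<Lambda>])
    qed
    have cseq: "(\<lambda>n. f (u n)) \<longlonglongrightarrow> f l" if "continuous_on {0..1} f" "\<And>n. u n \<in> {0..1}" "u \<longlonglongrightarrow> l" "l \<in> {0..1}"
      for f :: "real \<Rightarrow> 'a" and u l
      using that unfolding continuous_on_sequentially comp_def by blast
    have comp: "(\<lambda>n. \<phi> (u n)) \<longlonglongrightarrow> \<phi> l" if "u \<longlonglongrightarrow> l" for u l
    proof (rule isCont_tendsto_compose[OF _ that])
      show "isCont \<phi> l" using \<phi>c by (simp add: continuous_on_eq_continuous_at)
    qed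
    have "(\<lambda>n. \<integral>\<omega>. \<phi> (J (r n) \<omega>) \<partial>M) \<longlonglongrightarrow> (\<integral>\<omega>. \<phi> (J t \<omega>) \<partial>M)"
      by (rule integral_dominated_convergence[where w="\<lambda>_. 1"])
        (use \<phi>(2) comp[OF cseq[OF Jc r_in r0 t]] in auto)
    moreover have "(\<lambda>n. \<integral>\<omega>. \<phi> (X (r n) (inv (X (s n)) (J (s n) \<omega>))) \<partial>M) \<longlonglongrightarrow> (\<integral>\<omega>. \<phi> (X t (J 0 \<omega>)) \<partial>M)"
    proof (rule integral_dominated_convergence[where w="\<lambda>_. 1"])
      have "(\<lambda>n. X (r n) (inv (X (s n)) (J (s n) \<omega>))) \<longlonglongrightarrow> X t (J 0 \<omega>)" for \<omega>
      proof -
        let ?b = "J 0 \<omega>" and ?a = "\<lambda>n. inv (X (s n)) (J (s n) \<omega>)"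
        have L: "L > 0" using lipschitz_fieldD(1)[OF v] .
        have d1: "(\<lambda>n. J (s n) \<omega> - X (s n) ?b) \<longlonglongrightarrow> 0"
        proof -
          have "(\<lambda>n. J (s n) \<omega> - X (s n) ?b) \<longlonglongrightarrow> J 0 \<omega> - X 0 ?b"
            by (intro tendsto_diff cseq[OF Jc] cseq[OF unique_flow_time_continuous[OF X]] s_in s0) auto
          then show ?thesis by (simp add: unique_flow_0[OF X])
        qed
        have "(\<lambda>n. X (r n) (?a n) - X (r n) ?b) \<longlonglongrightarrow> 0"
        proof (rule Lim_null_comparison)
          have "norm (X (r n) (?a n) - X (r n) ?b) \<le> exp L * (exp L * norm (J (s n) \<omega> - X (s n) ?b))" for n
          proof -
            \<comment> \<open>With \<open>?b\<close> written as the inverse image of its own flow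
              line, the uniform Lipschitz bound of the inverse reduces the claim to
              \<open>d1\<close>.\<close>
            have inj: "inv (X (s n)) (X (s n) ?b) = ?b" using unique_flow_bij[OF v X s_in] by (simp add: bij_is_inj)
            have "norm (X (r n) (?a n) - X (r n) ?b) \<le> exp (L * r n) * norm (?a n - ?b)"
              by (rule unique_flow_lipschitz(1)[OF v X r_in])
            also have "\<dots> \<le> exp L * norm (?a n - ?b)"
              using L r_in[of n] by (intro mult_right_mono) (auto simp: mult_left_le)
            also have "norm (?a n - ?b) \<le> exp L * norm (J (s n) \<omega> - X (s n) ?b)"
              using unique_flow_inv_lipschitz[OF v X s_in, of n "J (s n) \<omega>" "X (s n) ?b"] unfolding inj .
            finally show ?thesis by simp
          qed
          then show "\<forall>\<^sub>F n in sequentially. norm (X (r n) (?a n) - X (r n) ?b) \<le> exp L * (exp L * norm (J (s n) \<omega> - X (s n) ?b))"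
            by (intro always_eventually allI)
          show "(\<lambda>n. exp L * (exp L * norm (J (s n) \<omega> - X (s n) ?b))) \<longlonglongrightarrow> 0"
            by (intro tendsto_mult_right_zero tendsto_norm_zero d1)
        qed
        moreover have "(\<lambda>n. X (r n) ?b) \<longlonglongrightarrow> X t ?b"
          by (rule cseq[OF unique_flow_time_continuous[OF X] r_in r0 t])
        ultimately show ?thesis using tendsto_add by fastforce
      qed
      then show "AE \<omega> in M. (\<lambda>n. \<phi> (X (r n) (inv (X (s n)) (J (s n) \<omega>)))) \<longlonglongrightarrow> \<phi> (X t (J 0 \<omega>))"
        by (intro AE_I2 comp)
    qed (use \<phi>(2) in auto)
    ultimately have "(\<integral>\<omega>. \<phi> (J t \<omega>) \<partial>M) = (\<integral>\<omega>. \<phi> (X t (J 0 \<omega>)) \<partial>M)"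
      unfolding eq by (rule LIMSEQ_unique)
    then show "(\<integral>x. \<phi> x \<partial>distr M borel (J t)) = (\<integral>x. \<phi> x \<partial>distr M borel (\<lambda>\<omega>. X t (J 0 \<omega>)))"
      by (subst (1 2) integral_distr) measurable
  qed auto
qed

subsection \<open>Tilted Gaussian measures\<close>

lemma integrable_tilt:
  fixes F :: "'b \<Rightarrow> 'c::euclidean_space"
  assumes [measurable]: "\<eta> \<in> borel_measurable M" "F \<in> borel_measurable M"
    and int: "integrable M (\<lambda>y. exp (2 * \<bar>\<eta> y\<bar>) *\<^sub>R F y)"
  shows "integrable M F" "integrable M (\<lambda>y. \<eta> y *\<^sub>R F y)"
proof -
  show "integrable M F"
    by (rule Bochner_Integration.integrable_bound[OF int])
      (auto simp: mult_le_cancel_right1)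
  have e: "\<bar>\<eta> y\<bar> \<le> exp (2 * \<bar>\<eta> y\<bar>)" for y
    using exp_ge_add_one_self[of "2 * \<bar>\<eta> y\<bar>"] by linarith
  show "integrable M (\<lambda>y. \<eta> y *\<^sub>R F y)"
    by (rule Bochner_Integration.integrable_bound[OF int]) (auto intro!: mult_right_mono e)
qed

text \<open>The derivative of a tilted mean is a covariance. As \<open>\<eta> y - m\<close> is
  centred under \<open>p\<close>, an arbitrary constant \<open>c\<close> may be subtracted from
  \<open>G\<close>; later it is chosen to exploit the Lipschitz bound of \<open>g\<close>.\<close>

lemma tilt_mean_derivative:
  fixes G :: "'b \<Rightarrow> 'c::euclidean_space"
  assumes [measurable]: "\<eta> \<in> borel_measurable M" "p \<in> borel_measurable M" "G \<in> borel_measurable M"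
    and ip: "integrable M (\<lambda>y. exp (2 * \<bar>\<eta> y\<bar>) * p y)"
    and iG: "integrable M (\<lambda>y. exp (2 * \<bar>\<eta> y\<bar>) *\<^sub>R (p y *\<^sub>R G y))"
    and P0: "(\<integral>y. p y \<partial>M) > 0"
    and m: "m = (\<integral>y. \<eta> y * p y \<partial>M) / (\<integral>y. p y \<partial>M)"
  shows "((\<lambda>r. (\<integral>y. exp (r * \<eta> y) *\<^sub>R (p y *\<^sub>R G y) \<partial>M) /\<^sub>R (\<integral>y. exp (r * \<eta> y) * p y \<partial>M))
     has_vector_derivative ((\<integral>y. (p y * (\<eta> y - m)) *\<^sub>R (G y - c) \<partial>M) /\<^sub>R (\<integral>y. p y \<partial>M))) (at 0)"
    and "integrable M (\<lambda>y. (p y * (\<eta> y - m)) *\<^sub>R (G y - c))"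
proof -
  define P where "P = (\<integral>y. p y \<partial>M)"
  have ip': "integrable M (\<lambda>y. exp (2 * \<bar>\<eta> y\<bar>) *\<^sub>R p y)" using ip by simp
  note i1 = integrable_tilt[OF _ _ ip', simplified] and i2 = integrable_tilt[OF _ _ iG]
  have ip1: "integrable M p" "integrable M (\<lambda>y. \<eta> y * p y)" using i1 by auto
  have ig1: "integrable M (\<lambda>y. p y *\<^sub>R G y)" "integrable M (\<lambda>y. \<eta> y *\<^sub>R (p y *\<^sub>R G y))" using i2 by auto
  have d1: "((\<lambda>r. \<integral>y. exp (r * \<eta> y) * p y \<partial>M) has_vector_derivative (\<integral>y. \<eta> y * p y \<partial>M)) (at 0)"
    using tilt_derivative[OF _ _ ip'] by simp
  have d2: "((\<lambda>r. \<integral>y. exp (r * \<eta> y) *\<^sub>R (p y *\<^sub>R G y) \<partial>M) has_vector_derivative (\<integral>y. \<eta> y *\<^sub>R (p y *\<^sub>R G y) \<partial>M)) (at 0)"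
    by (rule tilt_derivative[OF _ _ iG]) measurable
  have d3: "((\<lambda>r. inverse (\<integral>y. exp (r * \<eta> y) * p y \<partial>M)) has_real_derivative - (inverse P * m)) (at 0)"
  proof -
    have "((\<lambda>r. \<integral>y. exp (r * \<eta> y) * p y \<partial>M) has_real_derivative m * P) (at 0)"
      using d1 P0 unfolding m P_def by (simp add: has_real_derivative_iff_has_vector_derivative)
    from DERIV_inverse'[OF this] P0 show ?thesis by (simp add: P_def field_simps)
  qed
  have eq: "(p y * (\<eta> y - m)) *\<^sub>R (G y - c)
     = \<eta> y *\<^sub>R (p y *\<^sub>R G y) - m *\<^sub>R (p y *\<^sub>R G y) - (\<eta> y * p y) *\<^sub>R c + (m * p y) *\<^sub>R c" for y
    by (simp add: algebra_simps)
  show int: "integrable M (\<lambda>y. (p y * (\<eta> y - m)) *\<^sub>R (G y - c))"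
    unfolding eq using ip1 ig1 by (intro Bochner_Integration.integrable_add Bochner_Integration.integrable_diff integrable_scaleR_right integrable_scaleR_left integrable_mult_right)
  have "(\<integral>y. (p y * (\<eta> y - m)) *\<^sub>R (G y - c) \<partial>M)
    = (\<integral>y. \<eta> y *\<^sub>R (p y *\<^sub>R G y) \<partial>M) - m *\<^sub>R (\<integral>y. p y *\<^sub>R G y \<partial>M) - (\<integral>y. \<eta> y * p y \<partial>M) *\<^sub>R c + (m * P) *\<^sub>R c"
    unfolding eq P_def using ip1 ig1 by (simp del: scaleR_scaleR)
  also have "m * P = (\<integral>y. \<eta> y * p y \<partial>M)" using P0 by (simp add: m P_def)
  finally have I: "(\<integral>y. (p y * (\<eta> y - m)) *\<^sub>R (G y - c) \<partial>M) = (\<integral>y. \<eta> y *\<^sub>R (p y *\<^sub>R G y) \<partial>M) - m *\<^sub>R (\<integral>y. p y *\<^sub>R G y \<partial>M)"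
    by simp
  show "((\<lambda>r. (\<integral>y. exp (r * \<eta> y) *\<^sub>R (p y *\<^sub>R G y) \<partial>M) /\<^sub>R (\<integral>y. exp (r * \<eta> y) * p y \<partial>M))
     has_vector_derivative ((\<integral>y. (p y * (\<eta> y - m)) *\<^sub>R (G y - c) \<partial>M) /\<^sub>R (\<integral>y. p y \<partial>M))) (at 0)"
    by (rule has_vector_derivative_eq_rhs[OF has_vector_derivative_scaleR[OF d3 d2]])
      (unfold I, simp add: P_def algebra_simps)
qed

lemma derivative_along_line:
  fixes F :: "'a::real_normed_vector \<Rightarrow> 'c::real_normed_vector"
  assumes "\<And>x. ((\<lambda>r. F (x + r *\<^sub>R k)) has_vector_derivative F' x) (at 0)"
  shows "((\<lambda>r. F (x + r *\<^sub>R k)) has_vector_derivative F' (x + s *\<^sub>R k)) (at s)"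
proof -
  have "((\<lambda>r. F (x + s *\<^sub>R k + r *\<^sub>R k)) has_vector_derivative F' (x + s *\<^sub>R k)) (at (s - s))"
    using assms[of "x + s *\<^sub>R k"] by simp
  moreover have "((\<lambda>r. r - s) has_vector_derivative 1) (at s)" by (auto intro!: derivative_eq_intros)
  ultimately have "(((\<lambda>r. F (x + s *\<^sub>R k + r *\<^sub>R k)) \<circ> (\<lambda>r. r - s)) has_vector_derivative 1 *\<^sub>R F' (x + s *\<^sub>R k)) (at s)"
    by (intro vector_diff_chain_at)
  then show ?thesis by (simp add: comp_def algebra_simps)
qed

text \<open>Mean-value inequality on the segment from y to x; the directional derivatives at 0 are
  carried along it by translation.\<close>

lemma lipschitz_from_line_derivative:
  fixes F :: "'a::real_normed_vector \<Rightarrow> 'c::euclidean_space"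
  assumes d: "\<And>x k. ((\<lambda>r. F (x + r *\<^sub>R k)) has_vector_derivative F' k x) (at 0)"
    and b: "\<And>x k. norm (F' k x) \<le> K * norm k"
  shows "norm (F x - F y) \<le> K * norm (x - y)"
proof -
  let ?k = "x - y"
  have dl: "((\<lambda>r. F (y + r *\<^sub>R ?k)) has_vector_derivative F' ?k (y + s *\<^sub>R ?k)) (at s)" for s
    by (rule derivative_along_line[OF d])
  have "norm (F (y + 1 *\<^sub>R ?k) - F (y + 0 *\<^sub>R ?k)) \<le> K * norm ?k * 1 - K * norm ?k * 0"
  proof (rule differentiable_bound_general[where \<phi>="\<lambda>r. K * norm ?k * r" and \<phi>'="\<lambda>_. K * norm ?k"])
    show "continuous_on {0..1} (\<lambda>r. F (y + r *\<^sub>R ?k))"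
      using dl by (meson continuous_at_imp_continuous_on has_vector_derivative_continuous)
    show "continuous_on {0..1} (\<lambda>r. K * norm ?k * r)" by (intro continuous_intros)
    show "((\<lambda>r. F (y + r *\<^sub>R ?k)) has_vector_derivative F' ?k (y + s *\<^sub>R ?k)) (at s)" for s by (rule dl)
    show "((\<lambda>r. K * norm ?k * r) has_vector_derivative K * norm ?k) (at s)" for s
      by (auto intro!: derivative_eq_intros simp flip: has_real_derivative_iff_has_vector_derivative)
    show "norm (F' ?k (y + s *\<^sub>R ?k)) \<le> K * norm ?k" for s by (rule b)
  qed simp
  then show ?thesis by simp
qed

text \<open>Joint continuity includes \<tau> = 0, where the smoothing degenerates to evaluation.
  This is what later gives the velocity a limit at time 1. A convergent sequence of parameters is
  bounded, and its bound \<open>R\<close> provides the dominating function.\<close>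

lemma gaussian_smoothing_continuous:
  fixes q :: "'a::euclidean_space \<Rightarrow> 'c::euclidean_space"
  assumes q: "continuous_on UNIV q" and bd: "\<And>x. norm (q x) \<le> A * exp (B * norm x)" and B: "B \<ge> 0"
  shows "continuous_on UNIV (\<lambda>(z, \<tau>). \<integral>y. q (z + \<tau> *\<^sub>R y) \<partial>gaussian 1)"
proof (rule continuous_on_sequentiallyI)
  have A: "A \<ge> 0" using order_trans[OF norm_ge_zero bd[of 0]] by simp
  have [measurable]: "q \<in> borel_measurable borel" using q by (rule borel_measurable_continuous_onI)
  fix u :: "nat \<Rightarrow> 'a \<times> real" and a assume u: "u \<longlonglongrightarrow> a"
  then have "Bseq u" by (simp add: convergentI convergent_imp_Bseq)
  then obtain R where R: "\<And>n. norm (u n) \<le> R" unfolding Bseq_def by blast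
  have "(\<lambda>n. \<integral>y. q (fst (u n) + snd (u n) *\<^sub>R y) \<partial>gaussian 1) \<longlonglongrightarrow> (\<integral>y. q (fst a + snd a *\<^sub>R y) \<partial>gaussian 1)"
  proof (rule integral_dominated_convergence[where w="\<lambda>y. A * exp (B * R) * exp (B * R * norm y)"])
    show "integrable (gaussian 1) (\<lambda>y::'a. A * exp (B * R) * exp (B * R * norm y))"
      by (intro integrable_mult_right integrable_gaussian_exp_norm)
    show "AE y in gaussian 1. (\<lambda>n. q (fst (u n) + snd (u n) *\<^sub>R y)) \<longlonglongrightarrow> q (fst a + snd a *\<^sub>R y)"
    proof (rule AE_I2)
      fix y
      have "(\<lambda>n. fst (u n) + snd (u n) *\<^sub>R y) \<longlonglongrightarrow> fst a + snd a *\<^sub>R y"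
        by (intro tendsto_intros u)
      moreover have "isCont q (fst a + snd a *\<^sub>R y)" using q by (simp add: continuous_on_eq_continuous_at)
      ultimately show "(\<lambda>n. q (fst (u n) + snd (u n) *\<^sub>R y)) \<longlonglongrightarrow> q (fst a + snd a *\<^sub>R y)"
        by (rule isCont_tendsto_compose[rotated])
    qed
    fix n
    show "AE y in gaussian 1. norm (q (fst (u n) + snd (u n) *\<^sub>R y)) \<le> A * exp (B * R) * exp (B * R * norm y)"
    proof (rule AE_I2)
      fix y
      have f: "norm (fst (u n)) \<le> R" "\<bar>snd (u n)\<bar> \<le> R"
        using R[of n] norm_fst_le[of "fst (u n)" "snd (u n)"] norm_snd_le[of "snd (u n)" "fst (u n)"] by auto
      have "norm (fst (u n) + snd (u n) *\<^sub>R y) \<le> norm (fst (u n)) + \<bar>snd (u n)\<bar> * norm y"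
        by (metis norm_scaleR norm_triangle_ineq)
      also have "\<dots> \<le> R + R * norm y" using f by (intro add_mono mult_right_mono) auto
      finally have "norm (q (fst (u n) + snd (u n) *\<^sub>R y)) \<le> A * exp (B * (R + R * norm y))"
        using A B by (intro order_trans[OF bd] mult_left_mono) (auto intro: mult_left_mono)
      also have "\<dots> = A * exp (B * R) * exp (B * R * norm y)" by (simp add: distrib_left exp_add mult.assoc)
      finally show "norm (q (fst (u n) + snd (u n) *\<^sub>R y)) \<le> A * exp (B * R) * exp (B * R * norm y)" .
    qed
  qed measurable
  then show "(\<lambda>n. case u n of (z, \<tau>) \<Rightarrow> \<integral>y. q (z + \<tau> *\<^sub>R y) \<partial>gaussian 1)
     \<longlonglongrightarrow> (case a of (z, \<tau>) \<Rightarrow> \<integral>y. q (z + \<tau> *\<^sub>R y) \<partial>gaussian 1)"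
    by (simp add: case_prod_beta)
qed

section \<open>The tilt, its smoothing and its drift\<close>

text \<open>\<open>g\<close> is the gradient of log f. It is encoded through directional derivatives
  of f, the form in which integration by parts consumes it.\<close>

locale tilted_base =
  fixes f :: "'a::euclidean_space \<Rightarrow> real" and g :: "'a \<Rightarrow> 'a" and K A B :: real
  assumes f_pos: "\<And>x. f x > 0" and f_cont: "continuous_on UNIV f"
    and f_der: "\<And>x k. ((\<lambda>r. f (x + r *\<^sub>R k)) has_real_derivative f x * (g x \<bullet> k)) (at 0)"
    and g_lip: "\<And>x y. norm (g x - g y) \<le> K * norm (x - y)" and K: "K \<ge> 0"
    and f_bd: "\<And>x. f x \<le> A * exp (B * norm x)" and B: "B \<ge> 0"
begin

definition mass :: "'a \<Rightarrow> real \<Rightarrow> real" where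
  "mass z \<tau> = (\<integral>y. f (z + \<tau> *\<^sub>R y) \<partial>gaussian 1)"

text \<open>The function called h in the overview. At \<tau> = 0 it reduces to \<open>g\<close>, so
  one formula serves up to time 1.\<close>

definition drift :: "'a \<Rightarrow> real \<Rightarrow> 'a" where
  "drift z \<tau> = (\<integral>y. f (z + \<tau> *\<^sub>R y) *\<^sub>R g (z + \<tau> *\<^sub>R y) \<partial>gaussian 1) /\<^sub>R mass z \<tau>"

lemma A0: "A \<ge> 0"
  using f_bd[of 0] f_pos[of 0] by simp

lemma g_cont: "continuous_on UNIV g"
proof -
  have "K-lipschitz_on UNIV g" using g_lip K by (intro lipschitz_onI) (auto simp: dist_norm)
  then show ?thesis by (rule lipschitz_on_continuous_on)
qed

lemma f_meas[measurable]: "f \<in> borel_measurable borel"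
  using f_cont by (rule borel_measurable_continuous_onI)

lemma g_meas[measurable]: "g \<in> borel_measurable borel"
  using g_cont by (rule borel_measurable_continuous_onI)

definition Ag :: real where "Ag = A * (norm (g 0) + K)"

lemma Ag0: "Ag \<ge> 0"
  using A0 K by (simp add: Ag_def)

lemma fg_bd: "norm (f x *\<^sub>R g x) \<le> Ag * exp ((B + 1) * norm x)"
proof -
  have "norm (g x) \<le> norm (g 0) + K * norm x"
    using g_lip[of x 0] norm_triangle_sub[of "g x" "g 0"] by simp
  also have "\<dots> \<le> norm (g 0) * exp (norm x) + K * exp (norm x)"
    using K norm_le_exp[of x] by (intro add_mono mult_left_mono) (auto simp: mult_le_cancel_left1)
  finally have "norm (g x) \<le> (norm (g 0) + K) * exp (norm x)" by (simp add: distrib_right)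
  then have "f x * norm (g x) \<le> (A * exp (B * norm x)) * ((norm (g 0) + K) * exp (norm x))"
    using f_bd[of x] f_pos[of x] A0 by (intro mult_mono) auto
  also have "\<dots> = Ag * exp ((B + 1) * norm x)"
  proof -
    have "(B + 1) * norm x = B * norm x + norm x" by (simp add: distrib_right)
    then show ?thesis by (simp only: Ag_def exp_add mult_ac)
  qed
  finally show ?thesis using f_pos[of x] by simp
qed

lemma shift_bd:
  assumes "\<And>x. norm (q x) \<le> a * exp (b * norm x)" "a \<ge> 0" "b \<ge> 0"
  shows "norm (q (z + \<tau> *\<^sub>R y)) \<le> a * exp (b * norm z) * exp (b * \<bar>\<tau>\<bar> * norm y)"
proof -
  have "norm (z + \<tau> *\<^sub>R y) \<le> norm z + \<bar>\<tau>\<bar> * norm y" by (metis norm_scaleR norm_triangle_ineq)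
  then have "norm (q (z + \<tau> *\<^sub>R y)) \<le> a * exp (b * (norm z + \<bar>\<tau>\<bar> * norm y))"
    using assms by (intro order_trans[OF assms(1)] mult_left_mono) (auto intro: mult_left_mono)
  then show ?thesis by (simp add: distrib_left exp_add mult.assoc)
qed

lemma f_norm_bd: "norm (f x) \<le> A * exp (B * norm x)"
  using f_bd[of x] f_pos[of x] by simp

lemma f_int: "integrable (gaussian 1) (\<lambda>y. f (z + \<tau> *\<^sub>R y))"
  by (rule integrable_gaussian_exp_bound[OF _ shift_bd[OF f_norm_bd A0 B]]) measurable

lemma mass_pos: "mass z \<tau> > 0"
proof -
  interpret prob_space "gaussian 1 :: 'a measure" by (rule prob_space_gaussian) simp
  have "mass z \<tau> \<noteq> 0"
  proof
    assume "mass z \<tau> = 0"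
    then have "AE y in gaussian 1. f (z + \<tau> *\<^sub>R y) = 0"
      unfolding mass_def by (subst (asm) integral_nonneg_eq_0_iff_AE[OF f_int]) (simp_all add: less_imp_le[OF f_pos])
    then have "AE y in (gaussian 1 :: 'a measure). False"
      by eventually_elim (use f_pos in \<open>auto simp: less_le\<close>)
    then show False by simp
  qed
  moreover have "mass z \<tau> \<ge> 0" unfolding mass_def using f_pos by (intro integral_nonneg_AE AE_I2) (auto intro: less_imp_le)
  ultimately show ?thesis by simp
qed

lemma drift_continuous: "continuous_on UNIV (\<lambda>(z, \<tau>). drift z \<tau>)"
proof -
  have 1: "continuous_on UNIV (\<lambda>(z, \<tau>). mass z \<tau>)"
    unfolding mass_def by (rule gaussian_smoothing_continuous[OF f_cont f_norm_bd B])
  have 2: "continuous_on UNIV (\<lambda>(z, \<tau>). \<integral>y. f (z + \<tau> *\<^sub>R y) *\<^sub>R g (z + \<tau> *\<^sub>R y) \<partial>gaussian 1)"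
    by (rule gaussian_smoothing_continuous[OF _ fg_bd]) (use f_cont g_cont B in \<open>auto intro!: continuous_intros\<close>)
  have "mass (fst p) (snd p) \<noteq> 0" for p using mass_pos[of "fst p" "snd p"] by simp
  then show ?thesis
    using 1 2 unfolding drift_def case_prod_beta by (intro continuous_on_scaleR continuous_on_inverse) auto
qed

lemma drift_0: "drift z 0 = g z"
proof -
  interpret prob_space "gaussian 1 :: 'a measure" by (rule prob_space_gaussian) simp
  have "prob UNIV = 1" using prob_space by simp
  then show ?thesis unfolding drift_def mass_def using f_pos[of z] by simp
qed

text \<open>Stein's identity for the tilt. The factor \<tau> gained here is the one that cancels the
  singular derivative of \<open>a\<close>.\<close>

lemma integration_by_parts:
  "(\<integral>y. f (z + \<tau> *\<^sub>R y) *\<^sub>R y \<partial>gaussian 1) = (\<tau> * mass z \<tau>) *\<^sub>R drift z \<tau>"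
    and fy_int: "integrable (gaussian 1) (\<lambda>y. f (z + \<tau> *\<^sub>R y) *\<^sub>R y)"
proof -
  define b where "b = (B + 1) * \<bar>\<tau>\<bar>"
  define c where "c = (A + \<bar>\<tau>\<bar> * Ag) * exp ((B + 1) * norm z)"
  have b: "b \<ge> 0" using B by (simp add: b_def)
  have fb: "\<bar>f (z + \<tau> *\<^sub>R y)\<bar> \<le> c * exp (b * norm y)" for y
  proof -
    have "norm (f x) \<le> A * exp ((B + 1) * norm x)" for x
      using A0 by (intro order_trans[OF f_norm_bd] mult_left_mono) (auto simp: distrib_right)
    from shift_bd[OF this A0, of z \<tau> y] B
    have "\<bar>f (z + \<tau> *\<^sub>R y)\<bar> \<le> A * exp ((B + 1) * norm z) * exp (b * norm y)" by (simp add: b_def)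
    also have "\<dots> \<le> c * exp (b * norm y)" unfolding c_def using Ag0 by (intro mult_right_mono) auto
    finally show ?thesis .
  qed
  have gb: "\<tau> * norm (f (z + \<tau> *\<^sub>R y) *\<^sub>R g (z + \<tau> *\<^sub>R y)) \<le> c * exp (b * norm y)"
     "- \<tau> * norm (f (z + \<tau> *\<^sub>R y) *\<^sub>R g (z + \<tau> *\<^sub>R y)) \<le> c * exp (b * norm y)" for y
  proof -
    have "\<bar>\<tau>\<bar> * norm (f (z + \<tau> *\<^sub>R y) *\<^sub>R g (z + \<tau> *\<^sub>R y)) \<le> \<bar>\<tau>\<bar> * (Ag * exp ((B + 1) * norm z) * exp (b * norm y))"
      using shift_bd[OF fg_bd Ag0, of z \<tau> y] B by (intro mult_left_mono) (auto simp: b_def)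
    also have "\<dots> = (\<bar>\<tau>\<bar> * Ag) * exp ((B + 1) * norm z) * exp (b * norm y)" by (simp add: mult_ac)
    also have "\<dots> \<le> c * exp (b * norm y)" unfolding c_def using A0 by (intro mult_right_mono) auto
    finally have *: "\<bar>\<tau>\<bar> * norm (f (z + \<tau> *\<^sub>R y) *\<^sub>R g (z + \<tau> *\<^sub>R y)) \<le> c * exp (b * norm y)" .
    show "\<tau> * norm (f (z + \<tau> *\<^sub>R y) *\<^sub>R g (z + \<tau> *\<^sub>R y)) \<le> c * exp (b * norm y)"
     "- \<tau> * norm (f (z + \<tau> *\<^sub>R y) *\<^sub>R g (z + \<tau> *\<^sub>R y)) \<le> c * exp (b * norm y)"
      by (rule order_trans[OF mult_right_mono *]; simp)+
  qed
  have c: "c \<ge> 0" using A0 Ag0 by (simp add: c_def)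
  show int: "integrable (gaussian 1) (\<lambda>y. f (z + \<tau> *\<^sub>R y) *\<^sub>R y)"
  proof (rule integrable_gaussian_exp_bound)
    fix y :: 'a
    have "norm (f (z + \<tau> *\<^sub>R y) *\<^sub>R y) \<le> (c * exp (b * norm y)) * exp (norm y)"
      unfolding norm_scaleR using fb norm_le_exp c by (intro mult_mono) auto
    also have "\<dots> = c * exp ((b + 1) * norm y)" by (simp add: distrib_right exp_add)
    finally show "norm (f (z + \<tau> *\<^sub>R y) *\<^sub>R y) \<le> c * exp ((b + 1) * norm y)" .
  qed measurable
  have intg: "integrable (gaussian 1) (\<lambda>y. f (z + \<tau> *\<^sub>R y) *\<^sub>R g (z + \<tau> *\<^sub>R y))"
    by (rule integrable_gaussian_exp_bound[OF _ shift_bd[OF fg_bd Ag0]]) (use B in \<open>auto\<close>)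
  show "(\<integral>y. f (z + \<tau> *\<^sub>R y) *\<^sub>R y \<partial>gaussian 1) = (\<tau> * mass z \<tau>) *\<^sub>R drift z \<tau>"
  proof (rule euclidean_eqI)
    fix i :: 'a assume i: "i \<in> Basis"
    have "(\<integral>y. \<tau> * ((f (z + \<tau> *\<^sub>R y) *\<^sub>R g (z + \<tau> *\<^sub>R y)) \<bullet> i) \<partial>gaussian 1) = (\<integral>y. f (z + \<tau> *\<^sub>R y) * (y \<bullet> i) \<partial>gaussian 1)"
    proof (rule gaussian_integration_by_parts[OF _ _ fb _ b])
      fix y
      have "\<bar>(f (z + \<tau> *\<^sub>R y) *\<^sub>R g (z + \<tau> *\<^sub>R y)) \<bullet> i\<bar> \<le> norm (f (z + \<tau> *\<^sub>R y) *\<^sub>R g (z + \<tau> *\<^sub>R y))"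
        by (rule Basis_le_norm[OF i])
      then have "\<bar>\<tau>\<bar> * \<bar>(f (z + \<tau> *\<^sub>R y) *\<^sub>R g (z + \<tau> *\<^sub>R y)) \<bullet> i\<bar> \<le> \<bar>\<tau>\<bar> * norm (f (z + \<tau> *\<^sub>R y) *\<^sub>R g (z + \<tau> *\<^sub>R y))"
        by (rule mult_left_mono) simp
      also have "\<dots> \<le> c * exp (b * norm y)" using gb[of y] by (cases "\<tau> \<ge> 0") auto
      finally show "\<bar>\<tau> * ((f (z + \<tau> *\<^sub>R y) *\<^sub>R g (z + \<tau> *\<^sub>R y)) \<bullet> i)\<bar> \<le> c * exp (b * norm y)" by (simp only: abs_mult)
      have "((\<lambda>r. f ((z + \<tau> *\<^sub>R y) + r *\<^sub>R (\<tau> *\<^sub>R i))) has_real_derivative f (z + \<tau> *\<^sub>R y) * (g (z + \<tau> *\<^sub>R y) \<bullet> (\<tau> *\<^sub>R i))) (at 0)"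
        by (rule f_der)
      then show "((\<lambda>r. f (z + \<tau> *\<^sub>R (y + r *\<^sub>R i))) has_real_derivative \<tau> * ((f (z + \<tau> *\<^sub>R y) *\<^sub>R g (z + \<tau> *\<^sub>R y)) \<bullet> i)) (at 0)"
        by (simp add: algebra_simps)
    qed measurable
    moreover have "(\<integral>y. (f (z + \<tau> *\<^sub>R y) *\<^sub>R y) \<bullet> i \<partial>gaussian 1) = (\<integral>y. f (z + \<tau> *\<^sub>R y) *\<^sub>R y \<partial>gaussian 1) \<bullet> i"
      by (rule integral_inner_left) (rule int)
    moreover have "(\<integral>y. (f (z + \<tau> *\<^sub>R y) *\<^sub>R g (z + \<tau> *\<^sub>R y)) \<bullet> i \<partial>gaussian 1) = (\<integral>y. f (z + \<tau> *\<^sub>R y) *\<^sub>R g (z + \<tau> *\<^sub>R y) \<partial>gaussian 1) \<bullet> i"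
      by (rule integral_inner_left) (rule intg)
    moreover have "(\<integral>y. f (z + \<tau> *\<^sub>R y) *\<^sub>R g (z + \<tau> *\<^sub>R y) \<partial>gaussian 1) = mass z \<tau> *\<^sub>R drift z \<tau>"
      using mass_pos[of z \<tau>] by (simp add: drift_def)
    ultimately show "(\<integral>y. f (z + \<tau> *\<^sub>R y) *\<^sub>R y \<partial>gaussian 1) \<bullet> i = ((\<tau> * mass z \<tau>) *\<^sub>R drift z \<tau>) \<bullet> i"
      by simp
  qed
qed

lemma f_norm_sq_int: "integrable (gaussian 1) (\<lambda>y. f (z + \<tau> *\<^sub>R y) * (norm (y - c))\<^sup>2)"
proof (rule integrable_gaussian_exp_bound)
  fix y :: 'a
  have "(norm (y - c))\<^sup>2 \<le> (exp (norm (y - c)))\<^sup>2" by (intro power_mono norm_le_exp) simp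
  also have "\<dots> = exp (2 * norm (y - c))" by (simp add: exp_double)
  also have "\<dots> \<le> exp (2 * norm y + 2 * norm c)" using norm_triangle_ineq4[of y c] by simp
  finally have "f (z + \<tau> *\<^sub>R y) * (norm (y - c))\<^sup>2 \<le> (A * exp (B * norm z) * exp (B * \<bar>\<tau>\<bar> * norm y)) * exp (2 * norm y + 2 * norm c)"
    using shift_bd[OF f_norm_bd A0 B, of z \<tau> y] A0 by (intro mult_mono) auto
  also have "\<dots> = (A * exp (B * norm z) * exp (2 * norm c)) * exp ((B * \<bar>\<tau>\<bar> + 2) * norm y)"
    unfolding distrib_right exp_add by (simp only: mult_ac)
  finally show "norm (f (z + \<tau> *\<^sub>R y) * (norm (y - c))\<^sup>2) \<le> (A * exp (B * norm z) * exp (2 * norm c)) * exp ((B * \<bar>\<tau>\<bar> + 2) * norm y)"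
    using f_pos[of "z + \<tau> *\<^sub>R y"] by (simp add: abs_mult)
qed measurable

end

text \<open>The variance is taken in the standard Gaussian variable y, not in z + \<tau> y, so that
  one \<open>D\<close> can serve for all small \<tau>. Multiplying through by the mass avoids
  quotients.\<close>

locale tilted_gaussian = tilted_base +
  fixes D T :: real
  assumes var: "\<And>z \<tau> m. 0 < \<tau> \<Longrightarrow> \<tau> \<le> T \<Longrightarrow>
        mass z \<tau> *\<^sub>R m = (\<integral>y. f (z + \<tau> *\<^sub>R y) *\<^sub>R y \<partial>gaussian 1) \<Longrightarrow>
        (\<integral>y. f (z + \<tau> *\<^sub>R y) * (norm (y - m))\<^sup>2 \<partial>gaussian 1) \<le> D * mass z \<tau>"
begin

text \<open>The derivative of the drift in direction k is the covariance of
  \<open>y \<bullet> k / \<tau>\<close> with \<open>g (z + \<tau> *\<^sub>R y)\<close>. The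
  Lipschitz bound of g contributes a factor \<tau>, so the powers of \<tau> cancel and the variance
  remains. The maximum with 1 covers \<tau> = 0, where the drift is g.\<close>

lemma drift_lipschitz:
  assumes \<tau>: "0 \<le> \<tau>" "\<tau> \<le> T"
  shows "norm (drift x \<tau> - drift y \<tau>) \<le> K * max 1 D * norm (x - y)"
proof (cases "\<tau> = 0")
  case True
  have "K * norm (x - y) \<le> K * max 1 D * norm (x - y)" using K by (intro mult_right_mono) (auto simp: mult_le_cancel_left1)
  then show ?thesis using g_lip[of x y] True by (simp add: drift_0)
next
  case False
  then have t0: "\<tau> > 0" using \<tau> by simp
  define m where "m z = (\<integral>y. f (z + \<tau> *\<^sub>R y) *\<^sub>R y \<partial>gaussian 1) /\<^sub>R mass z \<tau>" for z
  \<comment> \<open>The covariance with the free constant taken as g at the tilted mean, so that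
    both factors are of order \<open>norm (y - m z)\<close>.\<close>
  define d where "d k z = (\<integral>y. (f (z + \<tau> *\<^sub>R y) * (y \<bullet> ((1/\<tau>) *\<^sub>R k) - m z \<bullet> ((1/\<tau>) *\<^sub>R k))) *\<^sub>R (g (z + \<tau> *\<^sub>R y) - g (z + \<tau> *\<^sub>R m z)) \<partial>gaussian 1) /\<^sub>R mass z \<tau>" for k z
  have *: "((\<lambda>r. drift (z + r *\<^sub>R k) \<tau>) has_vector_derivative d k z) (at 0)
     \<and> integrable (gaussian 1) (\<lambda>y. (f (z + \<tau> *\<^sub>R y) * (y \<bullet> ((1/\<tau>) *\<^sub>R k) - m z \<bullet> ((1/\<tau>) *\<^sub>R k))) *\<^sub>R (g (z + \<tau> *\<^sub>R y) - g (z + \<tau> *\<^sub>R m z)))" for z k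
  proof -
    define k' where "k' = (1/\<tau>) *\<^sub>R k"
    have kk: "k = \<tau> *\<^sub>R k'" using t0 by (simp add: k'_def)
    let ?p = "\<lambda>y. f (z + \<tau> *\<^sub>R y)" and ?G = "\<lambda>y. g (z + \<tau> *\<^sub>R y)" and ?\<eta> = "\<lambda>y. y \<bullet> k'"
    have ig: "integrable (gaussian 1) (\<lambda>y. exp (2 * \<bar>y \<bullet> k'\<bar>) *\<^sub>R F y)"
      if [measurable]: "F \<in> borel_measurable borel" and F: "\<And>y. norm (F y) \<le> a * exp (b * norm y)" for F :: "'a \<Rightarrow> 'c::euclidean_space" and a b
    proof (rule integrable_gaussian_exp_bound)
      fix y
      have "norm (exp (2 * \<bar>y \<bullet> k'\<bar>) *\<^sub>R F y) \<le> exp (2 * norm k' * norm y) * (a * exp (b * norm y))"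
        using mult_mono[OF exp_abs_inner_le[of y k'] F[of y]] by simp
      also have "\<dots> = a * exp ((2 * norm k' + b) * norm y)"
        unfolding distrib_right exp_add by (simp only: mult_ac)
      finally show "norm (exp (2 * \<bar>y \<bullet> k'\<bar>) *\<^sub>R F y) \<le> \<dots>" .
    qed measurable
    have i1: "integrable (gaussian 1) (\<lambda>y. exp (2 * \<bar>y \<bullet> k'\<bar>) * ?p y)"
      using ig[OF _ shift_bd[OF f_norm_bd A0 B], of z \<tau>] by simp
    have i2: "integrable (gaussian 1) (\<lambda>y. exp (2 * \<bar>y \<bullet> k'\<bar>) *\<^sub>R (?p y *\<^sub>R ?G y))"
      by (rule ig[OF _ shift_bd[OF fg_bd Ag0]]) (use B in \<open>auto\<close>)
    have P: "(\<integral>y. ?p y \<partial>gaussian 1) > 0" using mass_pos[of z \<tau>] by (simp add: mass_def)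
    have mk: "m z \<bullet> k' = (\<integral>y. (y \<bullet> k') * ?p y \<partial>gaussian 1) / (\<integral>y. ?p y \<partial>gaussian 1)"
      unfolding m_def mass_def using fy_int[of z \<tau>]
      by (simp add: divide_inverse mult.commute flip: integral_inner_left)
    note T = tilt_mean_derivative[OF _ _ _ i1 i2 P mk, of "g (z + \<tau> *\<^sub>R m z)"]
    \<comment> \<open>Cameron-Martin turns the translation of z into a tilt; the remaining scalar
      prefactor is common to numerator and mass and cancels.\<close>
    have shift: "drift (z + r *\<^sub>R k) \<tau> = (\<integral>y. exp (r * (y \<bullet> k')) *\<^sub>R (?p y *\<^sub>R ?G y) \<partial>gaussian 1) /\<^sub>R (\<integral>y. exp (r * (y \<bullet> k')) * ?p y \<partial>gaussian 1)" for r
    proof -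
      have e: "exp (y \<bullet> (r *\<^sub>R k') - (norm (r *\<^sub>R k'))\<^sup>2 / 2) = exp (- ((norm (r *\<^sub>R k'))\<^sup>2 / 2)) * exp (r * (y \<bullet> k'))" for y
        unfolding exp_add[symmetric] by simp
      have s: "(\<integral>y. F (z + r *\<^sub>R k + \<tau> *\<^sub>R y) \<partial>gaussian 1) = exp (- ((norm (r *\<^sub>R k'))\<^sup>2 / 2)) *\<^sub>R (\<integral>y. exp (r * (y \<bullet> k')) *\<^sub>R F (z + \<tau> *\<^sub>R y) \<partial>gaussian 1)"
        if [measurable]: "F \<in> borel_measurable borel" for F :: "'a \<Rightarrow> 'c::euclidean_space"
      proof -
        have "(\<integral>y. F (z + r *\<^sub>R k + \<tau> *\<^sub>R y) \<partial>gaussian 1) = (\<integral>y. F (z + \<tau> *\<^sub>R (y + r *\<^sub>R k')) \<partial>gaussian 1)"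
          unfolding kk by (simp add: algebra_simps)
        also have "\<dots> = (\<integral>y. exp (y \<bullet> (r *\<^sub>R k') - (norm (r *\<^sub>R k'))\<^sup>2 / 2) *\<^sub>R F (z + \<tau> *\<^sub>R y) \<partial>gaussian 1)"
          by (rule integral_gaussian_shift) measurable
        finally show ?thesis unfolding e scaleR_scaleR[symmetric] by (simp only: integral_scaleR_right)
      qed
      have s1: "(\<integral>y. f (z + r *\<^sub>R k + \<tau> *\<^sub>R y) *\<^sub>R g (z + r *\<^sub>R k + \<tau> *\<^sub>R y) \<partial>gaussian 1)
         = exp (- ((norm (r *\<^sub>R k'))\<^sup>2 / 2)) *\<^sub>R (\<integral>y. exp (r * (y \<bullet> k')) *\<^sub>R (?p y *\<^sub>R ?G y) \<partial>gaussian 1)"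
        by (rule s[of "\<lambda>x. f x *\<^sub>R g x"]) measurable
      have s2: "(\<integral>y. f (z + r *\<^sub>R k + \<tau> *\<^sub>R y) \<partial>gaussian 1) = exp (- ((norm (r *\<^sub>R k'))\<^sup>2 / 2)) * (\<integral>y. exp (r * (y \<bullet> k')) * ?p y \<partial>gaussian 1)"
        using s[of f] by simp
      show ?thesis unfolding drift_def mass_def s1 s2 by simp
    qed
    have "((\<lambda>r. drift (z + r *\<^sub>R k) \<tau>) has_vector_derivative d k z) (at 0)"
      unfolding shift d_def k'_def[symmetric] mass_def by (rule T(1)) measurable
    moreover have "integrable (gaussian 1) (\<lambda>y. (f (z + \<tau> *\<^sub>R y) * (y \<bullet> ((1/\<tau>) *\<^sub>R k) - m z \<bullet> ((1/\<tau>) *\<^sub>R k))) *\<^sub>R (g (z + \<tau> *\<^sub>R y) - g (z + \<tau> *\<^sub>R m z)))"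
      unfolding k'_def[symmetric] by (rule T(2)) measurable
    ultimately show ?thesis by blast
  qed
  have db: "norm (d k z) \<le> K * max 1 D * norm k" for k z
  proof -
    note mp = mass_pos[of z \<tau>]
    have "norm (\<integral>y. (f (z + \<tau> *\<^sub>R y) * (y \<bullet> ((1/\<tau>) *\<^sub>R k) - m z \<bullet> ((1/\<tau>) *\<^sub>R k))) *\<^sub>R (g (z + \<tau> *\<^sub>R y) - g (z + \<tau> *\<^sub>R m z)) \<partial>gaussian 1)
       \<le> (\<integral>y. (K * norm k) * (f (z + \<tau> *\<^sub>R y) * (norm (y - m z))\<^sup>2) \<partial>gaussian 1)"
    proof (rule norm_integral_le)
      show "integrable (gaussian 1) (\<lambda>y. (K * norm k) * (f (z + \<tau> *\<^sub>R y) * (norm (y - m z))\<^sup>2))"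
        by (intro integrable_mult_right f_norm_sq_int)
      fix y
      have a: "\<bar>y \<bullet> ((1/\<tau>) *\<^sub>R k) - m z \<bullet> ((1/\<tau>) *\<^sub>R k)\<bar> \<le> norm (y - m z) * (norm k / \<tau>)"
        unfolding inner_diff_left[symmetric] using Cauchy_Schwarz_ineq2[of "y - m z" "(1/\<tau>) *\<^sub>R k"] t0 by simp
      have b: "norm (g (z + \<tau> *\<^sub>R y) - g (z + \<tau> *\<^sub>R m z)) \<le> K * (\<tau> * norm (y - m z))"
        using g_lip[of "z + \<tau> *\<^sub>R y" "z + \<tau> *\<^sub>R m z"] t0 by (simp flip: scaleR_diff_right)
      have "norm ((f (z + \<tau> *\<^sub>R y) * (y \<bullet> ((1/\<tau>) *\<^sub>R k) - m z \<bullet> ((1/\<tau>) *\<^sub>R k))) *\<^sub>R (g (z + \<tau> *\<^sub>R y) - g (z + \<tau> *\<^sub>R m z)))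
        \<le> f (z + \<tau> *\<^sub>R y) * (norm (y - m z) * (norm k / \<tau>)) * (K * (\<tau> * norm (y - m z)))"
        unfolding norm_scaleR abs_mult using f_pos[of "z + \<tau> *\<^sub>R y"] a b t0
        by (intro mult_mono) auto
      also have "\<dots> = (K * norm k) * (f (z + \<tau> *\<^sub>R y) * (norm (y - m z))\<^sup>2)"
        using t0 by (simp add: power2_eq_square)
      finally show "norm ((f (z + \<tau> *\<^sub>R y) * (y \<bullet> ((1/\<tau>) *\<^sub>R k) - m z \<bullet> ((1/\<tau>) *\<^sub>R k))) *\<^sub>R (g (z + \<tau> *\<^sub>R y) - g (z + \<tau> *\<^sub>R m z)))
        \<le> (K * norm k) * (f (z + \<tau> *\<^sub>R y) * (norm (y - m z))\<^sup>2)" .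
    qed (use * in blast)
    also have "\<dots> = (K * norm k) * (\<integral>y. f (z + \<tau> *\<^sub>R y) * (norm (y - m z))\<^sup>2 \<partial>gaussian 1)"
      by (rule integral_mult_right_zero)
    also have "\<dots> \<le> (K * norm k) * (max 1 D * mass z \<tau>)"
    proof (rule mult_left_mono)
      have "(\<integral>y. f (z + \<tau> *\<^sub>R y) * (norm (y - m z))\<^sup>2 \<partial>gaussian 1) \<le> D * mass z \<tau>"
        by (rule var[OF t0 \<tau>(2)]) (use mp in \<open>simp add: m_def\<close>)
      also have "\<dots> \<le> max 1 D * mass z \<tau>" using mp by (intro mult_right_mono) auto
      finally show "(\<integral>y. f (z + \<tau> *\<^sub>R y) * (norm (y - m z))\<^sup>2 \<partial>gaussian 1) \<le> max 1 D * mass z \<tau>" .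
    qed (use K in simp)
    finally have "norm (d k z) \<le> inverse (mass z \<tau>) * ((K * norm k) * (max 1 D * mass z \<tau>))"
      unfolding d_def norm_scaleR using mp by (simp only: abs_inverse abs_of_pos) (intro mult_left_mono, auto)
    also have "\<dots> = K * max 1 D * norm k" using mp by simp
    finally show ?thesis .
  qed
  show ?thesis
    by (rule lipschitz_from_line_derivative[where F="\<lambda>z. drift z \<tau>", OF conjunct1[OF *] db])
qed

end

subsection \<open>The velocity field\<close>

text \<open>The set of disagreement is open, and a nonempty open set is not negligible.\<close>

lemma continuous_eq_if_AE_lborel:
  fixes F G :: "'a::euclidean_space \<Rightarrow> 'c::euclidean_space"
  assumes F: "continuous_on UNIV F" and G: "continuous_on UNIV G" and eq: "AE x in lborel. F x = G x"
  shows "F = G"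
proof (rule ccontr)
  assume "F \<noteq> G"
  then obtain x where x: "F x \<noteq> G x" by auto
  have o: "open {x. F x \<noteq> G x}" using F G by (rule open_Collect_neq)
  have "{x. F x \<noteq> G x} \<in> null_sets lborel"
  proof (rule AE_iff_null_sets[THEN iffD2])
    show "{x. F x \<noteq> G x} \<in> sets lborel" using o by (simp add: borel_open)
    show "AE x in lborel. x \<notin> {x. F x \<noteq> G x}" using eq by eventually_elim simp
  qed
  then have "negligible {x. F x \<noteq> G x}"
    by (simp add: negligible_iff_null_sets null_sets_completionI)
  then show False using open_not_negligible[OF o] x by auto
qed

lemma continuous_Icc_bound:
  fixes h :: "real \<Rightarrow> real"
  assumes "continuous_on {u..w} h"
  shows "\<exists>C. \<forall>t\<in>{u..w}. \<bar>h t\<bar> \<le> C"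
proof -
  have "bounded (h ` {u..w})" using assms by (intro compact_imp_bounded compact_continuous_image) auto
  then show ?thesis unfolding bounded_iff by simp
qed

text \<open>\<open>al'\<close> is the derivative of the square of \<open>a\<close>, which exists up
  to time 1. The variance bound is required for \<tau> up to \<sigma> because that is the range of
  \<open>tau\<close>.\<close>

locale stochastic_interpolant = prob_space M + tilted_gaussian f g K A B D \<sigma>
  for M :: "'w measure" and f :: "'a::euclidean_space \<Rightarrow> real" and g K A B D \<sigma> +
  fixes a b al' b' :: "real \<Rightarrow> real" and Z X1 :: "'w \<Rightarrow> 'a" and \<nu> :: "'a measure"
  assumes \<sigma>: "\<sigma> > 0" and coeffs: "interpolation_coeffs a b"
    and al': "\<And>t. t \<in> {0..1} \<Longrightarrow> ((\<lambda>t. (a t)\<^sup>2) has_real_derivative al' t) (at t within {0..1})"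
    and al'_cont: "continuous_on {0..1} al'"
    and b': "\<And>t. t \<in> {0..1} \<Longrightarrow> (b has_real_derivative b' t) (at t within {0..1})"
    and b'_cont: "continuous_on {0..1} b'"
    and lawZ: "distr M borel Z = gaussian 1" and lawX: "distr M borel X1 = \<nu>"
    and indep: "indep_var borel Z borel X1"
    and nu_prob: "prob_space \<nu>" and nu_moment: "integrable \<nu> (\<lambda>x. (norm x)\<^sup>2)"
    and nu_eq: "\<nu> = density (gaussian \<sigma>) (\<lambda>x. ennreal (f x))"
begin

lemma Z_meas[measurable]: "Z \<in> borel_measurable M" and X1_meas[measurable]: "X1 \<in> borel_measurable M"
  using indep indep_var_rv1 indep_var_rv2 by blast+

text \<open>The pair (Z, X1 / \<sigma>) is a standard Gaussian pair tilted through its second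
  component; the rotation preserves the Gaussian part and only rewrites the argument of f.\<close>

lemma joint_law:
  assumes cd: "c\<^sup>2 + d\<^sup>2 = 1" and c: "c > 0"
  shows "distr M (borel \<Otimes>\<^sub>M borel) (\<lambda>\<omega>. (Z \<omega>, X1 \<omega>))
    = distr (density (gaussian 1 \<Otimes>\<^sub>M gaussian 1) (\<lambda>(x, y). ennreal (f (\<sigma> *\<^sub>R (d *\<^sub>R x + c *\<^sub>R y)))))
        (borel \<Otimes>\<^sub>M borel) (\<lambda>(x, y). (c *\<^sub>R x - d *\<^sub>R y, \<sigma> *\<^sub>R (d *\<^sub>R x + c *\<^sub>R y)))"
    (is "_ = distr (density ?G ?p) _ ?R")
proof (rule measure_eqI)
  interpret g: prob_space "gaussian 1 :: 'a measure" by (rule prob_space_gaussian) simp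
  interpret n: prob_space \<nu> by (rule nu_prob)
  interpret gg: pair_prob_space "gaussian 1 :: 'a measure" "gaussian 1 :: 'a measure" ..
  interpret gn: pair_prob_space "gaussian 1 :: 'a measure" \<nu> ..
  have sets_eq[measurable_cong]: "sets ?G = sets (borel \<Otimes>\<^sub>M borel)" by (intro sets_pair_measure_cong) simp_all
  have sets_nu[measurable_cong]: "sets \<nu> = sets borel" by (simp add: nu_eq)
  fix E assume "E \<in> sets (distr M (borel \<Otimes>\<^sub>M borel) (\<lambda>\<omega>. (Z \<omega>, X1 \<omega>)))"
  then have E[measurable]: "E \<in> sets (borel \<Otimes>\<^sub>M borel)" by simp
  have [measurable]: "E \<in> sets (gaussian 1 \<Otimes>\<^sub>M \<nu>)" using E by (simp add: sets_pair_measure_cong[OF sets_gaussian sets_nu])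
  let ?i = "\<lambda>p. indicator E p :: ennreal"
  let ?q = "\<lambda>(x, y). ennreal (f (\<sigma> *\<^sub>R y)) * ?i (x, \<sigma> *\<^sub>R y)"
  have q[measurable]: "?q \<in> borel_measurable (borel \<Otimes>\<^sub>M borel)" by measurable
  have "distr M (borel \<Otimes>\<^sub>M borel) (\<lambda>\<omega>. (Z \<omega>, X1 \<omega>)) = gaussian 1 \<Otimes>\<^sub>M \<nu>"
    using indep_var_distribution_eq[of borel Z borel X1] indep lawZ lawX by simp
  then have "emeasure (distr M (borel \<Otimes>\<^sub>M borel) (\<lambda>\<omega>. (Z \<omega>, X1 \<omega>))) E = emeasure (gaussian 1 \<Otimes>\<^sub>M \<nu>) E" by simp
  also have "\<dots> = (\<integral>\<^sup>+x. \<integral>\<^sup>+w. ?i (x, w) \<partial>\<nu> \<partial>gaussian 1)"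
    by (rule n.emeasure_pair_measure) measurable
  also have "\<dots> = (\<integral>\<^sup>+x. \<integral>\<^sup>+y. ?q (x, y) \<partial>gaussian 1 \<partial>gaussian 1)"
  proof (rule nn_integral_cong)
    fix x :: 'a
    have "(\<integral>\<^sup>+w. ?i (x, w) \<partial>\<nu>) = (\<integral>\<^sup>+w. ennreal (f w) * ?i (x, w) \<partial>gaussian \<sigma>)"
      unfolding nu_eq by (rule nn_integral_density) measurable
    also have "\<dots> = (\<integral>\<^sup>+y. ennreal (f (\<sigma> *\<^sub>R y)) * ?i (x, \<sigma> *\<^sub>R y) \<partial>gaussian 1)"
      unfolding gaussian_scale[OF \<sigma>] by (rule nn_integral_distr) measurable
    finally show "(\<integral>\<^sup>+w. ?i (x, w) \<partial>\<nu>) = (\<integral>\<^sup>+y. ?q (x, y) \<partial>gaussian 1)" by simp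
  qed
  also have "\<dots> = (\<integral>\<^sup>+p. ?q p \<partial>?G)"
    by (rule g.nn_integral_fst) measurable
  \<comment> \<open>The Gaussian pair is replaced by its own rotated image.\<close>
  also have "\<dots> = (\<integral>\<^sup>+p. ?q p \<partial>distr ?G (borel \<Otimes>\<^sub>M borel) (\<lambda>(x, y). (c *\<^sub>R x - d *\<^sub>R y, d *\<^sub>R x + c *\<^sub>R y)))"
    by (simp only: gaussian_rotation[OF cd c])
  also have "\<dots> = (\<integral>\<^sup>+p. ?q ((\<lambda>(x, y). (c *\<^sub>R x - d *\<^sub>R y, d *\<^sub>R x + c *\<^sub>R y)) p) \<partial>?G)"
    by (rule nn_integral_distr) measurable
  also have "\<dots> = (\<integral>\<^sup>+p. ?p p * ?i (?R p) \<partial>?G)"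
    by (intro nn_integral_cong) (auto simp: case_prod_beta)
  also have "\<dots> = (\<integral>\<^sup>+p. ?i (?R p) \<partial>density ?G ?p)"
    by (rule nn_integral_density[symmetric]) measurable
  also have "\<dots> = (\<integral>\<^sup>+p. ?i p \<partial>distr (density ?G ?p) (borel \<Otimes>\<^sub>M borel) ?R)"
    by (rule nn_integral_distr[symmetric]) measurable
  also have "\<dots> = emeasure (distr (density ?G ?p) (borel \<Otimes>\<^sub>M borel) ?R) E" by simp
  finally show "emeasure (distr M (borel \<Otimes>\<^sub>M borel) (\<lambda>\<omega>. (Z \<omega>, X1 \<omega>))) E = \<dots>" .
qed simp

lemma expectation_joint:
  fixes F :: "'a \<times> 'a \<Rightarrow> 'c::euclidean_space"
  assumes cd: "c\<^sup>2 + d\<^sup>2 = 1" and c: "c > 0" and F[measurable]: "F \<in> borel_measurable (borel \<Otimes>\<^sub>M borel)"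
    and int: "integrable M (\<lambda>\<omega>. F (Z \<omega>, X1 \<omega>))"
  shows "(\<integral>\<omega>. F (Z \<omega>, X1 \<omega>) \<partial>M)
    = (\<integral>x. \<integral>y. f (\<sigma> *\<^sub>R (d *\<^sub>R x + c *\<^sub>R y)) *\<^sub>R F (c *\<^sub>R x - d *\<^sub>R y, \<sigma> *\<^sub>R (d *\<^sub>R x + c *\<^sub>R y)) \<partial>gaussian 1 \<partial>gaussian 1)"
proof -
  interpret g: prob_space "gaussian 1 :: 'a measure" by (rule prob_space_gaussian) simp
  interpret gg: pair_prob_space "gaussian 1 :: 'a measure" "gaussian 1 :: 'a measure" ..
  let ?G = "gaussian 1 \<Otimes>\<^sub>M (gaussian 1 :: 'a measure)"
  let ?p = "\<lambda>(x, y). f (\<sigma> *\<^sub>R (d *\<^sub>R x + c *\<^sub>R y))"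
  let ?R = "\<lambda>(x, y). (c *\<^sub>R x - d *\<^sub>R y, \<sigma> *\<^sub>R (d *\<^sub>R x + c *\<^sub>R y))"
  have sets_eq[measurable_cong]: "sets ?G = sets (borel \<Otimes>\<^sub>M borel)" by (intro sets_pair_measure_cong) simp_all
  have pe: "(\<lambda>(x, y). ennreal (f (\<sigma> *\<^sub>R (d *\<^sub>R x + c *\<^sub>R y)))) = (\<lambda>p. ennreal (?p p))" by (auto simp: fun_eq_iff)
  note J = joint_law[OF cd c, unfolded pe]
  have pm[measurable]: "?p \<in> borel_measurable ?G" by measurable
  have Rm[measurable]: "?R \<in> density ?G (\<lambda>p. ennreal (?p p)) \<rightarrow>\<^sub>M borel \<Otimes>\<^sub>M borel" by measurable
  have pp: "AE p in ?G. 0 \<le> ?p p" using f_pos by (intro AE_I2) (auto intro: less_imp_le simp: case_prod_beta)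
  have ZX[measurable]: "(\<lambda>\<omega>. (Z \<omega>, X1 \<omega>)) \<in> M \<rightarrow>\<^sub>M borel \<Otimes>\<^sub>M borel" by measurable
  have "integrable (distr M (borel \<Otimes>\<^sub>M borel) (\<lambda>\<omega>. (Z \<omega>, X1 \<omega>))) F"
    using int by (subst integrable_distr_eq[OF ZX F])
  then have "integrable (density ?G (\<lambda>p. ennreal (?p p))) (\<lambda>p. F (?R p))"
    unfolding J by (subst (asm) integrable_distr_eq[OF Rm F])
  then have i2: "integrable ?G (\<lambda>p. ?p p *\<^sub>R F (?R p))"
    by (subst (asm) integrable_density) (use pp in measurable)
  have "(\<integral>\<omega>. F (Z \<omega>, X1 \<omega>) \<partial>M) = (\<integral>p. F p \<partial>distr M (borel \<Otimes>\<^sub>M borel) (\<lambda>\<omega>. (Z \<omega>, X1 \<omega>)))"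
    by (rule integral_distr[symmetric]) measurable
  also have "\<dots> = (\<integral>p. F (?R p) \<partial>density ?G (\<lambda>p. ennreal (?p p)))"
    unfolding J by (rule integral_distr) measurable
  also have "\<dots> = (\<integral>p. ?p p *\<^sub>R F (?R p) \<partial>?G)"
    by (rule integral_density) (use pp in measurable)
  also have "\<dots> = (\<integral>x. \<integral>y. ?p (x, y) *\<^sub>R F (?R (x, y)) \<partial>gaussian 1 \<partial>gaussian 1)"
    by (rule gg.integral_fst'[OF i2, symmetric])
  finally show ?thesis by simp
qed

lemma Z_moment: "integrable M (\<lambda>\<omega>. (norm (Z \<omega>))\<^sup>2)"
proof -
  have "integrable (gaussian 1) (\<lambda>x::'a. (norm x)\<^sup>2)"
  proof (rule integrable_gaussian_exp_bound[of _ 1 2])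
    fix x :: 'a
    have "(norm x)\<^sup>2 \<le> (exp (norm x))\<^sup>2" by (intro power_mono norm_le_exp) simp
    then show "norm ((norm x)\<^sup>2) \<le> 1 * exp (2 * norm x)" by (simp add: exp_double)
  qed measurable
  then show ?thesis unfolding lawZ[symmetric] by (subst (asm) integrable_distr_eq) measurable
qed

lemma X1_moment: "integrable M (\<lambda>\<omega>. (norm (X1 \<omega>))\<^sup>2)"
  using nu_moment unfolding lawX[symmetric] by (subst (asm) integrable_distr_eq) measurable

text \<open>Dominates every pathwise quantity below up to a constant: linear in the two norms, so
  finite second moments suffice, with 1 added for the constant terms.\<close>

definition S :: "'w \<Rightarrow> real" where "S \<omega> = 1 + norm (Z \<omega>) + norm (X1 \<omega>)"

lemma S_meas[measurable]: "S \<in> borel_measurable M"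
  unfolding S_def by measurable

lemma S_ge_1: "1 \<le> S \<omega>"
  by (simp add: S_def)

lemma S_moment: "integrable M (\<lambda>\<omega>. (S \<omega>)\<^sup>2)"
proof (rule Bochner_Integration.integrable_bound)
  show "integrable M (\<lambda>\<omega>. 3 * (1 + (norm (Z \<omega>))\<^sup>2 + (norm (X1 \<omega>))\<^sup>2))"
    using Z_moment X1_moment by simp
  have "(1 + x + y)\<^sup>2 \<le> 3 * (1 + x\<^sup>2 + y\<^sup>2)" for x y :: real
    using zero_le_power2[of "x - y"] zero_le_power2[of "x - 1"] zero_le_power2[of "y - 1"]
    by (simp add: power2_eq_square algebra_simps)
  then show "AE \<omega> in M. norm ((S \<omega>)\<^sup>2) \<le> norm (3 * (1 + (norm (Z \<omega>))\<^sup>2 + (norm (X1 \<omega>))\<^sup>2))"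
    unfolding S_def by (intro AE_I2) simp
qed measurable

lemma S_integrable: "integrable M S"
proof (rule Bochner_Integration.integrable_bound[OF S_moment])
  have "S \<omega> \<le> (S \<omega>)\<^sup>2" for \<omega>
    using mult_left_mono[OF S_ge_1[of \<omega>], of "S \<omega>"] S_ge_1[of \<omega>] by (simp add: power2_eq_square)
  then show "AE \<omega> in M. norm (S \<omega>) \<le> norm ((S \<omega>)\<^sup>2)"
    using order_trans[OF zero_le_one S_ge_1] by (intro AE_I2) simp
qed measurable

text \<open>If \<open>X1 / \<sigma>\<close> were standard Gaussian, the interpolant would be \<open>sqrt (s2 t)\<close> times a standard
  Gaussian, and \<open>X1\<close> would be \<open>cz t\<close> times the interpolant plus \<open>tau t\<close> times an independent one.\<close>

definition s2 :: "real \<Rightarrow> real" where "s2 t = (a t)\<^sup>2 + (b t)\<^sup>2 * \<sigma>\<^sup>2"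
definition cz :: "real \<Rightarrow> real" where "cz t = b t * \<sigma>\<^sup>2 / s2 t"
definition tau :: "real \<Rightarrow> real" where "tau t = a t * \<sigma> / sqrt (s2 t)"
text \<open>\<open>vp\<close> is the logarithmic derivative of \<open>sqrt (s2 t)\<close>;
  \<open>vq\<close> is what remains of the coefficient of the second Gaussian coordinate after
  multiplication by \<open>tau\<close>. Neither contains a division by \<open>a\<close>.\<close>

definition vp :: "real \<Rightarrow> real" where "vp t = (al' t / 2 + b' t * b t * \<sigma>\<^sup>2) / s2 t"
definition vq :: "real \<Rightarrow> real" where "vq t = (b' t * (a t)\<^sup>2 - al' t * b t / 2) * \<sigma>\<^sup>2 / s2 t"
definition v :: "real \<Rightarrow> 'a \<Rightarrow> 'a" where
  "v t x = vp t *\<^sub>R x + vq t *\<^sub>R drift (cz t *\<^sub>R x) (tau t)"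

lemma ab_pos: "t \<in> {0<..<1} \<Longrightarrow> a t > 0" "t \<in> {0<..<1} \<Longrightarrow> b t > 0"
  and ab_end: "a 0 > 0" "b 0 \<ge> 0" "a 1 = 0" "b 1 = 1"
  using coeffs by (auto simp: interpolation_coeffs_def)

lemma a_nonneg: "t \<in> {0..1} \<Longrightarrow> a t \<ge> 0"
  using ab_pos(1)[of t] ab_end by (cases "t = 0"; cases "t = 1") auto

lemma s2_pos: "t \<in> {0..1} \<Longrightarrow> s2 t > 0"
proof -
  assume t: "t \<in> {0..1}"
  consider "t = 0" | "t = 1" | "t \<in> {0<..<1}" using t by fastforce
  then show "s2 t > 0"
  proof cases
    case 1 then show ?thesis using ab_end(1) by (simp add: s2_def add_pos_nonneg)
  next
    case 2 then show ?thesis using ab_end \<sigma> by (simp add: s2_def)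
  next
    case 3 then show ?thesis using ab_pos[OF 3] by (simp add: s2_def add_pos_nonneg)
  qed
qed

lemma al_cont: "continuous_on {0..1} (\<lambda>t. (a t)\<^sup>2)"
  using al' by (meson DERIV_continuous continuous_on_eq_continuous_within)

text \<open>Continuity at 1 is inherited from the square, because \<open>a\<close> is
  nonnegative.\<close>

lemma a_cont: "continuous_on {0..1} a"
proof -
  have "continuous_on {0..1} (\<lambda>t. sqrt ((a t)\<^sup>2))" by (intro continuous_intros al_cont)
  then show ?thesis by (rule continuous_on_eq) (simp add: a_nonneg)
qed

lemma b_cont: "continuous_on {0..1} b"
  using b' by (meson DERIV_continuous continuous_on_eq_continuous_within)

lemma s2_cont: "continuous_on {0..1} s2"
  unfolding s2_def by (intro continuous_intros al_cont b_cont)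

lemma coeff_cont: "continuous_on {0..1} cz" "continuous_on {0..1} tau" "continuous_on {0..1} vp" "continuous_on {0..1} vq"
  unfolding cz_def tau_def vp_def vq_def
  using s2_pos by (fastforce intro!: continuous_intros a_cont b_cont s2_cont al'_cont b'_cont al_cont simp: less_le)+

lemma tau_bounds: assumes "t \<in> {0..1}" shows "0 \<le> tau t" "tau t \<le> \<sigma>"
proof -
  show "0 \<le> tau t" using a_nonneg[OF assms] s2_pos[OF assms] \<sigma> by (simp add: tau_def)
  have "a t = sqrt ((a t)\<^sup>2)" using a_nonneg[OF assms] by simp
  also have "\<dots> \<le> sqrt (s2 t)" unfolding s2_def by (intro real_sqrt_le_mono) simp
  finally have "a t * \<sigma> \<le> sqrt (s2 t) * \<sigma>" using \<sigma> by (intro mult_right_mono) auto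
  then show "tau t \<le> \<sigma>" using s2_pos[OF assms] by (simp add: tau_def divide_le_eq mult.commute)
qed

lemma v_cont: "continuous_on ({0..1} \<times> UNIV) (\<lambda>(t, x). v t x)"
proof -
  have c: "continuous_on ({0..1} \<times> UNIV) (\<lambda>p::real \<times> 'a. h (fst p))" if "continuous_on {0..1} h" for h :: "real \<Rightarrow> real"
    by (rule continuous_on_compose2[OF that]) (auto intro!: continuous_intros)
  have "continuous_on ({0..1} \<times> UNIV) (\<lambda>p::real \<times> 'a. (\<lambda>(z, \<tau>). drift z \<tau>) (cz (fst p) *\<^sub>R snd p, tau (fst p)))"
    by (rule continuous_on_compose2[OF drift_continuous]) (auto intro!: continuous_intros c coeff_cont)
  then have d: "continuous_on ({0..1} \<times> UNIV) (\<lambda>p::real \<times> 'a. drift (cz (fst p) *\<^sub>R snd p) (tau (fst p)))" by simp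
  show ?thesis
    unfolding v_def case_prod_beta
    by (intro continuous_on_add continuous_on_scaleR d c coeff_cont continuous_on_snd continuous_on_id)
qed

lemma v_lipschitz_field: "\<exists>L. lipschitz_field L v"
proof -
  let ?K = "K * max 1 D"
  have K0: "?K \<ge> 0" using K by simp
  have "continuous_on {0..1} (\<lambda>t. \<bar>vp t\<bar> + \<bar>vq t\<bar> * (?K * \<bar>cz t\<bar>))"
    by (intro continuous_intros coeff_cont)
  from continuous_Icc_bound[OF this]
  obtain L where L: "\<And>t. t \<in> {0..1} \<Longrightarrow> \<bar>\<bar>vp t\<bar> + \<bar>vq t\<bar> * (?K * \<bar>cz t\<bar>)\<bar> \<le> L"
    by blast
  have "norm (v t x - v t y) \<le> (\<bar>L\<bar> + 1) * norm (x - y)" if t: "t \<in> {0..1}" for t x y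
  proof -
    have eq: "v t x - v t y = vp t *\<^sub>R (x - y) + vq t *\<^sub>R (drift (cz t *\<^sub>R x) (tau t) - drift (cz t *\<^sub>R y) (tau t))"
      by (simp add: v_def algebra_simps)
    have "norm (drift (cz t *\<^sub>R x) (tau t) - drift (cz t *\<^sub>R y) (tau t)) \<le> ?K * norm (cz t *\<^sub>R x - cz t *\<^sub>R y)"
      by (rule drift_lipschitz[OF tau_bounds[OF t]])
    also have "\<dots> = ?K * \<bar>cz t\<bar> * norm (x - y)" by (simp flip: scaleR_diff_right)
    finally have d: "norm (drift (cz t *\<^sub>R x) (tau t) - drift (cz t *\<^sub>R y) (tau t)) \<le> ?K * \<bar>cz t\<bar> * norm (x - y)" .
    have "norm (v t x - v t y) \<le> \<bar>vp t\<bar> * norm (x - y) + \<bar>vq t\<bar> * norm (drift (cz t *\<^sub>R x) (tau t) - drift (cz t *\<^sub>R y) (tau t))"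
      unfolding eq by (rule order_trans[OF norm_triangle_ineq]) simp
    also have "\<dots> \<le> \<bar>vp t\<bar> * norm (x - y) + \<bar>vq t\<bar> * (?K * \<bar>cz t\<bar> * norm (x - y))"
      by (intro add_left_mono mult_left_mono d) simp
    also have "\<dots> = (\<bar>vp t\<bar> + \<bar>vq t\<bar> * (?K * \<bar>cz t\<bar>)) * norm (x - y)" by (simp only: distrib_right mult.assoc)
    also have "\<dots> \<le> (\<bar>L\<bar> + 1) * norm (x - y)" using L[OF t] by (intro mult_right_mono) auto
    finally show ?thesis .
  qed
  then have "lipschitz_field (\<bar>L\<bar> + 1) v" unfolding lipschitz_field_def using v_cont by (auto intro: add_nonneg_pos)
  then show ?thesis by blast
qed

lemma a_deriv: assumes t: "t \<in> {0<..<1}" shows "(a has_real_derivative al' t / (2 * a t)) (at t)"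
proof -
  have "C2_on a {0..<1}" using coeffs by (simp add: interpolation_coeffs_def)
  then obtain a1 where "\<forall>t\<in>{0..<1}. (a has_real_derivative a1 t) (at t within {0..<1})"
    unfolding C2_on_def by blast
  moreover have "t \<in> {0..<1}" using t by simp
  ultimately have "(a has_real_derivative a1 t) (at t within {0..<1})" by (rule bspec)
  moreover have "at t within {0..<1} = at t" by (rule at_within_interior) (use t in simp)
  ultimately have d: "(a has_real_derivative a1 t) (at t)" by simp
  then have "((\<lambda>t. (a t)\<^sup>2) has_real_derivative 2 * a t * a1 t) (at t)"
    by (auto intro!: derivative_eq_intros)
  moreover have "((\<lambda>t. (a t)\<^sup>2) has_real_derivative al' t) (at t)"
    using al'[of t] t at_within_Icc_at[of 0 t 1] by auto
  ultimately have "2 * a t * a1 t = al' t" by (rule DERIV_unique)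
  then have "a1 t = al' t / (2 * a t)" using ab_pos(1)[OF t] by (simp add: field_simps)
  then show ?thesis using d by simp
qed

lemma b_deriv: assumes t: "t \<in> {0<..<1}" shows "(b has_real_derivative b' t) (at t)"
  using b'[of t] t at_within_Icc_at[of 0 t 1] by auto

abbreviation I :: "real \<Rightarrow> 'w \<Rightarrow> 'a" where "I t \<equiv> interpolant a b Z X1 t"
text \<open>The time derivative of the interpolant at interior times, with the derivative of
  \<open>a\<close> expressed through that of its square. At time 1 the division by zero yields 0, a
  value that no identity below relies on.\<close>

definition dI :: "real \<Rightarrow> 'w \<Rightarrow> 'a" where "dI t \<omega> = (al' t / (2 * a t)) *\<^sub>R Z \<omega> + b' t *\<^sub>R X1 \<omega>"

lemma I_meas[measurable]: "I t \<in> borel_measurable M"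
  unfolding interpolant_def[abs_def] by measurable

lemma dI_meas[measurable]: "dI t \<in> borel_measurable M"
  unfolding dI_def[abs_def] by measurable

lemma lin_S_bound: "norm (x *\<^sub>R Z \<omega> + y *\<^sub>R X1 \<omega>) \<le> (\<bar>x\<bar> + \<bar>y\<bar>) * S \<omega>"
proof -
  have "norm (x *\<^sub>R Z \<omega> + y *\<^sub>R X1 \<omega>) \<le> \<bar>x\<bar> * norm (Z \<omega>) + \<bar>y\<bar> * norm (X1 \<omega>)"
    by (rule order_trans[OF norm_triangle_ineq]) simp
  also have "\<dots> \<le> \<bar>x\<bar> * S \<omega> + \<bar>y\<bar> * S \<omega>"
    by (intro add_mono mult_left_mono) (auto simp: S_def)
  finally show ?thesis by (simp add: distrib_right)
qed

lemma v_growth: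
  obtains C where "C \<ge> 0" "\<And>t \<omega>. t \<in> {0..1} \<Longrightarrow> norm (v t (I t \<omega>)) \<le> C * S \<omega>"
proof -
  obtain L where L: "lipschitz_field L v" using v_lipschitz_field by blast
  have "continuous_on {0..1} (\<lambda>t. norm (v t 0) + L * (\<bar>a t\<bar> + \<bar>b t\<bar>))"
    by (intro continuous_intros lipschitz_field_continuous_on_curve[OF L] a_cont b_cont) auto
  from continuous_Icc_bound[OF this]
  obtain C where C: "\<And>t. t \<in> {0..1} \<Longrightarrow> \<bar>norm (v t 0) + L * (\<bar>a t\<bar> + \<bar>b t\<bar>)\<bar> \<le> C"
    by blast
  show thesis
  proof
    show "\<bar>C\<bar> \<ge> 0" by simp
    fix t \<omega> assume t: "t \<in> {0..1::real}"
    have "norm (v t (I t \<omega>)) \<le> norm (v t 0) + norm (v t (I t \<omega>) - v t 0)" by (rule norm_triangle_sub)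
    also have "\<dots> \<le> norm (v t 0) * S \<omega> + L * ((\<bar>a t\<bar> + \<bar>b t\<bar>) * S \<omega>)"
    proof (rule add_mono)
      show "norm (v t 0) \<le> norm (v t 0) * S \<omega>" using mult_left_mono[OF S_ge_1[of \<omega>] norm_ge_zero[of "v t 0"]] by simp
      have "norm (v t (I t \<omega>) - v t 0) \<le> L * norm (I t \<omega>)" using lipschitz_fieldD(3)[OF L t, of "I t \<omega>" 0] by simp
      also have "\<dots> \<le> L * ((\<bar>a t\<bar> + \<bar>b t\<bar>) * S \<omega>)"
        using lipschitz_fieldD(1)[OF L] unfolding interpolant_def by (intro mult_left_mono lin_S_bound) simp
      finally show "norm (v t (I t \<omega>) - v t 0) \<le> L * ((\<bar>a t\<bar> + \<bar>b t\<bar>) * S \<omega>)" .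
    qed
    also have "\<dots> = (norm (v t 0) + L * (\<bar>a t\<bar> + \<bar>b t\<bar>)) * S \<omega>" by (simp only: distrib_right mult.assoc)
    also have "\<dots> \<le> \<bar>C\<bar> * S \<omega>" using C[OF t] S_ge_1[of \<omega>] by (intro mult_right_mono) auto
    finally show "norm (v t (I t \<omega>)) \<le> \<bar>C\<bar> * S \<omega>" .
  qed
qed

lemma v_meas: "t \<in> {0..1} \<Longrightarrow> v t \<in> borel_measurable borel"
proof -
  assume t: "t \<in> {0..1}"
  have "continuous_on UNIV (\<lambda>x. (\<lambda>(t, x). v t x) (t, x))"
    by (rule continuous_on_compose2[OF v_cont]) (use t in \<open>auto intro!: continuous_intros\<close>)
  then show ?thesis by (intro borel_measurable_continuous_onI) simp
qed

lemma int_dI: "integrable M (dI t)"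
  by (rule Bochner_Integration.integrable_bound[of _ "\<lambda>\<omega>. (\<bar>al' t / (2 * a t)\<bar> + \<bar>b' t\<bar>) * S \<omega>"])
    (use S_integrable in \<open>auto simp: dI_def[abs_def] intro!: AE_I2 order_trans[OF lin_S_bound] abs_ge_self\<close>)

lemma int_vI: assumes "t \<in> {0..1}" shows "integrable M (\<lambda>\<omega>. v t (I t \<omega>))"
proof -
  obtain C where C: "C \<ge> 0" "\<And>t \<omega>. t \<in> {0..1} \<Longrightarrow> norm (v t (I t \<omega>)) \<le> C * S \<omega>" using v_growth by blast
  note [measurable] = v_meas[OF assms]
  show ?thesis
    by (rule Bochner_Integration.integrable_bound[of _ "\<lambda>\<omega>. C * S \<omega>"])
      (use S_integrable C(2)[OF assms] in \<open>auto intro!: AE_I2 order_trans[OF C(2)[OF assms]] abs_ge_self\<close>)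
qed

section \<open>The velocity as a conditional expectation\<close>

text \<open>\<open>c\<close> and \<open>d\<close> are cosine and sine of the angle of the point (a
  t, b t * \<sigma>), and \<open>s\<close> is its radius. In the last identity the factor
  \<open>tau t\<close>, proportional to \<open>a t\<close>, removes the division by
  \<open>a t\<close>.\<close>

lemma
  assumes t: "t \<in> {0<..<1}"
  defines "s \<equiv> sqrt (s2 t)"
  defines "c \<equiv> a t / s" and "d \<equiv> b t * \<sigma> / s"
  shows rotation_coeffs: "s > 0" "c\<^sup>2 + d\<^sup>2 = 1" "c > 0" "a t * c + b t * (\<sigma> * d) = s" "a t * d = b t * (\<sigma> * c)"
      "\<sigma> * d = cz t * s" "\<sigma> * c = tau t"
      "al' t / (2 * a t) * c + b' t * (\<sigma> * d) = vp t * s"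
      "(b' t * (\<sigma> * c) - al' t / (2 * a t) * d) * tau t = vq t"
proof -
  have s2: "s2 t > 0" using s2_pos[of t] t by simp
  then show s: "s > 0" by (simp add: s_def)
  have ss: "s * s = s2 t" using s2 by (simp add: s_def)
  have at: "a t > 0" using ab_pos(1)[OF t] .
  show "c\<^sup>2 + d\<^sup>2 = 1"
    using s ss by (simp add: c_def d_def s2_def power_divide power_mult_distrib add_divide_distrib[symmetric])
      (simp add: power2_eq_square)
  show "c > 0" using s at by (simp add: c_def)
  show "a t * c + b t * (\<sigma> * d) = s"
  proof -
    have "a t * c + b t * (\<sigma> * d) = s2 t / s" by (simp add: c_def d_def s2_def power2_eq_square add_divide_distrib mult_ac)
    then show ?thesis using s by (simp add: ss[symmetric])
  qed
  show "a t * d = b t * (\<sigma> * c)" by (simp add: c_def d_def)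
  show "\<sigma> * d = cz t * s"
    using s s2 by (simp add: d_def cz_def ss[symmetric] power2_eq_square)
  show tau: "\<sigma> * c = tau t" by (simp add: c_def tau_def s_def mult.commute)
  show "al' t / (2 * a t) * c + b' t * (\<sigma> * d) = vp t * s"
    using s at by (simp add: c_def d_def vp_def ss[symmetric] power2_eq_square field_simps)
  have "(b' t * (\<sigma> * c) - al' t / (2 * a t) * d) * (\<sigma> * c) = vq t"
    using s at by (simp add: c_def d_def vq_def ss[symmetric] power2_eq_square field_simps)
  then show "(b' t * (\<sigma> * c) - al' t / (2 * a t) * d) * tau t = vq t" by (simp only: tau)
qed

text \<open>In rotated coordinates the interpolant is s x, and its derivative is a combination of x
  and y. The test function depends on x alone, so integrating out y leaves the mass times the
  velocity formula.\<close>

lemma velocity_identity: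
  fixes \<xi> :: "'a \<Rightarrow> real"
  assumes t: "t \<in> {0<..<1}" and \<xi>[measurable]: "\<xi> \<in> borel_measurable borel" and b: "\<And>x. \<bar>\<xi> x\<bar> \<le> C"
  shows "(\<integral>\<omega>. \<xi> (I t \<omega>) *\<^sub>R dI t \<omega> \<partial>M) = (\<integral>\<omega>. \<xi> (I t \<omega>) *\<^sub>R v t (I t \<omega>) \<partial>M)"
proof -
  define s where "s = sqrt (s2 t)"
  define c where "c = a t / s"
  define d where "d = b t * \<sigma> / s"
  define e where "e = al' t / (2 * a t)"
  note rc = rotation_coeffs[OF t, folded s_def, folded c_def d_def, folded e_def]
  have t1: "t \<in> {0..1}" using t by auto
  note [measurable] = v_meas[OF t1]
  have bi: "integrable M (\<lambda>\<omega>. \<xi> (I t \<omega>) *\<^sub>R Y \<omega>)" if Y: "integrable M Y" for Y :: "'w \<Rightarrow> 'a"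
  proof (rule Bochner_Integration.integrable_bound)
    show "integrable M (\<lambda>\<omega>. C * norm (Y \<omega>))" using Y by simp
    show "AE \<omega> in M. norm (\<xi> (I t \<omega>) *\<^sub>R Y \<omega>) \<le> norm (C * norm (Y \<omega>))"
    proof (rule AE_I2)
      fix \<omega>
      have "\<bar>\<xi> (I t \<omega>)\<bar> * norm (Y \<omega>) \<le> \<bar>C\<bar> * norm (Y \<omega>)"
        using b[of "I t \<omega>"] by (intro mult_right_mono) auto
      then show "norm (\<xi> (I t \<omega>) *\<^sub>R Y \<omega>) \<le> norm (C * norm (Y \<omega>))" by (simp add: abs_mult)
    qed
    show "(\<lambda>\<omega>. \<xi> (I t \<omega>) *\<^sub>R Y \<omega>) \<in> borel_measurable M"
      using borel_measurable_integrable[OF Y] by measurable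
  qed
  have Ix: "a t *\<^sub>R (c *\<^sub>R x - d *\<^sub>R y) + b t *\<^sub>R (\<sigma> *\<^sub>R (d *\<^sub>R x + c *\<^sub>R y)) = s *\<^sub>R x" for x y :: 'a
  proof -
    have "a t *\<^sub>R (c *\<^sub>R x - d *\<^sub>R y) + b t *\<^sub>R (\<sigma> *\<^sub>R (d *\<^sub>R x + c *\<^sub>R y))
      = (a t * c + b t * (\<sigma> * d)) *\<^sub>R x + (b t * (\<sigma> * c) - a t * d) *\<^sub>R y" by (simp add: algebra_simps)
    then show ?thesis unfolding rc(4) rc(5) by simp
  qed
  have dIx: "e *\<^sub>R (c *\<^sub>R x - d *\<^sub>R y) + b' t *\<^sub>R (\<sigma> *\<^sub>R (d *\<^sub>R x + c *\<^sub>R y))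
      = (vp t * s) *\<^sub>R x + (b' t * (\<sigma> * c) - e * d) *\<^sub>R y" for x y :: 'a
    unfolding rc(8)[symmetric] by (simp add: algebra_simps)
  have fx: "\<sigma> *\<^sub>R (d *\<^sub>R x + c *\<^sub>R y) = cz t *\<^sub>R s *\<^sub>R x + tau t *\<^sub>R y" for x y :: 'a
    unfolding rc(7)[symmetric] scaleR_scaleR rc(6)[symmetric] by (simp add: algebra_simps)
  let ?m = "\<lambda>x. mass (cz t *\<^sub>R s *\<^sub>R x) (tau t)"
  define F1 where "F1 = (\<lambda>(z, x). \<xi> (a t *\<^sub>R z + b t *\<^sub>R x) *\<^sub>R (e *\<^sub>R z + b' t *\<^sub>R x))"
  define F2 where "F2 = (\<lambda>(z, x). \<xi> (a t *\<^sub>R z + b t *\<^sub>R x) *\<^sub>R v t (a t *\<^sub>R z + b t *\<^sub>R x))"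
  have [measurable]: "F1 \<in> borel_measurable (borel \<Otimes>\<^sub>M borel)" "F2 \<in> borel_measurable (borel \<Otimes>\<^sub>M borel)"
    unfolding F1_def F2_def by measurable
  have F1: "F1 (Z \<omega>, X1 \<omega>) = \<xi> (I t \<omega>) *\<^sub>R dI t \<omega>" for \<omega> by (simp add: F1_def interpolant_def dI_def e_def)
  have F2: "F2 (Z \<omega>, X1 \<omega>) = \<xi> (I t \<omega>) *\<^sub>R v t (I t \<omega>)" for \<omega> by (simp add: F2_def interpolant_def)
  have "(\<integral>\<omega>. \<xi> (I t \<omega>) *\<^sub>R dI t \<omega> \<partial>M) = (\<integral>\<omega>. F1 (Z \<omega>, X1 \<omega>) \<partial>M)" by (simp only: F1)
  also have "\<dots> = (\<integral>x. \<integral>y. f (\<sigma> *\<^sub>R (d *\<^sub>R x + c *\<^sub>R y)) *\<^sub>R F1 (c *\<^sub>R x - d *\<^sub>R y, \<sigma> *\<^sub>R (d *\<^sub>R x + c *\<^sub>R y)) \<partial>gaussian 1 \<partial>gaussian 1)"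
    by (rule expectation_joint[OF rc(2,3)]) (use bi[OF int_dI] in \<open>auto simp: F1\<close>)
  \<comment> \<open>The y-integral for fixed x: the part along x yields the mass, the part along y
    is Stein's identity.\<close>
  also have "\<dots> = (\<integral>x. (?m x * \<xi> (s *\<^sub>R x)) *\<^sub>R v t (s *\<^sub>R x) \<partial>gaussian 1)"
  proof (rule Bochner_Integration.integral_cong[OF refl])
    fix x :: 'a
    define z where "z = cz t *\<^sub>R s *\<^sub>R x"
    let ?e2 = "b' t * (\<sigma> * c) - e * d"
    have "(\<integral>y. f (\<sigma> *\<^sub>R (d *\<^sub>R x + c *\<^sub>R y)) *\<^sub>R F1 (c *\<^sub>R x - d *\<^sub>R y, \<sigma> *\<^sub>R (d *\<^sub>R x + c *\<^sub>R y)) \<partial>gaussian 1)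
      = (\<integral>y. \<xi> (s *\<^sub>R x) *\<^sub>R (f (z + tau t *\<^sub>R y) *\<^sub>R ((vp t * s) *\<^sub>R x) + ?e2 *\<^sub>R (f (z + tau t *\<^sub>R y) *\<^sub>R y)) \<partial>gaussian 1)"
      unfolding F1_def prod.case Ix dIx unfolding fx z_def[symmetric]
      by (simp add: scaleR_add_right mult_ac)
    also have "\<dots> = \<xi> (s *\<^sub>R x) *\<^sub>R (\<integral>y. (f (z + tau t *\<^sub>R y) *\<^sub>R ((vp t * s) *\<^sub>R x) + ?e2 *\<^sub>R (f (z + tau t *\<^sub>R y) *\<^sub>R y)) \<partial>gaussian 1)"
      by (rule integral_scaleR_right)
    also have "(\<integral>y. (f (z + tau t *\<^sub>R y) *\<^sub>R ((vp t * s) *\<^sub>R x) + ?e2 *\<^sub>R (f (z + tau t *\<^sub>R y) *\<^sub>R y)) \<partial>gaussian 1)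
       = (\<integral>y. f (z + tau t *\<^sub>R y) *\<^sub>R ((vp t * s) *\<^sub>R x) \<partial>gaussian 1) + (\<integral>y. ?e2 *\<^sub>R (f (z + tau t *\<^sub>R y) *\<^sub>R y) \<partial>gaussian 1)"
      using f_int fy_int by (intro Bochner_Integration.integral_add integrable_scaleR_left integrable_scaleR_right)
    also have "(\<integral>y. f (z + tau t *\<^sub>R y) *\<^sub>R ((vp t * s) *\<^sub>R x) \<partial>gaussian 1) = mass z (tau t) *\<^sub>R ((vp t * s) *\<^sub>R x)"
      unfolding mass_def by (rule integral_scaleR_left) (rule f_int)
    also have "(\<integral>y. ?e2 *\<^sub>R (f (z + tau t *\<^sub>R y) *\<^sub>R y) \<partial>gaussian 1) = ?e2 *\<^sub>R ((tau t * mass z (tau t)) *\<^sub>R drift z (tau t))"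
      unfolding integration_by_parts[symmetric] by (rule integral_scaleR_right)
    also have "?e2 *\<^sub>R ((tau t * mass z (tau t)) *\<^sub>R drift z (tau t)) = mass z (tau t) *\<^sub>R ((?e2 * tau t) *\<^sub>R drift z (tau t))"
      by (simp add: mult_ac)
    finally show "(\<integral>y. f (\<sigma> *\<^sub>R (d *\<^sub>R x + c *\<^sub>R y)) *\<^sub>R F1 (c *\<^sub>R x - d *\<^sub>R y, \<sigma> *\<^sub>R (d *\<^sub>R x + c *\<^sub>R y)) \<partial>gaussian 1)
      = (?m x * \<xi> (s *\<^sub>R x)) *\<^sub>R v t (s *\<^sub>R x)"
      unfolding rc(9) v_def z_def by (simp add: scaleR_add_right mult_ac)
  qed
  \<comment> \<open>The mass is read back as a y-integral of f, since
    \<open>v t (s *\<^sub>R x)\<close> does not depend on y.\<close>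
  also have "\<dots> = (\<integral>x. \<integral>y. f (\<sigma> *\<^sub>R (d *\<^sub>R x + c *\<^sub>R y)) *\<^sub>R F2 (c *\<^sub>R x - d *\<^sub>R y, \<sigma> *\<^sub>R (d *\<^sub>R x + c *\<^sub>R y)) \<partial>gaussian 1 \<partial>gaussian 1)"
  proof (rule Bochner_Integration.integral_cong[OF refl])
    fix x :: 'a
    have "(\<integral>y. f (\<sigma> *\<^sub>R (d *\<^sub>R x + c *\<^sub>R y)) *\<^sub>R F2 (c *\<^sub>R x - d *\<^sub>R y, \<sigma> *\<^sub>R (d *\<^sub>R x + c *\<^sub>R y)) \<partial>gaussian 1)
      = (\<integral>y. f (cz t *\<^sub>R s *\<^sub>R x + tau t *\<^sub>R y) *\<^sub>R (\<xi> (s *\<^sub>R x) *\<^sub>R v t (s *\<^sub>R x)) \<partial>gaussian 1)"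
      unfolding F2_def prod.case Ix unfolding fx ..
    also have "\<dots> = ?m x *\<^sub>R (\<xi> (s *\<^sub>R x) *\<^sub>R v t (s *\<^sub>R x))"
      unfolding mass_def by (rule integral_scaleR_left) (rule f_int)
    finally show "(?m x * \<xi> (s *\<^sub>R x)) *\<^sub>R v t (s *\<^sub>R x) = (\<integral>y. f (\<sigma> *\<^sub>R (d *\<^sub>R x + c *\<^sub>R y)) *\<^sub>R F2 (c *\<^sub>R x - d *\<^sub>R y, \<sigma> *\<^sub>R (d *\<^sub>R x + c *\<^sub>R y)) \<partial>gaussian 1)"
      by simp
  qed
  also have "\<dots> = (\<integral>\<omega>. F2 (Z \<omega>, X1 \<omega>) \<partial>M)"
    by (rule expectation_joint[OF rc(2,3), symmetric]) (use bi[OF int_vI[OF t1]] in \<open>auto simp: F2\<close>)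
  also have "\<dots> = (\<integral>\<omega>. \<xi> (I t \<omega>) *\<^sub>R v t (I t \<omega>) \<partial>M)" by (simp only: F2)
  finally show ?thesis .
qed

text \<open>The form required by the transport locale, obtained coordinate by coordinate from scalar
  test functions.\<close>

lemma velocity_identity_inner:
  assumes t: "t \<in> {0<..<1}" and G[measurable]: "G \<in> borel_measurable borel" and b: "\<And>x. norm (G x) \<le> C"
  shows "(\<integral>\<omega>. G (I t \<omega>) \<bullet> (dI t \<omega> - v t (I t \<omega>)) \<partial>M) = 0"
proof -
  have t1: "t \<in> {0..1}" using t by auto
  note [measurable] = v_meas[OF t1]
  have bi: "integrable M (\<lambda>\<omega>. (G (I t \<omega>) \<bullet> i) *\<^sub>R Y \<omega>)" if Y: "integrable M Y" and i: "i \<in> Basis" for Y :: "'w \<Rightarrow> 'a" and i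
  proof (rule Bochner_Integration.integrable_bound)
    show "integrable M (\<lambda>\<omega>. C * norm (Y \<omega>))" using Y by simp
    show "AE \<omega> in M. norm ((G (I t \<omega>) \<bullet> i) *\<^sub>R Y \<omega>) \<le> norm (C * norm (Y \<omega>))"
    proof (rule AE_I2)
      fix \<omega>
      have "\<bar>G (I t \<omega>) \<bullet> i\<bar> * norm (Y \<omega>) \<le> \<bar>C\<bar> * norm (Y \<omega>)"
        using b[of "I t \<omega>"] Basis_le_norm[OF i, of "G (I t \<omega>)"] by (intro mult_right_mono) auto
      then show "norm ((G (I t \<omega>) \<bullet> i) *\<^sub>R Y \<omega>) \<le> norm (C * norm (Y \<omega>))" by (simp add: abs_mult)
    qed
    show "(\<lambda>\<omega>. (G (I t \<omega>) \<bullet> i) *\<^sub>R Y \<omega>) \<in> borel_measurable M"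
      using borel_measurable_integrable[OF Y] by measurable
  qed
  have comp: "(\<integral>\<omega>. (G (I t \<omega>) \<bullet> i) * ((dI t \<omega> - v t (I t \<omega>)) \<bullet> i) \<partial>M) = 0
    \<and> integrable M (\<lambda>\<omega>. (G (I t \<omega>) \<bullet> i) * ((dI t \<omega> - v t (I t \<omega>)) \<bullet> i))" if i: "i \<in> Basis" for i
  proof -
    let ?D = "\<lambda>\<omega>. (G (I t \<omega>) \<bullet> i) *\<^sub>R dI t \<omega> - (G (I t \<omega>) \<bullet> i) *\<^sub>R v t (I t \<omega>)"
    have i1: "integrable M ?D" using bi[OF int_dI i] bi[OF int_vI[OF t1] i] by (rule Bochner_Integration.integrable_diff)
    have "(\<integral>\<omega>. (G (I t \<omega>) \<bullet> i) *\<^sub>R dI t \<omega> \<partial>M) = (\<integral>\<omega>. (G (I t \<omega>) \<bullet> i) *\<^sub>R v t (I t \<omega>) \<partial>M)"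
    proof (rule velocity_identity[OF t, of "\<lambda>x. G x \<bullet> i"])
      show "\<bar>G x \<bullet> i\<bar> \<le> C" for x using b[of x] Basis_le_norm[OF i, of "G x"] by linarith
    qed measurable
    then have "(\<integral>\<omega>. ?D \<omega> \<partial>M) = 0"
      using bi[OF int_dI i] bi[OF int_vI[OF t1] i] by simp
    then have "(\<integral>\<omega>. ?D \<omega> \<bullet> i \<partial>M) = 0"
      using integral_inner_left[of i M ?D] i1 by simp
    moreover have "integrable M (\<lambda>\<omega>. ?D \<omega> \<bullet> i)" using i1 by (rule integrable_inner_left)
    moreover have "?D \<omega> \<bullet> i = (G (I t \<omega>) \<bullet> i) * ((dI t \<omega> - v t (I t \<omega>)) \<bullet> i)" for \<omega>
      by (simp add: inner_diff_left right_diff_distrib)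
    ultimately show ?thesis by simp
  qed
  have "G (I t \<omega>) \<bullet> (dI t \<omega> - v t (I t \<omega>)) = (\<Sum>i\<in>Basis. (G (I t \<omega>) \<bullet> i) * ((dI t \<omega> - v t (I t \<omega>)) \<bullet> i))" for \<omega>
    by (rule euclidean_inner)
  then show ?thesis using comp by simp
qed

text \<open>After the rotation the interpolant is s times a Gaussian with positive weight f, so an
  almost sure identity holds Lebesgue-almost everywhere, and by continuity everywhere. This pins
  down the continuous version.\<close>

lemma full_support:
  fixes F G :: "'a \<Rightarrow> 'c::euclidean_space"
  assumes t: "t \<in> {0<..<1}" and F: "continuous_on UNIV F" and G: "continuous_on UNIV G"
    and eq: "AE \<omega> in M. F (I t \<omega>) = G (I t \<omega>)"
  shows "F = G"
proof -
  define s where "s = sqrt (s2 t)"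
  define c where "c = a t / s"
  define d where "d = b t * \<sigma> / s"
  note rc = rotation_coeffs[OF t, folded s_def, folded c_def d_def]
  interpret g: prob_space "gaussian 1 :: 'a measure" by (rule prob_space_gaussian) simp
  interpret gg: pair_prob_space "gaussian 1 :: 'a measure" "gaussian 1 :: 'a measure" ..
  let ?G = "gaussian 1 \<Otimes>\<^sub>M (gaussian 1 :: 'a measure)"
  have sets_eq[measurable_cong]: "sets ?G = sets (borel \<Otimes>\<^sub>M borel)" by (intro sets_pair_measure_cong) simp_all
  have [measurable]: "F \<in> borel_measurable borel" "G \<in> borel_measurable borel"
    using F G by (auto intro: borel_measurable_continuous_onI)
  define P where "P = (\<lambda>(z, x). F (a t *\<^sub>R z + b t *\<^sub>R x) = G (a t *\<^sub>R z + b t *\<^sub>R x))"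
  have [measurable]: "Measurable.pred (borel \<Otimes>\<^sub>M borel) P" unfolding P_def by measurable
  have ZX[measurable]: "(\<lambda>\<omega>. (Z \<omega>, X1 \<omega>)) \<in> M \<rightarrow>\<^sub>M borel \<Otimes>\<^sub>M borel" by measurable
  let ?R = "\<lambda>(x, y). (c *\<^sub>R x - d *\<^sub>R y, \<sigma> *\<^sub>R (d *\<^sub>R x + c *\<^sub>R y))"
  let ?p = "\<lambda>(x, y). ennreal (f (\<sigma> *\<^sub>R (d *\<^sub>R x + c *\<^sub>R y)))"
  have "AE \<omega> in M. P (Z \<omega>, X1 \<omega>)" using eq by (simp add: P_def interpolant_def)
  then have "AE p in distr M (borel \<Otimes>\<^sub>M borel) (\<lambda>\<omega>. (Z \<omega>, X1 \<omega>)). P p"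
    by (subst AE_distr_iff[OF ZX]) simp_all
  then have "AE p in density ?G ?p. P (?R p)"
    unfolding joint_law[OF rc(2,3)] by (subst (asm) AE_distr_iff) measurable
  then have "AE p in ?G. 0 < ?p p \<longrightarrow> P (?R p)"
    by (subst (asm) AE_density) measurable
  then have ae: "AE p in ?G. F (s *\<^sub>R fst p) = G (s *\<^sub>R fst p)"
  proof eventually_elim
    case (elim p)
    have Ix: "a t *\<^sub>R (c *\<^sub>R x - d *\<^sub>R y) + b t *\<^sub>R (\<sigma> *\<^sub>R (d *\<^sub>R x + c *\<^sub>R y)) = s *\<^sub>R x" for x y :: 'a
    proof -
      have "a t *\<^sub>R (c *\<^sub>R x - d *\<^sub>R y) + b t *\<^sub>R (\<sigma> *\<^sub>R (d *\<^sub>R x + c *\<^sub>R y))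
        = (a t * c + b t * (\<sigma> * d)) *\<^sub>R x + (b t * (\<sigma> * c) - a t * d) *\<^sub>R y" by (simp add: algebra_simps)
      then show ?thesis unfolding rc(4) rc(5) by simp
    qed
    show ?case using elim f_pos by (cases p) (simp add: P_def Ix del: scaleR_scaleR)
  qed
  have "AE x in gaussian 1. AE y in (gaussian 1 :: 'a measure). F (s *\<^sub>R x) = G (s *\<^sub>R x)"
    using gg.AE_pair[OF ae] by simp
  then have "AE x in gaussian 1. F (s *\<^sub>R x) = G (s *\<^sub>R x)" by simp
  then have "AE x in lborel. 0 < ennreal (gdens 1 x) \<longrightarrow> F (s *\<^sub>R x) = G (s *\<^sub>R x)"
    unfolding gaussian_eq by (subst (asm) AE_density) measurable
  then have "AE x in lborel. F (s *\<^sub>R x) = G (s *\<^sub>R x)" by eventually_elim (simp add: gdens_pos)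
  then have e: "(\<lambda>x. F (s *\<^sub>R x)) = (\<lambda>x. G (s *\<^sub>R x))"
    by (intro continuous_eq_if_AE_lborel continuous_on_compose2[OF F] continuous_on_compose2[OF G] continuous_intros) auto
  have "F x = G x" for x using fun_cong[OF e, of "(1/s) *\<^sub>R x"] rc(1) by simp
  then show ?thesis by auto
qed

text \<open>The events generated by the interpolant are preimages of Borel sets; their indicators
  are test functions for \<open>velocity_identity\<close>.\<close>

lemma cond_exp_version_v:
  assumes t: "t \<in> {0<..<1}"
  shows "cond_exp_version M (dI t) (I t) (v t)"
  unfolding cond_exp_version_def
proof (intro conjI ballI)
  have t1: "t \<in> {0..1}" using t by auto
  show vm[measurable]: "v t \<in> borel_measurable borel" by (rule v_meas[OF t1])
  fix i :: 'a assume i: "i \<in> Basis"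
  let ?F = "vimage_algebra (space M) (I t) borel"
  have "subalgebra M ?F"
    unfolding subalgebra_def by (auto simp: sets_vimage_algebra2 intro: measurable_sets[OF I_meas])
  then interpret fs: finite_measure_subalgebra M ?F
    by unfold_locales
  have If: "I t \<in> ?F \<rightarrow>\<^sub>M borel" by (rule measurable_vimage_algebra1) auto
  have "AE \<omega> in M. real_cond_exp M ?F (\<lambda>\<omega>. dI t \<omega> \<bullet> i) \<omega> = v t (I t \<omega>) \<bullet> i"
  proof (rule fs.real_cond_exp_charact)
    show "integrable M (\<lambda>\<omega>. dI t \<omega> \<bullet> i)" using int_dI by (rule integrable_inner_left)
    show "integrable M (\<lambda>\<omega>. v t (I t \<omega>) \<bullet> i)" using int_vI[OF t1] by (rule integrable_inner_left)
    show "(\<lambda>\<omega>. v t (I t \<omega>) \<bullet> i) \<in> borel_measurable ?F"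
      using measurable_compose[OF If vm] by measurable
    fix E assume "E \<in> sets ?F"
    then obtain U where U[measurable]: "U \<in> sets borel" and E: "E = I t -` U \<inter> space M"
      by (auto simp: sets_vimage_algebra2)
    have ind: "indicator E \<omega> = (indicator U (I t \<omega>) :: real)" if "\<omega> \<in> space M" for \<omega>
      using that by (auto simp: E split: split_indicator)
    let ?\<xi> = "indicator U :: 'a \<Rightarrow> real"
    have id: "(\<integral>\<omega>. ?\<xi> (I t \<omega>) *\<^sub>R dI t \<omega> \<partial>M) = (\<integral>\<omega>. ?\<xi> (I t \<omega>) *\<^sub>R v t (I t \<omega>) \<partial>M)"
      by (rule velocity_identity[OF t, of _ 1]) (auto split: split_indicator)
    have ii: "integrable M (\<lambda>\<omega>. ?\<xi> (I t \<omega>) *\<^sub>R Y \<omega>)" if Y: "integrable M Y" for Y :: "'w \<Rightarrow> 'a"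
      by (rule Bochner_Integration.integrable_bound[OF Y])
        (use borel_measurable_integrable[OF Y] in \<open>auto split: split_indicator\<close>)
    have "(\<integral>\<omega>\<in>E. (Y \<omega> \<bullet> i) \<partial>M) = (\<integral>\<omega>. ?\<xi> (I t \<omega>) *\<^sub>R Y \<omega> \<partial>M) \<bullet> i" if Y: "integrable M Y" for Y :: "'w \<Rightarrow> 'a"
    proof -
      have "(\<integral>\<omega>\<in>E. (Y \<omega> \<bullet> i) \<partial>M) = (\<integral>\<omega>. (?\<xi> (I t \<omega>) *\<^sub>R Y \<omega>) \<bullet> i \<partial>M)"
        unfolding set_lebesgue_integral_def by (intro Bochner_Integration.integral_cong refl) (simp add: ind)
      also have "\<dots> = (\<integral>\<omega>. ?\<xi> (I t \<omega>) *\<^sub>R Y \<omega> \<partial>M) \<bullet> i"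
        by (rule integral_inner_left) (rule ii[OF Y])
      finally show ?thesis .
    qed
    then show "(\<integral>\<omega>\<in>E. (dI t \<omega> \<bullet> i) \<partial>M) = (\<integral>\<omega>\<in>E. (v t (I t \<omega>) \<bullet> i) \<partial>M)"
      using int_dI int_vI[OF t1] id by simp
  qed
  then show "AE \<omega> in M. v t (I t \<omega>) \<bullet> i = real_cond_exp M ?F (\<lambda>\<omega>. dI t \<omega> \<bullet> i) \<omega>"
    by eventually_elim simp
qed

lemma v_cont_x: assumes "t \<in> {0..1}" shows "continuous_on UNIV (v t)"
proof -
  have "continuous_on UNIV (\<lambda>x. (\<lambda>(t, x). v t x) (t, x))"
    by (rule continuous_on_compose2[OF v_cont]) (use assms in \<open>auto intro!: continuous_intros\<close>)
  then show ?thesis by simp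
qed

text \<open>Two continuous versions agree almost surely along the interpolant, hence everywhere, so
  the definite description denotes \<open>v t\<close>.\<close>

lemma velocity_interior_eq:
  assumes t: "t \<in> {0<..<1}" shows "velocity_interior M a b Z X1 t = v t"
proof -
  have t1: "t \<in> {0..1}" using t by auto
  have "(\<lambda>\<omega>. deriv a t *\<^sub>R Z \<omega> + deriv b t *\<^sub>R X1 \<omega>) = dI t"
    using DERIV_imp_deriv[OF a_deriv[OF t]] DERIV_imp_deriv[OF b_deriv[OF t]] by (simp add: dI_def[abs_def])
  then have "velocity_interior M a b Z X1 t = (THE h. continuous_on UNIV h \<and> cond_exp_version M (dI t) (I t) h)"
    by (simp add: velocity_interior_def cond_exp_at_def)
  also have "\<dots> = v t"
  proof (rule the_equality)
    show "continuous_on UNIV (v t) \<and> cond_exp_version M (dI t) (I t) (v t)"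
      using v_cont_x[OF t1] cond_exp_version_v[OF t] by blast
    fix h assume h: "continuous_on UNIV h \<and> cond_exp_version M (dI t) (I t) h"
    show "h = v t"
    proof (rule full_support[OF t])
      have "AE \<omega> in M. \<forall>i\<in>Basis. h (I t \<omega>) \<bullet> i = v t (I t \<omega>) \<bullet> i"
      proof (rule AE_finite_allI)
        fix i :: 'a assume i: "i \<in> Basis"
        have 1: "AE \<omega> in M. h (I t \<omega>) \<bullet> i = real_cond_exp M (vimage_algebra (space M) (I t) borel) (\<lambda>\<omega>. dI t \<omega> \<bullet> i) \<omega>"
          using h i unfolding cond_exp_version_def by blast
        have 2: "AE \<omega> in M. v t (I t \<omega>) \<bullet> i = real_cond_exp M (vimage_algebra (space M) (I t) borel) (\<lambda>\<omega>. dI t \<omega> \<bullet> i) \<omega>"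
          using cond_exp_version_v[OF t] i unfolding cond_exp_version_def by blast
        from 1 2 show "AE \<omega> in M. h (I t \<omega>) \<bullet> i = v t (I t \<omega>) \<bullet> i" by eventually_elim simp
      qed simp
      then show "AE \<omega> in M. h (I t \<omega>) = v t (I t \<omega>)"
        by eventually_elim (auto intro: euclidean_eqI)
    qed (use h v_cont_x[OF t1] in auto)
  qed
  finally show ?thesis .
qed

text \<open>The one-sided limits at the endpoints exist because the explicit field is jointly
  continuous on the closed time interval.\<close>

lemma velocity_eq:
  assumes t: "t \<in> {0..1}" shows "velocity M a b Z X1 t x = v t x"
proof -
  have "continuous_on {0..1} (\<lambda>t. (\<lambda>(t, x). v t x) (t, x))"
    by (rule continuous_on_compose2[OF v_cont]) (auto intro!: continuous_intros)
  then have c: "continuous_on {0..1} (\<lambda>t. v t x)" by simp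
  consider "t = 0" | "t = 1" | "t \<in> {0<..<1}" using t by fastforce
  then show ?thesis
  proof cases
    case 1
    have "((\<lambda>s. v s x) \<longlongrightarrow> v 0 x) (at 0 within {0..1})" using c by (simp add: continuous_on_def)
    then have "((\<lambda>s. v s x) \<longlongrightarrow> v 0 x) (at_right 0)" by (simp add: at_within_Icc_at_right)
    moreover have "\<forall>\<^sub>F s in at_right 0. v s x = velocity_interior M a b Z X1 s x"
      using eventually_at_right_real[of 0 1] by (auto elim!: eventually_mono simp: velocity_interior_eq)
    ultimately have "((\<lambda>s. velocity_interior M a b Z X1 s x) \<longlongrightarrow> v 0 x) (at_right 0)"
      by (rule Lim_transform_eventually)
    then show ?thesis unfolding 1 velocity_def by (simp add: tendsto_Lim)
  next
    case 2
    have "((\<lambda>s. v s x) \<longlongrightarrow> v 1 x) (at 1 within {0..1})" using c by (simp add: continuous_on_def)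
    then have "((\<lambda>s. v s x) \<longlongrightarrow> v 1 x) (at_left 1)" by (simp add: at_within_Icc_at_left)
    moreover have "\<forall>\<^sub>F s in at_left 1. v s x = velocity_interior M a b Z X1 s x"
      using eventually_at_left_real[of 0 1] by (auto elim!: eventually_mono simp: velocity_interior_eq)
    ultimately have "((\<lambda>s. velocity_interior M a b Z X1 s x) \<longlongrightarrow> v 1 x) (at_left 1)"
      by (rule Lim_transform_eventually)
    then show ?thesis unfolding 2 velocity_def by (simp add: tendsto_Lim)
  next
    case 3
    then show ?thesis by (auto simp: velocity_def velocity_interior_eq)
  qed
qed

section \<open>The flow of the velocity and its reversal\<close>

lemma transport_interior:
  assumes L: "lipschitz_field L v" and s: "0 < s0" "s0 < s1" "s1 < 1"
  shows "\<exists>J' S K. transport M I J' v S L K s0 s1"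
proof -
  let ?e = "\<lambda>t. al' t / (2 * a t)"
  have sub: "{s0..s1} \<subseteq> {0<..<1}" "{s0..s1} \<subseteq> {0..1}" using s by auto
  have ec: "continuous_on {s0..s1} ?e"
  proof (intro continuous_intros)
    show "continuous_on {s0..s1} al'" "continuous_on {s0..s1} a"
      using al'_cont a_cont sub(2) by (auto intro: continuous_on_subset)
    show "\<forall>x\<in>{s0..s1}. 2 * a x \<noteq> 0" using ab_pos(1) sub(1) by force
  qed
  have bc: "continuous_on {s0..s1} b'" using b'_cont sub(2) by (rule continuous_on_subset)
  obtain C1 where C1: "\<And>t. t \<in> {s0..s1} \<Longrightarrow> \<bar>?e t\<bar> \<le> C1" using continuous_Icc_bound[OF ec] by blast
  obtain C2 where C2: "\<And>t. t \<in> {s0..s1} \<Longrightarrow> \<bar>b' t\<bar> \<le> C2" using continuous_Icc_bound[OF bc] by blast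
  obtain C3 where C3: "C3 \<ge> 0" "\<And>t \<omega>. t \<in> {0..1} \<Longrightarrow> norm (v t (I t \<omega>)) \<le> C3 * S \<omega>" using v_growth by blast
  have s0_in: "s0 \<in> {s0..s1}" using s by simp
  have C12: "C1 \<ge> 0" "C2 \<ge> 0"
    using order_trans[OF abs_ge_zero C1[OF s0_in]] order_trans[OF abs_ge_zero C2[OF s0_in]] by auto
  have S0: "0 \<le> S \<omega>" for \<omega> using S_ge_1[of \<omega>] by simp
  \<comment> \<open>Uniform linearisation by the mean-value inequality; it serves for both
    \<open>a\<close> and \<open>b\<close>, each with half of \<epsilon>.\<close>
  have lin: "\<bar>h t - h r - (t - r) * h' r\<bar> \<le> \<epsilon> * (t - r)"
    if h: "\<And>t. t \<in> {s0..s1} \<Longrightarrow> (h has_real_derivative h' t) (at t)"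
      and \<eta>: "\<And>t r. t \<in> {s0..s1} \<Longrightarrow> r \<in> {s0..s1} \<Longrightarrow> dist t r < \<eta> \<Longrightarrow> dist (h' t) (h' r) < \<epsilon>"
      and r: "r \<in> {s0..s1}" "t \<in> {s0..s1}" "r \<le> t" "t - r < \<eta>" for h h' :: "real \<Rightarrow> real" and \<eta> \<epsilon> t r
  proof -
    have sub': "{r..t} \<subseteq> {s0..s1}" using r by auto
    have "norm (h t - h r - (t - r) *\<^sub>R h' r) \<le> norm (t - r) * \<epsilon>"
    proof (rule vector_differentiable_bound_linearization[where S="{r..t}" and f'=h'])
      show "(h has_vector_derivative h' x) (at x within {r..t})" if "x \<in> {r..t}" for x
        using h[of x] that sub' has_vector_derivative_at_within
        by (auto simp: has_real_derivative_iff_has_vector_derivative)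
      show "closed_segment r t \<subseteq> {r..t}" using r by (simp add: closed_segment_eq_real_ivl)
      show "norm (h' x - h' r) \<le> \<epsilon>" if x: "x \<in> {r..t}" for x
      proof -
        have "dist x r < \<eta>" using x r by (simp add: dist_real_def)
        then show ?thesis using \<eta>[of x r] x sub' r by (auto simp: dist_norm)
      qed
    qed (use r in auto)
    then show ?thesis using r by (simp add: mult.commute)
  qed
  have "transport M I dI v S L (C1 + C2 + C3) s0 s1"
  proof
    show "lipschitz_field L v" by (rule L)
    show "0 \<le> s0" "s0 < s1" "s1 \<le> 1" using s by auto
    show "1 \<le> S \<omega>" for \<omega> by (rule S_ge_1)
    show "integrable M (\<lambda>\<omega>. (S \<omega>)\<^sup>2)" by (rule S_moment)
    show "0 \<le> C1 + C2 + C3" using C12 C3 by simp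
    fix t \<omega> assume t: "t \<in> {s0..s1}"
    have "norm (dI t \<omega>) \<le> (\<bar>?e t\<bar> + \<bar>b' t\<bar>) * S \<omega>" unfolding dI_def by (rule lin_S_bound)
    also have "\<dots> \<le> (C1 + C2 + C3) * S \<omega>" using C1[OF t] C2[OF t] C3(1) S0 by (intro mult_right_mono) auto
    finally show "norm (dI t \<omega>) \<le> (C1 + C2 + C3) * S \<omega>" .
    have "norm (v t (I t \<omega>)) \<le> C3 * S \<omega>" using C3(2) t sub by auto
    also have "\<dots> \<le> (C1 + C2 + C3) * S \<omega>" using C12 S0 by (intro mult_right_mono) auto
    finally show "norm (v t (I t \<omega>)) \<le> (C1 + C2 + C3) * S \<omega>" .
  next
    fix \<epsilon> :: real assume \<epsilon>: "\<epsilon> > 0"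
    then have e2: "\<epsilon> / 2 > 0" by simp
    have "uniformly_continuous_on {s0..s1} ?e" by (rule compact_uniformly_continuous[OF ec]) simp
    then obtain d1 where d1: "d1 > 0" "\<And>t r. t \<in> {s0..s1} \<Longrightarrow> r \<in> {s0..s1} \<Longrightarrow> dist t r < d1 \<Longrightarrow> dist (?e t) (?e r) < \<epsilon> / 2"
      using e2 unfolding uniformly_continuous_on_def by metis
    have "uniformly_continuous_on {s0..s1} b'" by (rule compact_uniformly_continuous[OF bc]) simp
    then obtain d2 where d2: "d2 > 0" "\<And>t r. t \<in> {s0..s1} \<Longrightarrow> r \<in> {s0..s1} \<Longrightarrow> dist t r < d2 \<Longrightarrow> dist (b' t) (b' r) < \<epsilon> / 2"
      using e2 unfolding uniformly_continuous_on_def by metis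
    show "\<exists>\<eta>>0. \<forall>r\<in>{s0..s1}. \<forall>t\<in>{s0..s1}. r \<le> t \<longrightarrow> t - r < \<eta> \<longrightarrow>
        (\<forall>\<omega>. norm (I t \<omega> - I r \<omega> - (t - r) *\<^sub>R dI r \<omega>) \<le> \<epsilon> * (t - r) * S \<omega>)"
    proof (rule exI[of _ "min d1 d2"], intro conjI ballI impI allI)
      show "min d1 d2 > 0" using d1 d2 by simp
      fix r t \<omega> assume r: "r \<in> {s0..s1}" and t: "t \<in> {s0..s1}" and le: "r \<le> t" and lt: "t - r < min d1 d2"
      have A: "\<bar>a t - a r - (t - r) * ?e r\<bar> \<le> \<epsilon> / 2 * (t - r)"
        by (rule lin[OF _ d1(2) r t le]) (use a_deriv sub lt in auto)
      have B: "\<bar>b t - b r - (t - r) * b' r\<bar> \<le> \<epsilon> / 2 * (t - r)"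
        by (rule lin[OF _ d2(2) r t le]) (use b_deriv sub lt in auto)
      have "I t \<omega> - I r \<omega> - (t - r) *\<^sub>R dI r \<omega> = (a t - a r - (t - r) * ?e r) *\<^sub>R Z \<omega> + (b t - b r - (t - r) * b' r) *\<^sub>R X1 \<omega>"
        by (simp add: interpolant_def dI_def algebra_simps)
      then have "norm (I t \<omega> - I r \<omega> - (t - r) *\<^sub>R dI r \<omega>) \<le> (\<bar>a t - a r - (t - r) * ?e r\<bar> + \<bar>b t - b r - (t - r) * b' r\<bar>) * S \<omega>"
        using lin_S_bound by simp
      also have "\<dots> \<le> (\<epsilon> / 2 * (t - r) + \<epsilon> / 2 * (t - r)) * S \<omega>"
        using A B S0 by (intro mult_right_mono add_mono) auto
      finally show "norm (I t \<omega> - I r \<omega> - (t - r) *\<^sub>R dI r \<omega>) \<le> \<epsilon> * (t - r) * S \<omega>" by simp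
    qed
  next
    fix t C and G :: "'a \<Rightarrow> 'a" assume "t \<in> {s0..s1}" "G \<in> borel_measurable borel" "\<And>x. norm (G x) \<le> C"
    then show "(\<integral>\<omega>. G (I t \<omega>) \<bullet> (dI t \<omega> - v t (I t \<omega>)) \<partial>M) = 0"
      using sub by (intro velocity_identity_inner) auto
  qed measurable
  then show ?thesis by blast
qed

lemma unique_flow_cong:
  assumes "\<And>t x. t \<in> {0..1} \<Longrightarrow> w t x = w' t x"
  shows "unique_flow w X \<longleftrightarrow> unique_flow w' X"
proof -
  have "solves_ivp w x y \<longleftrightarrow> solves_ivp w' x y" for x y
    using assms unfolding solves_ivp_def by auto
  then show ?thesis unfolding unique_flow_def by simp
qed

text \<open>The reversed flow is explicit: go back along the forward flow from time 1 to time 0,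
  then forward again to 1 - t.\<close>

theorem reversed_flow:
  "\<exists>X Xrev.
      unique_flow (velocity M a b Z X1) X \<and>
      unique_flow (\<lambda>t x. - velocity M a b Z X1 (1 - t) x) Xrev \<and>
      (\<forall>t\<in>{0..1}. Xrev t \<in> borel_measurable borel \<and>
         distr \<nu> borel (Xrev t) = distr M borel (interpolant a b Z X1 (1 - t))) \<and>
      (\<forall>t\<in>{0..1}. bij (X t) \<and> bij (Xrev t)) \<and>
      Xrev 1 = inv (X 1) \<and>
      (\<forall>t\<in>{0..1}. Xrev t = inv (transition X (1 - t) 1) \<and>
         inv (X t) = transition Xrev (1 - t) 1)"
proof -
  obtain L where L: "lipschitz_field L v" using v_lipschitz_field by blast
  obtain X where X: "unique_flow v X" using lipschitz_field_unique_flow[OF L] by blast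
  define Xrev where "Xrev t = X (1 - t) \<circ> inv (X 1)" for t
  have R: "unique_flow (\<lambda>t x. - v (1 - t) x) Xrev"
    using unique_flow_reverse[OF L X] by (simp add: Xrev_def[abs_def])
  have bX: "bij (X t)" if "t \<in> {0..1}" for t by (rule unique_flow_bij[OF L X that])
  have b1: "bij (X 1)" by (rule bX) simp
  have bR: "bij (Xrev t)" if "t \<in> {0..1}" for t
    unfolding Xrev_def using that b1 by (intro bij_comp bij_imp_bij_inv bX) auto
  have Xm[measurable]: "X t \<in> borel_measurable borel" if "t \<in> {0..1}" for t
    by (rule borel_measurable_continuous_onI[OF unique_flow_continuous[OF L X that]])
  have im[measurable]: "inv (X 1) \<in> borel_measurable borel"
    by (rule borel_measurable_continuous_onI[OF unique_flow_inv_continuous[OF L X]]) simp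
  have Rm: "Xrev t \<in> borel_measurable borel" if "t \<in> {0..1}" for t
    unfolding Xrev_def comp_def using measurable_compose[OF im Xm[of "1 - t"]] that by simp
  have Ic: "continuous_on {0..1} (\<lambda>t. I t \<omega>)" for \<omega>
    unfolding interpolant_def by (intro continuous_intros a_cont b_cont)
  have law: "distr M borel (I t) = distr M borel (\<lambda>\<omega>. X t (I 0 \<omega>))" if "t \<in> {0..1}" for t
    by (rule flow_transports_law[OF _ L X I_meas Ic transport_interior[OF L] that]) unfold_locales
  have I1: "I 1 = X1" by (auto simp: interpolant_def ab_end)
  have lawR: "distr \<nu> borel (Xrev t) = distr M borel (I (1 - t))" if t: "t \<in> {0..1}" for t
  proof -
    have [measurable]: "X 1 \<in> borel_measurable borel" "X (1 - t) \<in> borel_measurable borel" "Xrev t \<in> borel_measurable borel"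
      using Xm[of 1] Xm[of "1 - t"] Rm[OF t] t by auto
    \<comment> \<open>Since \<open>a 1 = 0\<close> and \<open>b 1 = 1\<close>, the interpolant ends
      in \<open>X1\<close>, so \<nu> is the image of the law at time 0 under \<open>X 1\<close>; the
      inverse in \<open>Xrev\<close> then cancels.\<close>
    have "\<nu> = distr M borel (\<lambda>\<omega>. X 1 (I 0 \<omega>))" using lawX law[of 1] I1 by simp
    then have "distr \<nu> borel (Xrev t) = distr M borel (Xrev t \<circ> (\<lambda>\<omega>. X 1 (I 0 \<omega>)))"
      by (simp add: distr_distr)
    also have "Xrev t \<circ> (\<lambda>\<omega>. X 1 (I 0 \<omega>)) = (\<lambda>\<omega>. X (1 - t) (I 0 \<omega>))"
      using b1 by (auto simp: Xrev_def bij_is_inj)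
    also have "distr M borel (\<lambda>\<omega>. X (1 - t) (I 0 \<omega>)) = distr M borel (I (1 - t))"
      using law[of "1 - t"] t by simp
    finally show ?thesis .
  qed
  have X0: "X 0 = id" using unique_flow_0[OF X] by auto
  have R1: "Xrev 1 = inv (X 1)" by (simp add: Xrev_def X0)
  have tr: "Xrev t = inv (transition X (1 - t) 1) \<and> inv (X t) = transition Xrev (1 - t) 1" if t: "t \<in> {0..1}" for t
  proof
    have bt: "bij (X (1 - t))" using bX t by auto
    have "inv (transition X (1 - t) 1) = inv (inv (X (1 - t))) \<circ> inv (X 1)"
      unfolding transition_def using b1 bt by (intro o_inv_distrib bij_imp_bij_inv)
    also have "\<dots> = Xrev t" using bt by (simp add: Xrev_def inv_inv_eq)
    finally show "Xrev t = inv (transition X (1 - t) 1)" ..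
    have bt': "bij (X t)" using bX t by auto
    have "transition Xrev (1 - t) 1 = inv (X 1) \<circ> inv (X t \<circ> inv (X 1))"
      unfolding transition_def R1 by (simp add: Xrev_def)
    also have "inv (X t \<circ> inv (X 1)) = inv (inv (X 1)) \<circ> inv (X t)"
      using b1 bt' by (intro o_inv_distrib bij_imp_bij_inv)
    also have "inv (X 1) \<circ> \<dots> = inv (X t)" using b1 by (auto simp: inv_inv_eq bij_is_inj)
    finally show "inv (X t) = transition Xrev (1 - t) 1" ..
  qed
  have "unique_flow (velocity M a b Z X1) X"
    using unique_flow_cong[of "velocity M a b Z X1" v X] velocity_eq X by blast
  moreover have "unique_flow (\<lambda>t x. - velocity M a b Z X1 (1 - t) x) Xrev"
    using unique_flow_cong[of "\<lambda>t x. - velocity M a b Z X1 (1 - t) x" "\<lambda>t x. - v (1 - t) x" Xrev] velocity_eq R by simp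
  ultimately show ?thesis using Rm lawR bX bR R1 tr by blast
qed

end

subsection \<open>Potentials with bounded Hessian\<close>

text \<open>On the segment from x to y, F minus its tangent is nondecreasing, and subtracting the
  quadratic with coefficient M/2 as well makes it nonincreasing.\<close>

lemma descent_bounds:
  fixes F :: "'a::euclidean_space \<Rightarrow> real"
  assumes d: "\<And>x. (F has_derivative (\<lambda>h. G x \<bullet> h)) (at x)"
    and mono: "\<And>x y. 0 \<le> (G x - G y) \<bullet> (x - y)" "\<And>x y. (G x - G y) \<bullet> (x - y) \<le> M * (norm (x - y))\<^sup>2"
  shows "F x + G x \<bullet> (y - x) \<le> F y" "F y \<le> F x + G x \<bullet> (y - x) + M / 2 * (norm (y - x))\<^sup>2"
proof -
  let ?k = "y - x"
  have der: "((\<lambda>r. F (x + r *\<^sub>R ?k)) has_real_derivative G (x + r *\<^sub>R ?k) \<bullet> ?k) (at r)" for r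
  proof -
    have "((\<lambda>r. x + r *\<^sub>R ?k) has_derivative (\<lambda>h. h *\<^sub>R ?k)) (at r)"
      by (auto intro!: derivative_eq_intros)
    from has_derivative_compose[OF this d] show ?thesis
      by (simp add: has_field_derivative_def mult.commute[of _ "G (x + r *\<^sub>R ?k) \<bullet> ?k"] fun_eq_iff)
  qed
  have m: "0 \<le> G (x + r *\<^sub>R ?k) \<bullet> ?k - G x \<bullet> ?k" "G (x + r *\<^sub>R ?k) \<bullet> ?k - G x \<bullet> ?k \<le> M * r * (norm ?k)\<^sup>2" if r: "r > 0" for r
  proof -
    have e: "(G (x + r *\<^sub>R ?k) - G x) \<bullet> (x + r *\<^sub>R ?k - x) = r * (G (x + r *\<^sub>R ?k) \<bullet> ?k - G x \<bullet> ?k)"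
      by (simp add: inner_diff_left)
    show "0 \<le> G (x + r *\<^sub>R ?k) \<bullet> ?k - G x \<bullet> ?k"
      using mono(1)[of "x + r *\<^sub>R ?k" x] r unfolding e by (simp add: zero_le_mult_iff)
    have "r * (G (x + r *\<^sub>R ?k) \<bullet> ?k - G x \<bullet> ?k) \<le> r * (M * r * (norm ?k)\<^sup>2)"
      using mono(2)[of "x + r *\<^sub>R ?k" x] r unfolding e by (simp add: power_mult_distrib power2_eq_square mult_ac)
    then show "G (x + r *\<^sub>R ?k) \<bullet> ?k - G x \<bullet> ?k \<le> M * r * (norm ?k)\<^sup>2" using r by simp
  qed
  have "F (x + 0 *\<^sub>R ?k) - 0 * (G x \<bullet> ?k) \<le> F (x + 1 *\<^sub>R ?k) - 1 * (G x \<bullet> ?k)"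
  proof (rule DERIV_nonneg_imp_increasing_open[where f="\<lambda>r. F (x + r *\<^sub>R ?k) - r * (G x \<bullet> ?k)"])
    fix r :: real assume "0 < r" "r < 1"
    then show "\<exists>y'. ((\<lambda>r. F (x + r *\<^sub>R ?k) - r * (G x \<bullet> ?k)) has_real_derivative y') (at r) \<and> 0 \<le> y'"
      using m(1)[of r] by (intro exI[of _ "G (x + r *\<^sub>R ?k) \<bullet> ?k - G x \<bullet> ?k"]) (auto intro!: derivative_eq_intros der)
  next
    show "continuous_on {0..1} (\<lambda>r. F (x + r *\<^sub>R ?k) - r * (G x \<bullet> ?k))"
      by (intro continuous_intros continuous_at_imp_continuous_on ballI DERIV_isCont[OF der])
  qed simp
  then show "F x + G x \<bullet> ?k \<le> F y" by simp
  have "F (x + 1 *\<^sub>R ?k) - 1 * (G x \<bullet> ?k) - M / 2 * (norm ?k)\<^sup>2 * 1\<^sup>2 \<le> F (x + 0 *\<^sub>R ?k) - 0 * (G x \<bullet> ?k) - M / 2 * (norm ?k)\<^sup>2 * 0\<^sup>2"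
  proof (rule DERIV_nonpos_imp_decreasing_open[where f="\<lambda>r. F (x + r *\<^sub>R ?k) - r * (G x \<bullet> ?k) - M / 2 * (norm ?k)\<^sup>2 * r\<^sup>2"])
    fix r :: real assume "0 < r" "r < 1"
    then show "\<exists>y'. ((\<lambda>r. F (x + r *\<^sub>R ?k) - r * (G x \<bullet> ?k) - M / 2 * (norm ?k)\<^sup>2 * r\<^sup>2) has_real_derivative y') (at r) \<and> y' \<le> 0"
      using m(2)[of r] by (intro exI[of _ "G (x + r *\<^sub>R ?k) \<bullet> ?k - G x \<bullet> ?k - M * r * (norm ?k)\<^sup>2"]) (auto intro!: derivative_eq_intros der)
  next
    show "continuous_on {0..1} (\<lambda>r. F (x + r *\<^sub>R ?k) - r * (G x \<bullet> ?k) - M / 2 * (norm ?k)\<^sup>2 * r\<^sup>2)"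
      by (intro continuous_intros continuous_at_imp_continuous_on ballI DERIV_isCont[OF der])
  qed simp
  then show "F y \<le> F x + G x \<bullet> ?k + M / 2 * (norm ?k)\<^sup>2" by simp
qed

text \<open>Cocoercivity of the gradient makes two-sided bounds on the quadratic form of the Hessian
  sufficient for a Lipschitz gradient, so that the symmetry of the Hessian is not needed.\<close>

lemma gradient_lipschitz:
  fixes F :: "'a::euclidean_space \<Rightarrow> real"
  assumes d: "\<And>x. (F has_derivative (\<lambda>h. G x \<bullet> h)) (at x)" and M: "M > 0"
    and mono: "\<And>x y. 0 \<le> (G x - G y) \<bullet> (x - y)" "\<And>x y. (G x - G y) \<bullet> (x - y) \<le> M * (norm (x - y))\<^sup>2"
  shows "norm (G x - G y) \<le> M * norm (x - y)"
proof -
  have *: "F x + G x \<bullet> (y - x) + (norm (G y - G x))\<^sup>2 / (2 * M) \<le> F y" for x y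
  proof -
    let ?d = "G y - G x"
    \<comment> \<open>The minimiser of the quadratic upper bound around y for F minus its tangent at
      x: a gradient step of length 1/M.\<close>
    define w where "w = y - (1 / M) *\<^sub>R ?d"
    have 1: "F x + G x \<bullet> (w - x) \<le> F w" by (rule descent_bounds(1)[OF d mono])
    have 2: "F w \<le> F y + G y \<bullet> (w - y) + M / 2 * (norm (w - y))\<^sup>2" by (rule descent_bounds(2)[OF d mono])
    have wy: "w - y = - ((1 / M) *\<^sub>R ?d)" by (simp add: w_def)
    have "M / 2 * (norm (w - y))\<^sup>2 = (norm ?d)\<^sup>2 / (2 * M)"
      unfolding wy using M by (simp add: power_divide power2_eq_square)
    moreover have "G y \<bullet> (w - y) - G x \<bullet> (w - y) = - (norm ?d)\<^sup>2 / M"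
      by (simp only: inner_diff_left[symmetric] wy) (simp add: power2_norm_eq_inner)
    moreover have "G x \<bullet> (w - x) = G x \<bullet> (y - x) + G x \<bullet> (w - y)" by (simp add: inner_diff_right)
    moreover have "(norm ?d)\<^sup>2 / M = (norm ?d)\<^sup>2 / (2 * M) + (norm ?d)\<^sup>2 / (2 * M)" by simp
    ultimately show ?thesis using 1 2 by linarith
  qed
  \<comment> \<open>Cocoercivity, by adding the inequality to its copy with x and y
    exchanged.\<close>
  have "(norm (G x - G y))\<^sup>2 / M \<le> (G x - G y) \<bullet> (x - y)"
  proof -
    have "(norm (G x - G y))\<^sup>2 / M = (norm (G y - G x))\<^sup>2 / (2 * M) + (norm (G x - G y))\<^sup>2 / (2 * M)"
      by (simp add: norm_minus_commute)
    moreover have "(G x - G y) \<bullet> (x - y) = - (G x \<bullet> (y - x)) - G y \<bullet> (x - y)"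
      by (simp add: inner_diff_left inner_diff_right)
    ultimately show ?thesis using *[of x y] *[of y x] by linarith
  qed
  also have "\<dots> \<le> norm (G x - G y) * norm (x - y)" by (rule norm_cauchy_schwarz)
  finally have "norm (G x - G y) * norm (G x - G y) \<le> norm (G x - G y) * (M * norm (x - y))"
    using M by (simp add: power2_eq_square field_simps)
  then show ?thesis
    by (cases "norm (G x - G y) = 0") (use M in \<open>auto simp: mult_le_cancel_left\<close>)
qed

text \<open>The mean value theorem with equality is applied to the scalar function obtained by
  pairing G with x - y along the segment.\<close>

lemma hessian_mean_value:
  fixes G :: "'a::euclidean_space \<Rightarrow> 'a"
  assumes H: "\<And>x. (G has_derivative blinfun_apply (H x)) (at x)"
  obtains z where "(G x - G y) \<bullet> (x - y) = (x - y) \<bullet> blinfun_apply (H z) (x - y)"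
proof -
  let ?k = "x - y"
  have der: "((\<lambda>r. G (y + r *\<^sub>R ?k) \<bullet> ?k) has_real_derivative ?k \<bullet> blinfun_apply (H (y + r *\<^sub>R ?k)) ?k) (at r)" for r
  proof -
    have "((\<lambda>r. y + r *\<^sub>R ?k) has_derivative (\<lambda>h. h *\<^sub>R ?k)) (at r)"
      by (auto intro!: derivative_eq_intros)
    from has_derivative_compose[OF this H]
    have "((\<lambda>r. G (y + r *\<^sub>R ?k)) has_derivative (\<lambda>h. h *\<^sub>R blinfun_apply (H (y + r *\<^sub>R ?k)) ?k)) (at r)"
      by (simp add: blinfun.scaleR_right)
    from has_derivative_inner_left[OF this, of ?k] show ?thesis
      unfolding has_field_derivative_def by (rule has_derivative_eq_rhs) (auto simp: fun_eq_iff inner_commute)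
  qed
  obtain r where "G (y + 1 *\<^sub>R ?k) \<bullet> ?k - G (y + 0 *\<^sub>R ?k) \<bullet> ?k = (1 - 0) * (?k \<bullet> blinfun_apply (H (y + r *\<^sub>R ?k)) ?k)"
    using MVT2[of 0 1 "\<lambda>r. G (y + r *\<^sub>R ?k) \<bullet> ?k" "\<lambda>r. ?k \<bullet> blinfun_apply (H (y + r *\<^sub>R ?k)) ?k"] der by auto
  then have "(G x - G y) \<bullet> ?k = ?k \<bullet> blinfun_apply (H (y + r *\<^sub>R ?k)) ?k" by (simp add: inner_diff_left)
  then show thesis by (rule that)
qed

text \<open>The two curvature conditions each come with a potential of their own; continuity
  upgrades almost everywhere equality of the densities to equality of the potentials.\<close>

lemma has_potential_unique:
  fixes U1 U2 :: "'a::euclidean_space \<Rightarrow> real"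
  assumes supp: "msupport \<nu> = UNIV" and U: "has_potential \<nu> U1" "has_potential \<nu> U2"
    and c: "continuous_on UNIV U1" "continuous_on UNIV U2"
  shows "U1 = U2"
proof -
  have [measurable]: "U1 \<in> borel_measurable borel" "U2 \<in> borel_measurable borel"
    using c by (auto intro: borel_measurable_continuous_onI)
  have "density lborel (\<lambda>x. ennreal (exp (- U1 x))) = density lborel (\<lambda>x. ennreal (exp (- U2 x)))"
    using U supp by (simp add: has_potential_def)
  then have "AE x in lborel. ennreal (exp (- U1 x)) = ennreal (exp (- U2 x))"
    by (subst (asm) sigma_finite_measure.density_unique_iff[OF sigma_finite_lborel]) auto
  then have "AE x in lborel. U1 x = U2 x" by eventually_elim simp
  then show ?thesis by (rule continuous_eq_if_AE_lborel[OF c])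
qed

text \<open>After the two potentials are identified their gradients coincide, so the upper bound of
  one Hessian and the lower bound of the other constrain the same gradient.\<close>

lemma semi_log_potential:
  fixes \<nu> :: "'a::euclidean_space measure"
  assumes cv: "semi_log_convex \<beta> \<nu>" and cc: "semi_log_concave \<kappa> \<nu>" and supp: "msupport \<nu> = UNIV"
  obtains U G where "\<nu> = density lborel (\<lambda>x. ennreal (exp (- U x)))"
    "\<And>x. (U has_derivative (\<lambda>h. G x \<bullet> h)) (at x)"
    "\<And>x y. \<kappa> * (norm (x - y))\<^sup>2 \<le> (G x - G y) \<bullet> (x - y)"
    "\<And>x y. (G x - G y) \<bullet> (x - y) \<le> \<beta> * (norm (x - y))\<^sup>2"
proof -
  obtain U1 H1 G1 where 1: "has_potential \<nu> U1" "\<And>x. (U1 has_derivative (\<lambda>h. G1 x \<bullet> h)) (at x)"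
    "\<And>x. (G1 has_derivative blinfun_apply (H1 x)) (at x)" "\<And>x h. h \<bullet> blinfun_apply (H1 x) h \<le> \<beta> * (h \<bullet> h)"
    using cv unfolding semi_log_convex_def C2_with_hessian_def supp by auto
  obtain U2 H2 G2 where 2: "has_potential \<nu> U2" "\<And>x. (U2 has_derivative (\<lambda>h. G2 x \<bullet> h)) (at x)"
    "\<And>x. (G2 has_derivative blinfun_apply (H2 x)) (at x)" "\<And>x h. h \<bullet> blinfun_apply (H2 x) h \<ge> \<kappa> * (h \<bullet> h)"
    using cc unfolding semi_log_concave_def C2_with_hessian_def supp by auto
  have "continuous_on UNIV U1" "continuous_on UNIV U2"
    using 1(2) 2(2) by (auto intro!: continuous_at_imp_continuous_on has_derivative_continuous)
  then have U: "U1 = U2" by (rule has_potential_unique[OF supp 1(1) 2(1)])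
  have G: "G1 x = G2 x" for x
  proof -
    have "(\<lambda>h. G1 x \<bullet> h) = (\<lambda>h. G2 x \<bullet> h)" using 1(2) 2(2) unfolding U by (rule has_derivative_unique)
    then show ?thesis by (metis vector_eq_rdot)
  qed
  show thesis
  proof
    show "\<nu> = density lborel (\<lambda>x. ennreal (exp (- U1 x)))" using 1(1) supp by (simp add: has_potential_def)
    show "(U1 has_derivative (\<lambda>h. G1 x \<bullet> h)) (at x)" for x by (rule 1(2))
    fix x y
    obtain z where z: "(G1 x - G1 y) \<bullet> (x - y) = (x - y) \<bullet> blinfun_apply (H1 z) (x - y)"
      using hessian_mean_value[of G1 H1 x y] 1(3) by blast
    then show "(G1 x - G1 y) \<bullet> (x - y) \<le> \<beta> * (norm (x - y))\<^sup>2" using 1(4) by (simp add: power2_norm_eq_inner)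
    obtain z where z: "(G2 x - G2 y) \<bullet> (x - y) = (x - y) \<bullet> blinfun_apply (H2 z) (x - y)"
      using hessian_mean_value[of G2 H2 x y] 2(3) by blast
    then show "\<kappa> * (norm (x - y))\<^sup>2 \<le> (G1 x - G1 y) \<bullet> (x - y)" using 2(4) unfolding G by (simp add: power2_norm_eq_inner)
  qed
qed

text \<open>Up to a constant, log f is the Gaussian exponent minus U, so its gradient is a multiple
  of x minus the gradient of U, for any choice of \<sigma>.\<close>

lemma density_ratio_tilt:
  fixes U :: "'a::euclidean_space \<Rightarrow> real"
  assumes \<sigma>: "\<sigma> > 0" and nu: "\<nu> = density lborel (\<lambda>x. ennreal (exp (- U x)))"
    and U: "\<And>x. (U has_derivative (\<lambda>h. G x \<bullet> h)) (at x)"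
    and mono: "\<And>x y. \<kappa> * (norm (x - y))\<^sup>2 \<le> (G x - G y) \<bullet> (x - y)"
      "\<And>x y. (G x - G y) \<bullet> (x - y) \<le> \<beta> * (norm (x - y))\<^sup>2"
  defines "f \<equiv> \<lambda>x. exp (- U x) / gdens \<sigma> x" and "g \<equiv> \<lambda>x. (1 / \<sigma>\<^sup>2) *\<^sub>R x - G x"
  shows "f x > 0" "continuous_on UNIV f" "\<nu> = density (gaussian \<sigma>) (\<lambda>x. ennreal (f x))"
    "((\<lambda>r. f (x + r *\<^sub>R k)) has_real_derivative f x * (g x \<bullet> k)) (at 0)"
    "\<exists>K\<ge>0. \<forall>x y. norm (g x - g y) \<le> K * norm (x - y)"
proof -
  show "f x > 0" by (simp add: f_def gdens_pos[OF \<sigma>])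
  have Uc: "continuous_on UNIV U" using U by (auto intro!: continuous_at_imp_continuous_on has_derivative_continuous)
  then have [measurable]: "U \<in> borel_measurable borel" by (rule borel_measurable_continuous_onI)
  have gc: "continuous_on UNIV (gdens \<sigma> :: 'a \<Rightarrow> real)" unfolding gdens_def by (intro continuous_intros) (use \<sigma> in auto)
  have g0: "gdens \<sigma> x \<noteq> 0" for x :: 'a using gdens_pos[OF \<sigma>, of x] by simp
  show "continuous_on UNIV f" unfolding f_def by (intro continuous_intros Uc gc) (use g0 in auto)
  show "\<nu> = density (gaussian \<sigma>) (\<lambda>x. ennreal (f x))"
  proof -
    have "density (gaussian \<sigma>) (\<lambda>x. ennreal (f x)) = density lborel (\<lambda>x. ennreal (gdens \<sigma> x) * ennreal (f x))"
      unfolding gaussian_eq f_def by (rule density_density_eq) measurable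
    also have "(\<lambda>x. ennreal (gdens \<sigma> x) * ennreal (f x)) = (\<lambda>x. ennreal (exp (- U x)))"
      using g0 by (simp add: f_def flip: ennreal_mult)
    finally show ?thesis using nu by simp
  qed
  define c0 where "c0 = (1 / sqrt (2 * pi * \<sigma>\<^sup>2)) ^ DIM('a)"
  have c0: "c0 > 0" using \<sigma> by (simp add: c0_def)
  have f_eq: "f x = exp (- U x + (x \<bullet> x) / (2 * \<sigma>\<^sup>2)) / c0" for x
  proof -
    have "gdens \<sigma> x = c0 * exp (- ((x \<bullet> x) / (2 * \<sigma>\<^sup>2)))"
      by (simp only: gdens_def c0_def power2_norm_eq_inner minus_divide_left)
    also have "\<dots> = c0 / exp ((x \<bullet> x) / (2 * \<sigma>\<^sup>2))" by (simp only: exp_minus divide_inverse)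
    finally have g: "gdens \<sigma> x = \<dots>" .
    show ?thesis unfolding f_def g exp_add by simp
  qed
  show "((\<lambda>r. f (x + r *\<^sub>R k)) has_real_derivative f x * (g x \<bullet> k)) (at 0)"
  proof -
    have l: "((\<lambda>r::real. x + r *\<^sub>R k) has_derivative (\<lambda>h. h *\<^sub>R k)) (at 0)"
      by (auto intro!: derivative_eq_intros)
    have "((\<lambda>r. U (x + r *\<^sub>R k)) has_derivative (\<lambda>h. G (x + 0 *\<^sub>R k) \<bullet> (h *\<^sub>R k))) (at 0)"
      by (rule has_derivative_compose[OF l U])
    then have u: "((\<lambda>r. U (x + r *\<^sub>R k)) has_real_derivative G x \<bullet> k) (at 0)"
      unfolding has_field_derivative_def by (rule has_derivative_eq_rhs) (auto simp: fun_eq_iff)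
    have q: "((\<lambda>r. (x + r *\<^sub>R k) \<bullet> (x + r *\<^sub>R k)) has_real_derivative 2 * (x \<bullet> k)) (at 0)"
      unfolding has_field_derivative_def
      by (rule has_derivative_eq_rhs[OF has_derivative_inner[OF l l]]) (auto simp: fun_eq_iff inner_commute)
    show ?thesis
      unfolding f_eq using c0 \<sigma>
      by (auto intro!: derivative_eq_intros u q simp: g_def inner_diff_left field_simps power2_eq_square)
  qed
  show "\<exists>K\<ge>0. \<forall>x y. norm (g x - g y) \<le> K * norm (x - y)"
  proof -
    \<comment> \<open>Subtracting \<open>\<kappa> / 2 * (x \<bullet> x)\<close> from U makes the
      gradient monotone with upper bound \<open>\<beta> - \<kappa>\<close>; the added 1 makes M
      positive.\<close>
    define M where "M = \<bar>\<beta> - \<kappa>\<bar> + 1"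
    have M: "M > 0" by (simp add: M_def add_nonneg_pos)
    have d: "((\<lambda>x. U x - \<kappa> / 2 * (x \<bullet> x)) has_derivative (\<lambda>h. (G x - \<kappa> *\<^sub>R x) \<bullet> h)) (at x)" for x
      by (auto intro!: derivative_eq_intros U simp: fun_eq_iff inner_diff_left inner_commute algebra_simps)
    have e: "(G x - \<kappa> *\<^sub>R x - (G y - \<kappa> *\<^sub>R y)) \<bullet> (x - y) = (G x - G y) \<bullet> (x - y) - \<kappa> * (norm (x - y))\<^sup>2" for x y
      by (simp add: power2_norm_eq_inner inner_diff_left inner_diff_right algebra_simps)
    have m1: "0 \<le> (G x - \<kappa> *\<^sub>R x - (G y - \<kappa> *\<^sub>R y)) \<bullet> (x - y)" for x y
      unfolding e using mono(1)[of x y] by simp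
    have m2: "(G x - \<kappa> *\<^sub>R x - (G y - \<kappa> *\<^sub>R y)) \<bullet> (x - y) \<le> M * (norm (x - y))\<^sup>2" for x y
    proof -
      have "(\<beta> - \<kappa>) * (norm (x - y))\<^sup>2 \<le> M * (norm (x - y))\<^sup>2" by (intro mult_right_mono) (auto simp: M_def)
      then show ?thesis unfolding e using mono(2)[of x y] by (simp add: left_diff_distrib)
    qed
    have lip: "norm (G x - \<kappa> *\<^sub>R x - (G y - \<kappa> *\<^sub>R y)) \<le> M * norm (x - y)" for x y
      by (rule gradient_lipschitz[OF d M m1 m2])
    have "norm (g x - g y) \<le> (\<bar>1 / \<sigma>\<^sup>2 - \<kappa>\<bar> + M) * norm (x - y)" for x y
    proof -
      have eq: "g x - g y = (1 / \<sigma>\<^sup>2 - \<kappa>) *\<^sub>R (x - y) - (G x - \<kappa> *\<^sub>R x - (G y - \<kappa> *\<^sub>R y))"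
        by (simp add: g_def algebra_simps)
      have "norm (g x - g y) \<le> \<bar>1 / \<sigma>\<^sup>2 - \<kappa>\<bar> * norm (x - y) + norm (G x - \<kappa> *\<^sub>R x - (G y - \<kappa> *\<^sub>R y))"
        unfolding eq by (rule order_trans[OF norm_triangle_ineq4]) simp
      also have "\<dots> \<le> \<bar>1 / \<sigma>\<^sup>2 - \<kappa>\<bar> * norm (x - y) + M * norm (x - y)" by (intro add_left_mono lip)
      finally show ?thesis by (simp add: distrib_right)
    qed
    moreover have "\<bar>1 / \<sigma>\<^sup>2 - \<kappa>\<bar> + M \<ge> 0" using M by simp
    ultimately show ?thesis by blast
  qed
qed

subsection \<open>Variance bounds\<close>

context tilted_base
begin

lemma variance_expand:
  assumes m: "mass z \<tau> *\<^sub>R m = (\<integral>y. f (z + \<tau> *\<^sub>R y) *\<^sub>R y \<partial>gaussian 1)"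
  shows "(\<integral>y. f (z + \<tau> *\<^sub>R y) * (norm (y - m))\<^sup>2 \<partial>gaussian 1)
      = (\<integral>y. f (z + \<tau> *\<^sub>R y) * (norm y)\<^sup>2 \<partial>gaussian 1) - mass z \<tau> * (norm m)\<^sup>2"
proof -
  have eq: "f (z + \<tau> *\<^sub>R y) * (norm (y - m))\<^sup>2
      = f (z + \<tau> *\<^sub>R y) * (norm y)\<^sup>2 - 2 * ((f (z + \<tau> *\<^sub>R y) *\<^sub>R y) \<bullet> m) + f (z + \<tau> *\<^sub>R y) * (norm m)\<^sup>2" for y
    by (simp add: power2_norm_eq_inner inner_diff_left inner_diff_right inner_commute algebra_simps)
  have i1: "integrable (gaussian 1) (\<lambda>y. f (z + \<tau> *\<^sub>R y) * (norm y)\<^sup>2)" using f_norm_sq_int[of z \<tau> 0] by simp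
  have i2: "integrable (gaussian 1) (\<lambda>y. (f (z + \<tau> *\<^sub>R y) *\<^sub>R y) \<bullet> m)" by (rule integrable_inner_left) (rule fy_int)
  have i3: "integrable (gaussian 1) (\<lambda>y. f (z + \<tau> *\<^sub>R y) * (norm m)\<^sup>2)" using f_int by simp
  have e2: "(\<integral>y. (f (z + \<tau> *\<^sub>R y) *\<^sub>R y) \<bullet> m \<partial>gaussian 1) = mass z \<tau> * (norm m)\<^sup>2"
  proof -
    have "(\<integral>y. (f (z + \<tau> *\<^sub>R y) *\<^sub>R y) \<bullet> m \<partial>gaussian 1) = (\<integral>y. f (z + \<tau> *\<^sub>R y) *\<^sub>R y \<partial>gaussian 1) \<bullet> m"
      by (rule integral_inner_left) (rule fy_int)
    then show ?thesis unfolding m[symmetric] by (simp add: power2_norm_eq_inner)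
  qed
  have "(\<integral>y. f (z + \<tau> *\<^sub>R y) * (norm (y - m))\<^sup>2 \<partial>gaussian 1)
     = (\<integral>y. f (z + \<tau> *\<^sub>R y) * (norm y)\<^sup>2 \<partial>gaussian 1) - 2 * (\<integral>y. (f (z + \<tau> *\<^sub>R y) *\<^sub>R y) \<bullet> m \<partial>gaussian 1)
       + (\<integral>y. f (z + \<tau> *\<^sub>R y) * (norm m)\<^sup>2 \<partial>gaussian 1)"
    unfolding eq using i1 i2 i3 by (simp only: Bochner_Integration.integral_add Bochner_Integration.integral_diff
      Bochner_Integration.integrable_diff integral_mult_right_zero integrable_mult_right)
  also have "(\<integral>y. f (z + \<tau> *\<^sub>R y) * (norm m)\<^sup>2 \<partial>gaussian 1) = mass z \<tau> * (norm m)\<^sup>2"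
    unfolding mass_def by (rule integral_mult_left_zero)
  finally show ?thesis unfolding e2 by simp
qed

text \<open>On the relevant scale \<open>f (z + \<tau> *\<^sub>R y)\<close> lies between
  \<open>f z\<close> times \<open>exp (- (L * T) * norm y)\<close> and \<open>f z\<close> times
  \<open>exp (L * T * norm y)\<close>. Second moment and mass are thus comparable to
  \<open>V\<close> and \<open>W\<close> times \<open>f z\<close>, and D = V / W.\<close>

lemma tilted_if_log_lipschitz:
  assumes ll: "\<And>x y. f x \<le> f y * exp (L * norm (x - y))" and L: "L \<ge> 0" and T: "T > 0"
  shows "\<exists>D. tilted_gaussian f g K A B D T"
proof -
  let ?\<gamma> = "gaussian 1 :: 'a measure"
  interpret g: prob_space ?\<gamma> by (rule prob_space_gaussian) simp
  define V where "V = (\<integral>y. exp (L * T * norm y) * (norm y)\<^sup>2 \<partial>?\<gamma>)"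
  define W where "W = (\<integral>y. exp (- (L * T) * norm y) \<partial>?\<gamma>)"
  have iV: "integrable ?\<gamma> (\<lambda>y. exp (L * T * norm y) * (norm y)\<^sup>2)"
  proof (rule integrable_gaussian_exp_bound)
    fix y :: 'a
    have "(norm y)\<^sup>2 \<le> (exp (norm y))\<^sup>2" by (intro power_mono norm_le_exp) simp
    then have "exp (L * T * norm y) * (norm y)\<^sup>2 \<le> exp (L * T * norm y) * exp (2 * norm y)"
      by (intro mult_left_mono) (auto simp: exp_double)
    also have "\<dots> = 1 * exp ((L * T + 2) * norm y)" by (simp add: distrib_right exp_add)
    finally show "norm (exp (L * T * norm y) * (norm y)\<^sup>2) \<le> 1 * exp ((L * T + 2) * norm y)" by simp
  qed measurable
  have iW: "integrable ?\<gamma> (\<lambda>y. exp (- (L * T) * norm y))"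
    by (rule integrable_gaussian_exp_norm)
  have W: "W > 0"
  proof -
    have "W \<noteq> 0"
    proof
      assume "W = 0"
      then have "AE y in ?\<gamma>. exp (- (L * T) * norm y) = 0"
        unfolding W_def by (subst (asm) integral_nonneg_eq_0_iff_AE[OF iW]) simp_all
      then show False by simp
    qed
    moreover have "W \<ge> 0" unfolding W_def by (intro integral_nonneg_AE AE_I2) simp
    ultimately show ?thesis by simp
  qed
  have "tilted_gaussian f g K A B (V / W) T"
  proof
    fix z m :: 'a and \<tau> :: real assume \<tau>: "0 < \<tau>" "\<tau> \<le> T" and m: "mass z \<tau> *\<^sub>R m = (\<integral>y. f (z + \<tau> *\<^sub>R y) *\<^sub>R y \<partial>gaussian 1)"
    have Lt: "L * (\<tau> * norm y) \<le> L * T * norm y" for y :: 'a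
      using \<tau> L by (simp add: mult.assoc mult_left_mono mult_right_mono)
    have up: "f (z + \<tau> *\<^sub>R y) \<le> f z * exp (L * T * norm y)" for y
    proof -
      have "f (z + \<tau> *\<^sub>R y) \<le> f z * exp (L * (\<tau> * norm y))" using ll[of "z + \<tau> *\<^sub>R y" z] \<tau> by simp
      also have "\<dots> \<le> f z * exp (L * T * norm y)" using Lt[of y] f_pos[of z] by (intro mult_left_mono) auto
      finally show ?thesis .
    qed
    have lo: "f z * exp (- (L * T) * norm y) \<le> f (z + \<tau> *\<^sub>R y)" for y
    proof -
      have "f z \<le> f (z + \<tau> *\<^sub>R y) * exp (L * (\<tau> * norm y))" using ll[of z "z + \<tau> *\<^sub>R y"] \<tau> by simp
      also have "\<dots> \<le> f (z + \<tau> *\<^sub>R y) * exp (L * T * norm y)" using Lt[of y] f_pos[of "z + \<tau> *\<^sub>R y"] by (intro mult_left_mono) auto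
      finally have "f z * exp (- (L * T) * norm y) \<le> f (z + \<tau> *\<^sub>R y) * exp (L * T * norm y) * exp (- (L * T) * norm y)"
        by (intro mult_right_mono) auto
      also have "\<dots> = f (z + \<tau> *\<^sub>R y)" unfolding mult.assoc exp_add[symmetric] by simp
      finally show ?thesis .
    qed
    \<comment> \<open>The variance is at most the second moment about 0.\<close>
    have "(\<integral>y. f (z + \<tau> *\<^sub>R y) * (norm (y - m))\<^sup>2 \<partial>gaussian 1) \<le> (\<integral>y. f (z + \<tau> *\<^sub>R y) * (norm y)\<^sup>2 \<partial>gaussian 1)"
      unfolding variance_expand[OF m] using mass_pos[of z \<tau>] by (simp add: less_imp_le)
    also have "\<dots> \<le> (\<integral>y. f z * (exp (L * T * norm y) * (norm y)\<^sup>2) \<partial>?\<gamma>)"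
    proof (rule integral_mono)
      show "integrable (gaussian 1) (\<lambda>y. f (z + \<tau> *\<^sub>R y) * (norm y)\<^sup>2)" using f_norm_sq_int[of z \<tau> 0] by simp
      show "integrable ?\<gamma> (\<lambda>y. f z * (exp (L * T * norm y) * (norm y)\<^sup>2))" using iV by simp
      show "f (z + \<tau> *\<^sub>R y) * (norm y)\<^sup>2 \<le> f z * (exp (L * T * norm y) * (norm y)\<^sup>2)" for y
        using mult_right_mono[OF up[of y], of "(norm y)\<^sup>2"] by (simp add: mult.assoc)
    qed
    also have "\<dots> = f z * V" unfolding V_def by (rule integral_mult_right_zero)
    finally have 1: "(\<integral>y. f (z + \<tau> *\<^sub>R y) * (norm (y - m))\<^sup>2 \<partial>gaussian 1) \<le> f z * V" .
    have "f z * W = (\<integral>y. f z * exp (- (L * T) * norm y) \<partial>?\<gamma>)" unfolding W_def by (rule integral_mult_right_zero[symmetric])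
    also have "\<dots> \<le> mass z \<tau>"
      unfolding mass_def by (rule integral_mono) (use iW f_int lo in auto)
    finally have 2: "f z * W \<le> mass z \<tau>" .
    have V0: "V \<ge> 0" unfolding V_def by (intro integral_nonneg_AE AE_I2) simp
    have "f z * V = V / W * (f z * W)" using W by simp
    also have "\<dots> \<le> V / W * mass z \<tau>" using 2 V0 W by (intro mult_left_mono) auto
    finally show "(\<integral>y. f (z + \<tau> *\<^sub>R y) * (norm (y - m))\<^sup>2 \<partial>gaussian 1) \<le> V / W * mass z \<tau>" using 1 by linarith
  qed
  then show ?thesis by blast
qed

text \<open>Integration by parts gives variance = dimension + \<tau> times the mean of g paired with
  y - m, up to the mass. The last mean is nonpositive because g is antitone, so the dimension is a
  bound for every \<tau>.\<close>

lemma tilted_if_log_concave: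
  assumes anti: "\<And>x y. (g x - g y) \<bullet> (x - y) \<le> 0"
  shows "tilted_gaussian f g K A B (real DIM('a)) T"
proof
  fix z m :: 'a and \<tau> :: real assume \<tau>: "0 < \<tau>" "\<tau> \<le> T" and m: "mass z \<tau> *\<^sub>R m = (\<integral>y. f (z + \<tau> *\<^sub>R y) *\<^sub>R y \<partial>gaussian 1)"
  let ?p = "\<lambda>y. f (z + \<tau> *\<^sub>R y)" and ?q = "\<lambda>y. f (z + \<tau> *\<^sub>R y) *\<^sub>R g (z + \<tau> *\<^sub>R y)"
  define b where "b = (B + 1) * \<bar>\<tau>\<bar> + 1"
  define c1 where "c1 = A * exp (B * norm z)"
  define c2 where "c2 = Ag * exp ((B + 1) * norm z)"
  have c: "c1 \<ge> 0" "c2 \<ge> 0" using A0 Ag0 by (auto simp: c1_def c2_def)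
  have b0: "b \<ge> 0" using B by (simp add: b_def)
  have pb: "norm (?p y) \<le> c1 * exp ((B + 1) * \<bar>\<tau>\<bar> * norm y)" for y
  proof -
    have "norm (?p y) \<le> c1 * exp (B * \<bar>\<tau>\<bar> * norm y)" using shift_bd[OF f_norm_bd A0 B, of z \<tau> y] by (simp add: c1_def)
    also have "\<dots> \<le> c1 * exp ((B + 1) * \<bar>\<tau>\<bar> * norm y)" using c by (intro mult_left_mono) (auto intro!: mult_right_mono)
    finally show ?thesis .
  qed
  have qb: "norm (?q y) \<le> c2 * exp ((B + 1) * \<bar>\<tau>\<bar> * norm y)" for y
    using shift_bd[OF fg_bd Ag0, of z \<tau> y] B by (simp add: c2_def)
  have ym: "norm (y - m) \<le> (1 + norm m) * exp (norm y)" for y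
  proof -
    have "norm (y - m) \<le> norm y + norm m" by (rule norm_triangle_ineq4)
    also have "\<dots> \<le> exp (norm y) + norm m * exp (norm y)"
      by (intro add_mono norm_le_exp) (auto simp: mult_le_cancel_left1)
    finally show ?thesis by (simp add: distrib_right)
  qed
  have prod_b: "u * norm (y - m) \<le> (c' * (1 + norm m)) * exp (b * norm y)"
    if "u \<le> c' * exp ((B + 1) * \<bar>\<tau>\<bar> * norm y)" "c' \<ge> 0" "u \<ge> 0" for u c' y
  proof -
    have "u * norm (y - m) \<le> (c' * exp ((B + 1) * \<bar>\<tau>\<bar> * norm y)) * ((1 + norm m) * exp (norm y))"
      using that ym[of y] by (intro mult_mono) auto
    also have "\<dots> = (c' * (1 + norm m)) * (exp ((B + 1) * \<bar>\<tau>\<bar> * norm y) * exp (norm y))" by (simp only: mult_ac)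
    also have "exp ((B + 1) * \<bar>\<tau>\<bar> * norm y) * exp (norm y) = exp (b * norm y)"
      unfolding exp_add[symmetric] b_def by (simp add: distrib_right)
    finally show ?thesis .
  qed
  have expb: "exp ((B + 1) * \<bar>\<tau>\<bar> * norm y) \<le> exp (b * norm y)" for y :: 'a
    by (simp add: b_def mult_right_mono)
  define C where "C = c1 * (1 + norm m) + \<tau> * (c2 * (1 + norm m)) + c1"
  have iq: "integrable (gaussian 1) (\<lambda>y. (?q y \<bullet> i) * ((y - m) \<bullet> j))" if "i \<in> Basis" "j \<in> Basis" for i j
  proof (rule integrable_gaussian_exp_bound)
    fix y
    have "norm ((?q y \<bullet> i) * ((y - m) \<bullet> j)) \<le> norm (?q y) * norm (y - m)"
      unfolding real_norm_def abs_mult using that by (intro mult_mono Basis_le_norm) auto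
    also have "\<dots> \<le> (c2 * (1 + norm m)) * exp (b * norm y)" by (rule prod_b[OF qb c(2)]) simp
    finally show "norm ((?q y \<bullet> i) * ((y - m) \<bullet> j)) \<le> (c2 * (1 + norm m)) * exp (b * norm y)" .
  qed measurable
  \<comment> \<open>Applied to f times the i-th coordinate of y - m: differentiating the coordinate
    yields the mass, differentiating f yields the drift term.\<close>
  have ibp: "(\<integral>y. ?p y * ((y - m) \<bullet> i) * (y \<bullet> i) \<partial>gaussian 1)
     = mass z \<tau> + \<tau> * (\<integral>y. (?q y \<bullet> i) * ((y - m) \<bullet> i) \<partial>gaussian 1)" if i: "i \<in> Basis" for i
  proof -
    have "(\<integral>y. \<tau> * ((?q y \<bullet> i) * ((y - m) \<bullet> i)) + ?p y \<partial>gaussian 1) = (\<integral>y. ?p y * ((y - m) \<bullet> i) * (y \<bullet> i) \<partial>gaussian 1)"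
    proof (rule gaussian_integration_by_parts[where A=C and B=b])
      fix y
      have yi: "\<bar>(y - m) \<bullet> i\<bar> \<le> norm (y - m)" by (rule Basis_le_norm[OF i])
      have 1: "\<bar>?p y * ((y - m) \<bullet> i)\<bar> \<le> (c1 * (1 + norm m)) * exp (b * norm y)"
      proof -
        have "\<bar>?p y * ((y - m) \<bullet> i)\<bar> \<le> norm (?p y) * norm (y - m)" unfolding abs_mult real_norm_def using yi by (intro mult_left_mono) auto
        also have "\<dots> \<le> (c1 * (1 + norm m)) * exp (b * norm y)" by (rule prod_b[OF pb c(1)]) simp
        finally show ?thesis .
      qed
      have 2: "\<bar>\<tau> * ((?q y \<bullet> i) * ((y - m) \<bullet> i))\<bar> \<le> (\<tau> * (c2 * (1 + norm m))) * exp (b * norm y)"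
      proof -
        have "\<bar>(?q y \<bullet> i) * ((y - m) \<bullet> i)\<bar> \<le> norm (?q y) * norm (y - m)"
          unfolding abs_mult using Basis_le_norm[OF i, of "?q y"] yi by (intro mult_mono) auto
        also have "\<dots> \<le> (c2 * (1 + norm m)) * exp (b * norm y)" by (rule prod_b[OF qb c(2)]) simp
        finally have "\<tau> * \<bar>(?q y \<bullet> i) * ((y - m) \<bullet> i)\<bar> \<le> \<tau> * ((c2 * (1 + norm m)) * exp (b * norm y))"
          using \<tau> by (intro mult_left_mono) auto
        then show ?thesis using \<tau> by (simp only: abs_mult abs_of_pos mult.assoc)
      qed
      have 3: "\<bar>?p y\<bar> \<le> c1 * exp (b * norm y)"
        using order_trans[OF pb[of y] mult_left_mono[OF expb c(1)]] by simp
      have nn: "0 \<le> c1 * exp (b * norm y)" "0 \<le> (\<tau> * (c2 * (1 + norm m))) * exp (b * norm y)"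
        using c \<tau> by auto
      have nn1: "0 \<le> (c1 * (1 + norm m)) * exp (b * norm y)" using c by auto
      show "\<bar>?p y * ((y - m) \<bullet> i)\<bar> \<le> C * exp (b * norm y)"
        using 1 nn unfolding C_def distrib_right[of _ _ "exp (b * norm y)"] by linarith
      show "\<bar>\<tau> * ((?q y \<bullet> i) * ((y - m) \<bullet> i)) + ?p y\<bar> \<le> C * exp (b * norm y)"
        using 2 3 nn1 unfolding C_def distrib_right[of _ _ "exp (b * norm y)"] by linarith
      have e: "z + \<tau> *\<^sub>R (y + r *\<^sub>R i) = (z + \<tau> *\<^sub>R y) + r *\<^sub>R (\<tau> *\<^sub>R i)" for r by (simp add: algebra_simps)
      have d1: "((\<lambda>r. f (z + \<tau> *\<^sub>R (y + r *\<^sub>R i))) has_real_derivative f (z + \<tau> *\<^sub>R y) * (g (z + \<tau> *\<^sub>R y) \<bullet> (\<tau> *\<^sub>R i))) (at 0)"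
        unfolding e by (rule f_der)
      have d2: "((\<lambda>r. (y + r *\<^sub>R i - m) \<bullet> i) has_real_derivative 1) (at 0)"
        using i by (auto intro!: derivative_eq_intros simp: inner_add_left inner_diff_left)
      show "((\<lambda>r. f (z + \<tau> *\<^sub>R (y + r *\<^sub>R i)) * ((y + r *\<^sub>R i - m) \<bullet> i)) has_real_derivative
         \<tau> * ((?q y \<bullet> i) * ((y - m) \<bullet> i)) + ?p y) (at 0)"
        by (rule DERIV_cong[OF DERIV_mult[OF d1 d2]]) simp
    qed (use b0 in measurable)
    then show ?thesis unfolding mass_def using iq[OF i i] f_int[of z \<tau>] by simp
  qed
  have ip2: "integrable (gaussian 1) (\<lambda>y. ?p y * ((y - m) \<bullet> i) * (y \<bullet> i))" if i: "i \<in> Basis" for i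
  proof (rule Bochner_Integration.integrable_bound[OF Bochner_Integration.integrable_add[OF f_norm_sq_int[of z \<tau> m] f_norm_sq_int[of z \<tau> 0]]])
    show "AE y in gaussian 1. norm (?p y * ((y - m) \<bullet> i) * (y \<bullet> i)) \<le> norm (?p y * (norm (y - m))\<^sup>2 + ?p y * (norm (y - 0))\<^sup>2)"
    proof (rule AE_I2)
      fix y
      have "\<bar>(y - m) \<bullet> i\<bar> * \<bar>y \<bullet> i\<bar> \<le> norm (y - m) * norm y"
        using i by (intro mult_mono Basis_le_norm) auto
      also have "\<dots> \<le> (norm (y - m))\<^sup>2 + (norm y)\<^sup>2"
        using sum_squares_bound[of "norm (y - m)" "norm y"]
          mult_nonneg_nonneg[OF norm_ge_zero norm_ge_zero, of "y - m" y] by linarith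
      finally have "?p y * (\<bar>(y - m) \<bullet> i\<bar> * \<bar>y \<bullet> i\<bar>) \<le> ?p y * ((norm (y - m))\<^sup>2 + (norm y)\<^sup>2)"
        using f_pos[of "z + \<tau> *\<^sub>R y"] by (intro mult_left_mono) auto
      then show "norm (?p y * ((y - m) \<bullet> i) * (y \<bullet> i)) \<le> norm (?p y * (norm (y - m))\<^sup>2 + ?p y * (norm (y - 0))\<^sup>2)"
        using f_pos[of "z + \<tau> *\<^sub>R y"] by (simp add: abs_mult distrib_left mult.assoc)
    qed
  qed measurable
  have total: "(\<integral>y. ?p y * ((y - m) \<bullet> y) \<partial>gaussian 1) = DIM('a) * mass z \<tau> + \<tau> * (\<integral>y. ?q y \<bullet> (y - m) \<partial>gaussian 1)"
  proof -
    have "(\<integral>y. ?p y * ((y - m) \<bullet> y) \<partial>gaussian 1) = (\<integral>y. (\<Sum>i\<in>Basis. ?p y * ((y - m) \<bullet> i) * (y \<bullet> i)) \<partial>gaussian 1)"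
      by (intro Bochner_Integration.integral_cong refl) (subst euclidean_inner, simp add: sum_distrib_left mult.assoc)
    also have "\<dots> = (\<Sum>i\<in>Basis. \<integral>y. ?p y * ((y - m) \<bullet> i) * (y \<bullet> i) \<partial>gaussian 1)"
      by (rule Bochner_Integration.integral_sum) (rule ip2)
    also have "\<dots> = (\<Sum>i\<in>(Basis :: 'a set). mass z \<tau> + \<tau> * (\<integral>y. (?q y \<bullet> i) * ((y - m) \<bullet> i) \<partial>gaussian 1))"
      by (intro sum.cong refl ibp)
    also have "\<dots> = DIM('a) * mass z \<tau> + \<tau> * (\<Sum>i\<in>Basis. \<integral>y. (?q y \<bullet> i) * ((y - m) \<bullet> i) \<partial>gaussian 1)"
      by (simp add: sum.distrib sum_distrib_left)
    also have "(\<Sum>i\<in>Basis. \<integral>y. (?q y \<bullet> i) * ((y - m) \<bullet> i) \<partial>gaussian 1) = (\<integral>y. (\<Sum>i\<in>Basis. (?q y \<bullet> i) * ((y - m) \<bullet> i)) \<partial>gaussian 1)"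
      by (rule Bochner_Integration.integral_sum[symmetric]) (rule iq)
    also have "\<dots> = (\<integral>y. ?q y \<bullet> (y - m) \<partial>gaussian 1)"
      by (intro Bochner_Integration.integral_cong refl) (rule euclidean_inner[symmetric])
    finally show ?thesis .
  qed
  have ifc: "(\<integral>y. ?p y *\<^sub>R (y - m) \<partial>gaussian 1) = 0"
    using fy_int[of z \<tau>] f_int[of z \<tau>] m unfolding scaleR_diff_right by (simp add: mass_def)
  have ifi: "integrable (gaussian 1) (\<lambda>y. ?p y *\<^sub>R (y - m))"
    using fy_int[of z \<tau>] f_int[of z \<tau>] unfolding scaleR_diff_right by simp
  have center: "(\<integral>y. ?p y * (c \<bullet> (y - m)) \<partial>gaussian 1) = 0" "integrable (gaussian 1) (\<lambda>y. ?p y * (c \<bullet> (y - m)))" for c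
  proof -
    have "(\<integral>y. c \<bullet> (?p y *\<^sub>R (y - m)) \<partial>gaussian 1) = c \<bullet> (\<integral>y. ?p y *\<^sub>R (y - m) \<partial>gaussian 1)"
      by (rule integral_inner_right) (rule ifi)
    then show "(\<integral>y. ?p y * (c \<bullet> (y - m)) \<partial>gaussian 1) = 0" unfolding ifc by simp
    have "integrable (gaussian 1) (\<lambda>y. c \<bullet> (?p y *\<^sub>R (y - m)))" by (rule integrable_inner_right) (rule ifi)
    then show "integrable (gaussian 1) (\<lambda>y. ?p y * (c \<bullet> (y - m)))" by simp
  qed
  \<comment> \<open>Since m is the tilted mean, one of the two factors y - m may be replaced by
    y.\<close>
  have "(\<integral>y. ?p y * (norm (y - m))\<^sup>2 \<partial>gaussian 1) = (\<integral>y. ?p y * ((y - m) \<bullet> y) \<partial>gaussian 1)"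
  proof -
    have i: "integrable (gaussian 1) (\<lambda>y. ?p y * (norm (y - m))\<^sup>2)" by (rule f_norm_sq_int)
    have "(\<integral>y. ?p y * ((y - m) \<bullet> y) \<partial>gaussian 1) = (\<integral>y. ?p y * (norm (y - m))\<^sup>2 + ?p y * (m \<bullet> (y - m)) \<partial>gaussian 1)"
      by (intro Bochner_Integration.integral_cong refl)
        (simp add: power2_norm_eq_inner inner_diff_left inner_diff_right inner_commute algebra_simps)
    also have "\<dots> = (\<integral>y. ?p y * (norm (y - m))\<^sup>2 \<partial>gaussian 1)"
      using center[of m] i by simp
    finally show ?thesis ..
  qed
  moreover have "\<tau> * (\<integral>y. ?q y \<bullet> (y - m) \<partial>gaussian 1) \<le> 0"
  proof -
    have iq': "integrable (gaussian 1) (\<lambda>y. ?q y \<bullet> (y - m))"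
      by (subst euclidean_inner) (intro Bochner_Integration.integrable_sum iq)
    \<comment> \<open>The constant vector g at the mean is subtracted at no cost, which brings in
      the difference to which antitonicity applies.\<close>
    have "(\<integral>y. ?q y \<bullet> (y - m) \<partial>gaussian 1) = (\<integral>y. ?q y \<bullet> (y - m) - ?p y * (g (z + \<tau> *\<^sub>R m) \<bullet> (y - m)) \<partial>gaussian 1)"
      using center[of "g (z + \<tau> *\<^sub>R m)"] iq' by simp
    also have "\<dots> \<le> (\<integral>y. 0 \<partial>(gaussian 1 :: 'a measure))"
    proof (rule integral_mono)
      show "integrable (gaussian 1) (\<lambda>y. ?q y \<bullet> (y - m) - ?p y * (g (z + \<tau> *\<^sub>R m) \<bullet> (y - m)))"
        using center(2) iq' by simp
      fix y
      have "\<tau> * ((g (z + \<tau> *\<^sub>R y) - g (z + \<tau> *\<^sub>R m)) \<bullet> (y - m)) = (g (z + \<tau> *\<^sub>R y) - g (z + \<tau> *\<^sub>R m)) \<bullet> ((z + \<tau> *\<^sub>R y) - (z + \<tau> *\<^sub>R m))"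
        by (simp add: inner_diff_right right_diff_distrib)
      also have "\<dots> \<le> 0" by (rule anti)
      finally have "(g (z + \<tau> *\<^sub>R y) - g (z + \<tau> *\<^sub>R m)) \<bullet> (y - m) \<le> 0" using \<tau> by (simp add: mult_le_0_iff)
      then have "?p y * ((g (z + \<tau> *\<^sub>R y) - g (z + \<tau> *\<^sub>R m)) \<bullet> (y - m)) \<le> 0"
        using f_pos[of "z + \<tau> *\<^sub>R y"] by (simp add: mult_nonneg_nonpos)
      then show "?q y \<bullet> (y - m) - ?p y * (g (z + \<tau> *\<^sub>R m) \<bullet> (y - m)) \<le> 0"
        by (simp add: inner_diff_left right_diff_distrib)
    qed simp
    finally show ?thesis using \<tau> by (simp add: mult_nonneg_nonpos)
  qed
  ultimately show "(\<integral>y. ?p y * (norm (y - m))\<^sup>2 \<partial>gaussian 1) \<le> real DIM('a) * mass z \<tau>"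
    unfolding total by linarith
qed

end

subsection \<open>The three classes of target measures\<close>

lemma strongly_log_concave_tilted:
  fixes \<nu> :: "'a::euclidean_space measure"
  assumes cv: "semi_log_convex \<beta> \<nu>" and cc: "semi_log_concave \<kappa> \<nu>" and supp: "msupport \<nu> = UNIV" and \<kappa>: "\<kappa> > 0"
  shows "\<exists>\<sigma> f g K A B D. \<sigma> > 0 \<and> tilted_gaussian f g K A B D \<sigma> \<and> \<nu> = density (gaussian \<sigma>) (\<lambda>x. ennreal (f x))"
proof -
  obtain U G where nu: "\<nu> = density lborel (\<lambda>x. ennreal (exp (- U x)))"
    and U: "\<And>x. (U has_derivative (\<lambda>h. G x \<bullet> h)) (at x)"
    and m1: "\<And>x y. \<kappa> * (norm (x - y))\<^sup>2 \<le> (G x - G y) \<bullet> (x - y)"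
    and m2: "\<And>x y. (G x - G y) \<bullet> (x - y) \<le> \<beta> * (norm (x - y))\<^sup>2"
    by (rule semi_log_potential[OF cv cc supp]) (rule that, assumption+)
  \<comment> \<open>The reference Gaussian has precision \<kappa>, exactly the guaranteed curvature
    of U; hence log f is concave.\<close>
  define \<sigma> where "\<sigma> = 1 / sqrt \<kappa>"
  have \<sigma>: "\<sigma> > 0" using \<kappa> by (simp add: \<sigma>_def)
  have \<sigma>2: "1 / \<sigma>\<^sup>2 = \<kappa>" using \<kappa> by (simp add: \<sigma>_def power_divide)
  define f where "f x = exp (- U x) / gdens \<sigma> x" for x
  define g where "g x = (1 / \<sigma>\<^sup>2) *\<^sub>R x - G x" for x
  note R = density_ratio_tilt[OF \<sigma> nu U m1 m2, folded f_def g_def]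
  from R(5) obtain K where "K \<ge> 0 \<and> (\<forall>x y. norm (g x - g y) \<le> K * norm (x - y))" by (rule exE)
  then have K: "K \<ge> 0" "\<And>x y. norm (g x - g y) \<le> K * norm (x - y)" by simp_all
  have anti: "(g x - g y) \<bullet> (x - y) \<le> 0" for x y
  proof -
    have "g x - g y = \<kappa> *\<^sub>R (x - y) - (G x - G y)" by (simp only: g_def \<sigma>2) (simp add: algebra_simps)
    then have "(g x - g y) \<bullet> (x - y) = \<kappa> * (norm (x - y))\<^sup>2 - (G x - G y) \<bullet> (x - y)"
      by (simp add: inner_diff_left[of "\<kappa> *\<^sub>R (x - y)"] power2_norm_eq_inner)
    then show ?thesis using m1[of x y] by simp
  qed
  \<comment> \<open>A concave log f lies below its tangent at 0, which yields the exponential growth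
    bound with rate \<open>norm (g 0)\<close>.\<close>
  have fb: "f y \<le> f 0 * exp (norm (g 0) * norm y)" for y
  proof -
    have dr: "((\<lambda>r. ln (f (0 + r *\<^sub>R y))) has_real_derivative g (r *\<^sub>R y) \<bullet> y) (at r)" for r
    proof -
      have "((\<lambda>r. f (0 + r *\<^sub>R y)) has_vector_derivative (\<lambda>x. f x * (g x \<bullet> y)) (0 + r *\<^sub>R y)) (at r)"
        by (rule derivative_along_line) (use R(4) in \<open>simp add: has_real_derivative_iff_has_vector_derivative\<close>)
      then have "((\<lambda>r. f (0 + r *\<^sub>R y)) has_real_derivative f (0 + r *\<^sub>R y) * (g (0 + r *\<^sub>R y) \<bullet> y)) (at r)"
        by (simp add: has_real_derivative_iff_has_vector_derivative)
      from DERIV_chain2[OF DERIV_ln[OF R(1)] this] R(1)[of "0 + r *\<^sub>R y"] show ?thesis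
        by (simp add: mult.assoc[symmetric])
    qed
    obtain r where r: "0 < r" "ln (f (0 + 1 *\<^sub>R y)) - ln (f (0 + 0 *\<^sub>R y)) = (1 - 0) * (g (r *\<^sub>R y) \<bullet> y)"
      using MVT2[of 0 1 "\<lambda>r. ln (f (0 + r *\<^sub>R y))" "\<lambda>r. g (r *\<^sub>R y) \<bullet> y"] dr by auto
    have "r * ((g (r *\<^sub>R y) - g 0) \<bullet> y) \<le> 0" using anti[of "r *\<^sub>R y" 0] by simp
    then have "g (r *\<^sub>R y) \<bullet> y \<le> g 0 \<bullet> y" using r(1) by (simp add: mult_le_0_iff inner_diff_left)
    also have "\<dots> \<le> norm (g 0) * norm y" by (rule norm_cauchy_schwarz)
    finally have "ln (f y) \<le> ln (f 0) + norm (g 0) * norm y" using r(2) by simp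
    then have "exp (ln (f y)) \<le> exp (ln (f 0) + norm (g 0) * norm y)" by simp
    then show ?thesis using R(1) by (simp add: exp_add)
  qed
  interpret tilted_base f g K "f 0" "norm (g 0)"
    by unfold_locales (use R(1,2,4) K fb in auto)
  show ?thesis using tilted_if_log_concave[OF anti] \<sigma> R(3) by blast
qed

lemma log_lipschitz_exp_bound:
  assumes "log_lipschitz L f"
  shows "f x \<le> f y * exp (L * norm (x - y))"
proof -
  have p: "f x > 0" "f y > 0" using assms by (auto simp: log_lipschitz_def)
  have "\<bar>ln (f x) - ln (f y)\<bar> \<le> L * norm (x - y)"
    using assms lipschitz_onD[of L UNIV "\<lambda>x. ln (f x)" x y] by (simp add: log_lipschitz_def dist_norm)
  then have "exp (ln (f x)) \<le> exp (ln (f y) + L * norm (x - y))" by simp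
  then show ?thesis using p by (simp add: exp_add)
qed

lemma log_lipschitz_continuous:
  assumes "log_lipschitz L f" shows "continuous_on UNIV f"
proof -
  have "continuous_on UNIV (\<lambda>x. exp (ln (f x)))"
    using assms by (intro continuous_intros lipschitz_on_continuous_on[of L]) (simp add: log_lipschitz_def)
  then show ?thesis using assms by (simp add: log_lipschitz_def)
qed

lemma log_lipschitz_tilted:
  fixes \<nu> :: "'a::euclidean_space measure"
  assumes cv: "semi_log_convex \<beta> \<nu>" and cc: "semi_log_concave \<kappa> \<nu>" and supp: "msupport \<nu> = UNIV"
    and nuf: "\<nu> = density (gaussian 1) (\<lambda>x. ennreal (f0 x))" and ll: "log_lipschitz L f0" and L: "L \<ge> 0"
  shows "\<exists>\<sigma> f g K A B D. \<sigma> > 0 \<and> tilted_gaussian f g K A B D \<sigma> \<and> \<nu> = density (gaussian \<sigma>) (\<lambda>x. ennreal (f x))"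
proof -
  obtain U G where nu: "\<nu> = density lborel (\<lambda>x. ennreal (exp (- U x)))"
    and U: "\<And>x. (U has_derivative (\<lambda>h. G x \<bullet> h)) (at x)"
    and m1: "\<And>x y. \<kappa> * (norm (x - y))\<^sup>2 \<le> (G x - G y) \<bullet> (x - y)"
    and m2: "\<And>x y. (G x - G y) \<bullet> (x - y) \<le> \<beta> * (norm (x - y))\<^sup>2"
    by (rule semi_log_potential[OF cv cc supp]) (rule that, assumption+)
  define f where "f x = exp (- U x) / gdens 1 x" for x
  define g where "g x = (1 / 1\<^sup>2) *\<^sub>R x - G x" for x
  note R = density_ratio_tilt[OF zero_less_one nu U m1 m2, folded f_def g_def]
  from R(5) obtain K where "K \<ge> 0 \<and> (\<forall>x y. norm (g x - g y) \<le> K * norm (x - y))" by (rule exE)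
  then have K: "K \<ge> 0" "\<And>x y. norm (g x - g y) \<le> K * norm (x - y)" by simp_all
  \<comment> \<open>The smooth ratio built from the potential and the given density ratio are both
    continuous versions of one density, so differentiability and the log-Lipschitz bound apply to
    the same function.\<close>
  have "f = f0"
  proof (rule continuous_eq_if_AE_lborel[OF R(2) log_lipschitz_continuous[OF ll]])
    have [measurable]: "f \<in> borel_measurable borel" "f0 \<in> borel_measurable borel"
      using R(2) log_lipschitz_continuous[OF ll] by (auto intro: borel_measurable_continuous_onI)
    interpret prob_space "gaussian 1 :: 'a measure" by (rule prob_space_gaussian) simp
    have "density (gaussian 1) (\<lambda>x. ennreal (f x)) = density (gaussian 1) (\<lambda>x. ennreal (f0 x))"
      using R(3) nuf by simp
    then have "AE x in gaussian 1. ennreal (f x) = ennreal (f0 x)"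
      by (subst (asm) density_unique_iff) auto
    then have "AE x in lborel. 0 < ennreal (gdens 1 x) \<longrightarrow> ennreal (f x) = ennreal (f0 x)"
      unfolding gaussian_eq by (subst (asm) AE_density) measurable
    then show "AE x in lborel. f x = f0 x"
      by eventually_elim (use R(1) ll in \<open>simp add: gdens_pos log_lipschitz_def less_imp_le\<close>)
  qed
  then have fl: "f x \<le> f y * exp (L * norm (x - y))" for x y using log_lipschitz_exp_bound[OF ll] by simp
  have fb: "f x \<le> f 0 * exp (L * norm x)" for x using fl[of x 0] by simp
  interpret tilted_base f g K "f 0" L
    by unfold_locales (use R(1,2,4) K fb L in auto)
  show ?thesis using tilted_if_log_lipschitz[OF fl L zero_less_one] R(3) zero_less_one by blast
qed

text \<open>Outside the support every point has a null open neighbourhood; by Lindelof countably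
  many of them cover the complement.\<close>

lemma msupport_compl_null:
  fixes \<rho> :: "'a::euclidean_space measure"
  assumes s: "sets \<rho> = sets borel" and C: "closed C" "msupport \<rho> \<subseteq> C"
  shows "AE x in \<rho>. x \<in> C"
proof -
  define \<F> where "\<F> = {A. open A \<and> emeasure \<rho> A = 0}"
  obtain \<G> where \<G>: "\<G> \<subseteq> \<F>" "countable \<G>" "\<Union>\<G> = \<Union>\<F>"
    using Lindelof[of \<F>] by (auto simp: \<F>_def)
  have "\<G> \<subseteq> null_sets \<rho>"
    using \<G>(1) s by (auto simp: \<F>_def null_sets_def intro: borel_open)
  then have "(\<Union>A\<in>\<G>. A) \<in> null_sets \<rho>" using \<G>(2) by (intro null_sets_UN') auto
  then have "\<Union>\<F> \<in> null_sets \<rho>" using \<G>(3) by simp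
  moreover have sub: "- C \<subseteq> \<Union>\<F>"
  proof
    fix x assume "x \<in> - C"
    then have "x \<notin> msupport \<rho>" using C(2) by blast
    then obtain A where "open A" "x \<in> A" "\<not> emeasure \<rho> A > 0" unfolding msupport_def by blast
    then show "x \<in> \<Union>\<F>" by (auto simp: \<F>_def not_gr_zero)
  qed
  ultimately have "AE x in \<rho>. x \<notin> \<Union>\<F>" by (intro AE_not_in)
  then show ?thesis by eventually_elim (use sub in auto)
qed

text \<open>f averages the density ratios of shifted to centred Gaussians, and g is the posterior
  mean of the mixing variable over \<sigma> squared. Bounded mixing makes f log-Lipschitz and the
  posterior covariance bounded.\<close>

lemma gaussian_mixture_tilted:
  fixes \<nu> :: "'a::ordered_euclidean_space measure"
  assumes \<sigma>: "\<sigma> > 0" and \<rho>: "prob_space \<rho>" "sets \<rho> = sets borel" and supp: "msupport \<rho> \<subseteq> cball c R"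
    and nu: "\<nu> = convolution (gaussian \<sigma>) \<rho>"
  shows "\<exists>\<sigma> f g K A B D. \<sigma> > 0 \<and> tilted_gaussian f g K A B D \<sigma> \<and> \<nu> = density (gaussian \<sigma>) (\<lambda>x. ennreal (f x))"
proof -
  interpret r: prob_space \<rho> by fact
  note [measurable_cong] = \<rho>(2)
  have spr: "space \<rho> = UNIV" using sets_eq_imp_space_eq[OF \<rho>(2)] by simp
  \<comment> \<open>The ball is enlarged to one centred at the origin, so that norms of mixing
    points are bounded directly.\<close>
  define R0 where "R0 = norm c + \<bar>R\<bar>"
  have R0: "R0 \<ge> 0" by (simp add: R0_def)
  have sub: "cball c R \<subseteq> cball 0 R0"
  proof
    fix y assume "y \<in> cball c R"
    then have "norm (y - c) \<le> R" by (simp add: dist_norm norm_minus_commute)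
    then have "norm y \<le> norm c + \<bar>R\<bar>" using norm_triangle_sub[of y c] by linarith
    then show "y \<in> cball 0 R0" by (simp add: R0_def)
  qed
  have ae: "AE y in \<rho>. y \<in> cball 0 R0"
    using msupport_compl_null[OF \<rho>(2) closed_cball order_trans[OF supp sub]] .
  \<comment> \<open>Ratio of the Gaussian density centred at y to the one centred at 0. The
    indicator changes it on a \<rho>-null set only and makes the bounds hold for every y.\<close>
  define p where "p x y = indicator (cball 0 R0) y * exp ((x \<bullet> y) / \<sigma>\<^sup>2 - (norm y)\<^sup>2 / (2 * \<sigma>\<^sup>2))" for x y :: 'a
  have [measurable]: "p x \<in> borel_measurable borel" for x
    unfolding p_def
    by (intro borel_measurable_times borel_measurable_indicator borel_measurable_continuous_onI continuous_intros)
      (use \<sigma> in auto)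
  have p0: "p x y \<ge> 0" for x y by (simp add: p_def)
  have s2: "\<sigma>\<^sup>2 > 0" using \<sigma> by simp
  have ip: "\<bar>(x \<bullet> y) / \<sigma>\<^sup>2\<bar> \<le> R0 * norm x / \<sigma>\<^sup>2" if "norm y \<le> R0" for x y :: 'a
  proof -
    have "\<bar>x \<bullet> y\<bar> \<le> norm x * norm y" by (rule Cauchy_Schwarz_ineq2)
    also have "\<dots> \<le> norm x * R0" using that by (intro mult_left_mono) auto
    finally show ?thesis using s2 by (simp add: divide_right_mono mult.commute)
  qed
  have pb: "p x y \<le> exp (R0 * norm x / \<sigma>\<^sup>2)" for x y
  proof (cases "norm y \<le> R0")
    case True
    have "0 \<le> (norm y)\<^sup>2 / (2 * \<sigma>\<^sup>2)" by simp
    then have "(x \<bullet> y) / \<sigma>\<^sup>2 - (norm y)\<^sup>2 / (2 * \<sigma>\<^sup>2) \<le> R0 * norm x / \<sigma>\<^sup>2"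
      using ip[OF True, of x] by linarith
    then show ?thesis using True by (simp add: p_def)
  next
    case False then show ?thesis by (simp add: p_def)
  qed
  have int_bd: "integrable \<rho> F" if [measurable]: "F \<in> borel_measurable borel" and b: "\<And>y. norm (F y) \<le> C"
    for F :: "'a \<Rightarrow> 'a" and C
    by (rule r.integrable_const_bound[where B=C]) (use b in auto)
  have int_bd1: "integrable \<rho> F" if [measurable]: "F \<in> borel_measurable borel" and b: "\<And>y. norm (F y) \<le> C"
    for F :: "'a \<Rightarrow> real" and C
    by (rule r.integrable_const_bound[where B=C]) (use b in auto)
  have pint: "integrable \<rho> (p x)" for x
    by (rule int_bd1[of _ "exp (R0 * norm x / \<sigma>\<^sup>2)"]) (use pb p0 in \<open>auto\<close>)
  define f where "f x = (\<integral>y. p x y \<partial>\<rho>)" for x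
  define g where "g x = (1 / \<sigma>\<^sup>2) *\<^sub>R ((\<integral>y. p x y *\<^sub>R y \<partial>\<rho>) /\<^sub>R f x)" for x
  have f_pos: "f x > 0" for x
  proof -
    have "f x \<noteq> 0"
    proof
      assume "f x = 0"
      then have "AE y in \<rho>. p x y = 0"
        unfolding f_def using p0 by (subst (asm) integral_nonneg_eq_0_iff_AE[OF pint]) simp_all
      with ae have "AE y in \<rho>. False" by eventually_elim (simp add: p_def)
      then show False by simp
    qed
    moreover have "f x \<ge> 0" unfolding f_def using p0 by (intro integral_nonneg_AE AE_I2) simp
    ultimately show ?thesis by simp
  qed
  let ?\<eta> = "\<lambda>k y. (k \<bullet> y) / \<sigma>\<^sup>2"
  have pyb: "norm (p x y *\<^sub>R y) \<le> exp (R0 * norm x / \<sigma>\<^sup>2) * R0" for x y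
  proof (cases "norm y \<le> R0")
    case True then show ?thesis using pb[of x y] p0[of x y] by (auto intro!: mult_mono)
  next
    case False then show ?thesis using R0 by (simp add: p_def)
  qed
  have eb: "exp (2 * \<bar>?\<eta> k y\<bar>) * p x y \<le> exp (2 * (R0 * norm k / \<sigma>\<^sup>2)) * exp (R0 * norm x / \<sigma>\<^sup>2)" for k x y
  proof (cases "norm y \<le> R0")
    case True then show ?thesis using pb[of x y] p0[of x y] ip[OF True, of k] by (intro mult_mono) auto
  next
    case False then show ?thesis by (simp add: p_def)
  qed
  have i1: "integrable \<rho> (\<lambda>y. exp (2 * \<bar>?\<eta> k y\<bar>) * p x y)" for k x
    by (rule int_bd1[of _ "exp (2 * (R0 * norm k / \<sigma>\<^sup>2)) * exp (R0 * norm x / \<sigma>\<^sup>2)"]) (use eb p0 in \<open>auto simp: abs_mult\<close>)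
  have i2: "integrable \<rho> (\<lambda>y. exp (2 * \<bar>?\<eta> k y\<bar>) *\<^sub>R (p x y *\<^sub>R y))" for k x
  proof (rule int_bd[of _ "exp (2 * (R0 * norm k / \<sigma>\<^sup>2)) * exp (R0 * norm x / \<sigma>\<^sup>2) * R0"])
    fix y
    show "norm (exp (2 * \<bar>?\<eta> k y\<bar>) *\<^sub>R (p x y *\<^sub>R y)) \<le> exp (2 * (R0 * norm k / \<sigma>\<^sup>2)) * exp (R0 * norm x / \<sigma>\<^sup>2) * R0"
    proof (cases "norm y \<le> R0")
      case True
      have "(exp (2 * \<bar>?\<eta> k y\<bar>) * p x y) * norm y \<le> (exp (2 * (R0 * norm k / \<sigma>\<^sup>2)) * exp (R0 * norm x / \<sigma>\<^sup>2)) * R0"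
        by (rule mult_mono[OF eb True]) simp_all
      then show ?thesis using p0[of x y] by (simp add: mult.assoc)
    next
      case False then show ?thesis using R0 by (simp add: p_def)
    qed
  qed measurable
  have p_shift: "p (x + r *\<^sub>R k) y = exp (r * ?\<eta> k y) * p x y" for x k y r
    unfolding p_def by (simp add: inner_add_left add_divide_distrib exp_add exp_diff)
  have f_pos': "(\<integral>y. p x y \<partial>\<rho>) > 0" for x using f_pos[of x] by (simp add: f_def)
  have f_der: "((\<lambda>r. f (x + r *\<^sub>R k)) has_real_derivative f x * (g x \<bullet> k)) (at 0)" for x k
  proof -
    have d: "((\<lambda>r. \<integral>y. exp (r * ?\<eta> k y) *\<^sub>R p x y \<partial>\<rho>) has_vector_derivative (\<integral>y. ?\<eta> k y *\<^sub>R p x y \<partial>\<rho>)) (at 0)"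
      by (rule tilt_derivative) (use i1[of k x] in auto)
    have "(\<integral>y. (p x y *\<^sub>R y) \<bullet> k \<partial>\<rho>) = (\<integral>y. p x y *\<^sub>R y \<partial>\<rho>) \<bullet> k"
      by (rule integral_inner_left, rule int_bd[OF _ pyb]) measurable
    also have "\<dots> = \<sigma>\<^sup>2 * (f x * (g x \<bullet> k))" using f_pos[of x] s2 by (simp add: g_def)
    finally have "(\<integral>y. ?\<eta> k y *\<^sub>R p x y \<partial>\<rho>) = f x * (g x \<bullet> k)"
    proof -
      assume h: "(\<integral>y. (p x y *\<^sub>R y) \<bullet> k \<partial>\<rho>) = \<sigma>\<^sup>2 * (f x * (g x \<bullet> k))"
      have "(\<integral>y. ?\<eta> k y *\<^sub>R p x y \<partial>\<rho>) = (\<integral>y. (1 / \<sigma>\<^sup>2) * ((p x y *\<^sub>R y) \<bullet> k) \<partial>\<rho>)"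
        by (intro Bochner_Integration.integral_cong refl) (simp add: inner_commute)
      also have "\<dots> = (1 / \<sigma>\<^sup>2) * (\<integral>y. (p x y *\<^sub>R y) \<bullet> k \<partial>\<rho>)" by (rule integral_mult_right_zero)
      finally show ?thesis unfolding h using s2 by simp
    qed
    then show ?thesis using d unfolding has_real_derivative_iff_has_vector_derivative f_def p_shift by simp
  qed
  \<comment> \<open>A crude covariance bound, 2 R0 times R0, with one factor 1 / \<sigma>^2 from the
    tilt and one from the definition of g.\<close>
  define K where "K = 2 * R0 * R0 / (\<sigma>\<^sup>2 * \<sigma>\<^sup>2)"
  have K: "K \<ge> 0" using R0 by (simp add: K_def)
  have g_lip: "norm (g x - g y) \<le> K * norm (x - y)" for x y
  proof -
    define m where "m k x = (\<integral>y. ?\<eta> k y * p x y \<partial>\<rho>) / (\<integral>y. p x y \<partial>\<rho>)" for k x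
    define h where "h x = (\<integral>y. p x y *\<^sub>R y \<partial>\<rho>) /\<^sub>R f x" for x
    define h' where "h' k x = (\<integral>y. (p x y * (?\<eta> k y - m k x)) *\<^sub>R (y - 0) \<partial>\<rho>) /\<^sub>R (\<integral>y. p x y \<partial>\<rho>)" for k x
    note T = tilt_mean_derivative[OF _ _ _ i1 i2 f_pos' m_def]
    have hs: "h (x + r *\<^sub>R k) = (\<integral>y. exp (r * ?\<eta> k y) *\<^sub>R (p x y *\<^sub>R y) \<partial>\<rho>) /\<^sub>R (\<integral>y. exp (r * ?\<eta> k y) * p x y \<partial>\<rho>)" for x r k
      by (simp add: h_def f_def p_shift)
    have hd: "((\<lambda>r. h (x + r *\<^sub>R k)) has_vector_derivative h' k x) (at 0)" for x k
      unfolding hs h'_def by (rule T(1)) measurable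
    have ih: "integrable \<rho> (\<lambda>y. (p x y * (?\<eta> k y - m k x)) *\<^sub>R (y - 0))" for x k
      by (rule T(2)) measurable
    have mb: "\<bar>m k x\<bar> \<le> R0 * norm k / \<sigma>\<^sup>2" for k x
    proof -
      have "norm (\<integral>y. ?\<eta> k y * p x y \<partial>\<rho>) \<le> (\<integral>y. (R0 * norm k / \<sigma>\<^sup>2) * p x y \<partial>\<rho>)"
      proof (rule norm_integral_le)
        show "integrable \<rho> (\<lambda>y. (R0 * norm k / \<sigma>\<^sup>2) * p x y)" using pint by (intro integrable_mult_right)
        have "integrable \<rho> (\<lambda>y. exp (2 * \<bar>?\<eta> k y\<bar>) *\<^sub>R p x y)" using i1 by simp
        from integrable_tilt(2)[OF _ _ this] show "integrable \<rho> (\<lambda>y. ?\<eta> k y * p x y)" by simp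
        fix y
        show "norm (?\<eta> k y * p x y) \<le> (R0 * norm k / \<sigma>\<^sup>2) * p x y"
        proof (cases "norm y \<le> R0")
          case True
          then show ?thesis using ip[OF True, of k] p0[of x y] unfolding real_norm_def abs_mult
            by (simp only: abs_of_nonneg) (intro mult_right_mono, auto)
        next
          case False then show ?thesis by (simp add: p_def)
        qed
      qed
      also have "\<dots> = (R0 * norm k / \<sigma>\<^sup>2) * f x" unfolding f_def by (rule integral_mult_right_zero)
      finally have "\<bar>\<integral>y. ?\<eta> k y * p x y \<partial>\<rho>\<bar> / f x \<le> R0 * norm k / \<sigma>\<^sup>2" using f_pos[of x] by (simp only: pos_divide_le_eq real_norm_def)
      then show ?thesis using f_pos[of x] by (simp add: m_def f_def abs_divide)
    qed
    have h'b: "norm (h' k x) \<le> (2 * R0 * R0 / \<sigma>\<^sup>2) * norm k" for k x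
    proof -
      have "norm (\<integral>y. (p x y * (?\<eta> k y - m k x)) *\<^sub>R (y - 0) \<partial>\<rho>) \<le> (\<integral>y. (2 * R0 * R0 / \<sigma>\<^sup>2 * norm k) * p x y \<partial>\<rho>)"
      proof (rule norm_integral_le[OF ih])
        show "integrable \<rho> (\<lambda>y. (2 * R0 * R0 / \<sigma>\<^sup>2 * norm k) * p x y)" using pint by (intro integrable_mult_right)
        fix y
        show "norm ((p x y * (?\<eta> k y - m k x)) *\<^sub>R (y - 0)) \<le> (2 * R0 * R0 / \<sigma>\<^sup>2 * norm k) * p x y"
        proof (cases "norm y \<le> R0")
          case True
          have "\<bar>?\<eta> k y - m k x\<bar> \<le> 2 * (R0 * norm k / \<sigma>\<^sup>2)"
            using ip[OF True, of k] mb[of k x] by linarith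
          then have "\<bar>?\<eta> k y - m k x\<bar> * norm y \<le> (2 * (R0 * norm k / \<sigma>\<^sup>2)) * R0"
            using True R0 by (intro mult_mono) auto
          then have "p x y * (\<bar>?\<eta> k y - m k x\<bar> * norm y) \<le> p x y * ((2 * (R0 * norm k / \<sigma>\<^sup>2)) * R0)"
            using p0[of x y] by (rule mult_left_mono)
          then show ?thesis using p0[of x y] by (simp add: abs_mult mult_ac)
        next
          case False then show ?thesis by (simp add: p_def)
        qed
      qed
      also have "\<dots> = (2 * R0 * R0 / \<sigma>\<^sup>2 * norm k) * f x" unfolding f_def by (rule integral_mult_right_zero)
      finally have "norm (\<integral>y. (p x y * (?\<eta> k y - m k x)) *\<^sub>R (y - 0) \<partial>\<rho>) / f x \<le> 2 * R0 * R0 / \<sigma>\<^sup>2 * norm k"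
        using f_pos[of x] by (simp only: pos_divide_le_eq)
      then show ?thesis using f_pos[of x] unfolding h'_def f_def[symmetric] by (simp add: divide_inverse mult.commute)
    qed
    have "norm (h x - h y) \<le> (2 * R0 * R0 / \<sigma>\<^sup>2) * norm (x - y)"
      by (rule lipschitz_from_line_derivative[OF hd h'b])
    then have "(1 / \<sigma>\<^sup>2) * norm (h x - h y) \<le> (1 / \<sigma>\<^sup>2) * ((2 * R0 * R0 / \<sigma>\<^sup>2) * norm (x - y))"
      using s2 by (intro mult_left_mono) auto
    moreover have "norm (g x - g y) = (1 / \<sigma>\<^sup>2) * norm (h x - h y)"
      unfolding g_def h_def[symmetric] scaleR_diff_right[symmetric] using s2 by simp
    moreover have "(1 / \<sigma>\<^sup>2) * ((2 * R0 * R0 / \<sigma>\<^sup>2) * norm (x - y)) = K * norm (x - y)" by (simp add: K_def)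
    ultimately show ?thesis by simp
  qed
  define L where "L = R0 / \<sigma>\<^sup>2"
  have L: "L \<ge> 0" using R0 by (simp add: L_def)
  have fl: "f x \<le> f y * exp (L * norm (x - y))" for x y
  proof -
    have "f x \<le> (\<integral>z. p y z * exp (L * norm (x - y)) \<partial>\<rho>)"
      unfolding f_def
    proof (rule integral_mono[OF pint])
      show "integrable \<rho> (\<lambda>z. p y z * exp (L * norm (x - y)))" using pint by (intro integrable_mult_left)
      fix z
      show "p x z \<le> p y z * exp (L * norm (x - y))"
      proof (cases "norm z \<le> R0")
        case True
        have e: "p x z = p y z * exp (?\<eta> (x - y) z)" using p_shift[of y 1 "x - y" z] by simp
        have "?\<eta> (x - y) z \<le> L * norm (x - y)" using abs_le_D1[OF ip[OF True, of "x - y"]] by (simp add: L_def)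
        then show ?thesis unfolding e using p0[of y z] by (intro mult_left_mono) auto
      next
        case False then show ?thesis by (simp add: p_def)
      qed
    qed
    also have "\<dots> = f y * exp (L * norm (x - y))" unfolding f_def by (rule integral_mult_left_zero)
    finally show ?thesis .
  qed
  have fll: "log_lipschitz L f"
    unfolding log_lipschitz_def
  proof (intro conjI allI f_pos lipschitz_onI L)
    fix x y
    have le: "ln (f x) \<le> ln (f y) + L * norm (x - y)" for x y
    proof -
      have "ln (f x) \<le> ln (f y * exp (L * norm (x - y)))" using fl[of x y] f_pos[of x] by simp
      then show ?thesis using f_pos[of y] by (simp add: ln_mult)
    qed
    show "dist (ln (f x)) (ln (f y)) \<le> L * dist x y"
      using le[of x y] le[of y x] by (simp add: dist_norm norm_minus_commute abs_le_iff)
  qed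
  have f_cont: "continuous_on UNIV f" by (rule log_lipschitz_continuous[OF fll])
  have fb: "f x \<le> f 0 * exp (L * norm x)" for x using fl[of x 0] by simp
  interpret tb: tilted_base f g K "f 0" L
    by unfold_locales (use f_pos f_cont f_der g_lip K fb L in auto)
  have nu_eq: "\<nu> = density (gaussian \<sigma>) (\<lambda>x. ennreal (f x))"
  proof (rule measure_eqI)
    show "sets \<nu> = sets (density (gaussian \<sigma>) (\<lambda>x. ennreal (f x)))" by (simp add: nu)
    fix E assume "E \<in> sets \<nu>"
    then have [measurable]: "E \<in> sets borel" by (simp add: nu)
    interpret gs: prob_space "gaussian \<sigma> :: 'a measure" by (rule prob_space_gaussian[OF \<sigma>])
    interpret gr: pair_prob_space "gaussian \<sigma> :: 'a measure" \<rho> ..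
    interpret lr: pair_sigma_finite "lborel :: 'a measure" \<rho> ..
    let ?i = "\<lambda>x. indicator E x :: ennreal"
    have [measurable]: "(\<lambda>(x, y). gdens \<sigma> (x - y)) \<in> borel_measurable (borel \<Otimes>\<^sub>M borel)" unfolding gdens_def by measurable
    \<comment> \<open>Expanding the square in the Gaussian exponent; the pointwise identity holds on
      the ball, that is, \<rho>-almost everywhere.\<close>
    have fe: "(\<integral>\<^sup>+y. ennreal (gdens \<sigma> (x - y)) \<partial>\<rho>) = ennreal (gdens \<sigma> x) * ennreal (f x)" for x
    proof -
      have "(\<integral>\<^sup>+y. ennreal (gdens \<sigma> (x - y)) \<partial>\<rho>) = (\<integral>\<^sup>+y. ennreal (gdens \<sigma> x) * ennreal (p x y) \<partial>\<rho>)"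
      proof (rule nn_integral_cong_AE)
        show "AE y in \<rho>. ennreal (gdens \<sigma> (x - y)) = ennreal (gdens \<sigma> x) * ennreal (p x y)"
          using ae
        proof eventually_elim
          fix y :: 'a assume y: "y \<in> cball 0 R0"
          have "- (norm (x - y))\<^sup>2 / (2 * \<sigma>\<^sup>2) = - (norm x)\<^sup>2 / (2 * \<sigma>\<^sup>2) + ((x \<bullet> y) / \<sigma>\<^sup>2 - (norm y)\<^sup>2 / (2 * \<sigma>\<^sup>2))"
            using s2 by (simp add: power2_norm_eq_inner inner_diff_left inner_diff_right inner_commute field_simps)
          then have "gdens \<sigma> (x - y) = gdens \<sigma> x * p x y"
            using y unfolding gdens_def p_def by (simp only: exp_add) simp
          then show "ennreal (gdens \<sigma> (x - y)) = ennreal (gdens \<sigma> x) * ennreal (p x y)"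
            using p0[of x y] by (simp add: ennreal_mult)
        qed
      qed
      also have "\<dots> = ennreal (gdens \<sigma> x) * (\<integral>\<^sup>+y. ennreal (p x y) \<partial>\<rho>)" by (rule nn_integral_cmult) measurable
      also have "(\<integral>\<^sup>+y. ennreal (p x y) \<partial>\<rho>) = ennreal (f x)"
        unfolding f_def by (rule nn_integral_eq_integral[OF pint]) (use p0 in simp)
      finally show ?thesis .
    qed
    have fin: "finite_measure (gaussian \<sigma> :: 'a measure)" "finite_measure \<rho>" by unfold_locales
    have "emeasure \<nu> E = (\<integral>\<^sup>+x. ?i x \<partial>\<nu>)" by (simp add: nu)
    also have "\<dots> = (\<integral>\<^sup>+x. \<integral>\<^sup>+y. ?i (x + y) \<partial>\<rho> \<partial>gaussian \<sigma>)"
      unfolding nu by (rule nn_integral_convolution[OF fin]) (use \<rho>(2) in simp_all)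
    also have "\<dots> = (\<integral>\<^sup>+y. \<integral>\<^sup>+x. ?i (x + y) \<partial>gaussian \<sigma> \<partial>\<rho>)"
      by (rule gr.Fubini'[symmetric]) measurable
    also have "\<dots> = (\<integral>\<^sup>+y. \<integral>\<^sup>+x. ennreal (gdens \<sigma> (x - y)) * ?i x \<partial>lborel \<partial>\<rho>)"
    proof (rule nn_integral_cong)
      fix y
      have "(\<integral>\<^sup>+x. ?i (x + y) \<partial>gaussian \<sigma>) = (\<integral>\<^sup>+x. ennreal (gdens \<sigma> x) * ?i (x + y) \<partial>lborel)"
        by (rule nn_integral_gaussian) measurable
      also have "\<dots> = ennreal (1 ^ DIM('a)) * (\<integral>\<^sup>+x. ennreal (gdens \<sigma> (- y + 1 *\<^sub>R x)) * ?i (- y + 1 *\<^sub>R x + y) \<partial>lborel)"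
        by (rule nn_integral_lborel_affine) simp_all
      finally show "(\<integral>\<^sup>+x. ?i (x + y) \<partial>gaussian \<sigma>) = (\<integral>\<^sup>+x. ennreal (gdens \<sigma> (x - y)) * ?i x \<partial>lborel)" by simp
    qed
    also have "\<dots> = (\<integral>\<^sup>+x. \<integral>\<^sup>+y. ennreal (gdens \<sigma> (x - y)) * ?i x \<partial>\<rho> \<partial>lborel)"
      by (rule lr.Fubini') measurable
    also have "\<dots> = (\<integral>\<^sup>+x. ennreal (gdens \<sigma> x) * (ennreal (f x) * ?i x) \<partial>lborel)"
    proof (rule nn_integral_cong)
      fix x
      have "(\<integral>\<^sup>+y. ennreal (gdens \<sigma> (x - y)) * ?i x \<partial>\<rho>) = (\<integral>\<^sup>+y. ennreal (gdens \<sigma> (x - y)) \<partial>\<rho>) * ?i x"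
        by (rule nn_integral_multc) measurable
      then show "(\<integral>\<^sup>+y. ennreal (gdens \<sigma> (x - y)) * ?i x \<partial>\<rho>) = ennreal (gdens \<sigma> x) * (ennreal (f x) * ?i x)"
        unfolding fe by (simp only: mult.assoc)
    qed
    also have "\<dots> = (\<integral>\<^sup>+x. ennreal (f x) * ?i x \<partial>gaussian \<sigma>)"
      by (rule nn_integral_gaussian[symmetric]) measurable
    also have "\<dots> = emeasure (density (gaussian \<sigma>) (\<lambda>x. ennreal (f x))) E"
      by (simp add: emeasure_density)
    finally show "emeasure \<nu> E = \<dots>" .
  qed
  show ?thesis using tb.tilted_if_log_lipschitz[OF fl L \<sigma>] nu_eq \<sigma> by blast
qed

theorem corollary27:
  fixes a b :: "real \<Rightarrow> real"
    and \<nu> :: "(real ^ 'd) measure"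
    and M :: "'w measure"
    and Z X1 :: "'w \<Rightarrow> real ^ 'd"
  assumes "interpolation_coeffs a b"
    and "prob_space M"
    and "distr M borel Z = gaussian 1"
    and "distr M borel X1 = \<nu>"
    and "prob_space.indep_var M borel Z borel X1"
    and "prob_space \<nu>"
    and "absolutely_continuous lborel \<nu>"
    and "integrable \<nu> (\<lambda>x. (norm x)\<^sup>2)"
    and "(\<exists>\<beta> \<kappa>. \<beta> > 0 \<and> \<kappa> > 0 \<and> semi_log_convex \<beta> \<nu> \<and> semi_log_concave \<kappa> \<nu> \<and>
            msupport \<nu> = UNIV)
       \<or> (\<exists>\<sigma> R c \<rho>. \<sigma> > 0 \<and> R > 0 \<and> prob_space \<rho> \<and> sets \<rho> = sets borel \<and>
            msupport \<rho> \<subseteq> cball c R \<and> \<nu> = convolution (gaussian \<sigma>) \<rho>)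
       \<or> (\<exists>\<beta> \<kappa> L f. \<beta> > 0 \<and> \<kappa> \<le> 0 \<and> L \<ge> 0 \<and> semi_log_convex \<beta> \<nu> \<and> semi_log_concave \<kappa> \<nu> \<and>
            \<nu> = density (gaussian 1) (\<lambda>x. ennreal (f x)) \<and> log_lipschitz L f \<and>
            msupport \<nu> = UNIV)"
  shows "\<exists>X Xrev.
      unique_flow (velocity M a b Z X1) X \<and>
      unique_flow (\<lambda>t x. - velocity M a b Z X1 (1 - t) x) Xrev \<and>
      (\<forall>t\<in>{0..1}. Xrev t \<in> borel_measurable borel \<and>
         distr \<nu> borel (Xrev t) = distr M borel (interpolant a b Z X1 (1 - t))) \<and>
      (\<forall>t\<in>{0..1}. bij (X t) \<and> bij (Xrev t)) \<and>
      Xrev 1 = inv (X 1) \<and>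
      (\<forall>t\<in>{0..1}. Xrev t = inv (transition X (1 - t) 1) \<and>
         inv (X t) = transition Xrev (1 - t) 1)"
proof -
  have "\<exists>\<sigma> f g K A B D. \<sigma> > 0 \<and> tilted_gaussian f g K A B D \<sigma> \<and> \<nu> = density (gaussian \<sigma>) (\<lambda>x. ennreal (f x))"
    using assms(9)
  proof (elim disjE exE conjE)
    fix \<beta> \<kappa> :: real assume "\<kappa> > 0" "semi_log_convex \<beta> \<nu>" "semi_log_concave \<kappa> \<nu>" "msupport \<nu> = UNIV"
    then show ?thesis by (intro strongly_log_concave_tilted)
  next
    fix \<sigma> R c \<rho> assume "\<sigma> > 0" "prob_space \<rho>" "sets \<rho> = sets borel"
            "msupport \<rho> \<subseteq> cball c R" "\<nu> = convolution (gaussian \<sigma>) \<rho>"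
    then show ?thesis by (rule gaussian_mixture_tilted)
  next
    fix \<beta> \<kappa> L f assume "semi_log_convex \<beta> \<nu>" "semi_log_concave \<kappa> \<nu>" "msupport \<nu> = UNIV"
      "\<nu> = density (gaussian 1) (\<lambda>x. ennreal (f x))" "log_lipschitz L f" "L \<ge> 0"
    then show ?thesis by (rule log_lipschitz_tilted)
  qed
  then obtain \<sigma> f g K A B D where \<sigma>: "\<sigma> > 0" and t: "tilted_gaussian f g K A B D \<sigma>"
    and nu: "\<nu> = density (gaussian \<sigma>) (\<lambda>x. ennreal (f x))" by blast
  have "C1_on (\<lambda>t. (a t)\<^sup>2) {0..1}" "C1_on b {0..1}" using assms(1) by (auto simp: interpolation_coeffs_def)
  then obtain al' b' where d: "\<forall>t\<in>{0..1}. ((\<lambda>t. (a t)\<^sup>2) has_real_derivative al' t) (at t within {0..1})" "continuous_on {0..1} al'"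
    "\<forall>t\<in>{0..1}. (b has_real_derivative b' t) (at t within {0..1})" "continuous_on {0..1} b'"
    unfolding C1_on_def by blast
  interpret prob_space M by fact
  interpret n: prob_space \<nu> by fact
  interpret tilted_gaussian f g K A B D \<sigma> by fact
  interpret stochastic_interpolant M f g K A B D \<sigma> a b al' b' Z X1 \<nu>
    by unfold_locales
      (fact assms(1) assms(3-6) assms(8) \<sigma> nu d(2) d(4) | rule d(1)[rule_format] d(3)[rule_format], assumption)+
  show ?thesis by (rule reversed_flow)
qed

end
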